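(* Let $\Phi$ be a matrix function in $L^\infty(\mathbb{M}_{m,n})$ such that $\|\Phi\|_{L^\infty}=1$ and $\|H_\Phi\|_{\rm e}<\|\Phi\|_{L^\infty}$. Then the zero function is the only best approximation of $\Phi$ by functions in $H^\infty(\mathbb{M}_{m,n})$ if and only if the following two conditions are satisfied: (i) for almost all $\zeta\in\mathbb{T}$, the matrix $\Phi(\zeta)$ is isometric if $n\le m$, and the transposed matrix $\Phi(\zeta)^{\rm t}$ is isometric if $n>m$; (ii) the function $\zeta\mapsto(\operatorname{Ker}\Phi(\zeta))^\perp$, $\zeta\in\mathbb{T}$, is spanned by finitely many functions in $\operatorname{Ker}T_\Phi$; that is, there exist finitely many functions $f_1,\dots,f_l\in\operatorname{Ker}T_\Phi$ such that $(\operatorname{Ker}\Phi(\zeta))^\perp=\operatorname{span}\{f_j(\zeta):1\le j\le l\}$ for almost all $\zeta\in\mathbb{T}$.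
   Context: $\mathbb{T}$ is the unit circle. $\mathbb{M}_{m,n}$ is the space of $m\times n$ complex matrices with the operator norm; $L^\infty(\mathbb{M}_{m,n})$ is the space of bounded measurable $\mathbb{M}_{m,n}$-valued functions on $\mathbb{T}$ with norm $\|\Phi\|_{L^\infty}=\operatorname{ess\,sup}_{\zeta\in\mathbb{T}}\|\Phi(\zeta)\|$, and $H^\infty(\mathbb{M}_{m,n})$ is its subspace of (boundary values of) bounded analytic matrix functions on the unit disk. $H^2(\mathbb{C}^n)$ is the Hardy space of $\mathbb{C}^n$-valued functions, and $H^2_-(\mathbb{C}^n)=L^2(\mathbb{C}^n)\ominus H^2(\mathbb{C}^n)$. The Toeplitz operator $T_\Phi:H^2(\mathbb{C}^n)\to H^2(\mathbb{C}^m)$ and the Hankel operator $H_\Phi:H^2(\mathbb{C}^n)\to H^2_-(\mathbb{C}^m)$ are defined by $T_\Phi f=\mathbb{P}_+(\Phi f)$, $H_\Phi f=\mathbb{P}_-(\Phi f)$, where $\mathbb{P}_+$, $\mathbb{P}_-$ are the orthogonal projections onto $H^2(\mathbb{C}^m)$, $H^2_-(\mathbb{C}^m)$. $\|\cdot\|_{\rm e}$ denotes the essential norm of an operator (distance to the compact operators). A function $F\in H^\infty(\mathbb{M}_{m,n})$ is a best approximation of $\Phi$ if $\|\Phi-F\|_{L^\infty}=\inf\{\|\Phi-G\|_{L^\infty}:G\in H^\infty(\mathbb{M}_{m,n})\}$. A matrix $A$ is isometric if $A^*A=I$. *)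

theory Defs
  imports "HOL-Analysis.Analysis" "HOL-Probability.Essential_Supremum"
begin

text \<open>
  Elements of the Lebesgue spaces on the circle are represented by Borel measurable functions,
  constrained only on the unit circle; the identification of almost everywhere equal functions is
  made explicit by stating equalities almost everywhere. An \<open>m \<times> n\<close> complex matrix is an element of
  \<open>complex^'n^'m\<close>, with \<open>m = CARD('m)\<close> and \<open>n = CARD('n)\<close>; it acts on \<open>complex^'n\<close> by \<open>*v\<close>.
\<close>

definition circle :: "complex measure" where
  "circle = distr (uniform_measure lborel {0..2 * pi}) (restrict_space borel (sphere 0 1)) cis"

definition vec_cinner :: "complex^'n \<Rightarrow> complex^'n \<Rightarrow> complex" where
  "vec_cinner x y = (\<Sum>i\<in>UNIV. x $ i * cnj (y $ i))"

definition vec_ortho :: "(complex^'n) set \<Rightarrow> (complex^'n) set" where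
  "vec_ortho S = {x. \<forall>y\<in>S. vec_cinner x y = 0}"

definition mat_ker :: "complex^'n^'m \<Rightarrow> (complex^'n) set" where
  "mat_ker A = {x. A *v x = 0}"

definition conj_transpose :: "complex^'n^'m \<Rightarrow> complex^'m^'n" where
  "conj_transpose A = (\<chi> i j. cnj (A $ j $ i))"

definition isometric_mat :: "complex^'n^'m \<Rightarrow> bool" where
  "isometric_mat A \<longleftrightarrow> conj_transpose A ** A = mat 1"


definition Linf_norm :: "(complex \<Rightarrow> complex^'n^'m) \<Rightarrow> ennreal" where
  "Linf_norm \<Phi> = esssup circle (\<lambda>\<zeta>. ennreal (onorm ((*v) (\<Phi> \<zeta>))))"

definition Linf :: "(complex \<Rightarrow> complex^'n^'m) set" where
  "Linf = {\<Phi> \<in> borel_measurable circle. Linf_norm \<Phi> < \<infinity>}"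

text \<open>The boundary values are taken as radial limits.\<close>

definition Hinf :: "(complex \<Rightarrow> complex^'n^'m) set" where
  "Hinf = {F \<in> Linf. \<exists>G.
      (\<forall>i j. (\<lambda>z. G z $ i $ j) holomorphic_on ball 0 1) \<and>
      bounded (G ` ball 0 1) \<and>
      (AE \<zeta> in circle. ((\<lambda>r. G (complex_of_real r * \<zeta>)) \<longlongrightarrow> F \<zeta>) (at_left 1))}"

definition best_approximation ::
    "(complex \<Rightarrow> complex^'n^'m) \<Rightarrow> (complex \<Rightarrow> complex^'n^'m) \<Rightarrow> bool" where
  "best_approximation \<Phi> F \<longleftrightarrow>
     F \<in> Hinf \<and> Linf_norm (\<lambda>\<zeta>. \<Phi> \<zeta> - F \<zeta>) = (INF G\<in>Hinf. Linf_norm (\<lambda>\<zeta>. \<Phi> \<zeta> - G \<zeta>))"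


definition L2 :: "(complex \<Rightarrow> complex^'n) set" where
  "L2 = {f \<in> borel_measurable circle. integrable circle (\<lambda>\<zeta>. (norm (f \<zeta>))\<^sup>2)}"

definition L2_inner :: "(complex \<Rightarrow> complex^'n) \<Rightarrow> (complex \<Rightarrow> complex^'n) \<Rightarrow> complex" where
  "L2_inner f g = (LINT \<zeta>|circle. vec_cinner (f \<zeta>) (g \<zeta>))"

definition L2_norm :: "(complex \<Rightarrow> complex^'n) \<Rightarrow> real" where
  "L2_norm f = sqrt (LINT \<zeta>|circle. (norm (f \<zeta>))\<^sup>2)"

definition fourier_coeff :: "(complex \<Rightarrow> complex^'n) \<Rightarrow> int \<Rightarrow> complex^'n" where
  "fourier_coeff f k = (LINT \<zeta>|circle. (\<zeta> powi (- k)) *s f \<zeta>)"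

definition H2 :: "(complex \<Rightarrow> complex^'n) set" where
  "H2 = {f \<in> L2. \<forall>k<0. fourier_coeff f k = 0}"

definition H2_minus :: "(complex \<Rightarrow> complex^'n) set" where
  "H2_minus = {g \<in> L2. \<forall>h\<in>H2. L2_inner g h = 0}"

text \<open>For a closed subspace \<open>S\<close> the projection of \<open>f \<in> L2\<close> is determined up to a null set; a
  representative is chosen.\<close>

definition L2_proj ::
    "(complex \<Rightarrow> complex^'n) set \<Rightarrow> (complex \<Rightarrow> complex^'n) \<Rightarrow> (complex \<Rightarrow> complex^'n)" where
  "L2_proj S f = (SOME g. g \<in> S \<and> (\<forall>h\<in>S. L2_inner (\<lambda>\<zeta>. f \<zeta> - g \<zeta>) h = 0))"

definition toeplitz ::
    "(complex \<Rightarrow> complex^'n^'m) \<Rightarrow> (complex \<Rightarrow> complex^'n) \<Rightarrow> (complex \<Rightarrow> complex^'m)" where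
  "toeplitz \<Phi> f = L2_proj H2 (\<lambda>\<zeta>. \<Phi> \<zeta> *v f \<zeta>)"

definition hankel ::
    "(complex \<Rightarrow> complex^'n^'m) \<Rightarrow> (complex \<Rightarrow> complex^'n) \<Rightarrow> (complex \<Rightarrow> complex^'m)" where
  "hankel \<Phi> f = L2_proj H2_minus (\<lambda>\<zeta>. \<Phi> \<zeta> *v f \<zeta>)"

definition toeplitz_ker :: "(complex \<Rightarrow> complex^'n^'m) \<Rightarrow> (complex \<Rightarrow> complex^'n) set" where
  "toeplitz_ker \<Phi> = {f \<in> H2. AE \<zeta> in circle. toeplitz \<Phi> f \<zeta> = 0}"


definition L2_linear_on ::
    "(complex \<Rightarrow> complex^'n) set \<Rightarrow> (complex \<Rightarrow> complex^'m) set \<Rightarrow>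
     ((complex \<Rightarrow> complex^'n) \<Rightarrow> (complex \<Rightarrow> complex^'m)) \<Rightarrow> bool" where
  "L2_linear_on U V K \<longleftrightarrow>
     (\<forall>f\<in>U. K f \<in> V) \<and>
     (\<forall>f\<in>U. \<forall>g\<in>U. \<forall>a b. AE \<zeta> in circle.
        K (\<lambda>\<xi>. a *s f \<xi> + b *s g \<xi>) \<zeta> = a *s K f \<zeta> + b *s K g \<zeta>)"

text \<open>The sequential condition also forces \<open>K\<close> to respect almost everywhere equality: if \<open>f = 0\<close>
  almost everywhere, apply it to the sequence \<open>k *s f\<close> (\<open>k = 0, 1, \<dots>\<close>) of functions of norm \<open>0\<close>.
  So no separate congruence condition is required.\<close>

definition L2_compact_on ::
    "(complex \<Rightarrow> complex^'n) set \<Rightarrow> (complex \<Rightarrow> complex^'m) set \<Rightarrow>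
     ((complex \<Rightarrow> complex^'n) \<Rightarrow> (complex \<Rightarrow> complex^'m)) \<Rightarrow> bool" where
  "L2_compact_on U V K \<longleftrightarrow>
     L2_linear_on U V K \<and>
     (\<forall>f :: nat \<Rightarrow> complex \<Rightarrow> complex^'n. (\<forall>k. f k \<in> U \<and> L2_norm (f k) \<le> 1) \<longrightarrow>
        (\<exists>r g. strict_mono (r :: nat \<Rightarrow> nat) \<and> g \<in> V \<and>
           (\<lambda>k. L2_norm (\<lambda>\<zeta>. K (f (r k)) \<zeta> - g \<zeta>)) \<longlonglongrightarrow> 0))"

definition L2_opnorm ::
    "(complex \<Rightarrow> complex^'n) set \<Rightarrow> ((complex \<Rightarrow> complex^'n) \<Rightarrow> (complex \<Rightarrow> complex^'m)) \<Rightarrow>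
     ennreal" where
  "L2_opnorm U A = (SUP f\<in>{f \<in> U. L2_norm f \<le> 1}. ennreal (L2_norm (A f)))"

definition L2_essnorm ::
    "(complex \<Rightarrow> complex^'n) set \<Rightarrow> (complex \<Rightarrow> complex^'m) set \<Rightarrow>
     ((complex \<Rightarrow> complex^'n) \<Rightarrow> (complex \<Rightarrow> complex^'m)) \<Rightarrow> ennreal" where
  "L2_essnorm U V A =
     (INF K\<in>{K. L2_compact_on U V K}. L2_opnorm U (\<lambda>f \<zeta>. A f \<zeta> - K f \<zeta>))"

end

theory Submission
  imports Defs "HOL-Probability.Probability_Measure" "HOL-Complex_Analysis.Cauchy_Integral_Formula"
    "HOL-Library.Function_Algebras"
begin

text \<open>Because \<open>\<Phi>\<close> has norm one, zero is its only best approximation precisely when every bounded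
analytic \<open>F\<close> with \<open>\<Phi> - F\<close> contractive almost everywhere vanishes (\<open>best_approximation_zero_iff\<close>).

\<^emph>\<open>Sufficiency.\<close> Let \<open>f\<close> in \<open>Ker T\<^sub>\<Phi>\<close> take its values in \<open>(Ker \<Phi>)\<^sup>\<bottom>\<close>, where condition (i) makes \<open>\<Phi>\<close>
isometric. Then \<open>\<Phi> f\<close> lies in \<open>H2_minus\<close> and \<open>F f\<close> in \<open>H2\<close>, so
\<open>|f|\<^sup>2 \<ge> |(\<Phi> - F) f|\<^sup>2 = |\<Phi> f|\<^sup>2 + |F f|\<^sup>2 = |f|\<^sup>2 + |F f|\<^sup>2\<close>, which forces \<open>F f = 0\<close>. By (ii) such \<open>f\<close>
span \<open>(Ker \<Phi>)\<^sup>\<bottom>\<close>, and a contraction \<open>\<Phi> - F\<close> that is already isometric there cannot differ from \<open>\<Phi>\<close>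
(\<open>contraction_rigidity\<close>).

\<^emph>\<open>Necessity.\<close> Put \<open>Q f = |f|\<^sup>2 - |H\<^sub>\<Phi> f|\<^sup>2\<close> on \<open>H2\<close> and let \<open>L f\<close> be the mean value of \<open>\<Phi> f\<close>. For a constant
matrix \<open>C\<close> the function \<open>cnj \<zeta> (\<Phi> - C)\<close> has a contractive Hankel operator if and only if
\<open>|L f - C f(0)|\<^sup>2 \<le> Q f\<close> for all \<open>f\<close> (\<open>hankel_contractive_step_iff\<close>). By Nehari's theorem (\<open>nehari\<close>) every
such \<open>C\<close> is the value at the origin of some bounded analytic \<open>F\<close> with \<open>\<Phi> - F\<close> contractive, so
uniqueness says that \<open>C = 0\<close> is the only admissible matrix. An essential norm below one makes the
functions in \<open>H2\<close> vanishing at the origin complete for \<open>Q\<close>, so that orthogonal projections and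
Riesz representers exist there. Testing rank-one candidates for \<open>C\<close> then leaves two
possibilities (\<open>uniqueness_alternative\<close>). Either every constant vector is the value at the origin
of some \<open>x\<close> with \<open>Q x = 0\<close>; such \<open>x\<close> lie in \<open>Ker T\<^sub>\<Phi>\<close> and \<open>\<Phi>\<close> preserves their length pointwise. Or every
vector \<open>p\<close> equals \<open>L y\<close> for some \<open>y\<close> vanishing at the origin with \<open>Q y = |p|\<^sup>2\<close>; then \<open>cnj \<zeta> y\<close> lies in
\<open>Ker T\<^sub>\<Phi>\<close>, \<open>\<Phi>\<close> preserves the length of \<open>y\<close>, and \<open>\<Phi> y\<close> is the conjugate of a function in \<open>H2\<close> whose value at
the origin is the conjugate of \<open>p\<close>. Functions in \<open>H2\<close> with linearly independent values at the origin
stay independent almost everywhere, because a suitable multiple of their determinant is bounded,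
analytic and not identically zero (\<open>independent_AE\<close>). Hence \<open>\<Phi>\<close> is isometric in the first case and
coisometric in the second, and the functions found span \<open>(Ker \<Phi>)\<^sup>\<bottom>\<close>.

Nehari's theorem is obtained by choosing the Taylor coefficients of \<open>F\<close> one after another: Parrott's
argument (\<open>parrott_step\<close>) keeps all the Hankel operators contractive, and Szego kernels together with
Fatou's theorem on radial limits turn the resulting operator bounds into a pointwise bound.\<close>

section \<open>The normalized measure on the circle\<close>

lemma space_circle [simp]: "space circle = sphere 0 1"
  by (simp add: circle_def)

lemma sets_circle: "sets circle = sets (restrict_space borel (sphere 0 1))"
  by (simp add: circle_def)

lemma measurable_circleI:
  assumes "f \<in> borel_measurable borel" shows "f \<in> borel_measurable circle"
proof -
  have "measurable circle borel = measurable (restrict_space borel (sphere 0 1)) borel"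
    by (intro measurable_cong_sets sets_circle refl)
  then show ?thesis using measurable_restrict_space1[OF assms] by blast
qed

lemma emeasure_interval_2pi: "emeasure lborel {0..2*pi} = ennreal (2*pi)"
  by simp

lemma cis_measurable_circle:
  "cis \<in> measurable (uniform_measure lborel {0..2*pi}) (restrict_space borel (sphere 0 1))"
proof (rule measurable_restrict_space2)
  show "cis \<in> space (uniform_measure lborel {0..2*pi}) \<rightarrow> sphere 0 1" by simp
  have "cis \<in> borel_measurable borel"
    by (intro borel_measurable_continuous_onI continuous_intros)
  then show "cis \<in> borel_measurable (uniform_measure lborel {0..2 * pi})" by simp
qed

lemma prob_space_circle: "prob_space circle"
  unfolding circle_def
  by (intro prob_space.prob_space_distr prob_space_uniform_measure cis_measurable_circle) auto

interpretation circle: prob_space circle by (rule prob_space_circle)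

lemma uniform_2pi_density:
  "uniform_measure lborel {0..2*pi} = density lborel (\<lambda>t. ennreal (indicator {0..2*pi} t / (2*pi)))"
  unfolding uniform_measure_def
  by (intro density_cong)
     (auto simp: emeasure_interval_2pi divide_ennreal[symmetric] indicator_def ennreal_divide_numeral split: split_indicator)

lemma
  fixes f :: "complex \<Rightarrow> 'b::{banach, second_countable_topology}"
  assumes f: "f \<in> borel_measurable circle"
  shows integrable_circle_iff: "integrable circle f \<longleftrightarrow> set_integrable lborel {0..2*pi} (\<lambda>t. f (cis t))"
    and integral_circle: "(LINT \<zeta>|circle. f \<zeta>) = (LINT t:{0..2*pi}|lborel. f (cis t)) /\<^sub>R (2*pi)"
proof -
  have f': "f \<in> borel_measurable (restrict_space borel (sphere 0 1))"
    using f measurable_cong_sets[OF sets_circle refl] by blast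
  have m: "(\<lambda>t. f (cis t)) \<in> borel_measurable lborel"
    using measurable_compose[OF cis_measurable_circle f'] by simp
  have "integrable circle f \<longleftrightarrow> integrable (uniform_measure lborel {0..2*pi}) (\<lambda>t. f (cis t))"
    unfolding circle_def by (rule integrable_distr_eq[OF cis_measurable_circle f'])
  also have "\<dots> \<longleftrightarrow> integrable lborel (\<lambda>t. (indicator {0..2*pi} t / (2*pi)) *\<^sub>R f (cis t))"
    unfolding uniform_2pi_density using m by (intro integrable_density) auto
  also have "\<dots> \<longleftrightarrow> integrable lborel (\<lambda>t. (1/(2*pi)) *\<^sub>R (indicator {0..2*pi} t *\<^sub>R f (cis t)))"
    by simp
  also have "\<dots> \<longleftrightarrow> set_integrable lborel {0..2*pi} (\<lambda>t. f (cis t))"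
    unfolding set_integrable_def
  proof
    assume "integrable lborel (\<lambda>t. (1/(2*pi)) *\<^sub>R (indicator {0..2*pi} t *\<^sub>R f (cis t)))"
    from integrable_scaleR_right[of "2*pi", OF this]
    show "integrable lborel (\<lambda>t. indicator {0..2*pi} t *\<^sub>R f (cis t))" by simp
  next
    assume "integrable lborel (\<lambda>t. indicator {0..2*pi} t *\<^sub>R f (cis t))"
    then show "integrable lborel (\<lambda>t. (1/(2*pi)) *\<^sub>R (indicator {0..2*pi} t *\<^sub>R f (cis t)))"
      by (rule integrable_scaleR_right)
  qed
  finally show "integrable circle f \<longleftrightarrow> set_integrable lborel {0..2*pi} (\<lambda>t. f (cis t))" .
  have "(LINT \<zeta>|circle. f \<zeta>) = (LINT t|uniform_measure lborel {0..2*pi}. f (cis t))"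
    unfolding circle_def by (rule integral_distr[OF cis_measurable_circle f'])
  also have "\<dots> = (LINT t|lborel. (indicator {0..2*pi} t / (2*pi)) *\<^sub>R f (cis t))"
    unfolding uniform_2pi_density using m by (intro integral_density) auto
  also have "\<dots> = (LINT t|lborel. (1/(2*pi)) *\<^sub>R (indicator {0..2*pi} t *\<^sub>R f (cis t)))"
    by simp
  also have "\<dots> = (LINT t:{0..2*pi}|lborel. f (cis t)) /\<^sub>R (2*pi)"
    unfolding set_lebesgue_integral_def inverse_eq_divide by (rule integral_scaleR_right)
  finally show "(LINT \<zeta>|circle. f \<zeta>) = (LINT t:{0..2*pi}|lborel. f (cis t)) /\<^sub>R (2*pi)" .
qed

text \<open>Away from the point \<open>1\<close> the argument is continuous, so the image of a null set of parameters is measurable and hence a null set. Discarding the end points lets the Lebesgue points used later be interior to the parameter interval.\<close>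

lemma AE_circleI:
  assumes N: "N \<in> null_sets lborel" and P: "\<And>t. t \<in> {0<..<2*pi} - N \<Longrightarrow> P (cis t)"
  shows "AE \<zeta> in circle. P \<zeta>"
proof -
  define S where "S = sphere (0::complex) 1 - {1}"
  have NS: "N \<in> sets borel" using N by auto
  have "isCont Arg2pi z" if "z \<in> S" for z
  proof (rule continuous_at_Arg2pi)
    show "z \<notin> \<real>\<^sub>\<ge>\<^sub>0" using that by (auto simp: S_def complex_nonneg_Reals_iff cmod_eq_Re complex_eq_iff)
  qed
  then have "continuous_on S Arg2pi" by (simp add: continuous_at_imp_continuous_on)
  then have "Arg2pi \<in> borel_measurable (restrict_space borel S)"
    by (rule borel_measurable_continuous_on_restrict)
  then have "Arg2pi -` N \<inter> space (restrict_space borel S) \<in> sets (restrict_space borel S)"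
    using NS by (rule measurable_sets)
  moreover have Sb: "S \<in> sets borel" unfolding S_def by auto
  ultimately have A: "Arg2pi -` N \<inter> S \<in> sets borel"
    by (simp add: space_restrict_space sets_restrict_space_iff)
  define A where "A = insert 1 (Arg2pi -` N \<inter> S)"
  have A': "A \<in> sets (restrict_space borel (sphere 0 1))"
    using A by (auto simp: A_def sets_restrict_space_iff S_def)
  have cA: "cis -` A \<inter> {0..2*pi} \<subseteq> N \<union> {0, 2*pi}"
  proof
    fix t assume t: "t \<in> cis -` A \<inter> {0..2*pi}"
    show "t \<in> N \<union> {0,2*pi}"
    proof (rule ccontr)
      assume n: "t \<notin> N \<union> {0,2*pi}"
      then have t2: "0 < t" "t < 2*pi" using t by auto
      have "Arg2pi (cis t) = t" using t2 by (intro Arg2pi_unique[of 1]) (auto simp: cis_conv_exp)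
      moreover have "cis t \<noteq> 1"
      proof
        assume "cis t = 1"
        then have "Arg2pi (cis t) = 0" by (simp add: Arg2pi_of_real[of 1, simplified])
        then show False using \<open>Arg2pi (cis t) = t\<close> t2 by simp
      qed
      ultimately show False using t n by (auto simp: A_def)
    qed
  qed
  have "emeasure circle A = emeasure (uniform_measure lborel {0..2*pi}) (cis -` A)"
    unfolding circle_def using emeasure_distr[OF cis_measurable_circle A'] by simp
  also have "\<dots> = emeasure lborel ({0..2*pi} \<inter> cis -` A) / emeasure lborel {0..2*pi}"
    using measurable_sets[OF cis_measurable_circle A'] by (intro emeasure_uniform_measure) auto
  also have "emeasure lborel ({0..2*pi} \<inter> cis -` A) = 0"
  proof -
    have "{0, 2*pi} \<in> null_sets lborel"
      by (intro countable_imp_null_set_lborel) auto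
    then have "N \<union> {0,2*pi} \<in> null_sets lborel" using N by (intro null_sets.Un)
    moreover have "{0..2*pi} \<inter> cis -` A \<in> sets lborel"
      using measurable_sets[OF cis_measurable_circle A'] by auto
    ultimately have "{0..2*pi} \<inter> cis -` A \<in> null_sets lborel"
      using null_sets_subset cA by (metis inf_commute)
    then show ?thesis by auto
  qed
  finally have "emeasure circle A = 0" by simp
  then have nA: "A \<in> null_sets circle" using A' by (auto simp: sets_circle null_sets_def)
  show ?thesis
  proof (rule AE_I'[OF nA], rule subsetI)
    fix z assume "z \<in> {x \<in> space circle. \<not> P x}"
    then have z: "norm z = 1" "\<not> P z" by auto
    have cz: "z = cis (Arg2pi z)" using Arg2pi_eq[of z] z by (simp add: cis_conv_exp)
    have b: "0 \<le> Arg2pi z" "Arg2pi z < 2*pi" by (auto simp: Arg2pi)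
    show "z \<in> A"
    proof (cases "z = 1 \<or> Arg2pi z \<in> N")
      case True then show ?thesis using z by (auto simp: A_def S_def)
    next
      case False
      then have "Arg2pi z \<noteq> 0" using cz by (metis cis_zero)
      then have "Arg2pi z \<in> {0<..<2*pi} - N" using b False by auto
      then show ?thesis using P cz z by metis
    qed
  qed
qed

lemma integral_circle_power_int:
  "(LINT \<zeta>|circle. \<zeta> powi k) = (if k = 0 then 1 else 0)"
proof (cases "k = 0")
  case True then show ?thesis using circle.prob_space by simp
next
  case False
  have m: "(\<lambda>\<zeta>. \<zeta> powi k) \<in> borel_measurable circle"
    by (intro measurable_circleI) (cases k rule: int_cases4, auto simp: power_int_minus)
  have d: "((\<lambda>t. cis (k*t) / (\<i> * of_int k)) has_vector_derivative cis (k * t)) (at t within {0..2*pi})" for t :: real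
  proof -
    have "((\<lambda>t. exp (\<i> * of_int k * t) / (\<i> * of_int k)) has_field_derivative exp (\<i> * of_int k * z)) (at z)" for z
      using False by (auto intro!: derivative_eq_intros)
    from has_vector_derivative_real_field[OF this[of "of_real t"]]
    show ?thesis by (simp add: cis_conv_exp mult.assoc)
  qed
  have "((\<lambda>t. cis (k * t)) has_integral (cis (k*(2*pi)) / (\<i> * of_int k) - cis (of_int k*0) / (\<i> * of_int k))) {0..2*pi}"
    by (rule fundamental_theorem_of_calculus) (use d in auto)
  moreover have "cis (k*(2*pi)) = 1" using cis_multiple_2pi[of k] by (simp add: mult_ac)
  ultimately have hi: "((\<lambda>t. cis (k * t)) has_integral 0) {0..2*pi}" by simp
  have "set_integrable lborel {0..2*pi} (\<lambda>t. cis (k * t))"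
    by (intro borel_integrable_atLeastAtMost') (intro continuous_intros)
  from trans[OF set_borel_integral_eq_integral(2)[OF this] integral_unique[OF hi]]
  have z: "(LINT t:{0..2*pi}|lborel. cis (k*t)) = 0" .
  have e: "cis t powi k = cis (k * t)" for t :: real by (rule Complex.cis_power_int)
  have "(LINT \<zeta>|circle. \<zeta> powi k) = 0"
    unfolding integral_circle[OF m] e z by (rule scaleR_zero_right)
  then show ?thesis unfolding if_not_P[OF False] .
qed

section \<open>Integration against monotone kernels\<close>

lemma norm_integral_le:
  fixes f :: "'a \<Rightarrow> 'b::{banach, second_countable_topology}"
  assumes g: "integrable M g" and le: "AE x in M. norm (f x) \<le> g x"
  shows "norm (LINT x|M. f x) \<le> (LINT x|M. g x)"
proof (cases "integrable M f")
  case True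
  have "norm (LINT x|M. f x) \<le> (LINT x|M. norm (f x))" by (rule integral_norm_bound)
  also have "\<dots> \<le> (LINT x|M. g x)"
    by (rule integral_mono_AE[OF integrable_norm[OF True] g le])
  finally show ?thesis .
next
  case False
  have "0 \<le> (LINT x|M. g x)"
    by (rule integral_nonneg_AE, rule AE_mp[OF le]) (auto intro: order_trans[OF norm_ge_zero])
  then show ?thesis using not_integrable_integral_eq[OF False] by simp
qed

text \<open>Integration by parts for an integrand \<open>h\<close> that is merely integrable: write \<open>\<phi> t - \<phi> \<delta>\<close> as the integral of \<open>\<psi>\<close> over \<open>{t..\<delta>}\<close> and exchange the two integrations.\<close>

lemma kernel_by_parts:
  fixes h :: "real \<Rightarrow> complex"
  assumes d: "0 \<le> \<delta>" and h: "set_integrable lborel {0..\<delta>} h"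
    and der: "\<And>t. t \<in> {0..\<delta>} \<Longrightarrow> (\<phi> has_real_derivative - \<psi> t) (at t)"
    and cont: "continuous_on {0..\<delta>} \<psi>"
  shows "(LINT t:{0..\<delta>}|lborel. \<phi> t *\<^sub>R h t)
    = \<phi> \<delta> *\<^sub>R (LINT t:{0..\<delta>}|lborel. h t) + (LINT v:{0..\<delta>}|lborel. \<psi> v *\<^sub>R (LINT t:{0..v}|lborel. h t))"
proof -
  define h' where "h' = (\<lambda>t. indicator {0..\<delta>} t *\<^sub>R h t)"
  define p where "p = (\<lambda>t. indicator {0..\<delta>} t *\<^sub>R \<psi> t)"
  have ih: "integrable lborel h'" using h by (simp add: h'_def set_integrable_def)
  have ip: "integrable lborel p"
    using borel_integrable_atLeastAtMost'[OF cont] by (simp add: p_def set_integrable_def)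
  have [measurable]: "h' \<in> borel_measurable lborel" "p \<in> borel_measurable lborel"
    using ih ip by auto
  define f where "f = (\<lambda>t v. (if t \<le> v then 1 else 0) *\<^sub>R (p v *\<^sub>R h' t))"
  have fm: "case_prod f \<in> borel_measurable (lborel \<Otimes>\<^sub>M lborel)"
    unfolding f_def by measurable
  have fint: "integrable (lborel \<Otimes>\<^sub>M lborel) (case_prod f)"
  proof (rule lborel_pair.Fubini_integrable[OF fm])
    have b: "integrable lborel (\<lambda>v. f t v)" for t
      by (rule Bochner_Integration.integrable_bound[OF integrable_scaleR_left[of "h' t", OF ip]])
         (auto simp: f_def)
    then show "AE t in lborel. integrable lborel (\<lambda>v. case (t, v) of (x, xa) \<Rightarrow> f x xa)" by simp
    show "integrable lborel (\<lambda>t. \<integral>v. norm (case (t, v) of (x, xa) \<Rightarrow> f x xa) \<partial>lborel)"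
    proof (rule Bochner_Integration.integrable_bound)
      show "integrable lborel (\<lambda>t. (\<integral>v. norm (p v) \<partial>lborel) *\<^sub>R h' t)" using ih by simp
      show "(\<lambda>t. \<integral>v. norm (case (t, v) of (x, xa) \<Rightarrow> f x xa) \<partial>lborel) \<in> borel_measurable lborel"
        using fm by measurable
      have "(\<integral>v. norm (f t v) \<partial>lborel) \<le> (\<integral>v. norm (p v) * norm (h' t) \<partial>lborel)" for t
      proof (rule integral_mono)
        show "integrable lborel (\<lambda>v. norm (f t v))" by (rule integrable_norm[OF b])
        show "integrable lborel (\<lambda>v. norm (p v) * norm (h' t))"
          by (rule integrable_mult_left[OF integrable_norm[OF ip]])
      qed (simp add: f_def)
      then show "AE t in lborel. norm (\<integral>v. norm (case (t, v) of (x, xa) \<Rightarrow> f x xa) \<partial>lborel)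
          \<le> norm ((\<integral>v. norm (p v) \<partial>lborel) *\<^sub>R h' t)" by simp
    qed
  qed
  have A: "(\<integral>v. f t v \<partial>lborel) = indicator {0..\<delta>} t *\<^sub>R ((\<phi> t - \<phi> \<delta>) *\<^sub>R h t)" for t
  proof (cases "t \<in> {0..\<delta>}")
    case True
    have I1: "set_integrable lborel {t..\<delta>} \<psi>"
      using True by (intro borel_integrable_atLeastAtMost' continuous_on_subset[OF cont]) auto
    have I2: "(\<psi> has_integral (- \<phi> \<delta> - - \<phi> t)) {t..\<delta>}"
    proof (rule fundamental_theorem_of_calculus)
      fix v assume "v \<in> {t..\<delta>}"
      then have "((\<lambda>x. - \<phi> x) has_real_derivative \<psi> v) (at v)"
        using True DERIV_minus[OF der[of v]] by simp
      then show "((\<lambda>x. - \<phi> x) has_vector_derivative \<psi> v) (at v within {t..\<delta>})"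
        by (simp add: has_real_derivative_iff_has_vector_derivative has_vector_derivative_at_within)
    qed (use True in simp)
    have I: "(LINT v:{t..\<delta>}|lborel. \<psi> v) = \<phi> t - \<phi> \<delta>"
      using trans[OF set_borel_integral_eq_integral(2)[OF I1] integral_unique[OF I2]] by simp
    have "(\<integral>v. f t v \<partial>lborel) = (\<integral>v. (indicator {t..\<delta>} v *\<^sub>R \<psi> v) *\<^sub>R h t \<partial>lborel)"
      using True by (intro Bochner_Integration.integral_cong) (auto simp: f_def h'_def p_def indicator_def)
    also have "\<dots> = (\<integral>v. indicator {t..\<delta>} v *\<^sub>R \<psi> v \<partial>lborel) *\<^sub>R h t"
      by (rule integral_scaleR_left) (use I1 in \<open>simp only: set_integrable_def\<close>)
    also have "\<dots> = (\<phi> t - \<phi> \<delta>) *\<^sub>R h t"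
      using I by (simp only: set_lebesgue_integral_def)
    finally show ?thesis using True by simp
  qed (simp add: f_def h'_def)
  have B: "(\<integral>t. f t v \<partial>lborel) = indicator {0..\<delta>} v *\<^sub>R (\<psi> v *\<^sub>R (LINT t:{0..v}|lborel. h t))" for v
  proof (cases "v \<in> {0..\<delta>}")
    case True
    have "(\<integral>t. f t v \<partial>lborel) = (\<integral>t. \<psi> v *\<^sub>R (indicator {0..v} t *\<^sub>R h t) \<partial>lborel)"
      using True by (intro Bochner_Integration.integral_cong) (auto simp: f_def h'_def p_def indicator_def)
    then show ?thesis using True by (simp add: set_lebesgue_integral_def del: scaleR_scaleR)
  qed (simp add: f_def p_def)
  have "(LINT t:{0..\<delta>}|lborel. (\<phi> t - \<phi> \<delta>) *\<^sub>R h t) = (LINT v:{0..\<delta>}|lborel. \<psi> v *\<^sub>R (LINT t:{0..v}|lborel. h t))"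
    using lborel_pair.Fubini_integral[OF fint] unfolding A B set_lebesgue_integral_def by simp
  moreover have "set_integrable lborel {0..\<delta>} (\<lambda>t. \<phi> t *\<^sub>R h t)"
  proof -
    have "continuous_on {0..\<delta>} \<phi>"
      by (intro continuous_at_imp_continuous_on ballI DERIV_isCont[OF der])
    then have "(\<lambda>t. indicator {0..\<delta>} t *\<^sub>R \<phi> t) \<in> borel_measurable lborel"
      using borel_measurable_continuous_on_indicator[of "{0..\<delta>}" \<phi>] by simp
    moreover obtain C where C: "\<And>t. t \<in> {0..\<delta>} \<Longrightarrow> \<bar>\<phi> t\<bar> \<le> C"
      using compact_imp_bounded[OF compact_continuous_image[OF \<open>continuous_on {0..\<delta>} \<phi>\<close> compact_Icc]]
      by (meson bounded_real imageI)
    have "integrable lborel (\<lambda>t. (indicator {0..\<delta>} t *\<^sub>R \<phi> t) *\<^sub>R h' t)"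
    proof (rule Bochner_Integration.integrable_bound[OF integrable_scaleR_right[of C, OF ih]])
      show "(\<lambda>t. (indicator {0..\<delta>} t *\<^sub>R \<phi> t) *\<^sub>R h' t) \<in> borel_measurable lborel"
        using calculation by measurable
      show "AE t in lborel. norm ((indicator {0..\<delta>} t *\<^sub>R \<phi> t) *\<^sub>R h' t) \<le> norm (C *\<^sub>R h' t)"
        using C d by (auto simp: indicator_def abs_le_iff intro!: AE_I2 mult_right_mono order_trans[OF C] split: if_splits)
    qed
    moreover have "(\<lambda>t. (indicator {0..\<delta>} t *\<^sub>R \<phi> t) *\<^sub>R h' t) = (\<lambda>t. indicator {0..\<delta>} t *\<^sub>R \<phi> t *\<^sub>R h t)"
      by (auto simp: fun_eq_iff h'_def indicator_def)
    ultimately show ?thesis unfolding set_integrable_def by simp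
  qed
  ultimately show ?thesis using h
    by (simp add: scaleR_diff_left set_integral_diff set_integrable_scaleR_right del: scaleR_scaleR) (simp add: set_lebesgue_integral_def algebra_simps)
qed

text \<open>A decreasing kernel is a positive combination of indicators of intervals \<open>{0..v}\<close>; a bound on the means of \<open>h\<close> over such intervals therefore carries over to the kernel. Comparison with \<open>h = 1\<close> identifies the constant.\<close>

lemma kernel_bound:
  fixes h :: "real \<Rightarrow> complex"
  assumes d: "0 \<le> \<delta>" and h: "set_integrable lborel {0..\<delta>} h"
    and der: "\<And>t. t \<in> {0..\<delta>} \<Longrightarrow> (\<phi> has_real_derivative - \<psi> t) (at t)"
    and cont: "continuous_on {0..\<delta>} \<psi>"
    and psi: "\<And>t. t \<in> {0..\<delta>} \<Longrightarrow> 0 \<le> \<psi> t" and phi: "0 \<le> \<phi> \<delta>"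
    and bd: "\<And>u. u \<in> {0..\<delta>} \<Longrightarrow> norm (LINT t:{0..u}|lborel. h t) \<le> \<epsilon> * u"
  shows "norm (LINT t:{0..\<delta>}|lborel. \<phi> t *\<^sub>R h t) \<le> \<epsilon> * (LINT t:{0..\<delta>}|lborel. \<phi> t)"
proof -
  have c1: "set_integrable lborel {0..\<delta>} (\<lambda>t. 1::complex)"
    by (intro borel_integrable_atLeastAtMost') auto
  have len: "(LINT t:{0..v}|lborel. 1::complex) = of_real v" if "0 \<le> v" for v :: real
    using that by (simp add: set_lebesgue_integral_def scaleR_conv_of_real)
  have e0: "0 \<le> \<epsilon>" if "0 < \<delta>"
    using bd[of \<delta>] that norm_ge_zero order_trans by (metis atLeastAtMost_iff order_refl less_imp_le zero_le_mult_iff not_less)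
  have ip: "set_integrable lborel {0..\<delta>} (\<lambda>v. \<psi> v * v)"
    by (intro borel_integrable_atLeastAtMost' continuous_intros cont)
  have "of_real (LINT t:{0..\<delta>}|lborel. \<phi> t) = (LINT t:{0..\<delta>}|lborel. \<phi> t *\<^sub>R (1::complex))"
    unfolding set_lebesgue_integral_def by (simp add: scaleR_conv_of_real flip: integral_complex_of_real of_real_mult)
  also have "\<dots> = \<phi> \<delta> *\<^sub>R of_real \<delta> + (LINT v:{0..\<delta>}|lborel. \<psi> v *\<^sub>R (LINT t:{0..v}|lborel. 1::complex))"
    using kernel_by_parts[OF d c1 der cont] len[OF d] by simp
  also have "(LINT v:{0..\<delta>}|lborel. \<psi> v *\<^sub>R (LINT t:{0..v}|lborel. 1::complex))
     = (LINT v:{0..\<delta>}|lborel. of_real (\<psi> v * v))"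
    by (intro set_lebesgue_integral_cong) (auto simp: len scaleR_conv_of_real)
  also have "\<dots> = of_real (LINT v:{0..\<delta>}|lborel. \<psi> v * v)"
    unfolding set_lebesgue_integral_def by (simp add: scaleR_conv_of_real flip: integral_complex_of_real of_real_mult)
  finally have "complex_of_real (LINT t:{0..\<delta>}|lborel. \<phi> t) = of_real (\<phi> \<delta> * \<delta> + (LINT v:{0..\<delta>}|lborel. \<psi> v * v))"
    by (simp add: scaleR_conv_of_real)
  then have one: "(LINT t:{0..\<delta>}|lborel. \<phi> t) = \<phi> \<delta> * \<delta> + (LINT v:{0..\<delta>}|lborel. \<psi> v * v)"
    using of_real_eq_iff by blast
  have "norm (LINT v:{0..\<delta>}|lborel. \<psi> v *\<^sub>R (LINT t:{0..v}|lborel. h t)) \<le> (LINT v:{0..\<delta>}|lborel. \<epsilon> * (\<psi> v * v))"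
    unfolding set_lebesgue_integral_def
  proof (rule norm_integral_le)
    show "integrable lborel (\<lambda>v. indicator {0..\<delta>} v *\<^sub>R (\<epsilon> * (\<psi> v * v)))"
      using set_integrable_mult_right[OF ip, of \<epsilon>] by (simp add: set_integrable_def)
    show "AE v in lborel. norm (indicator {0..\<delta>} v *\<^sub>R \<psi> v *\<^sub>R (\<integral>x. indicator {0..v} x *\<^sub>R h x \<partial>lborel))
        \<le> indicator {0..\<delta>} v *\<^sub>R (\<epsilon> * (\<psi> v * v))"
    proof (rule AE_I2)
      fix v :: real
      show "norm (indicator {0..\<delta>} v *\<^sub>R \<psi> v *\<^sub>R (\<integral>x. indicator {0..v} x *\<^sub>R h x \<partial>lborel))
        \<le> indicator {0..\<delta>} v *\<^sub>R (\<epsilon> * (\<psi> v * v))"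
        using mult_left_mono[OF bd[of v] psi[of v]]
        by (auto simp: indicator_def set_lebesgue_integral_def psi mult_ac)
    qed
  qed
  then have A: "norm (LINT v:{0..\<delta>}|lborel. \<psi> v *\<^sub>R (LINT t:{0..v}|lborel. h t)) \<le> \<epsilon> * (LINT v:{0..\<delta>}|lborel. \<psi> v * v)"
    by simp
  have B: "norm (\<phi> \<delta> *\<^sub>R (LINT t:{0..\<delta>}|lborel. h t)) \<le> \<epsilon> * (\<phi> \<delta> * \<delta>)"
    using mult_left_mono[OF bd[of \<delta>] phi] d phi by (simp add: mult_ac)
  have "norm (LINT t:{0..\<delta>}|lborel. \<phi> t *\<^sub>R h t) \<le> \<epsilon> * (\<phi> \<delta> * \<delta>) + \<epsilon> * (LINT v:{0..\<delta>}|lborel. \<psi> v * v)"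
    by (subst kernel_by_parts[OF d h der cont], assumption, intro norm_triangle_le add_mono A B)
  then show ?thesis unfolding one by (simp add: distrib_left)
qed

section \<open>Fourier coefficients, Cauchy transform and Poisson kernel\<close>

text \<open>Scalar Fourier coefficients; \<open>fourier_coeff_nth\<close> relates them to the vector-valued ones.\<close>

definition fc :: "(complex \<Rightarrow> complex) \<Rightarrow> int \<Rightarrow> complex" where
  "fc f k = (LINT \<zeta>|circle. \<zeta> powi (-k) * f \<zeta>)"

lemma power_int_measurable_circle [measurable]: "(\<lambda>\<zeta>. \<zeta> powi k) \<in> borel_measurable circle"
  by (intro measurable_circleI) (cases k rule: int_cases4, auto simp: power_int_minus)

lemma ident_measurable_circle [measurable]: "(\<lambda>\<zeta>. \<zeta>) \<in> borel_measurable circle"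
  by (intro measurable_circleI) simp

lemma integrable_bounded_mult:
  fixes f g :: "'a \<Rightarrow> complex"
  assumes f: "integrable M f" and g: "g \<in> borel_measurable M" and B: "AE \<zeta> in M. norm (g \<zeta>) \<le> B"
  shows "integrable M (\<lambda>\<zeta>. g \<zeta> * f \<zeta>)"
proof (rule Bochner_Integration.integrable_bound)
  show "integrable M (\<lambda>\<zeta>. of_real B * f \<zeta>)" using f by simp
  show "(\<lambda>\<zeta>. g \<zeta> * f \<zeta>) \<in> borel_measurable M" using f g by measurable
  show "AE \<zeta> in M. norm (g \<zeta> * f \<zeta>) \<le> norm (of_real B * f \<zeta>)"
    using B by (rule AE_mp) (auto simp: norm_mult intro!: mult_right_mono AE_I2 order_trans[OF _ abs_ge_self])
qed

lemma integrable_circle_bounded: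
  fixes g :: "complex \<Rightarrow> 'b::{banach, second_countable_topology}"
  assumes g: "g \<in> borel_measurable circle" and B: "AE \<zeta> in circle. norm (g \<zeta>) \<le> B"
  shows "integrable circle g"
  by (rule circle.integrable_const_bound[OF B g])

lemma inverse_on_circle: "norm \<zeta> = 1 \<Longrightarrow> inverse \<zeta> = cnj \<zeta>"
proof -
  assume "norm \<zeta> = 1"
  then have "\<zeta> * cnj \<zeta> = 1" by (simp flip: complex_norm_square)
  then show ?thesis by (simp add: inverse_unique)
qed

lemma power_int_on_circle: "norm \<zeta> = 1 \<Longrightarrow> \<zeta> powi (- int k) = cnj \<zeta> ^ k"
  by (simp add: power_int_minus power_inverse[symmetric] inverse_on_circle)

lemma integrable_power_int_mult:
  "integrable circle f \<Longrightarrow> integrable circle (\<lambda>\<zeta>. \<zeta> powi k * f \<zeta>)" for f :: "complex \<Rightarrow> complex"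
  by (rule integrable_bounded_mult[where B = 1]) (auto simp: norm_power_int intro!: AE_I2)

text \<open>The Cauchy transform. On the disk it is the sum of the power series whose coefficients are the nonnegative Fourier coefficients of \<open>f\<close>.\<close>

definition cau :: "(complex \<Rightarrow> complex) \<Rightarrow> complex \<Rightarrow> complex" where
  "cau f z = (LINT \<xi>|circle. f \<xi> / (1 - z * cnj \<xi>))"

lemma one_minus_nonzero: "norm z < 1 \<Longrightarrow> norm \<xi> = 1 \<Longrightarrow> 1 - z * cnj \<xi> \<noteq> 0"
  by (metis complex_mod_cnj eq_iff_diff_eq_0 less_irrefl mult.right_neutral norm_mult norm_one)

lemma cau_sums:
  assumes f: "integrable circle f" and z: "norm z < 1"
  shows "(\<lambda>k. fc f (int k) * z ^ k) sums cau f z"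
proof -
  define g where "g = (\<lambda>(k::nat) \<xi>. z ^ k * (\<xi> powi (- int k) * f \<xi>))"
  have gi: "integrable circle (g k)" for k
    unfolding g_def using integrable_power_int_mult[OF f] by simp
  have gn: "norm (g k \<xi>) = norm z ^ k * norm (f \<xi>)" if "norm \<xi> = 1" for k \<xi>
    using that by (simp add: g_def norm_mult norm_power norm_power_int)
  have geo: "summable (\<lambda>k. norm z ^ k)" using z by simp
  have "(\<lambda>k. integral\<^sup>L circle (g k)) sums (LINT \<xi>|circle. (\<Sum>k. g k \<xi>))"
  proof (rule sums_integral[OF gi])
    show "AE \<xi> in circle. summable (\<lambda>k. norm (g k \<xi>))"
      by (rule AE_I2) (simp add: gn summable_mult2[OF geo])
    have "(LINT \<xi>|circle. norm (g k \<xi>)) = norm z ^ k * (LINT \<xi>|circle. norm (f \<xi>))" for k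
    proof -
      have "(LINT \<xi>|circle. norm (g k \<xi>)) = (LINT \<xi>|circle. norm z ^ k * norm (f \<xi>))"
        by (rule Bochner_Integration.integral_cong) (simp_all add: gn)
      then show ?thesis by simp
    qed
    then show "summable (\<lambda>k. LINT \<xi>|circle. norm (g k \<xi>))" using summable_mult2[OF geo] by simp
  qed
  moreover have "(LINT \<xi>|circle. (\<Sum>k. g k \<xi>)) = cau f z"
    unfolding cau_def
  proof (rule Bochner_Integration.integral_cong[OF refl])
    fix \<xi> assume "\<xi> \<in> space circle"
    then have x: "norm \<xi> = 1" by simp
    have "(\<lambda>k. (z * cnj \<xi>) ^ k) sums (1 / (1 - z * cnj \<xi>))"
      using geometric_sums[of "z * cnj \<xi>"] z x by (simp add: norm_mult)
    from sums_mult2[OF this, of "f \<xi>"]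
    have "(\<lambda>k. g k \<xi>) sums (f \<xi> / (1 - z * cnj \<xi>))"
      by (simp add: g_def power_int_on_circle[OF x] power_mult_distrib mult_ac)
    then show "(\<Sum>k. g k \<xi>) = f \<xi> / (1 - z * cnj \<xi>)" by (simp add: sums_iff)
  qed
  moreover have "integral\<^sup>L circle (g k) = fc f (int k) * z ^ k" for k
    unfolding g_def fc_def by (simp add: mult.commute)
  ultimately show ?thesis by simp
qed

lemma cau_holomorphic: "integrable circle f \<Longrightarrow> cau f holomorphic_on ball 0 1"
  using cau_sums by (intro power_series_holomorphic[where a = "\<lambda>k. fc f (int k)"]) auto

lemma cau_0: "cau f 0 = (LINT \<xi>|circle. f \<xi>)"
  by (simp add: cau_def)

definition poisson_kernel :: "complex \<Rightarrow> complex \<Rightarrow> real" where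
  "poisson_kernel z \<xi> = (1 - (norm z)\<^sup>2) / (norm (\<xi> - z))\<^sup>2"

lemma poisson_kernel_nonneg: "norm z < 1 \<Longrightarrow> 0 \<le> poisson_kernel z \<xi>"
  by (simp add: poisson_kernel_def power_le_one)

lemma poisson_kernel_eq:
  assumes z: "norm z < 1" and x: "norm \<xi> = 1"
  shows "complex_of_real (poisson_kernel z \<xi>) = 1 / (1 - z * cnj \<xi>) + 1 / (1 - cnj z * \<xi>) - 1"
proof -
  define a where "a = 1 - z * cnj \<xi>"
  have a: "a \<noteq> 0" using one_minus_nonzero[OF z x] by (simp add: a_def)
  have ca: "cnj a = 1 - cnj z * \<xi>" by (simp add: a_def)
  have xx: "\<xi> * cnj \<xi> = 1" using x by (simp flip: complex_norm_square)
  have "\<xi> - z = \<xi> * a" using xx by (simp add: a_def algebra_simps)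
  then have "norm (\<xi> - z) = norm a" using x by (simp add: norm_mult)
  then have "complex_of_real (poisson_kernel z \<xi>) = (1 - z * cnj z) / (a * cnj a)"
    by (simp add: poisson_kernel_def complex_norm_square[symmetric])
  also have "1 - z * cnj z = a + cnj a - a * cnj a"
  proof -
    have "a + cnj a - a * cnj a = 1 - (z * cnj z) * (\<xi> * cnj \<xi>)" by (simp add: a_def algebra_simps)
    then show ?thesis using xx by simp
  qed
  also have "\<dots> / (a * cnj a) = 1 / a + 1 / cnj a - 1" using a by (simp add: field_simps)
  finally show ?thesis by (simp add: ca a_def)
qed

lemma integrable_cau:
  assumes f: "integrable circle f" and z: "norm z < 1"
  shows "integrable circle (\<lambda>\<xi>. f \<xi> / (1 - z * cnj \<xi>))"
proof -
  have "integrable circle (\<lambda>\<xi>. (1 / (1 - z * cnj \<xi>)) * f \<xi>)"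
  proof (rule integrable_bounded_mult[OF f])
    have "(\<lambda>\<xi>. cnj \<xi>) \<in> borel_measurable circle"
      by (intro measurable_circleI borel_measurable_continuous_onI continuous_intros)
    then show "(\<lambda>\<xi>. 1 / (1 - z * cnj \<xi>)) \<in> borel_measurable circle" by measurable
    show "AE \<xi> in circle. norm (1 / (1 - z * cnj \<xi>)) \<le> 1 / (1 - norm z)"
    proof (rule AE_I2)
      fix \<xi> assume "\<xi> \<in> space circle"
      then have "norm (z * cnj \<xi>) = norm z" by (simp add: norm_mult)
      then have "1 - norm z \<le> norm (1 - z * cnj \<xi>)"
        using norm_triangle_ineq2[of 1 "z * cnj \<xi>"] by simp
      then show "norm (1 / (1 - z * cnj \<xi>)) \<le> 1 / (1 - norm z)"
        using z by (simp add: norm_divide frac_le)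
    qed
  qed
  then show ?thesis by simp
qed

text \<open>The Poisson kernel is the sum of the Cauchy kernel and its conjugate, minus one, so the Poisson integral is the sum of an analytic and an antianalytic Cauchy transform.\<close>

lemma poisson_cau:
  assumes f: "integrable circle f" and z: "norm z < 1"
  shows "(LINT \<xi>|circle. of_real (poisson_kernel z \<xi>) * f \<xi>)
     = cau f z + cnj (cau (\<lambda>\<xi>. cnj (f \<xi>)) z) - (LINT \<xi>|circle. f \<xi>)"
    and "integrable circle (\<lambda>\<xi>. of_real (poisson_kernel z \<xi>) * f \<xi>)"
proof -
  have fc: "integrable circle (\<lambda>\<xi>. cnj (f \<xi>))" using f by simp
  note i1 = integrable_cau[OF f z] and i2 = integrable_cau[OF fc z]
  have i3: "integrable circle (\<lambda>\<xi>. cnj (cnj (f \<xi>) / (1 - z * cnj \<xi>)))" using i2 by fast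
  have eq: "of_real (poisson_kernel z \<xi>) * f \<xi> = f \<xi> / (1 - z * cnj \<xi>) + cnj (cnj (f \<xi>) / (1 - z * cnj \<xi>)) - f \<xi>"
    if "\<xi> \<in> space circle" for \<xi>
  proof -
    have "of_real (poisson_kernel z \<xi>) * f \<xi> = (1 / (1 - z * cnj \<xi>) + 1 / (1 - cnj z * \<xi>) - 1) * f \<xi>"
      using poisson_kernel_eq[OF z, of \<xi>] that by simp
    then show ?thesis by (simp add: ring_distribs)
  qed
  show "integrable circle (\<lambda>\<xi>. of_real (poisson_kernel z \<xi>) * f \<xi>)"
    using Bochner_Integration.integrable_cong[OF refl eq] i1 i3 f by fast
  have "(LINT \<xi>|circle. of_real (poisson_kernel z \<xi>) * f \<xi>)
     = (LINT \<xi>|circle. f \<xi> / (1 - z * cnj \<xi>) + cnj (cnj (f \<xi>) / (1 - z * cnj \<xi>)) - f \<xi>)"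
    by (rule Bochner_Integration.integral_cong[OF refl eq])
  also have "\<dots> = (LINT \<xi>|circle. f \<xi> / (1 - z * cnj \<xi>)) + (LINT \<xi>|circle. cnj (cnj (f \<xi>) / (1 - z * cnj \<xi>))) - (LINT \<xi>|circle. f \<xi>)"
    by (subst Bochner_Integration.integral_diff[OF Bochner_Integration.integrable_add[OF i1 i3] f],
        subst Bochner_Integration.integral_add[OF i1 i3]) (rule refl)
  also have "(LINT \<xi>|circle. cnj (cnj (f \<xi>) / (1 - z * cnj \<xi>))) = cnj (cau (\<lambda>\<xi>. cnj (f \<xi>)) z)"
    unfolding cau_def by (metis Bochner_Integration.integral_cnj)
  finally show "(LINT \<xi>|circle. of_real (poisson_kernel z \<xi>) * f \<xi>)
     = cau f z + cnj (cau (\<lambda>\<xi>. cnj (f \<xi>)) z) - (LINT \<xi>|circle. f \<xi>)"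
    by (simp add: cau_def)
qed

lemma cau_const: "norm z < 1 \<Longrightarrow> cau (\<lambda>_. c) z = c"
proof -
  assume z: "norm z < 1"
  have e: "fc (\<lambda>_. c) (int k) = (if k = 0 then c else 0)" for k
    using integral_circle_power_int[of "- int k"] by (simp add: fc_def)
  have "(\<lambda>k. fc (\<lambda>_. c) (int k) * z ^ k) sums cau (\<lambda>_. c) z"
    by (rule cau_sums[OF _ z]) simp
  moreover have "(\<lambda>k. fc (\<lambda>_. c) (int k) * z ^ k) = (\<lambda>k. if k = 0 then c else 0)" by (auto simp: e)
  ultimately show ?thesis using sums_single[of 0 "\<lambda>_. c"] sums_unique2 by metis
qed

lemma integral_poisson_kernel_const: "norm z < 1 \<Longrightarrow> (LINT \<xi>|circle. of_real (poisson_kernel z \<xi>) * c) = (c::complex)"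
  using circle.prob_space by (subst poisson_cau) (simp_all add: cau_const)

lemma integrable_poisson_kernel: "norm z < 1 \<Longrightarrow> integrable circle (poisson_kernel z)"
  using poisson_cau(2)[of "\<lambda>_. 1" z] by (simp add: integrable_Re[of circle "\<lambda>\<xi>. complex_of_real (poisson_kernel z \<xi>)", simplified])

lemma integral_poisson_kernel: "norm z < 1 \<Longrightarrow> (LINT \<xi>|circle. poisson_kernel z \<xi>) = 1"
  using integral_poisson_kernel_const[of z 1] by simp

section \<open>Fatou's theorem on radial limits\<close>

text \<open>Only one-sided averages matter here, because the Poisson kernel will be split at its peak; the left-hand averages come from the same statement for the reflected function.\<close>

lemma lebesgue_point_right:
  fixes g :: "real \<Rightarrow> complex"
  assumes g: "integrable lborel g"
  obtains N where "N \<in> null_sets lborel"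
    "\<And>x e. x \<notin> N \<Longrightarrow> 0 < e \<Longrightarrow>
       \<exists>d>0. \<forall>h. 0 \<le> h \<and> h < d \<longrightarrow> norm (LINT u:{0..h}|lborel. g (x + u) - g x) \<le> e * h"
proof -
  have gi: "g integrable_on cbox a b" for a b
    using integrable_on_lborel[OF g] by (rule integrable_on_subcbox) simp
  obtain N where N: "negligible N" and
    lim: "\<And>x e. \<lbrakk>x \<notin> N; 0 < e\<rbrakk> \<Longrightarrow> \<exists>d>0. \<forall>h. 0 < h \<and> h < d \<longrightarrow>
             norm (integral (cbox x (x + h *\<^sub>R One)) g /\<^sub>R h ^ DIM(real) - g x) < e"
    using integrable_ccontinuous_explicit[OF gi] by blast
  obtain N' where N': "N' \<in> null_sets lborel" "N \<subseteq> N'"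
    using N by (auto simp: negligible_iff_null_sets null_sets_completion_iff2)
  show ?thesis
  proof (rule that[OF N'(1)])
    fix x e :: real assume x: "x \<notin> N'" and e: "0 < e"
    then have "x \<notin> N" using N' by auto
    from lim[OF this e] obtain d where d: "d > 0"
      "\<And>h. 0 < h \<Longrightarrow> h < d \<Longrightarrow> norm (integral {x..x + h} g /\<^sub>R h - g x) < e"
      by auto
    have "norm (LINT u:{0..h}|lborel. g (x + u) - g x) \<le> e * h" if h: "0 \<le> h" "h < d" for h
    proof (cases "h = 0")
      case True
      have "(LINT u:{0..0::real}|lborel. g (x + u) - g x) = 0"
        unfolding set_lebesgue_integral_def
        by (rule integral_eq_zero_AE) (use AE_lborel_singleton[of "0::real"] in \<open>auto elim!: eventually_mono\<close>)
      then show ?thesis using True by simp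
    next
      case False
      then have h0: "0 < h" using h by simp
      have s1: "set_integrable lborel {x..x + h} g"
        unfolding set_integrable_def using g by (rule integrable_mult_indicator[rotated]) simp
      have "integral {x..x + h} g = (LINT t:{x..x+h}|lborel. g t)"
        by (rule set_borel_integral_eq_integral(2)[OF s1, symmetric])
      also have "\<dots> = (LINT u|lborel. indicator {x..x+h} (x + 1 * u) *\<^sub>R g (x + 1 * u))"
        unfolding set_lebesgue_integral_def by (subst lborel_integral_real_affine[of 1 _ x]) simp_all
      also have "\<dots> = (LINT u:{0..h}|lborel. g (x + u))"
        unfolding set_lebesgue_integral_def
        by (intro Bochner_Integration.integral_cong) (auto simp: indicator_def)
      finally have I: "integral {x..x + h} g = (LINT u:{0..h}|lborel. g (x + u))" .
      have "integrable lborel (\<lambda>u. g (x + 1 * u))"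
        using lborel_integrable_real_affine[OF g, of 1 x] by simp
      then have s2: "set_integrable lborel {0..h} (\<lambda>u. g (x + u))"
        unfolding set_integrable_def by (intro integrable_mult_indicator) simp_all
      have s3: "set_integrable lborel {0..h} (\<lambda>u. g x)"
        by (intro borel_integrable_atLeastAtMost') simp
      have s4: "(LINT u:{0..h}|lborel. g x) = h *\<^sub>R g x"
        using h0 by (simp add: set_lebesgue_integral_def)
      have "(LINT u:{0..h}|lborel. g (x + u) - g x) = integral {x..x + h} g - h *\<^sub>R g x"
        unfolding I s4[symmetric] by (rule set_integral_diff(2)[OF s2 s3])
      also have "\<dots> = h *\<^sub>R (integral {x..x + h} g /\<^sub>R h - g x)"
        using h0 by (simp add: scaleR_diff_right)
      also have "norm \<dots> = h * norm (integral {x..x + h} g /\<^sub>R h - g x)" using h0 by simp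
      also have "\<dots> \<le> h * e" using d(2)[OF h0 h(2)] h0 by (intro mult_left_mono) auto
      finally show ?thesis by (simp add: mult.commute)
    qed
    then show "\<exists>d>0. \<forall>h. 0 \<le> h \<and> h < d \<longrightarrow> norm (LINT u:{0..h}|lborel. g (x + u) - g x) \<le> e * h"
      using d(1) by blast
  qed
qed

text \<open>The Poisson kernel of a point of modulus \<open>r\<close> as a function of the angle measured from that point.\<close>

definition poisson_angle :: "real \<Rightarrow> real \<Rightarrow> real" where
  "poisson_angle r u = (1 - r\<^sup>2) / ((1 - r)\<^sup>2 + 2 * r * (1 - cos u))"

lemma poisson_kernel_cis:
  assumes r: "0 \<le> r"
  shows "poisson_kernel (of_real r * cis s) (cis (s + u)) = poisson_angle r u"
proof -
  have "(norm (cis (s + u) - of_real r * cis s))\<^sup>2 = (cos (s+u) - r * cos s)\<^sup>2 + (sin (s+u) - r * sin s)\<^sup>2"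
    by (simp add: cmod_power2)
  also have "\<dots> = ((cos (s+u))\<^sup>2 + (sin (s+u))\<^sup>2) + r\<^sup>2 * ((cos s)\<^sup>2 + (sin s)\<^sup>2) - 2 * r * (cos (s+u) * cos s + sin (s+u) * sin s)"
    by algebra
  also have "cos (s+u) * cos s + sin (s+u) * sin s = cos u"
    using cos_diff[of "s+u" s] by simp
  finally have "(norm (cis (s + u) - of_real r * cis s))\<^sup>2 = (1 - r)\<^sup>2 + 2 * r * (1 - cos u)"
    using sin_cos_squared_add2[of "s + u"] sin_cos_squared_add2[of s] by algebra
  then show ?thesis using r by (simp add: poisson_kernel_def poisson_angle_def norm_mult)
qed

lemma poisson_angle_denom_pos: "0 < (r::real) \<Longrightarrow> r < 1 \<Longrightarrow> 0 < (1 - r)\<^sup>2 + 2 * r * (1 - cos u)"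
  by (rule add_pos_nonneg) auto

lemma poisson_angle_nonneg: "0 < r \<Longrightarrow> r < 1 \<Longrightarrow> 0 \<le> poisson_angle r u"
  unfolding poisson_angle_def using poisson_angle_denom_pos[of r u] by (intro divide_nonneg_nonneg) (auto simp: power_le_one)

lemma poisson_angle_le:
  assumes r: "0 < r" "r < 1" and c: "cos u \<le> c" "c < 1"
  shows "poisson_angle r u \<le> (1 - r\<^sup>2) / (2 * r * (1 - c))"
  unfolding poisson_angle_def
proof (rule divide_left_mono)
  show "2 * r * (1 - c) \<le> (1 - r)\<^sup>2 + 2 * r * (1 - cos u)"
    using r c by (intro add_increasing mult_left_mono) auto
  show "0 \<le> 1 - r\<^sup>2" using r by (simp add: power_le_one)
  show "0 < ((1 - r)\<^sup>2 + 2 * r * (1 - cos u)) * (2 * r * (1 - c))"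
    using r c by (intro mult_pos_pos poisson_angle_denom_pos) auto
qed

lemma poisson_angle_deriv:
  assumes r: "0 < r" "r < 1"
  shows "(poisson_angle r has_real_derivative - ((1 - r\<^sup>2) * (2 * r * sin t) / ((1 - r)\<^sup>2 + 2 * r * (1 - cos t))\<^sup>2)) (at t)"
  unfolding poisson_angle_def[abs_def]
  using poisson_angle_denom_pos[OF r, of t]
  by (auto intro!: derivative_eq_intros simp: power2_eq_square)

lemma poisson_angle_cont: "0 < r \<Longrightarrow> r < 1 \<Longrightarrow> continuous_on A (poisson_angle r)"
  by (intro continuous_at_imp_continuous_on ballI DERIV_isCont[OF poisson_angle_deriv])

lemma circle_integral_shift:
  fixes F :: "complex \<Rightarrow> 'b::{banach, second_countable_topology}"
  assumes F: "F \<in> borel_measurable circle"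
  shows "(LINT \<xi>|circle. F \<xi>) = (LINT u:{-s..2*pi-s}|lborel. F (cis (s + u))) /\<^sub>R (2*pi)"
proof -
  have "(LINT t:{0..2*pi}|lborel. F (cis t)) = (LINT u|lborel. indicator {0..2*pi} (s + 1 * u) *\<^sub>R F (cis (s + 1 * u)))"
    unfolding set_lebesgue_integral_def by (subst lborel_integral_real_affine[of 1 _ s]) simp_all
  also have "\<dots> = (LINT u:{-s..2*pi-s}|lborel. F (cis (s + u)))"
    unfolding set_lebesgue_integral_def
    by (intro Bochner_Integration.integral_cong) (auto simp: indicator_def)
  finally show ?thesis unfolding integral_circle[OF F] by simp
qed

lemma cos_le_away:
  assumes d: "0 < \<delta>" "\<delta> \<le> pi" and u: "\<delta> \<le> \<bar>u\<bar>" "\<bar>u\<bar> \<le> 2 * pi - \<delta>"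
  shows "cos u \<le> cos \<delta>"
proof (cases "\<bar>u\<bar> \<le> pi")
  case True
  have "cos \<bar>u\<bar> \<le> cos \<delta>" by (rule cos_monotone_0_pi_le) (use d u True in auto)
  then show ?thesis by simp
next
  case False
  have "cos (2 * pi - \<bar>u\<bar>) \<le> cos \<delta>" by (rule cos_monotone_0_pi_le) (use d u False in auto)
  then show ?thesis by (simp add: cos_diff)
qed

text \<open>The kernel is split at angle \<open>\<delta>\<close>: close to the peak it is decreasing on each side and \<open>kernel_bound\<close> applies; away from the peak it is at most \<open>(1 - r\<^sup>2) / (2 * r * (1 - cos \<delta>))\<close>, which tends to zero as \<open>r\<close> tends to one.\<close>

lemma poisson_local_bound:
  fixes k :: "real \<Rightarrow> complex"
  assumes r: "0 < r" "r < 1" and d: "0 < \<delta>" "\<delta> \<le> pi"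
    and k: "integrable lborel k" and supp: "\<And>u. \<bar>u\<bar> > 2 * pi - \<delta> \<Longrightarrow> k u = 0"
    and right: "\<And>h. h \<in> {0..\<delta>} \<Longrightarrow> norm (LINT u:{0..h}|lborel. k u) \<le> e * h"
    and left: "\<And>h. h \<in> {0..\<delta>} \<Longrightarrow> norm (LINT u:{0..h}|lborel. k (- u)) \<le> e * h"
  shows "norm (LINT u|lborel. poisson_angle r u *\<^sub>R k u)
    \<le> 2 * (e * (LINT u:{0..\<delta>}|lborel. poisson_angle r u)) + (1 - r\<^sup>2) / (2 * r * (1 - cos \<delta>)) * (LINT u|lborel. norm (k u))"
proof -
  define C where "C = (1 - r\<^sup>2) / (2 * r * (1 - cos \<delta>))"
  have cd: "cos \<delta> < 1" using cos_monotone_0_pi[of 0 \<delta>] d by simp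
  have C0: "0 \<le> C" unfolding C_def using r cd by (intro divide_nonneg_nonneg) (auto simp: power_le_one)
  have prm: "poisson_angle r \<in> borel_measurable borel"
    by (rule borel_measurable_continuous_onI[OF poisson_angle_cont[OF r]])
  have prb: "\<bar>poisson_angle r u\<bar> \<le> (1 - r\<^sup>2) / (1 - r)\<^sup>2" for u
  proof -
    have "poisson_angle r u \<le> (1 - r\<^sup>2) / (1 - r)\<^sup>2"
      unfolding poisson_angle_def using r poisson_angle_denom_pos[OF r, of u]
      by (intro divide_left_mono) (auto simp: power_le_one)
    then show ?thesis using poisson_angle_nonneg[OF r] by simp
  qed
  have kn: "integrable lborel (\<lambda>u. k (- u))"
    using lborel_integrable_real_affine[OF k, of "-1" 0] by simp
  have Pk: "integrable lborel (\<lambda>u. poisson_angle r u *\<^sub>R k u)"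
  proof (rule Bochner_Integration.integrable_bound)
    show "integrable lborel (\<lambda>u. ((1 - r\<^sup>2) / (1 - r)\<^sup>2) *\<^sub>R k u)" using k by simp
    show "(\<lambda>u. poisson_angle r u *\<^sub>R k u) \<in> borel_measurable lborel" using prm k by measurable
    show "AE u in lborel. norm (poisson_angle r u *\<^sub>R k u) \<le> norm (((1 - r\<^sup>2) / (1 - r)\<^sup>2) *\<^sub>R k u)"
    proof (rule AE_I2)
      fix u
      show "norm (poisson_angle r u *\<^sub>R k u) \<le> norm (((1 - r\<^sup>2) / (1 - r)\<^sup>2) *\<^sub>R k u)"
      proof -
        have "\<bar>(1 - r\<^sup>2) / (1 - r)\<^sup>2\<bar> = (1 - r\<^sup>2) / (1 - r)\<^sup>2" using r by (simp add: power_le_one)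
        then show ?thesis unfolding norm_scaleR using prb[of u] by (intro mult_right_mono) auto
      qed
    qed
  qed
  have ind: "integrable lborel (\<lambda>u. indicator A u *\<^sub>R (poisson_angle r u *\<^sub>R k u))" if "A \<in> sets borel" for A
    using that Pk by (intro integrable_mult_indicator) simp_all
  define R where "R = - {-\<delta>..\<delta>}"
  have split: "poisson_angle r u *\<^sub>R k u = indicator {0..\<delta>} u *\<^sub>R (poisson_angle r u *\<^sub>R k u) + indicator {-\<delta>..<0} u *\<^sub>R (poisson_angle r u *\<^sub>R k u)
      + indicator R u *\<^sub>R (poisson_angle r u *\<^sub>R k u)" for u
    using d by (auto simp: indicator_def R_def)
  have "(LINT u|lborel. poisson_angle r u *\<^sub>R k u) = (LINT u|lborel. indicator {0..\<delta>} u *\<^sub>R (poisson_angle r u *\<^sub>R k u) + indicator {-\<delta>..<0} u *\<^sub>R (poisson_angle r u *\<^sub>R k u)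
      + indicator R u *\<^sub>R (poisson_angle r u *\<^sub>R k u))"
    using split by (rule Bochner_Integration.integral_cong[OF refl])
  also have "\<dots> = (LINT u|lborel. indicator {0..\<delta>} u *\<^sub>R (poisson_angle r u *\<^sub>R k u)) + (LINT u|lborel. indicator {-\<delta>..<0} u *\<^sub>R (poisson_angle r u *\<^sub>R k u))
      + (LINT u|lborel. indicator R u *\<^sub>R (poisson_angle r u *\<^sub>R k u))"
    by (subst Bochner_Integration.integral_add, intro Bochner_Integration.integrable_add ind, simp, simp,
        rule ind, simp add: R_def, subst Bochner_Integration.integral_add, rule ind, simp, rule ind, simp, rule refl)
  finally have sum3: "(LINT u|lborel. poisson_angle r u *\<^sub>R k u) = \<dots>" .
  define \<psi> where "\<psi> = (\<lambda>t. (1 - r\<^sup>2) * (2 * r * sin t) / ((1 - r)\<^sup>2 + 2 * r * (1 - cos t))\<^sup>2)"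
  have der: "(poisson_angle r has_real_derivative - \<psi> t) (at t)" for t
    unfolding \<psi>_def by (rule poisson_angle_deriv[OF r])
  have psic: "continuous_on {0..\<delta>} \<psi>"
  proof -
    have "(1 - r)\<^sup>2 + 2 * r * (1 - cos t) \<noteq> 0" for t using poisson_angle_denom_pos[OF r, of t] by simp
    then show ?thesis unfolding \<psi>_def by (intro continuous_intros) simp
  qed
  have psi0: "0 \<le> \<psi> t" if "t \<in> {0..\<delta>}" for t
    unfolding \<psi>_def using r d that by (intro divide_nonneg_nonneg mult_nonneg_nonneg sin_ge_zero) (auto simp: power_le_one)
  have sk: "set_integrable lborel {0..\<delta>} k" "set_integrable lborel {0..\<delta>} (\<lambda>u. k (- u))"
    unfolding set_integrable_def using k kn by (auto intro!: integrable_mult_indicator)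
  have b1: "norm (LINT u|lborel. indicator {0..\<delta>} u *\<^sub>R (poisson_angle r u *\<^sub>R k u)) \<le> e * (LINT u:{0..\<delta>}|lborel. poisson_angle r u)"
    using kernel_bound[OF _ sk(1) der psic psi0 poisson_angle_nonneg[OF r] right] d by (simp add: set_lebesgue_integral_def)
  have "(LINT u|lborel. indicator {-\<delta>..<0} u *\<^sub>R (poisson_angle r u *\<^sub>R k u))
      = (LINT u|lborel. indicator {-\<delta>..<0} (0 + (-1) * u) *\<^sub>R (poisson_angle r (0 + (-1) * u) *\<^sub>R k (0 + (-1) * u)))"
    by (subst lborel_integral_real_affine[of "-1" _ 0]) simp_all
  also have "\<dots> = (LINT u|lborel. indicator {0..\<delta>} u *\<^sub>R (poisson_angle r u *\<^sub>R k (- u)))"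
  proof (rule integral_cong_AE)
    show "(\<lambda>u. indicator {-\<delta>..<0} (0 + (-1) * u) *\<^sub>R (poisson_angle r (0 + (-1) * u) *\<^sub>R k (0 + (-1) * u))) \<in> borel_measurable lborel"
      using prm kn by (simp, measurable)
    show "(\<lambda>u. indicator {0..\<delta>} u *\<^sub>R (poisson_angle r u *\<^sub>R k (- u))) \<in> borel_measurable lborel"
      using prm kn by measurable
    show "AE u in lborel. indicator {-\<delta>..<0} (0 + (-1) * u) *\<^sub>R (poisson_angle r (0 + (-1) * u) *\<^sub>R k (0 + (-1) * u))
        = indicator {0..\<delta>} u *\<^sub>R (poisson_angle r u *\<^sub>R k (- u))"
      using AE_lborel_singleton[of "0::real"]
      by (rule AE_mp) (auto simp: indicator_def poisson_angle_def intro!: AE_I2)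
  qed
  finally have b2: "norm (LINT u|lborel. indicator {-\<delta>..<0} u *\<^sub>R (poisson_angle r u *\<^sub>R k u)) \<le> e * (LINT u:{0..\<delta>}|lborel. poisson_angle r u)"
    using kernel_bound[OF _ sk(2) der psic psi0 poisson_angle_nonneg[OF r] left] d by (simp add: set_lebesgue_integral_def)
  have b3: "norm (LINT u|lborel. indicator R u *\<^sub>R (poisson_angle r u *\<^sub>R k u)) \<le> (LINT u|lborel. C * norm (k u))"
  proof (rule norm_integral_le)
    show "integrable lborel (\<lambda>u. C * norm (k u))" using k by simp
    show "AE u in lborel. norm (indicator R u *\<^sub>R (poisson_angle r u *\<^sub>R k u)) \<le> C * norm (k u)"
    proof (rule AE_I2)
      fix u
      show "norm (indicator R u *\<^sub>R (poisson_angle r u *\<^sub>R k u)) \<le> C * norm (k u)"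
      proof (cases "u \<in> R \<and> \<bar>u\<bar> \<le> 2 * pi - \<delta>")
        case True
        then have "\<delta> \<le> \<bar>u\<bar>" by (auto simp: R_def)
        then have "poisson_angle r u \<le> C" unfolding C_def using True cos_le_away[OF d] cd by (intro poisson_angle_le[OF r]) auto
        then show ?thesis using True poisson_angle_nonneg[OF r, of u] by (auto intro!: mult_right_mono)
      next
        case False
        then show ?thesis using supp[of u] C0 by (auto simp: indicator_def)
      qed
    qed
  qed
  have "norm (LINT u|lborel. poisson_angle r u *\<^sub>R k u) \<le> e * (LINT u:{0..\<delta>}|lborel. poisson_angle r u) + e * (LINT u:{0..\<delta>}|lborel. poisson_angle r u)
      + (LINT u|lborel. C * norm (k u))"
    unfolding sum3 by (intro norm_triangle_le add_mono b1 b2 b3)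
  then show ?thesis by (simp add: C_def)
qed

text \<open>At a Lebesgue point the averages of \<open>f - f \<zeta>\<close> over short arcs are small compared with their length. By \<open>poisson_local_bound\<close> the Poisson integral of \<open>f - f \<zeta>\<close> is then small for radii close to one.\<close>

theorem fatou_radial_limit:
  fixes f :: "complex \<Rightarrow> complex"
  assumes f: "integrable circle f"
  shows "AE \<zeta> in circle. ((\<lambda>r. LINT \<xi>|circle. of_real (poisson_kernel (of_real r * \<zeta>) \<xi>) * f \<xi>) \<longlongrightarrow> f \<zeta>) (at_left 1)"
proof -
  define g where "g = (\<lambda>t. indicator {0..2*pi} t *\<^sub>R f (cis t))"
  have fm [measurable]: "f \<in> borel_measurable circle" using f by auto
  have gi: "integrable lborel g"
    using integrable_circle_iff[OF fm] f by (simp add: g_def set_integrable_def)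
  have gn: "integrable lborel (\<lambda>t. g (- t))"
    using lborel_integrable_real_affine[OF gi, of "-1" 0] by simp
  obtain N1 where N1: "N1 \<in> null_sets lborel"
    "\<And>x e. x \<notin> N1 \<Longrightarrow> 0 < e \<Longrightarrow> \<exists>d>0. \<forall>h. 0 \<le> h \<and> h < d \<longrightarrow> norm (LINT u:{0..h}|lborel. g (x + u) - g x) \<le> e * h"
    using lebesgue_point_right[OF gi] by blast
  obtain N2 where N2: "N2 \<in> null_sets lborel"
    "\<And>x e. x \<notin> N2 \<Longrightarrow> 0 < e \<Longrightarrow> \<exists>d>0. \<forall>h. 0 \<le> h \<and> h < d \<longrightarrow> norm (LINT u:{0..h}|lborel. g (- (x + u)) - g (- x)) \<le> e * h"
    using lebesgue_point_right[OF gn] by blast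
  have "AE x in lborel. x \<notin> N2" using N2(1) by (rule AE_not_in)
  moreover have "Measurable.pred borel (\<lambda>x. x \<notin> N2)" using N2(1) by auto
  ultimately have "AE x in lborel. 0 + (-1) * x \<notin> N2" by (intro AE_borel_affine) auto
  moreover have "AE x in lborel. x \<notin> N1" using N1(1) by (rule AE_not_in)
  ultimately have "AE x in lborel. x \<notin> N1 \<and> - x \<notin> N2" by (auto elim: AE_mp)
  then obtain N where N: "N \<in> null_sets lborel" "\<And>x. x \<notin> N \<Longrightarrow> x \<notin> N1 \<and> - x \<notin> N2"
    unfolding eventually_ae_filter by auto
  show ?thesis
  proof (rule AE_circleI[OF N(1)])
    fix s assume s: "s \<in> {0<..<2*pi} - N"
    define \<zeta> where "\<zeta> = cis s"
    define I where "I = {-s..2*pi-s}"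
    define k where "k = (\<lambda>u. indicator I u *\<^sub>R (f (cis (s + u)) - f \<zeta>))"
    have gs: "g s = f \<zeta>" using s by (simp add: g_def \<zeta>_def)
    have kg: "k u = g (s + u) - indicator I u *\<^sub>R f \<zeta>" for u
      by (auto simp: k_def g_def I_def indicator_def)
    have "integrable lborel (\<lambda>u. g (s + 1 * u))" by (rule lborel_integrable_real_affine[OF gi]) simp
    moreover have "integrable lborel (\<lambda>u. indicator I u *\<^sub>R f \<zeta>)"
      using borel_integrable_atLeastAtMost'[of "-s" "2*pi-s" "\<lambda>_. f \<zeta>"] by (simp add: set_integrable_def I_def)
    ultimately have ki: "integrable lborel k" unfolding kg[abs_def] by simp
    define P where "P = (\<lambda>r. LINT \<xi>|circle. of_real (poisson_kernel (of_real r * \<zeta>) \<xi>) * f \<xi>)"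
    have Pk: "P r - f \<zeta> = (LINT u|lborel. poisson_angle r u *\<^sub>R k u) /\<^sub>R (2*pi)" if r: "0 < r" "r < 1" for r
    proof -
      have nr: "norm (of_real r * \<zeta>) < 1" using r by (simp add: \<zeta>_def norm_mult)
      have "P r - f \<zeta> = P r - (LINT \<xi>|circle. of_real (poisson_kernel (of_real r * \<zeta>) \<xi>) * f \<zeta>)"
        using integral_poisson_kernel_const[OF nr] by simp
      also have "\<dots> = (LINT \<xi>|circle. of_real (poisson_kernel (of_real r * \<zeta>) \<xi>) * f \<xi> - of_real (poisson_kernel (of_real r * \<zeta>) \<xi>) * f \<zeta>)"
        unfolding P_def using poisson_cau(2)[OF f nr] poisson_cau(2)[of "\<lambda>_. f \<zeta>", OF _ nr]
        by (intro Bochner_Integration.integral_diff[symmetric]) simp_all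
      also have "\<dots> = (LINT \<xi>|circle. of_real (poisson_kernel (of_real r * \<zeta>) \<xi>) * (f \<xi> - f \<zeta>))"
        by (simp only: right_diff_distrib)
      also have "\<dots> = (LINT u:I|lborel. of_real (poisson_kernel (of_real r * \<zeta>) (cis (s + u))) * (f (cis (s + u)) - f \<zeta>)) /\<^sub>R (2*pi)"
        unfolding I_def
      proof (rule circle_integral_shift)
        have "poisson_kernel (of_real r * \<zeta>) \<in> borel_measurable circle" using integrable_poisson_kernel[OF nr] by simp
        then show "(\<lambda>\<xi>. of_real (poisson_kernel (of_real r * \<zeta>) \<xi>) * (f \<xi> - f \<zeta>)) \<in> borel_measurable circle" by measurable
      qed
      also have "(LINT u:I|lborel. of_real (poisson_kernel (of_real r * \<zeta>) (cis (s + u))) * (f (cis (s + u)) - f \<zeta>)) = (LINT u|lborel. poisson_angle r u *\<^sub>R k u)"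
        unfolding set_lebesgue_integral_def using r
        by (intro Bochner_Integration.integral_cong) (auto simp: k_def \<zeta>_def poisson_kernel_cis scaleR_conv_of_real)
      finally show ?thesis .
    qed
    have prI: "(LINT u:I|lborel. poisson_angle r u) = 2 * pi" if r: "0 < r" "r < 1" for r
    proof -
      have nr: "norm (of_real r * \<zeta>) < 1" using r by (simp add: \<zeta>_def norm_mult)
      have "1 = (LINT u:I|lborel. poisson_kernel (of_real r * \<zeta>) (cis (s + u))) /\<^sub>R (2*pi)"
        unfolding I_def integral_poisson_kernel[OF nr, symmetric]
        by (rule circle_integral_shift) (use integrable_poisson_kernel[OF nr] in simp)
      also have "(LINT u:I|lborel. poisson_kernel (of_real r * \<zeta>) (cis (s + u))) = (LINT u:I|lborel. poisson_angle r u)"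
        using r by (simp add: \<zeta>_def poisson_kernel_cis)
      finally show ?thesis by (simp add: field_simps)
    qed
    have "(P \<longlongrightarrow> f \<zeta>) (at_left 1)"
    proof (rule tendstoI)
      fix e :: real assume e: "0 < e"
      define \<epsilon> where "\<epsilon> = e / 8"
      have e': "0 < \<epsilon>" using e by (simp add: \<epsilon>_def)
      obtain d1 where d1: "d1 > 0" "\<And>h. 0 \<le> h \<Longrightarrow> h < d1 \<Longrightarrow> norm (LINT u:{0..h}|lborel. g (s + u) - g s) \<le> \<epsilon> * h"
        using N1(2)[of s \<epsilon>] N(2)[of s] s e' by auto
      obtain d2 where d2: "d2 > 0" "\<And>h. 0 \<le> h \<Longrightarrow> h < d2 \<Longrightarrow> norm (LINT u:{0..h}|lborel. g (- (- s + u)) - g s) \<le> \<epsilon> * h"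
        using N2(2)[of "- s" \<epsilon>] N(2)[of s] s e' by auto
      define m where "m = min d1 (min d2 (min s (min (2*pi-s) pi)))"
      define \<delta> where "\<delta> = m / 2"
      have "m > 0" using d1(1) d2(1) s by (simp add: m_def)
      moreover have "m \<le> d1" "m \<le> d2" "m \<le> s" "m \<le> 2*pi-s" "m \<le> pi" by (simp_all add: m_def min_le_iff_disj)
      ultimately have dd: "0 < \<delta>" "\<delta> < d1" "\<delta> < d2" "\<delta> < s" "\<delta> < 2*pi-s" "\<delta> < pi"
        unfolding \<delta>_def by linarith+
      have R: "norm (LINT u:{0..h}|lborel. k u) \<le> \<epsilon> * h" if h: "h \<in> {0..\<delta>}" for h
      proof -
        have "(LINT u:{0..h}|lborel. k u) = (LINT u:{0..h}|lborel. g (s + u) - g s)"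
          unfolding set_lebesgue_integral_def using h dd
          by (intro Bochner_Integration.integral_cong) (auto simp: kg gs I_def indicator_def)
        then show ?thesis using d1(2)[of h] h dd by auto
      qed
      have L: "norm (LINT u:{0..h}|lborel. k (- u)) \<le> \<epsilon> * h" if h: "h \<in> {0..\<delta>}" for h
      proof -
        have "(LINT u:{0..h}|lborel. k (- u)) = (LINT u:{0..h}|lborel. g (- (- s + u)) - g s)"
          unfolding set_lebesgue_integral_def using h dd
          by (intro Bochner_Integration.integral_cong) (auto simp: kg gs I_def indicator_def)
        then show ?thesis using d2(2)[of h] h dd by auto
      qed
      have supp: "k u = 0" if "\<bar>u\<bar> > 2*pi - \<delta>" for u
        using that dd s by (auto simp: k_def I_def indicator_def)
      define T where "T = (\<lambda>r. (1 - r\<^sup>2) / (2 * r * (1 - cos \<delta>)) * (LINT u|lborel. norm (k u)))"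
      have cd: "cos \<delta> < 1" using cos_monotone_0_pi[of 0 \<delta>] dd by simp
      have "(T \<longlongrightarrow> (1 - 1\<^sup>2) / (2 * 1 * (1 - cos \<delta>)) * (LINT u|lborel. norm (k u))) (at_left 1)"
        unfolding T_def using cd by (intro tendsto_intros) auto
      then have "(T \<longlongrightarrow> 0) (at_left 1)" by simp
      then have "\<forall>\<^sub>F r in at_left 1. T r < e" using e by (rule order_tendstoD)
      moreover have "\<forall>\<^sub>F r in at_left (1::real). r \<in> {0<..<1}" by (rule eventually_at_leftI[of 0]) auto
      ultimately show "\<forall>\<^sub>F r in at_left 1. dist (P r) (f \<zeta>) < e"
      proof eventually_elim
        case (elim r)
        then have r: "0 < r" "r < 1" by auto
        have "norm (LINT u|lborel. poisson_angle r u *\<^sub>R k u) \<le> 2 * (\<epsilon> * (LINT u:{0..\<delta>}|lborel. poisson_angle r u)) + T r"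
          unfolding T_def by (rule poisson_local_bound[OF r dd(1) less_imp_le[OF dd(6)] ki supp R L])
        moreover have "(LINT u:{0..\<delta>}|lborel. poisson_angle r u) \<le> (LINT u:I|lborel. poisson_angle r u)"
        proof -
          have i: "integrable lborel (\<lambda>u. indicator {a..b} u *\<^sub>R poisson_angle r u)" for a b
            using borel_integrable_atLeastAtMost'[OF poisson_angle_cont[OF r]] by (simp add: set_integrable_def)
          show ?thesis unfolding set_lebesgue_integral_def I_def
            by (intro integral_mono i) (use dd s poisson_angle_nonneg[OF r] in \<open>auto simp: indicator_def\<close>)
        qed
        ultimately have "norm (LINT u|lborel. poisson_angle r u *\<^sub>R k u) < 2 * (\<epsilon> * (2 * pi)) + e"
          using elim e' mult_left_mono[of "LINT u:{0..\<delta>}|lborel. poisson_angle r u" "2*pi" \<epsilon>] prI[OF r] by linarith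
        then have "norm (LINT u|lborel. poisson_angle r u *\<^sub>R k u) / (2 * pi) < (2 * (\<epsilon> * (2 * pi)) + e) / (2 * pi)"
          by (rule divide_strict_right_mono) simp
        moreover have "norm (x /\<^sub>R (2 * pi)) = norm x / (2 * pi)" for x :: complex by (simp add: field_simps)
        ultimately have "norm (P r - f \<zeta>) < (2 * (\<epsilon> * (2 * pi)) + e) / (2 * pi)"
          unfolding Pk[OF r] by (simp only:)
        also have "\<dots> = e / 4 + e / (2 * pi)" by (simp add: \<epsilon>_def field_simps)
        also have "\<dots> \<le> e / 4 + e / 4" using e pi_gt3 by (intro add_mono frac_le) auto
        also have "\<dots> < e" using e by simp
        finally show ?case by (simp add: dist_norm)
      qed
    qed
    then show "((\<lambda>r. LINT \<xi>|circle. of_real (poisson_kernel (of_real r * cis s) \<xi>) * f \<xi>) \<longlongrightarrow> f (cis s)) (at_left 1)"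
      by (simp add: P_def \<zeta>_def)
  qed
qed

section \<open>Spaces with a semi-inner product\<close>

text \<open>Square integrable functions are handled as genuine functions, not as classes modulo null sets. The pointwise vector space structure lets the abstract results on semi-inner products apply to them directly.\<close>

instantiation "fun" :: (type, real_vector) real_vector
begin
definition scaleR_fun_def: "c *\<^sub>R f = (\<lambda>x. c *\<^sub>R f x)"
instance by standard (simp_all add: fun_eq_iff scaleR_fun_def scaleR_add_right scaleR_add_left)
end

lemma scaleR_fun_apply [simp]: "(c *\<^sub>R f) x = c *\<^sub>R f x"
  by (simp add: scaleR_fun_def)

lemma null_seq_squeeze:
  fixes a :: "nat \<Rightarrow> real"
  assumes le: "\<And>k. \<bar>a k\<bar> \<le> b k" and b: "b \<longlonglongrightarrow> 0" shows "a \<longlonglongrightarrow> 0"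
proof (rule Lim_null_comparison[OF _ b])
  show "\<forall>\<^sub>F k in sequentially. norm (a k) \<le> b k" using le by simp
qed

text \<open>The form is only required to be nonnegative, hence a semi-inner product: functions that vanish almost everywhere have length zero, and so may nonzero functions under the Hankel form considered below.\<close>

locale psd_form =
  fixes V :: "'a::real_vector set" and B :: "'a \<Rightarrow> 'a \<Rightarrow> real"
  assumes V: "subspace V"
    and sym: "x \<in> V \<Longrightarrow> y \<in> V \<Longrightarrow> B x y = B y x"
    and add: "x \<in> V \<Longrightarrow> y \<in> V \<Longrightarrow> z \<in> V \<Longrightarrow> B (x + y) z = B x z + B y z"
    and scale: "x \<in> V \<Longrightarrow> y \<in> V \<Longrightarrow> B (c *\<^sub>R x) y = c * B x y"
    and nonneg: "x \<in> V \<Longrightarrow> 0 \<le> B x x"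
begin

lemma closed: "x \<in> V \<Longrightarrow> y \<in> V \<Longrightarrow> x + y \<in> V" "x \<in> V \<Longrightarrow> y \<in> V \<Longrightarrow> x - y \<in> V"
  "x \<in> V \<Longrightarrow> c *\<^sub>R x \<in> V" "0 \<in> V"
  using V by (simp_all add: subspace_add subspace_diff subspace_scale subspace_0)

lemma add_right: "x \<in> V \<Longrightarrow> y \<in> V \<Longrightarrow> z \<in> V \<Longrightarrow> B z (x + y) = B z x + B z y"
  using add[of x y z] sym closed by metis

lemma scale_right: "x \<in> V \<Longrightarrow> y \<in> V \<Longrightarrow> B y (c *\<^sub>R x) = c * B y x"
  using scale[of x y c] sym closed by metis

lemma diff: "x \<in> V \<Longrightarrow> y \<in> V \<Longrightarrow> z \<in> V \<Longrightarrow> B (x - y) z = B x z - B y z"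
  using add[of x "(-1) *\<^sub>R y" z] scale[of y z "-1"] closed(3)[of y "-1"] by simp

lemma diff_right: "x \<in> V \<Longrightarrow> y \<in> V \<Longrightarrow> z \<in> V \<Longrightarrow> B z (x - y) = B z x - B z y"
  using diff[of x y z] sym closed by metis

lemma square_add: "x \<in> V \<Longrightarrow> y \<in> V \<Longrightarrow> B (x + y) (x + y) = B x x + 2 * B x y + B y y"
  using add[of x y "x + y"] add_right[of x y x] add_right[of x y y] sym[of x y] closed(1)[of x y] by simp

lemma square_diff: "x \<in> V \<Longrightarrow> y \<in> V \<Longrightarrow> B (x - y) (x - y) = B x x - 2 * B x y + B y y"
  using diff[of x y "x - y"] diff_right[of x y x] diff_right[of x y y] sym[of x y] closed(2)[of x y] by simp

lemma square_scale: "x \<in> V \<Longrightarrow> B (c *\<^sub>R x) (c *\<^sub>R x) = c\<^sup>2 * B x x"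
  using scale[of x "c *\<^sub>R x" c] scale_right[of x x c] closed(3)[of x c] by (simp add: power2_eq_square)

lemma square_diff_commute: "x \<in> V \<Longrightarrow> y \<in> V \<Longrightarrow> B (x - y) (x - y) = B (y - x) (y - x)"
  using square_diff[of x y] square_diff[of y x] sym[of x y] by simp

lemma quadratic_nonneg_discrim:
  fixes a b c :: real
  assumes "\<And>t. 0 \<le> a * t\<^sup>2 + 2 * b * t + c" and a: "0 \<le> a"
  shows "b\<^sup>2 \<le> a * c"
proof (cases "a = 0")
  case True
  have "b = 0"
  proof (rule ccontr)
    assume "b \<noteq> 0"
    then show False using assms(1)[of "- (c + 1) / (2 * b)"] True by simp
  qed
  then show ?thesis using True by simp
next
  case False
  then have "a > 0" using a by simp
  have "0 \<le> a * (a * (- b / a)\<^sup>2 + 2 * b * (- b / a) + c)"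
    using assms(1)[of "- b / a"] a by (rule mult_nonneg_nonneg[rotated])
  also have "\<dots> = a * c - b\<^sup>2" using \<open>a > 0\<close> by (simp add: field_simps power2_eq_square)
  finally show ?thesis by simp
qed

lemma cauchy_schwarz:
  assumes x: "x \<in> V" and y: "y \<in> V" shows "(B x y)\<^sup>2 \<le> B x x * B y y"
proof -
  have "(B x y)\<^sup>2 \<le> B y y * B x x"
  proof (rule quadratic_nonneg_discrim)
    fix t
    have "0 \<le> B (x + t *\<^sub>R y) (x + t *\<^sub>R y)" using x y by (intro nonneg closed)
    also have "\<dots> = B y y * t\<^sup>2 + 2 * B x y * t + B x x"
      using x y square_add[of x "t *\<^sub>R y"] closed(3)[of y t] square_scale[of y t] scale_right[of y x t] by simp
    finally show "0 \<le> B y y * t\<^sup>2 + 2 * B x y * t + B x x" .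
  qed (rule nonneg[OF y])
  then show ?thesis by (simp add: mult.commute)
qed

lemma cauchy_schwarz_abs: "x \<in> V \<Longrightarrow> y \<in> V \<Longrightarrow> \<bar>B x y\<bar> \<le> sqrt (B x x) * sqrt (B y y)"
  using cauchy_schwarz[of x y] by (metis real_sqrt_abs real_sqrt_le_mono real_sqrt_mult)

lemma seminorm_triangle:
  assumes x: "x \<in> V" and y: "y \<in> V" shows "sqrt (B (x + y) (x + y)) \<le> sqrt (B x x) + sqrt (B y y)"
proof (rule real_le_lsqrt)
  show "B (x + y) (x + y) \<le> (sqrt (B x x) + sqrt (B y y))\<^sup>2"
    unfolding square_add[OF x y] power2_sum using cauchy_schwarz_abs[OF x y] nonneg[OF x] nonneg[OF y] by simp
qed (use nonneg x y in simp)

lemma null_orthogonal: "x \<in> V \<Longrightarrow> y \<in> V \<Longrightarrow> B y y = 0 \<Longrightarrow> B x y = 0"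
  using cauchy_schwarz[of x y] by simp

definition form_cauchy :: "(nat \<Rightarrow> 'a) \<Rightarrow> bool" where
  "form_cauchy y \<longleftrightarrow> (\<forall>e>0. \<exists>N. \<forall>j\<ge>N. \<forall>k\<ge>N. B (y j - y k) (y j - y k) < e)"

text \<open>Limits are unique only up to vectors of length zero.\<close>

definition form_complete :: "'a set \<Rightarrow> bool" where
  "form_complete Y \<longleftrightarrow> (\<forall>y. (\<forall>k. y k \<in> Y) \<and> form_cauchy y \<longrightarrow> (\<exists>z\<in>Y. (\<lambda>k. B (y k - z) (y k - z)) \<longlonglongrightarrow> 0))"

lemma form_completeE:
  assumes "form_complete Y" "\<And>k. y k \<in> Y" "form_cauchy y"
  obtains z where "z \<in> Y" "(\<lambda>k. B (y k - z) (y k - z)) \<longlonglongrightarrow> 0"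
proof -
  have "(\<forall>k. y k \<in> Y) \<and> form_cauchy y" using assms(2,3) by simp
  then have "\<exists>z\<in>Y. (\<lambda>k. B (y k - z) (y k - z)) \<longlonglongrightarrow> 0"
    by (rule assms(1)[unfolded form_complete_def, THEN spec, THEN mp])
  then show ?thesis by (elim bexE) (rule that)
qed

text \<open>Without completeness a bounded functional need not be represented by a vector. A minimizing sequence of \<open>B x x - 2 * l x\<close> is still Cauchy by the parallelogram law, and perturbing its members in the direction \<open>z\<close> shows that it represents \<open>l\<close> in the limit.\<close>

lemma approximate_riesz:
  assumes Y: "subspace Y" "Y \<subseteq> V"
    and l_add: "\<And>x y. x \<in> Y \<Longrightarrow> y \<in> Y \<Longrightarrow> l (x + y) = l x + l y"
    and l_scale: "\<And>c x. x \<in> Y \<Longrightarrow> l (c *\<^sub>R x) = c * l x"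
    and l_bound: "\<And>x. x \<in> Y \<Longrightarrow> (l x)\<^sup>2 \<le> c * B x x" and c: "0 \<le> c"
  obtains y where "\<And>k. y k \<in> Y" "form_cauchy y" "\<And>z. z \<in> Y \<Longrightarrow> (\<lambda>k. B (y k) z) \<longlonglongrightarrow> l z"
proof -
  define J where "J = (\<lambda>x. B x x - 2 * l x)"
  have YV: "x \<in> Y \<Longrightarrow> x \<in> V" for x using Y by auto
  note Yc = subspace_add[OF Y(1)] subspace_diff[OF Y(1)] subspace_scale[OF Y(1)] subspace_0[OF Y(1)]
  have Jlow: "- c \<le> J x" if x: "x \<in> Y" for x
  proof -
    have "2 * l x \<le> 2 * \<bar>l x\<bar>" by simp
    also have "\<bar>l x\<bar> \<le> sqrt c * sqrt (B x x)"
      using l_bound[OF x] by (metis real_sqrt_abs real_sqrt_le_mono real_sqrt_mult)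
    also have "2 * (sqrt c * sqrt (B x x)) \<le> c + B x x"
      using sum_squares_bound[of "sqrt c" "sqrt (B x x)"] c nonneg[OF YV[OF x]] by (simp add: mult.assoc)
    finally show ?thesis by (simp add: J_def)
  qed
  \<comment> \<open>The infimum of the quadratic functional exists by the bound on \<open>l\<close>.\<close>
  define m where "m = Inf (J ` Y)"
  have bdd: "bdd_below (J ` Y)" using Jlow by (intro bdd_belowI[of _ "- c"]) auto
  have m: "m \<le> J x" if "x \<in> Y" for x unfolding m_def using that bdd by (intro cInf_lower) auto
  have "\<exists>x\<in>Y. J x < m + e" if "0 < e" for e
    using cInf_lessD[of "J ` Y" "m + e"] Yc(4) that unfolding m_def by auto
  then have "\<exists>x\<in>Y. J x < m + 1 / real (Suc k)" for k by simp
  then obtain y where y: "\<And>k. y k \<in> Y" "\<And>k. J (y k) < m + 1 / real (Suc k)" by metis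
  have par: "B (y j - y k) (y j - y k) < 2 * (1 / real (Suc j)) + 2 * (1 / real (Suc k))" for j k
  proof -
    let ?x = "y j" and ?z = "y k"
    note v = YV[OF y(1)[of j]] YV[OF y(1)[of k]]
    have s: "?x + ?z \<in> Y" using y Yc by auto
    have "m \<le> J ((1/2) *\<^sub>R (?x + ?z))" using s Yc by (intro m) auto
    also have "\<dots> = B (?x + ?z) (?x + ?z) / 4 - (l ?x + l ?z)"
      unfolding J_def using square_scale[OF YV[OF s], of "1/2"] l_scale[OF s, of "1/2"] l_add[OF y(1)[of j] y(1)[of k]]
      by (simp add: power2_eq_square)
    finally have "4 * m \<le> B (?x + ?z) (?x + ?z) - 4 * (l ?x + l ?z)" by simp
    moreover have "B (?x + ?z) (?x + ?z) + B (?x - ?z) (?x - ?z) = 2 * B ?x ?x + 2 * B ?z ?z"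
      using square_add[OF v] square_diff[OF v] by simp
    ultimately have "B (?x - ?z) (?x - ?z) \<le> 2 * J ?x + 2 * J ?z - 4 * m" by (simp add: J_def)
    then show ?thesis using y(2)[of j] y(2)[of k] by linarith
  qed
  have cau: "form_cauchy y" unfolding form_cauchy_def
  proof (intro allI impI)
    fix e :: real assume e: "0 < e"
    obtain N where N: "1 / real (Suc N) < e / 4" using e nat_approx_posE[of "e/4"] by auto
    have le: "1 / real (Suc j) \<le> 1 / real (Suc N)" if "j \<ge> N" for j
      using that by (simp add: frac_le)
    have "B (y j - y k) (y j - y k) < e" if "j \<ge> N" "k \<ge> N" for j k
      using par[of j k] le[OF that(1)] le[OF that(2)] N by linarith
    then show "\<exists>N. \<forall>j\<ge>N. \<forall>k\<ge>N. B (y j - y k) (y j - y k) < e" by blast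
  qed
  have lim: "(\<lambda>k. B (y k) z) \<longlonglongrightarrow> l z" if z: "z \<in> Y" for z
  proof -
    have disc: "(B (y k) z - l z)\<^sup>2 \<le> B z z * (1 / real (Suc k))" for k
    proof (rule quadratic_nonneg_discrim)
      fix t
      note v = YV[OF y(1)[of k]] YV[OF z]
      have tz: "t *\<^sub>R z \<in> Y" using z Yc by auto
      have "m \<le> J (y k + t *\<^sub>R z)" using tz y Yc by (intro m) auto
      also have "\<dots> = J (y k) + (B z z * t\<^sup>2 + 2 * (B (y k) z - l z) * t)"
        unfolding J_def using square_add[OF v(1) YV[OF tz]] square_scale[OF v(2), of t] scale_right[OF v(2) v(1), of t]
          l_add[OF y(1)[of k] tz] l_scale[OF z, of t] by (simp add: algebra_simps)
      finally show "0 \<le> B z z * t\<^sup>2 + 2 * (B (y k) z - l z) * t + 1 / real (Suc k)"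
        using y(2)[of k] by linarith
    qed (rule nonneg[OF YV[OF z]])
    have "(\<lambda>k. B z z * (1 / real (Suc k))) \<longlonglongrightarrow> B z z * 0"
      by (intro tendsto_mult tendsto_const LIMSEQ_Suc[OF lim_1_over_n])
    then have "(\<lambda>k. (B (y k) z - l z)\<^sup>2) \<longlonglongrightarrow> 0"
      unfolding mult_zero_right
    proof (rule null_seq_squeeze[rotated])
      show "\<bar>(B (y k) z - l z)\<^sup>2\<bar> \<le> B z z * (1 / real (Suc k))" for k
        unfolding abs_of_nonneg[OF zero_le_power2] by (rule disc)
    qed
    then have "(\<lambda>k. sqrt ((B (y k) z - l z)\<^sup>2)) \<longlonglongrightarrow> sqrt 0" by (rule tendsto_real_sqrt)
    then have "(\<lambda>k. \<bar>B (y k) z - l z\<bar>) \<longlonglongrightarrow> 0" by simp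
    then have "(\<lambda>k. B (y k) z - l z) \<longlonglongrightarrow> 0" by (rule tendsto_rabs_zero_cancel)
    then show ?thesis by (rule LIM_zero_cancel)
  qed
  show ?thesis using that y(1) cau lim by blast
qed

lemma riesz:
  assumes Y: "subspace Y" "Y \<subseteq> V" and comp: "form_complete Y"
    and l: "\<And>x y. x \<in> Y \<Longrightarrow> y \<in> Y \<Longrightarrow> l (x + y) = l x + l y" "\<And>c x. x \<in> Y \<Longrightarrow> l (c *\<^sub>R x) = c * l x"
      "\<And>x. x \<in> Y \<Longrightarrow> (l x)\<^sup>2 \<le> c * B x x" and c: "0 \<le> c"
  obtains y where "y \<in> Y" "\<And>z. z \<in> Y \<Longrightarrow> B y z = l z"
proof -
  obtain y where y: "\<And>k. y k \<in> Y" "form_cauchy y" "\<And>z. z \<in> Y \<Longrightarrow> (\<lambda>k. B (y k) z) \<longlonglongrightarrow> l z"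
    using approximate_riesz[OF Y l c] by blast
  obtain x where x: "x \<in> Y" "(\<lambda>k. B (y k - x) (y k - x)) \<longlonglongrightarrow> 0"
    by (rule form_completeE[OF comp y(1,2)])
  have "B x z = l z" if z: "z \<in> Y" for z
  proof -
    have v: "z \<in> V" "x \<in> V" "\<And>k. y k \<in> V" using z x y Y by auto
    have "(\<lambda>k. sqrt (B (y k - x) (y k - x)) * sqrt (B z z)) \<longlonglongrightarrow> sqrt 0 * sqrt (B z z)"
      by (intro tendsto_intros x(2))
    then have "(\<lambda>k. B (y k - x) z) \<longlonglongrightarrow> 0"
      unfolding real_sqrt_zero mult_zero_left
      by (rule null_seq_squeeze[rotated]) (intro cauchy_schwarz_abs closed v)
    then have "(\<lambda>k. B (y k) z - B x z) \<longlonglongrightarrow> 0" using diff v by simp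
    then have "(\<lambda>k. B (y k) z) \<longlonglongrightarrow> B x z" by (rule LIM_zero_cancel)
    then show ?thesis using y(3)[OF z] LIMSEQ_unique by blast
  qed
  then show ?thesis using that x(1) by blast
qed

lemma projection:
  assumes Y: "subspace Y" "Y \<subseteq> V" and comp: "form_complete Y" and x: "x \<in> V"
  obtains y where "y \<in> Y" "\<And>z. z \<in> Y \<Longrightarrow> B (x - y) z = 0"
proof -
  obtain y where y: "y \<in> Y" "\<And>z. z \<in> Y \<Longrightarrow> B y z = B x z"
  proof (rule riesz[OF Y comp, of "B x" "B x x"])
    show "0 \<le> B x x" by (rule nonneg[OF x])
    show "(B x z)\<^sup>2 \<le> B x x * B z z" if "z \<in> Y" for z using that Y x by (intro cauchy_schwarz) auto
  qed (use Y x add_right scale_right in \<open>auto simp: subset_iff\<close>)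
  have "B (x - y) z = 0" if "z \<in> Y" for z using y that Y x diff[of x y z] by (auto simp: subset_iff)
  then show ?thesis using that y(1) by blast
qed

end

text \<open>A smaller form \<open>Q\<close> inherits completeness from \<open>I\<close> if bounded sequences on which \<open>Q\<close> tends to zero are
compact. The compactness yields a spectral gap: on the part of \<open>W\<close> that is \<open>I\<close>-orthogonal to the kernel
\<open>N\<close> of \<open>Q\<close>, the two forms are equivalent. A \<open>Q\<close>-Cauchy sequence is therefore \<open>I\<close>-Cauchy after
subtracting its projections to \<open>N\<close>, which changes no \<open>Q\<close>-length.\<close>

lemma complete_of_compact_perturbation:
  assumes I: "psd_form V I" and Q: "psd_form V Q"
    and W: "subspace W" "W \<subseteq> V" and comp: "psd_form.form_complete I W"
    and le: "\<And>x. x \<in> V \<Longrightarrow> Q x x \<le> I x x"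
    and cpt: "\<And>f. (\<And>k::nat. f k \<in> W) \<Longrightarrow> (\<And>k. I (f k) (f k) \<le> 1) \<Longrightarrow> (\<lambda>k. Q (f k) (f k)) \<longlonglongrightarrow> 0
       \<Longrightarrow> \<exists>r. strict_mono r \<and> psd_form.form_cauchy I (\<lambda>k. f (r k))"
  shows "psd_form.form_complete Q W"
proof -
  interpret I: psd_form V I by (rule I)
  interpret Q: psd_form V Q by (rule Q)
  define N where "N = {x \<in> W. Q x x = 0}"
  have WV: "x \<in> W \<Longrightarrow> x \<in> V" for x using W by auto
  note Wc = subspace_add[OF W(1)] subspace_diff[OF W(1)] subspace_scale[OF W(1)] subspace_0[OF W(1)]
  have Nsub: "subspace N"
  proof (rule subspaceI)
    show "0 \<in> N" using Wc(4) Q.square_scale[of 0 0] WV by (auto simp: N_def)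
    show "x + y \<in> N" if "x \<in> N" "y \<in> N" for x y
      using that Q.square_add[of x y] Q.null_orthogonal[of x y] Wc WV by (auto simp: N_def)
    show "c *\<^sub>R x \<in> N" if "x \<in> N" for c x
      using that Q.square_scale[of x c] Wc WV by (auto simp: N_def)
  qed
  have NV: "N \<subseteq> V" using WV by (auto simp: N_def)
  have Qlim: "Q z z = 0" if z: "z \<in> W" and y: "\<And>k::nat. y k \<in> W" and yz: "(\<lambda>k. I (y k - z) (y k - z)) \<longlonglongrightarrow> 0"
     and Qy: "(\<lambda>k. Q (y k) (y k)) \<longlonglongrightarrow> 0" for y z
  proof -
    have "sqrt (Q z z) \<le> sqrt (I (y k - z) (y k - z)) + sqrt (Q (y k) (y k))" for k
    proof -
      have v: "z - y k \<in> V" "y k \<in> V" using z y Wc WV by auto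
      have "sqrt (Q z z) \<le> sqrt (Q (z - y k) (z - y k)) + sqrt (Q (y k) (y k))"
        using Q.seminorm_triangle[OF v] by simp
      also have "Q (z - y k) (z - y k) \<le> I (z - y k) (z - y k)" by (rule le[OF v(1)])
      also have "\<dots> = I (y k - z) (y k - z)" using I.square_diff_commute z y WV by blast
      finally show ?thesis by simp
    qed
    moreover have "(\<lambda>k. sqrt (I (y k - z) (y k - z)) + sqrt (Q (y k) (y k))) \<longlonglongrightarrow> sqrt 0 + sqrt 0"
      by (intro tendsto_intros yz Qy)
    ultimately have "sqrt (Q z z) \<le> sqrt 0 + sqrt 0" by (intro LIMSEQ_le_const) auto
    then show ?thesis using Q.nonneg[OF WV[OF z]] by simp
  qed
  have Ncomp: "I.form_complete N" unfolding I.form_complete_def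
  proof (intro allI impI)
    fix y assume y: "(\<forall>k. y k \<in> N) \<and> I.form_cauchy y"
    then have yW: "y k \<in> W" "Q (y k) (y k) = 0" for k by (auto simp: N_def)
    obtain z where z: "z \<in> W" "(\<lambda>k. I (y k - z) (y k - z)) \<longlonglongrightarrow> 0"
      by (rule I.form_completeE[OF comp yW(1) conjunct2[OF y]])
    have "Q z z = 0" by (rule Qlim[OF z(1) yW(1) z(2)]) (simp add: yW)
    then show "\<exists>z\<in>N. (\<lambda>k. I (y k - z) (y k - z)) \<longlonglongrightarrow> 0" using z by (auto simp: N_def)
  qed
  \<comment> \<open>Otherwise unit vectors orthogonal to \<open>N\<close> with \<open>Q\<close> tending to zero accumulate at a unit vector of \<open>N\<close>.\<close>
  have gap: "\<exists>\<delta>>0. \<forall>x\<in>W. (\<forall>n\<in>N. I x n = 0) \<longrightarrow> \<delta> * I x x \<le> Q x x"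
  proof (rule ccontr)
    assume neg: "\<not> ?thesis"
    have "\<exists>x\<in>W. (\<forall>n\<in>N. I x n = 0) \<and> Q x x < 1 / real (Suc k) * I x x" for k
    proof (rule ccontr)
      assume "\<not> ?thesis"
      then have "\<forall>x\<in>W. (\<forall>n\<in>N. I x n = 0) \<longrightarrow> 1 / real (Suc k) * I x x \<le> Q x x" by (meson not_less)
      moreover have "0 < 1 / real (Suc k)" by simp
      ultimately show False using neg by blast
    qed
    then obtain x where x: "\<And>k. x k \<in> W" "\<And>k n. n \<in> N \<Longrightarrow> I (x k) n = 0"
      "\<And>k. Q (x k) (x k) < 1 / real (Suc k) * I (x k) (x k)" by metis
    have Ipos: "0 < I (x k) (x k)" for k
    proof -
      have "0 < 1 / real (Suc k) * I (x k) (x k)" using x(3)[of k] Q.nonneg[OF WV[OF x(1)[of k]]] by linarith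
      then show ?thesis by (rule zero_less_mult_pos) simp
    qed
    define f where "f = (\<lambda>k. (1 / sqrt (I (x k) (x k))) *\<^sub>R x k)"
    have fW: "f k \<in> W" for k unfolding f_def using x(1) Wc by auto
    have If: "I (f k) (f k) = 1" for k
      unfolding f_def I.square_scale[OF WV[OF x(1)]] using Ipos[of k] by (simp add: power_divide)
    have fN: "I (f k) n = 0" if "n \<in> N" for k n
      unfolding f_def using I.scale[of "x k" n] x(1)[of k] x(2)[OF that] that NV WV by auto
    have Qf: "Q (f k) (f k) < 1 / real (Suc k)" for k
    proof -
      have "Q (f k) (f k) = (1 / sqrt (I (x k) (x k)))\<^sup>2 * Q (x k) (x k)"
        unfolding f_def by (rule Q.square_scale[OF WV[OF x(1)]])
      also have "\<dots> = Q (x k) (x k) / I (x k) (x k)" using Ipos[of k] by (simp add: power_divide)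
      also have "\<dots> < 1 / real (Suc k)" unfolding pos_divide_less_eq[OF Ipos] by (rule x(3))
      finally show ?thesis .
    qed
    have Qf0: "(\<lambda>k. Q (f k) (f k)) \<longlonglongrightarrow> 0"
    proof (rule null_seq_squeeze[OF _ LIMSEQ_Suc[OF lim_1_over_n]])
      show "\<bar>Q (f k) (f k)\<bar> \<le> 1 / real (Suc k)" for k
        unfolding abs_of_nonneg[OF Q.nonneg[OF WV[OF fW]]] by (rule less_imp_le[OF Qf])
    qed
    have "\<exists>r. strict_mono r \<and> I.form_cauchy (\<lambda>k. f (r k))"
      by (rule cpt[OF fW _ Qf0]) (simp add: If)
    then obtain r where r: "strict_mono r" "I.form_cauchy (\<lambda>k. f (r k))" by blast
    obtain z where z: "z \<in> W" "(\<lambda>k. I (f (r k) - z) (f (r k) - z)) \<longlonglongrightarrow> 0"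
      by (rule I.form_completeE[OF comp fW r(2)])
    have "(\<lambda>k. Q (f (r k)) (f (r k))) \<longlonglongrightarrow> 0"
      using LIMSEQ_subseq_LIMSEQ[OF Qf0 r(1)] by (simp add: o_def)
    then have "Q z z = 0" using Qlim[OF z(1) fW z(2)] by blast
    then have zN: "z \<in> N" using z by (simp add: N_def)
    have "I (f (r k) - z) (f (r k) - z) \<ge> 1" for k
      using I.square_diff[OF WV[OF fW] WV[OF z(1)], of "r k"] If fN[OF zN] I.nonneg[OF WV[OF z(1)]] by simp
    then have "1 \<le> (0::real)" using z(2) by (intro LIMSEQ_le_const[OF z(2)]) auto
    then show False by simp
  qed
  then obtain \<delta> where d0: "\<delta> > 0" "\<forall>x\<in>W. (\<forall>n\<in>N. I x n = 0) \<longrightarrow> \<delta> * I x x \<le> Q x x" by (elim exE conjE)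
  have d: "\<delta> > 0" "\<And>x. x \<in> W \<Longrightarrow> (\<And>n. n \<in> N \<Longrightarrow> I x n = 0) \<Longrightarrow> \<delta> * I x x \<le> Q x x"
    using d0 by simp_all
  show ?thesis unfolding Q.form_complete_def
  proof (intro allI impI)
    fix y assume y: "(\<forall>k. y k \<in> W) \<and> Q.form_cauchy y"
    have "\<exists>m\<in>N. \<forall>n\<in>N. I (y k - m) n = 0" for k
    proof -
      have yV: "y k \<in> V" using y WV by simp
      show ?thesis
      proof (rule I.projection[OF Nsub NV Ncomp yV])
        fix m assume "m \<in> N" "\<And>n. n \<in> N \<Longrightarrow> I (y k - m) n = 0"
        then show ?thesis by (intro bexI[of _ m] ballI)
      qed
    qed
    then obtain m where m: "\<And>k. m k \<in> N" "\<And>k n. n \<in> N \<Longrightarrow> I (y k - m k) n = 0" by metis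
    define s where "s = (\<lambda>k. y k - m k)"
    have mW: "m k \<in> W" for k using m by (simp add: N_def)
    have sW: "s k \<in> W" for k unfolding s_def using y mW Wc by auto
    have Qn: "Q (x + n) (x + n) = Q x x" if "x \<in> W" "n \<in> N" for x n
      using that Q.square_add[of x n] Q.null_orthogonal[of x n] WV by (simp add: N_def)
    have sc: "I.form_cauchy s" unfolding I.form_cauchy_def
    proof (intro allI impI)
      fix e :: real assume "0 < e"
      then have "0 < \<delta> * e" using d by simp
      then have "\<exists>M. \<forall>j\<ge>M. \<forall>k\<ge>M. Q (y j - y k) (y j - y k) < \<delta> * e"
        by (rule conjunct2[OF y, unfolded Q.form_cauchy_def, THEN spec, THEN mp])
      then obtain M where M: "\<And>j k. j \<ge> M \<Longrightarrow> k \<ge> M \<Longrightarrow> Q (y j - y k) (y j - y k) < \<delta> * e" by auto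
      have "I (s j - s k) (s j - s k) < e" if jk: "j \<ge> M" "k \<ge> M" for j k
      proof -
        have "\<delta> * I (s j - s k) (s j - s k) \<le> Q (s j - s k) (s j - s k)"
        proof (rule d(2))
          show "s j - s k \<in> W" using sW Wc by auto
          show "I (s j - s k) n = 0" if "n \<in> N" for n
            using I.diff[OF WV[OF sW] WV[OF sW], of n j k] m(2)[OF that] that NV unfolding s_def by auto
        qed
        also have "\<dots> = Q ((s j - s k) + (m j - m k)) ((s j - s k) + (m j - m k))"
          using sW Wc m subspace_diff[OF Nsub] by (intro Qn[symmetric]) auto
        also have "(s j - s k) + (m j - m k) = y j - y k" by (simp add: s_def)
        also have "Q (y j - y k) (y j - y k) < \<delta> * e" by (rule M[OF jk])
        finally show ?thesis using d(1) by simp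
      qed
      then show "\<exists>N. \<forall>j\<ge>N. \<forall>k\<ge>N. I (s j - s k) (s j - s k) < e" by blast
    qed
    obtain z where z: "z \<in> W" "(\<lambda>k. I (s k - z) (s k - z)) \<longlonglongrightarrow> 0"
      by (rule I.form_completeE[OF comp sW sc])
    have "Q (y k - z) (y k - z) = Q (s k - z) (s k - z)" for k
    proof -
      have e: "y k - z = (s k - z) + m k" by (simp add: s_def)
      show ?thesis unfolding e by (rule Qn) (use sW z Wc m in auto)
    qed
    then have "(\<lambda>k. Q (y k - z) (y k - z)) = (\<lambda>k. Q (s k - z) (s k - z))" by (rule ext)
    moreover have "(\<lambda>k. Q (s k - z) (s k - z)) \<longlonglongrightarrow> 0"
    proof (rule null_seq_squeeze[OF _ z(2)])
      fix k
      have v: "s k - z \<in> V" using WV sW z(1) I.closed(2) by blast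
      show "\<bar>Q (s k - z) (s k - z)\<bar> \<le> I (s k - z) (s k - z)"
        unfolding abs_of_nonneg[OF Q.nonneg[OF v]] by (rule le[OF v])
    qed
    ultimately show "\<exists>z\<in>W. (\<lambda>k. Q (y k - z) (y k - z)) \<longlonglongrightarrow> 0" using z(1) by (intro bexI[of _ z]) simp_all
  qed
qed

context psd_form
begin

lemma form_tendsto:
  assumes V: "\<And>k::nat. x k \<in> V" "\<And>k. y k \<in> V" "x' \<in> V" "y' \<in> V"
    and x: "(\<lambda>k. B (x k - x') (x k - x')) \<longlonglongrightarrow> 0" and y: "(\<lambda>k. B (y k - y') (y k - y')) \<longlonglongrightarrow> 0"
  shows "(\<lambda>k. B (x k) (y k)) \<longlonglongrightarrow> B x' y'"
proof -
  have dx: "x k - x' \<in> V" and dy: "y k - y' \<in> V" for k using V closed by auto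
  define b where "b = (\<lambda>k. sqrt (B (x k - x') (x k - x')) * sqrt (B (y k - y') (y k - y')) +
     (sqrt (B (x k - x') (x k - x')) * sqrt (B y' y') + sqrt (B x' x') * sqrt (B (y k - y') (y k - y'))))"
  have "b \<longlonglongrightarrow> sqrt 0 * sqrt 0 + (sqrt 0 * sqrt (B y' y') + sqrt (B x' x') * sqrt 0)"
    unfolding b_def by (intro tendsto_intros x y)
  then have b0: "b \<longlonglongrightarrow> 0" by simp
  have "(\<lambda>k. B (x k) (y k) - B x' y') \<longlonglongrightarrow> 0"
  proof (rule null_seq_squeeze[OF _ b0])
    fix k
    have "B (x k) (y k) - B x' y' = B (x k - x') (y k - y') + (B (x k - x') y' + B x' (y k - y'))"
      using diff[OF V(1) V(3) dy] diff_right[OF V(2) V(4)] V dx dy by (simp add: diff diff_right)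
    also have "\<bar>\<dots>\<bar> \<le> b k"
      unfolding b_def by (intro order_trans[OF abs_triangle_ineq] add_mono cauchy_schwarz_abs dx dy V)
    finally show "\<bar>B (x k) (y k) - B x' y'\<bar> \<le> b k" .
  qed
  then show ?thesis by (rule LIM_zero_cancel)
qed

text \<open>Such a sequence stands for a vector of the completion that is orthogonal to \<open>Y\<close>.\<close>

definition weak_null_cauchy :: "'a set \<Rightarrow> (nat \<Rightarrow> 'a) \<Rightarrow> bool" where
  "weak_null_cauchy Y x \<longleftrightarrow> (\<forall>k. x k \<in> V) \<and> form_cauchy x \<and> (\<forall>z\<in>Y. (\<lambda>k. B (x k) z) \<longlonglongrightarrow> 0)"

lemma form_cauchy_ex:
  assumes "form_cauchy x" "0 < e" shows "\<exists>N. \<forall>j\<ge>N. \<forall>k\<ge>N. B (x j - x k) (x j - x k) < e"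
  using assms unfolding form_cauchy_def by (elim allE impE)

lemma form_cauchyD:
  assumes "form_cauchy x" "0 < e" obtains N where "\<And>j k. j \<ge> N \<Longrightarrow> k \<ge> N \<Longrightarrow> B (x j - x k) (x j - x k) < e"
proof -
  have "\<exists>N. \<forall>j\<ge>N. \<forall>k\<ge>N. B (x j - x k) (x j - x k) < e"
    using assms unfolding form_cauchy_def by (elim allE impE)
  then show ?thesis using that by auto
qed

lemma form_cauchy_add:
  assumes x: "form_cauchy x" "\<And>k. x k \<in> V" and y: "form_cauchy y" "\<And>k. y k \<in> V"
  shows "form_cauchy (\<lambda>k. x k + y k)"
  unfolding form_cauchy_def
proof (intro allI impI)
  fix e :: real assume e: "0 < e"
  then have e4: "0 < e / 4" by simp
  obtain N where N: "\<And>j k. j \<ge> N \<Longrightarrow> k \<ge> N \<Longrightarrow> B (x j - x k) (x j - x k) < e / 4" by (rule form_cauchyD[OF x(1) e4]) (rule that, simp)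
  obtain M where M: "\<And>j k. j \<ge> M \<Longrightarrow> k \<ge> M \<Longrightarrow> B (y j - y k) (y j - y k) < e / 4" by (rule form_cauchyD[OF y(1) e4]) (rule that, simp)
  have "B ((x j + y j) - (x k + y k)) ((x j + y j) - (x k + y k)) < e" if "j \<ge> max N M" "k \<ge> max N M" for j k
  proof -
    define u where "u = x j - x k"
    define v where "v = y j - y k"
    have uv: "u \<in> V" "v \<in> V" unfolding u_def v_def using x(2) y(2) closed by auto
    have "(x j + y j) - (x k + y k) = u + v" by (simp add: u_def v_def)
    moreover have "B (u + v) (u + v) \<le> 2 * B u u + 2 * B v v"
      using square_add[OF uv] square_diff[OF uv] nonneg[OF closed(2)[OF uv]] by simp
    moreover have "B u u < e / 4" "B v v < e / 4" using N M that by (auto simp: u_def v_def)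
    ultimately show ?thesis by (simp only:)
  qed
  then show "\<exists>N. \<forall>j\<ge>N. \<forall>k\<ge>N. B ((x j + y j) - (x k + y k)) ((x j + y j) - (x k + y k)) < e" by blast
qed

lemma weak_null_cauchy_add:
  assumes Y: "Y \<subseteq> V" and x: "weak_null_cauchy Y x" and y: "weak_null_cauchy Y y"
  shows "weak_null_cauchy Y (\<lambda>k. x k + y k)"
proof -
  have V: "x k \<in> V" "y k \<in> V" for k using x y by (simp_all add: weak_null_cauchy_def)
  have "(\<lambda>k. B (x k + y k) z) \<longlonglongrightarrow> 0" if z: "z \<in> Y" for z
  proof -
    have "(\<lambda>k. B (x k) z + B (y k) z) \<longlonglongrightarrow> 0 + 0"
      using x y z by (intro tendsto_add) (simp_all add: weak_null_cauchy_def)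
    moreover have "B (x k + y k) z = B (x k) z + B (y k) z" for k using V z Y by (intro add) auto
    ultimately show ?thesis by simp
  qed
  then show ?thesis unfolding weak_null_cauchy_def
    using form_cauchy_add[OF _ V(1) _ V(2)] x y V closed(1) by (simp add: weak_null_cauchy_def)
qed

text \<open>The elements \<open>g - x k\<close> of \<open>Y\<close> vary with \<open>k\<close>, so asymptotic orthogonality to each fixed element of \<open>Y\<close> is not enough; the Cauchy property permits replacing \<open>g - x k\<close> by one fixed \<open>g - x N\<close>.\<close>

lemma weak_null_cross:
  assumes Y: "Y \<subseteq> V" and x: "weak_null_cauchy Y x" and g: "g \<in> V" and gY: "\<And>k. g - x k \<in> Y"
  shows "(\<lambda>k. B (g - x k) (x k)) \<longlonglongrightarrow> 0"
proof (rule LIMSEQ_I)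
  fix e :: real assume e: "0 < e"
  have V: "x k \<in> V" for k using x by (simp add: weak_null_cauchy_def)
  have cau: "form_cauchy x" using x by (simp add: weak_null_cauchy_def)
  have "\<exists>N. \<forall>j\<ge>N. \<forall>k\<ge>N. B (x j - x k) (x j - x k) < 1"
    using cau zero_less_one unfolding form_cauchy_def by (elim allE impE)
  then obtain N0 where N0: "\<And>j k. j \<ge> N0 \<Longrightarrow> k \<ge> N0 \<Longrightarrow> B (x j - x k) (x j - x k) < 1" by auto
  define M where "M = 1 + sqrt (B (x N0) (x N0))"
  have Mpos: "0 < M" using nonneg[OF V[of N0]] by (simp add: M_def add_pos_nonneg)
  have M: "sqrt (B (x k) (x k)) \<le> M" if "k \<ge> N0" for k
  proof -
    have "sqrt (B (x k) (x k)) \<le> sqrt (B (x k - x N0) (x k - x N0)) + sqrt (B (x N0) (x N0))"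
      using seminorm_triangle[OF closed(2)[OF V V] V, of k N0 N0] by simp
    also have "sqrt (B (x k - x N0) (x k - x N0)) \<le> 1" using N0[OF that order_refl] by (simp add: less_imp_le)
    finally show ?thesis by (simp add: M_def)
  qed
  have d: "0 < (e / (2 * M))\<^sup>2" using e Mpos by simp
  have "\<exists>N. \<forall>j\<ge>N. \<forall>k\<ge>N. B (x j - x k) (x j - x k) < (e / (2 * M))\<^sup>2"
    using cau d unfolding form_cauchy_def by (elim allE impE)
  then obtain N1 where N1: "\<And>j k. j \<ge> N1 \<Longrightarrow> k \<ge> N1 \<Longrightarrow> B (x j - x k) (x j - x k) < (e / (2 * M))\<^sup>2" by blast
  have "(\<lambda>k. B (x k) (g - x N1)) \<longlonglongrightarrow> 0" using x gY[of N1] by (simp add: weak_null_cauchy_def)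
  then have "\<exists>no. \<forall>k\<ge>no. norm (B (x k) (g - x N1) - 0) < e / 2" by (rule LIMSEQ_D) (use e in simp)
  then obtain N2 where N2: "\<And>k. k \<ge> N2 \<Longrightarrow> \<bar>B (x k) (g - x N1)\<bar> < e / 2" by auto
  have "norm (B (g - x k) (x k) - 0) < e" if k: "k \<ge> max N0 (max N1 N2)" for k
  proof -
    have v: "g - x N1 \<in> V" "x N1 - x k \<in> V" using g V closed(2) by auto
    have "B (g - x k) (x k) = B ((g - x N1) + (x N1 - x k)) (x k)" by simp
    also have "\<dots> = B (g - x N1) (x k) + B (x N1 - x k) (x k)" by (rule add[OF v V])
    finally have e1: "B (g - x k) (x k) = B (x k) (g - x N1) + B (x N1 - x k) (x k)" using sym[OF v(1) V] by simp
    have "\<bar>B (x N1 - x k) (x k)\<bar> \<le> sqrt (B (x N1 - x k) (x N1 - x k)) * sqrt (B (x k) (x k))"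
      by (rule cauchy_schwarz_abs[OF v(2) V])
    also have "\<dots> \<le> (e / (2 * M)) * M"
    proof (rule mult_mono)
      have "B (x N1 - x k) (x N1 - x k) \<le> (e / (2 * M))\<^sup>2" using N1[of N1 k] k by simp
      then show "sqrt (B (x N1 - x k) (x N1 - x k)) \<le> e / (2 * M)" using e Mpos by (intro real_le_lsqrt) auto
      show "sqrt (B (x k) (x k)) \<le> M" using M k by simp
    qed (use e Mpos nonneg[OF V] in auto)
    also have "\<dots> = e / 2" using Mpos by simp
    finally show ?thesis using N2[of k] k unfolding e1 by simp
  qed
  then show "\<exists>no. \<forall>k\<ge>no. norm (B (g - x k) (x k) - 0) < e" by blast
qed

end

section \<open>Completeness of the square integrable functions\<close>

definition sqi :: "(complex \<Rightarrow> 'b::euclidean_space) \<Rightarrow> bool" where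
  "sqi f \<longleftrightarrow> f \<in> borel_measurable circle \<and> integrable circle (\<lambda>\<zeta>. (norm (f \<zeta>))\<^sup>2)"

lemma sqi_measurable [measurable_dest]: "sqi f \<Longrightarrow> f \<in> borel_measurable circle"
  by (simp add: sqi_def)

lemma norm_add_square_le: "(norm (x + y))\<^sup>2 \<le> 2 * (norm x)\<^sup>2 + 2 * (norm (y::'b::real_normed_vector))\<^sup>2"
proof -
  have "(norm (x + y))\<^sup>2 \<le> (norm x + norm y)\<^sup>2" by (intro power_mono norm_triangle_ineq norm_ge_zero)
  also have "\<dots> \<le> 2 * (norm x)\<^sup>2 + 2 * (norm y)\<^sup>2"
    using sum_squares_bound[of "norm x" "norm y"] by (simp add: power2_sum)
  finally show ?thesis .
qed

lemma sqi_add: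
  assumes f: "sqi f" and g: "sqi g" shows "sqi (\<lambda>\<zeta>. f \<zeta> + g \<zeta>)"
  unfolding sqi_def
proof
  show m: "(\<lambda>\<zeta>. f \<zeta> + g \<zeta>) \<in> borel_measurable circle" using f g by measurable
  show "integrable circle (\<lambda>\<zeta>. (norm (f \<zeta> + g \<zeta>))\<^sup>2)"
  proof (rule Bochner_Integration.integrable_bound)
    show "integrable circle (\<lambda>\<zeta>. 2 * (norm (f \<zeta>))\<^sup>2 + 2 * (norm (g \<zeta>))\<^sup>2)"
      using f g by (simp add: sqi_def)
    show "AE \<zeta> in circle. norm ((norm (f \<zeta> + g \<zeta>))\<^sup>2) \<le> norm (2 * (norm (f \<zeta>))\<^sup>2 + 2 * (norm (g \<zeta>))\<^sup>2)"
      using norm_add_square_le by (intro AE_I2) simp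
  qed (use m in measurable)
qed

lemma sqi_bounded_image:
  fixes f :: "complex \<Rightarrow> 'b::euclidean_space" and g :: "complex \<Rightarrow> 'c::euclidean_space"
  assumes f: "sqi f" and m: "g \<in> borel_measurable circle"
    and le: "AE \<zeta> in circle. norm (g \<zeta>) \<le> C * norm (f \<zeta>)"
  shows "sqi g"
  unfolding sqi_def
proof
  show "g \<in> borel_measurable circle" by (rule m)
  show "integrable circle (\<lambda>\<zeta>. (norm (g \<zeta>))\<^sup>2)"
  proof (rule Bochner_Integration.integrable_bound)
    show "integrable circle (\<lambda>\<zeta>. C\<^sup>2 * (norm (f \<zeta>))\<^sup>2)" using f by (simp add: sqi_def)
    show "AE \<zeta> in circle. norm ((norm (g \<zeta>))\<^sup>2) \<le> norm (C\<^sup>2 * (norm (f \<zeta>))\<^sup>2)"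
      using le by (rule AE_mp) (auto intro!: AE_I2 simp: power_mult_distrib[symmetric] dest: power_mono[of _ _ 2])
  qed (use m in measurable)
qed

lemma sqi_minus: "sqi f \<Longrightarrow> sqi (\<lambda>\<zeta>. - f \<zeta>)"
  by (simp add: sqi_def)

lemma sqi_diff: "sqi f \<Longrightarrow> sqi g \<Longrightarrow> sqi (\<lambda>\<zeta>. f \<zeta> - g \<zeta>)"
  using sqi_add[OF _ sqi_minus, of f g] by (simp only: diff_conv_add_uminus)

lemma sqi_bounded:
  assumes m: "g \<in> borel_measurable circle" and le: "AE \<zeta> in circle. norm (g \<zeta>) \<le> C"
  shows "sqi g"
proof (rule sqi_bounded_image[OF _ m, of "\<lambda>_. 1::real" C])
  show "sqi (\<lambda>_. 1::real)" by (simp add: sqi_def)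
qed (use le in simp)

lemma sqi_integrable:
  assumes "sqi f" shows "integrable circle f"
proof (rule Bochner_Integration.integrable_bound)
  show "integrable circle (\<lambda>\<zeta>. 1 + (norm (f \<zeta>))\<^sup>2)" using assms by (simp add: sqi_def)
  show "f \<in> borel_measurable circle" using assms by (simp add: sqi_def)
  have "x \<le> 1 + x\<^sup>2" for x :: real using zero_le_power2[of "x - 1/2"] by (simp add: power2_eq_square algebra_simps)
  then show "AE \<zeta> in circle. norm (f \<zeta>) \<le> norm (1 + (norm (f \<zeta>))\<^sup>2)" by (intro AE_I2) simp
qed

lemma L1_le_L2:
  assumes f: "sqi f" shows "(LINT \<zeta>|circle. norm (f \<zeta>)) \<le> sqrt (LINT \<zeta>|circle. (norm (f \<zeta>))\<^sup>2)"
proof -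
  define m where "m = (LINT \<zeta>|circle. norm (f \<zeta>))"
  have i1: "integrable circle (\<lambda>\<zeta>. norm (f \<zeta>))" using sqi_integrable[OF f] by simp
  have i2: "integrable circle (\<lambda>\<zeta>. (norm (f \<zeta>))\<^sup>2)" using f by (simp add: sqi_def)
  have "0 \<le> (LINT \<zeta>|circle. (norm (f \<zeta>) - m)\<^sup>2)" by simp
  also have "\<dots> = (LINT \<zeta>|circle. (norm (f \<zeta>))\<^sup>2 - (2 * m) * norm (f \<zeta>) + m\<^sup>2)"
    by (intro Bochner_Integration.integral_cong) (auto simp: power2_diff)
  also have "\<dots> = (LINT \<zeta>|circle. (norm (f \<zeta>))\<^sup>2) - (2 * m) * m + m\<^sup>2"
    using i1 i2 circle.prob_space by (simp add: m_def)
  finally have "m\<^sup>2 \<le> (LINT \<zeta>|circle. (norm (f \<zeta>))\<^sup>2)" by (simp add: power2_eq_square)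
  then show ?thesis unfolding m_def by (rule real_le_rsqrt)
qed

text \<open>The increments have summable norms in \<open>L\<^sup>1\<close> of the circle, which has finite measure, so almost everywhere the series of increments converges absolutely.\<close>

lemma L2_rapid_convergence:
  fixes f :: "nat \<Rightarrow> complex \<Rightarrow> 'b::euclidean_space"
  assumes f: "\<And>k. sqi (f k)"
    and rapid: "\<And>k. (LINT \<zeta>|circle. (norm (f (Suc k) \<zeta> - f k \<zeta>))\<^sup>2) \<le> (1/4) ^ k"
  shows "AE \<zeta> in circle. convergent (\<lambda>k. f k \<zeta>)"
proof -
  define d where "d = (\<lambda>k \<zeta>. norm (f (Suc k) \<zeta> - f k \<zeta>))"
  have sd: "sqi (\<lambda>\<zeta>. f (Suc k) \<zeta> - f k \<zeta>)" for k by (intro sqi_diff f)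
  have [measurable]: "d k \<in> borel_measurable circle" for k
    unfolding d_def using sqi_measurable[OF sd] by measurable
  have nd: "(\<integral>\<^sup>+\<zeta>. ennreal (d k \<zeta>) \<partial>circle) \<le> ennreal ((1/2) ^ k)" for k
  proof -
    have "(LINT \<zeta>|circle. d k \<zeta>) \<le> sqrt ((1/4) ^ k)"
      using L1_le_L2[OF sd[of k]] real_sqrt_le_mono[OF rapid[of k]] unfolding d_def by linarith
    also have "sqrt ((1/4::real) ^ k) = (1/2) ^ k"
      by (intro real_sqrt_unique) (simp_all add: power2_eq_square flip: power_mult_distrib)
    finally show ?thesis
      using sqi_integrable[OF sd[of k]] unfolding d_def
      by (subst nn_integral_eq_integral) (simp_all add: ennreal_leI)
  qed
  have "(\<integral>\<^sup>+\<zeta>. (\<Sum>k. ennreal (d k \<zeta>)) \<partial>circle) = (\<Sum>k. \<integral>\<^sup>+\<zeta>. ennreal (d k \<zeta>) \<partial>circle)"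
    by (rule nn_integral_suminf) measurable
  also have "\<dots> \<le> (\<Sum>k. ennreal ((1/2) ^ k))"
    by (intro suminf_le nd summableI)
  also have "(\<Sum>k. ennreal ((1/2) ^ k)) = ennreal (1 / (1 - 1/2))"
    by (rule suminf_ennreal_eq[OF _ geometric_sums]) simp_all
  also have "\<dots> < \<infinity>" by simp
  finally have "(\<integral>\<^sup>+\<zeta>. (\<Sum>k. ennreal (d k \<zeta>)) \<partial>circle) \<noteq> \<infinity>" by simp
  then have "AE \<zeta> in circle. (\<Sum>k. ennreal (d k \<zeta>)) \<noteq> \<infinity>"
    by (intro nn_integral_PInf_AE) measurable
  then show ?thesis
  proof (rule AE_mp, intro AE_I2 impI)
    fix \<zeta> assume "(\<Sum>k. ennreal (d k \<zeta>)) \<noteq> \<infinity>"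
    then have "summable (\<lambda>k. d k \<zeta>)" by (intro summable_suminf_not_top) (auto simp: d_def)
    then have "summable (\<lambda>k. f (Suc k) \<zeta> - f k \<zeta>)" unfolding d_def by (rule summable_norm_cancel)
    then have "convergent (\<lambda>n. \<Sum>k<n. f (Suc k) \<zeta> - f k \<zeta>)" by (simp add: summable_iff_convergent)
    moreover have "(\<Sum>k<n. f (Suc k) \<zeta> - f k \<zeta>) = f n \<zeta> - f 0 \<zeta>" for n
      by (rule sum_lessThan_telescope)
    ultimately have "convergent (\<lambda>n. f n \<zeta> - f 0 \<zeta>)" by (simp only:)
    then show "convergent (\<lambda>k. f k \<zeta>)" using convergent_diff_const_right_iff by blast
  qed
qed

text \<open>Fatou's lemma for the squared distances to \<open>h\<close>.\<close>

lemma L2_limit_bound: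
  fixes f :: "nat \<Rightarrow> complex \<Rightarrow> 'b::euclidean_space"
  assumes f: "\<And>k. sqi (f k)" and g: "g \<in> borel_measurable circle" and h: "sqi h"
    and lim: "AE \<zeta> in circle. (\<lambda>k. f k \<zeta>) \<longlonglongrightarrow> g \<zeta>"
    and bd: "\<And>k. k \<ge> K \<Longrightarrow> (LINT \<zeta>|circle. (norm (h \<zeta> - f k \<zeta>))\<^sup>2) \<le> e"
  shows "integrable circle (\<lambda>\<zeta>. (norm (h \<zeta> - g \<zeta>))\<^sup>2) \<and> (LINT \<zeta>|circle. (norm (h \<zeta> - g \<zeta>))\<^sup>2) \<le> e"
proof -
  have hm [measurable]: "h \<in> borel_measurable circle" "g \<in> borel_measurable circle" "\<And>k. f k \<in> borel_measurable circle"
    using h g f by (auto simp: sqi_def)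
  have e0: "0 \<le> e" using bd[of K] by (meson Bochner_Integration.integral_nonneg order_refl order_trans zero_le_power2)
  have "(\<integral>\<^sup>+\<zeta>. ennreal ((norm (h \<zeta> - g \<zeta>))\<^sup>2) \<partial>circle) = (\<integral>\<^sup>+\<zeta>. liminf (\<lambda>k. ennreal ((norm (h \<zeta> - f (k + K) \<zeta>))\<^sup>2)) \<partial>circle)"
  proof (rule nn_integral_cong_AE, rule AE_mp[OF lim], intro AE_I2 impI)
    fix \<zeta> assume "(\<lambda>k. f k \<zeta>) \<longlonglongrightarrow> g \<zeta>"
    then have "(\<lambda>k. f (k + K) \<zeta>) \<longlonglongrightarrow> g \<zeta>" by (rule LIMSEQ_ignore_initial_segment)
    then have "(\<lambda>k. ennreal ((norm (h \<zeta> - f (k + K) \<zeta>))\<^sup>2)) \<longlonglongrightarrow> ennreal ((norm (h \<zeta> - g \<zeta>))\<^sup>2)"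
      by (intro tendsto_ennrealI tendsto_intros)
    then show "ennreal ((norm (h \<zeta> - g \<zeta>))\<^sup>2) = liminf (\<lambda>k. ennreal ((norm (h \<zeta> - f (k + K) \<zeta>))\<^sup>2))"
      by (rule lim_imp_Liminf[symmetric, OF trivial_limit_sequentially])
  qed
  also have "\<dots> \<le> liminf (\<lambda>k. \<integral>\<^sup>+\<zeta>. ennreal ((norm (h \<zeta> - f (k + K) \<zeta>))\<^sup>2) \<partial>circle)"
    by (rule nn_integral_liminf) measurable
  also have "\<dots> \<le> liminf (\<lambda>k::nat. ennreal e)"
  proof (intro Liminf_mono always_eventually allI)
    fix k
    have "integrable circle (\<lambda>\<zeta>. (norm (h \<zeta> - f (k + K) \<zeta>))\<^sup>2)" using sqi_diff[OF h f] by (simp add: sqi_def)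
    then show "(\<integral>\<^sup>+\<zeta>. ennreal ((norm (h \<zeta> - f (k + K) \<zeta>))\<^sup>2) \<partial>circle) \<le> ennreal e"
      using bd[of "k + K"] by (subst nn_integral_eq_integral) (auto intro: ennreal_leI)
  qed
  finally have nn: "(\<integral>\<^sup>+\<zeta>. ennreal ((norm (h \<zeta> - g \<zeta>))\<^sup>2) \<partial>circle) \<le> ennreal e" by (simp add: Liminf_const)
  then have i: "integrable circle (\<lambda>\<zeta>. (norm (h \<zeta> - g \<zeta>))\<^sup>2)"
    by (intro integrableI_bounded) (auto simp: le_less_trans)
  then have "ennreal (LINT \<zeta>|circle. (norm (h \<zeta> - g \<zeta>))\<^sup>2) \<le> ennreal e" using nn by (subst (asm) nn_integral_eq_integral) auto
  then show ?thesis using i e0 by (simp add: ennreal_le_iff)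
qed

theorem L2_complete:
  fixes f :: "nat \<Rightarrow> complex \<Rightarrow> 'b::euclidean_space"
  assumes f: "\<And>k. sqi (f k)"
    and cau: "\<And>e. 0 < e \<Longrightarrow> \<exists>N. \<forall>m\<ge>N. \<forall>n\<ge>N. (LINT \<zeta>|circle. (norm (f m \<zeta> - f n \<zeta>))\<^sup>2) < e"
  obtains g where "sqi g" "(\<lambda>n. LINT \<zeta>|circle. (norm (f n \<zeta> - g \<zeta>))\<^sup>2) \<longlonglongrightarrow> 0"
proof -
  have "\<exists>N. \<forall>m\<ge>N. \<forall>n\<ge>N. (LINT \<zeta>|circle. (norm (f m \<zeta> - f n \<zeta>))\<^sup>2) < (1/4) ^ k" for k
    by (rule cau) simp
  then obtain N where N: "\<And>k m n. m \<ge> N k \<Longrightarrow> n \<ge> N k \<Longrightarrow> (LINT \<zeta>|circle. (norm (f m \<zeta> - f n \<zeta>))\<^sup>2) < (1/4) ^ k" by metis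
  define r where "r = (\<lambda>k. (\<Sum>i\<le>k. N i) + k)"
  have rN: "N k \<le> r k" for k unfolding r_def by (simp add: atMost_Suc_eq_insert_0 trans_le_add1 member_le_sum)
  have rs: "strict_mono r" unfolding strict_mono_Suc_iff r_def by simp
  have rk: "k \<le> r k" for k by (simp add: r_def)
  have "AE \<zeta> in circle. convergent (\<lambda>k. f (r k) \<zeta>)"
  proof (rule L2_rapid_convergence)
    show "sqi (f (r k))" for k by (rule f)
    show "(LINT \<zeta>|circle. (norm (f (r (Suc k)) \<zeta> - f (r k) \<zeta>))\<^sup>2) \<le> (1/4) ^ k" for k
      using N[of k "r (Suc k)" "r k"] rN[of k] strict_mono_less[OF rs, of k "Suc k"] by simp
  qed
  then have lim: "AE \<zeta> in circle. (\<lambda>k. f (r k) \<zeta>) \<longlonglongrightarrow> lim (\<lambda>k. f (r k) \<zeta>)"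
    by (simp add: convergent_LIMSEQ_iff)
  define g where "g = (\<lambda>\<zeta>. lim (\<lambda>k. f (r k) \<zeta>))"
  have gm: "g \<in> borel_measurable circle" unfolding g_def
    by (rule borel_measurable_lim_metric) (use f in \<open>simp add: sqi_def\<close>)
  have key: "integrable circle (\<lambda>\<zeta>. (norm (f n \<zeta> - g \<zeta>))\<^sup>2) \<and> (LINT \<zeta>|circle. (norm (f n \<zeta> - g \<zeta>))\<^sup>2) \<le> e"
    if nM: "n \<ge> M" and bd: "\<And>m n. m \<ge> M \<Longrightarrow> n \<ge> M \<Longrightarrow> (LINT \<zeta>|circle. (norm (f m \<zeta> - f n \<zeta>))\<^sup>2) < e" for n M e
  proof (rule L2_limit_bound[where f = "\<lambda>k. f (r k)" and K = M])
    show "(LINT \<zeta>|circle. (norm (f n \<zeta> - f (r k) \<zeta>))\<^sup>2) \<le> e" if "k \<ge> M" for k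
      using bd[OF nM order_trans[OF that rk]] by (rule less_imp_le)
  qed (use f gm lim in \<open>auto simp: g_def\<close>)
  have tend: "(\<lambda>n. LINT \<zeta>|circle. (norm (f n \<zeta> - g \<zeta>))\<^sup>2) \<longlonglongrightarrow> 0"
  proof (rule LIMSEQ_I)
    fix e :: real assume e: "0 < e"
    then obtain M where M: "\<And>m n. m \<ge> M \<Longrightarrow> n \<ge> M \<Longrightarrow> (LINT \<zeta>|circle. (norm (f m \<zeta> - f n \<zeta>))\<^sup>2) < e / 2"
      using cau[of "e/2"] by auto
    have "norm ((LINT \<zeta>|circle. (norm (f n \<zeta> - g \<zeta>))\<^sup>2) - 0) < e" if "n \<ge> M" for n
      using key[OF that M] e by simp
    then show "\<exists>no. \<forall>n\<ge>no. norm ((LINT \<zeta>|circle. (norm (f n \<zeta> - g \<zeta>))\<^sup>2) - 0) < e" by blast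
  qed
  obtain M where M: "\<And>m n. m \<ge> M \<Longrightarrow> n \<ge> M \<Longrightarrow> (LINT \<zeta>|circle. (norm (f m \<zeta> - f n \<zeta>))\<^sup>2) < 1"
    using cau[of 1] by auto
  have "sqi (\<lambda>\<zeta>. f M \<zeta> - g \<zeta>)" unfolding sqi_def
    using conjunct1[OF key[of M M 1, OF order_refl M]] borel_measurable_diff[OF sqi_measurable[OF f] gm] by blast
  then have "sqi (\<lambda>\<zeta>. f M \<zeta> - (f M \<zeta> - g \<zeta>))" using f sqi_diff by blast
  then have "sqi g" by simp
  then show ?thesis using that tend by blast
qed

section \<open>Fourier series of square integrable functions\<close>

lemma fc_add: "integrable circle f \<Longrightarrow> integrable circle g \<Longrightarrow> fc (\<lambda>\<zeta>. f \<zeta> + g \<zeta>) k = fc f k + fc g k"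
  unfolding fc_def distrib_left by (intro Bochner_Integration.integral_add integrable_power_int_mult)

lemma fc_diff: "integrable circle f \<Longrightarrow> integrable circle g \<Longrightarrow> fc (\<lambda>\<zeta>. f \<zeta> - g \<zeta>) k = fc f k - fc g k"
  unfolding fc_def right_diff_distrib by (intro Bochner_Integration.integral_diff integrable_power_int_mult)

lemma fc_mult_left: "fc (\<lambda>\<zeta>. c * f \<zeta>) k = c * fc f k"
  unfolding fc_def by (simp add: mult.left_commute)

lemma fc_sum: "(\<And>i. i \<in> I \<Longrightarrow> integrable circle (f i)) \<Longrightarrow> fc (\<lambda>\<zeta>. \<Sum>i\<in>I. f i \<zeta>) k = (\<Sum>i\<in>I. fc (f i) k)"
  unfolding fc_def sum_distrib_left by (intro Bochner_Integration.integral_sum integrable_power_int_mult)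

lemma fc_cnj: "fc (\<lambda>\<zeta>. cnj (f \<zeta>)) k = cnj (fc f (- k))"
proof -
  have "fc (\<lambda>\<zeta>. cnj (f \<zeta>)) k = (LINT \<zeta>|circle. cnj (\<zeta> powi k * f \<zeta>))"
    unfolding fc_def
  proof (rule Bochner_Integration.integral_cong[OF refl])
    fix \<zeta> :: complex assume "\<zeta> \<in> space circle"
    then have n: "norm \<zeta> = 1" by simp
    have "cnj (\<zeta> powi k) = inverse \<zeta> powi k" unfolding inverse_on_circle[OF n] by simp
    then show "\<zeta> powi (-k) * cnj (f \<zeta>) = cnj (\<zeta> powi k * f \<zeta>)" by (simp add: power_int_minus power_int_inverse)
  qed
  also have "\<dots> = cnj (LINT \<zeta>|circle. \<zeta> powi k * f \<zeta>)" by (metis Bochner_Integration.integral_cnj)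
  finally show ?thesis by (simp add: fc_def)
qed

lemma fc_shift: "fc (\<lambda>\<zeta>. \<zeta> powi j * f \<zeta>) k = fc f (k - j)"
  unfolding fc_def
proof (rule Bochner_Integration.integral_cong[OF refl])
  fix \<zeta> :: complex assume "\<zeta> \<in> space circle"
  then have n: "\<zeta> \<noteq> 0" by auto
  show "\<zeta> powi (-k) * (\<zeta> powi j * f \<zeta>) = \<zeta> powi (-(k-j)) * f \<zeta>"
    using power_int_add[of \<zeta> "-k" j] n by (simp add: mult.assoc[symmetric])
qed

lemma fc_power_int: "fc (\<lambda>\<zeta>. \<zeta> powi j) k = (if k = j then 1 else 0)"
  using fc_shift[of j "\<lambda>_. 1" k] integral_circle_power_int[of "- (k - j)"] by (simp add: fc_def)

lemma norm_fc_le: "integrable circle f \<Longrightarrow> norm (fc f k) \<le> (LINT \<zeta>|circle. norm (f \<zeta>))"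
  unfolding fc_def
  by (rule norm_integral_le) (auto simp: norm_mult norm_power_int intro!: AE_I2)

lemma fc_limit:
  assumes f: "\<And>n. sqi (f n)" and g: "sqi g"
    and lim: "(\<lambda>n. LINT \<zeta>|circle. (norm (f n \<zeta> - g \<zeta>))\<^sup>2) \<longlonglongrightarrow> 0"
  shows "(\<lambda>n. fc (f n) k) \<longlonglongrightarrow> fc g k"
proof -
  have le: "norm (fc (f n) k - fc g k) \<le> sqrt (LINT \<zeta>|circle. (norm (f n \<zeta> - g \<zeta>))\<^sup>2)" for n
    using norm_fc_le[OF sqi_integrable[OF sqi_diff[OF f g]], of n k] L1_le_L2[OF sqi_diff[OF f g], of n]
      fc_diff[OF sqi_integrable[OF f] sqi_integrable[OF g], of n k] by simp
  have "(\<lambda>n. sqrt (LINT \<zeta>|circle. (norm (f n \<zeta> - g \<zeta>))\<^sup>2)) \<longlonglongrightarrow> sqrt 0" by (intro tendsto_real_sqrt lim)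
  then have "(\<lambda>n. norm (fc (f n) k - fc g k)) \<longlonglongrightarrow> 0"
    unfolding real_sqrt_zero by (rule null_seq_squeeze[rotated]) (simp only: abs_norm_cancel le)
  then have "(\<lambda>n. fc (f n) k - fc g k) \<longlonglongrightarrow> 0" by (rule tendsto_norm_zero_cancel)
  then show ?thesis by (rule LIM_zero_cancel)
qed

lemma integral_trig_product:
  fixes c :: "int \<Rightarrow> complex"
  assumes S: "finite S" and h: "integrable circle h"
  shows "(LINT \<zeta>|circle. h \<zeta> * cnj (\<Sum>k\<in>S. c k * \<zeta> powi k)) = (\<Sum>k\<in>S. cnj (c k) * fc h k)"
proof -
  have "(LINT \<zeta>|circle. h \<zeta> * cnj (\<Sum>k\<in>S. c k * \<zeta> powi k)) = (LINT \<zeta>|circle. (\<Sum>k\<in>S. cnj (c k) * (\<zeta> powi (-k) * h \<zeta>)))"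
  proof (rule Bochner_Integration.integral_cong[OF refl])
    fix \<zeta> :: complex assume "\<zeta> \<in> space circle"
    then have n: "norm \<zeta> = 1" by simp
    have "cnj (\<zeta> powi k) = \<zeta> powi (-k)" for k
    proof -
      have "cnj (\<zeta> powi k) = inverse \<zeta> powi k" unfolding inverse_on_circle[OF n] by simp
      then show ?thesis by (simp add: power_int_minus power_int_inverse)
    qed
    then show "h \<zeta> * cnj (\<Sum>k\<in>S. c k * \<zeta> powi k) = (\<Sum>k\<in>S. cnj (c k) * (\<zeta> powi (-k) * h \<zeta>))"
      by (simp add: sum_distrib_left mult_ac)
  qed
  also have "\<dots> = (\<Sum>k\<in>S. cnj (c k) * fc h k)"
    unfolding fc_def by (subst Bochner_Integration.integral_sum) (auto intro!: integrable_power_int_mult h)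
  finally show ?thesis .
qed

lemma trig_poly_bounded:
  "norm \<zeta> = 1 \<Longrightarrow> norm (\<Sum>k\<in>S. c k * \<zeta> powi k) \<le> (\<Sum>k\<in>S. norm (c k :: complex))"
  by (rule order_trans[OF norm_sum]) (simp add: norm_mult norm_power_int)

lemma sqi_trig_poly: "sqi (\<lambda>\<zeta>. \<Sum>k\<in>S. c k * \<zeta> powi k :: complex)"
  by (rule sqi_bounded[where C = "\<Sum>k\<in>S. norm (c k)"]) (auto intro!: AE_I2 trig_poly_bounded)

lemma integrable_trig_poly: "integrable circle (\<lambda>\<zeta>. c k * \<zeta> powi k :: complex)"
  using sqi_integrable[OF sqi_trig_poly[where S = "{k}" and c = c]] by simp

lemma fc_trig_poly:
  "finite S \<Longrightarrow> fc (\<lambda>\<zeta>. \<Sum>k\<in>S. c k * \<zeta> powi k) j = (if j \<in> S then c j else 0)"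
  by (subst fc_sum) (simp_all add: integrable_trig_poly fc_mult_left fc_power_int if_distrib sum.delta' cong: if_cong)

lemma trig_poly_norm:
  fixes c :: "int \<Rightarrow> complex"
  assumes S: "finite S"
  shows "(LINT \<zeta>|circle. (norm (\<Sum>k\<in>S. c k * \<zeta> powi k))\<^sup>2) = (\<Sum>k\<in>S. (norm (c k))\<^sup>2)"
proof -
  define p where "p = (\<lambda>\<zeta>. \<Sum>k\<in>S. c k * \<zeta> powi k)"
  have "complex_of_real (LINT \<zeta>|circle. (norm (p \<zeta>))\<^sup>2) = (LINT \<zeta>|circle. p \<zeta> * cnj (p \<zeta>))"
    unfolding complex_norm_square[symmetric] of_real_power[symmetric] by (rule integral_complex_of_real[symmetric])
  also have "\<dots> = (\<Sum>k\<in>S. cnj (c k) * fc p k)"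
    using integral_trig_product[OF S sqi_integrable[OF sqi_trig_poly[where S = S and c = c]], of c] by (simp add: p_def)
  also have "\<dots> = (\<Sum>k\<in>S. cnj (c k) * c k)" unfolding p_def using S by (simp add: fc_trig_poly)
  also have "\<dots> = complex_of_real (\<Sum>k\<in>S. (norm (c k))\<^sup>2)" unfolding of_real_sum complex_norm_square by (simp add: mult.commute)
  finally show ?thesis unfolding p_def using of_real_eq_iff by blast
qed

lemma cmod_diff_square: "(cmod (x - y))\<^sup>2 = (cmod x)\<^sup>2 - 2 * Re (x * cnj y) + (cmod y)\<^sup>2"
  by (simp only: cmod_power2) (simp add: power2_eq_square algebra_simps)

text \<open>The squared distance from \<open>h\<close> to its partial Fourier sum is nonnegative.\<close>

lemma bessel:
  assumes S: "finite S" and h: "sqi (h :: complex \<Rightarrow> complex)"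
  shows "(\<Sum>k\<in>S. (norm (fc h k))\<^sup>2) \<le> (LINT \<zeta>|circle. (norm (h \<zeta>))\<^sup>2)"
proof -
  define p where "p = (\<lambda>\<zeta>. \<Sum>k\<in>S. fc h k * \<zeta> powi k)"
  define C where "C = (\<Sum>k\<in>S. norm (fc h k))"
  have ih: "integrable circle h" using sqi_integrable[OF h] .
  have sp: "sqi p" unfolding p_def by (rule sqi_trig_poly)
  have [measurable]: "p \<in> borel_measurable circle" "h \<in> borel_measurable circle" using sp h by (auto simp: sqi_def)
  have ihp: "integrable circle (\<lambda>\<zeta>. h \<zeta> * cnj (p \<zeta>))"
  proof -
    have "integrable circle (\<lambda>\<zeta>. cnj (p \<zeta>) * h \<zeta>)"
    proof (rule integrable_bounded_mult[OF ih])
      show "(\<lambda>\<zeta>. cnj (p \<zeta>)) \<in> borel_measurable circle"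
        by (rule measurable_compose[OF \<open>p \<in> borel_measurable circle\<close> borel_measurable_continuous_onI]) (intro continuous_intros)
      show "AE \<zeta> in circle. norm (cnj (p \<zeta>)) \<le> C"
        unfolding complex_mod_cnj p_def C_def by (intro AE_I2 trig_poly_bounded) simp
    qed
    then show ?thesis by (simp add: mult.commute)
  qed
  have "(LINT \<zeta>|circle. h \<zeta> * cnj (p \<zeta>)) = (\<Sum>k\<in>S. cnj (fc h k) * fc h k)"
    unfolding p_def by (rule integral_trig_product[OF S ih])
  also have "\<dots> = complex_of_real (\<Sum>k\<in>S. (norm (fc h k))\<^sup>2)" unfolding of_real_sum complex_norm_square by (simp add: mult.commute)
  finally have "Re (LINT \<zeta>|circle. h \<zeta> * cnj (p \<zeta>)) = (\<Sum>k\<in>S. (norm (fc h k))\<^sup>2)" by simp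
  then have re: "(LINT \<zeta>|circle. Re (h \<zeta> * cnj (p \<zeta>))) = (\<Sum>k\<in>S. (norm (fc h k))\<^sup>2)"
    using integral_Re[OF ihp] by simp
  have i1: "integrable circle (\<lambda>\<zeta>. (norm (h \<zeta>))\<^sup>2)" "integrable circle (\<lambda>\<zeta>. (norm (p \<zeta>))\<^sup>2)"
    using h sp by (auto simp: sqi_def)
  have i2: "integrable circle (\<lambda>\<zeta>. Re (h \<zeta> * cnj (p \<zeta>)))" using ihp by (rule integrable_Re)
  have n2: "(LINT \<zeta>|circle. (norm (p \<zeta>))\<^sup>2) = (\<Sum>k\<in>S. (norm (fc h k))\<^sup>2)"
    unfolding p_def by (rule trig_poly_norm[OF S])
  have n3: "(LINT \<zeta>|circle. 2 * Re (h \<zeta> * cnj (p \<zeta>))) = 2 * (\<Sum>k\<in>S. (norm (fc h k))\<^sup>2)"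
    unfolding re[symmetric] by (rule integral_mult_right_zero)
  have "0 \<le> (LINT \<zeta>|circle. (norm (h \<zeta> - p \<zeta>))\<^sup>2)" by simp
  also have "\<dots> = (LINT \<zeta>|circle. (norm (h \<zeta>))\<^sup>2 - 2 * Re (h \<zeta> * cnj (p \<zeta>)) + (norm (p \<zeta>))\<^sup>2)"
    by (simp only: cmod_diff_square)
  also have "\<dots> = (LINT \<zeta>|circle. (norm (h \<zeta>))\<^sup>2) - 2 * (\<Sum>k\<in>S. (norm (fc h k))\<^sup>2) + (\<Sum>k\<in>S. (norm (fc h k))\<^sup>2)"
    by (simp only: Bochner_Integration.integral_add Bochner_Integration.integral_diff Bochner_Integration.integrable_diff integrable_mult_right i1 i2 n2 n3)
  finally show ?thesis by simp
qed

text \<open>The partial sums are Cauchy in \<open>L2\<close>; the coefficients of their limit are read off by continuity of \<open>fc\<close>.\<close>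

lemma riesz_fischer:
  fixes a :: "nat \<Rightarrow> complex"
  assumes a: "\<And>n. (\<Sum>k<n. (norm (a k))\<^sup>2) \<le> C"
  obtains F where "sqi F" "\<And>k. fc F (int k) = a k" "\<And>k. k < 0 \<Longrightarrow> fc F k = 0"
    "(\<lambda>n. LINT \<zeta>|circle. (norm ((\<Sum>k<n. a k * \<zeta> ^ k) - F \<zeta>))\<^sup>2) \<longlonglongrightarrow> 0"
proof -
  define s where "s = (\<lambda>n \<zeta>. \<Sum>k<n. a k * \<zeta> ^ k)"
  define c where "c = (\<lambda>k::int. a (nat k))"
  have sum_conv: "(\<Sum>k\<in>int ` A. c k * \<zeta> powi k) = (\<Sum>k\<in>A. a k * \<zeta> ^ k)" for A \<zeta>
    by (subst sum.reindex) (auto simp: c_def o_def)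
  have s_conv: "s n = (\<lambda>\<zeta>. \<Sum>k\<in>int ` {..<n}. c k * \<zeta> powi k)" for n
    unfolding s_def sum_conv by simp
  have ss: "sqi (s n)" for n unfolding s_conv by (rule sqi_trig_poly)
  have summ: "summable (\<lambda>k. (norm (a k))\<^sup>2)"
    by (rule bounded_imp_summable[of _ C]) (use a[of "Suc _"] in \<open>simp_all only: lessThan_Suc_atMost zero_le_power2\<close>)
  have dist: "(LINT \<zeta>|circle. (norm (s m \<zeta> - s n \<zeta>))\<^sup>2) = (\<Sum>k\<in>{n..<m}. (norm (a k))\<^sup>2)" if "n \<le> m" for m n
  proof -
    have "s m \<zeta> - s n \<zeta> = (\<Sum>k\<in>int ` {n..<m}. c k * \<zeta> powi k)" for \<zeta>
      unfolding sum_conv s_def using that by (simp add: lessThan_atLeast0 sum_diff_nat_ivl)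
    then show ?thesis using trig_poly_norm[of "int ` {n..<m}" c] by (simp add: sum.reindex c_def o_def)
  qed
  have cauchy: "\<exists>N. \<forall>m\<ge>N. \<forall>n\<ge>N. (LINT \<zeta>|circle. (norm (s m \<zeta> - s n \<zeta>))\<^sup>2) < e" if e: "0 < e" for e
  proof -
    obtain N where N: "\<And>m n. m \<ge> N \<Longrightarrow> norm (\<Sum>k\<in>{m..<n}. (norm (a k))\<^sup>2) < e"
      using summ e unfolding summable_Cauchy by blast
    have "(LINT \<zeta>|circle. (norm (s m \<zeta> - s n \<zeta>))\<^sup>2) < e" if "m \<ge> N" "n \<ge> N" for m n
    proof (cases "n \<le> m")
      case True
      then show ?thesis using dist[OF True] N[OF that(2), of m] by (simp add: sum_nonneg)
    next
      case False
      then have mn: "m \<le> n" by simp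
      have "(LINT \<zeta>|circle. (norm (s m \<zeta> - s n \<zeta>))\<^sup>2) = (LINT \<zeta>|circle. (norm (s n \<zeta> - s m \<zeta>))\<^sup>2)"
        by (subst norm_minus_commute) (rule refl)
      then show ?thesis using dist[OF mn] N[OF that(1), of n] by (simp add: sum_nonneg)
    qed
    then show ?thesis by blast
  qed
  from L2_complete[OF ss cauchy] obtain F where F: "sqi F" "(\<lambda>n. LINT \<zeta>|circle. (norm (s n \<zeta> - F \<zeta>))\<^sup>2) \<longlonglongrightarrow> 0"
    by blast
  have fcs: "fc (s n) k = (if 0 \<le> k \<and> k < int n then a (nat k) else 0)" for n k
    unfolding s_conv by (subst fc_trig_poly) (simp_all add: c_def lessThan_atLeast0 image_int_atLeastLessThan)
  have "fc F (int k) = a k" for k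
  proof (rule LIMSEQ_unique[OF fc_limit[OF ss F]])
    show "(\<lambda>n. fc (s n) (int k)) \<longlonglongrightarrow> a k"
      by (rule tendsto_eventually, rule eventually_sequentiallyI[of "Suc k"]) (simp add: fcs)
  qed
  moreover have "fc F k = 0" if "k < 0" for k
  proof (rule LIMSEQ_unique[OF fc_limit[OF ss F]])
    show "(\<lambda>n. fc (s n) k) \<longlonglongrightarrow> 0" using that by (simp add: fcs)
  qed
  ultimately show ?thesis using that[of F] F by (simp add: s_def)
qed

section \<open>Bounded analytic functions and their boundary values\<close>

text \<open>\<open>F\<close> is the radial boundary function of the bounded analytic function \<open>G\<close> on the disk. Keeping the pair makes values at the origin and boundary values available together.\<close>

definition bdh :: "(complex \<Rightarrow> complex) \<Rightarrow> (complex \<Rightarrow> complex) \<Rightarrow> bool" where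
  "bdh F G \<longleftrightarrow> F \<in> borel_measurable circle \<and> G holomorphic_on ball 0 1 \<and>
     (\<exists>C. \<forall>z\<in>ball 0 1. norm (G z) \<le> C) \<and>
     (AE \<zeta> in circle. ((\<lambda>r. G (of_real r * \<zeta>)) \<longlongrightarrow> F \<zeta>) (at_left 1))"

lemma measurable_circle_continuous:
  assumes "continuous_on (sphere 0 1) h" shows "h \<in> borel_measurable circle"
  using borel_measurable_continuous_on_restrict[OF assms] measurable_cong_sets[OF sets_circle refl, of borel] by blast

lemma at_left_1_seq: "filterlim (\<lambda>n. 1 - 1 / real (n + 2)) (at_left 1) sequentially"
proof -
  have "(\<lambda>n. 1 - 1 / real (n + 2)) \<longlonglongrightarrow> 1 - 0"
    by (intro tendsto_intros LIMSEQ_ignore_initial_segment[OF lim_1_over_n])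
  then show ?thesis unfolding filterlim_at by (auto intro!: always_eventually)
qed

lemma at_left_1_interval: "\<forall>\<^sub>F r in at_left (1::real). 0 < r \<and> r < 1"
  by (subst eventually_at_left[of 0]) (auto intro: exI[of _ 0])

lemma radial_in_ball: "0 < r \<Longrightarrow> r < 1 \<Longrightarrow> norm \<zeta> = 1 \<Longrightarrow> of_real r * \<zeta> \<in> ball (0::complex) 1"
  by (simp add: norm_mult)

lemma radial_measurable:
  assumes G: "continuous_on (ball 0 1) G" and r: "0 < r" "r < 1"
  shows "(\<lambda>\<zeta>. G (of_real r * \<zeta>) :: complex) \<in> borel_measurable circle"
  using r by (intro measurable_circle_continuous continuous_on_compose2[OF G] continuous_intros)
    (auto simp: norm_mult)

text \<open>A power series that converges absolutely on the circle may be integrated term by term.\<close>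

lemma power_series_integral:
  assumes f: "integrable circle f" and b: "summable (\<lambda>j. norm (b j))"
    and H: "\<And>\<zeta>. norm \<zeta> = 1 \<Longrightarrow> (\<lambda>j. b j * \<zeta> ^ j) sums H \<zeta>"
  shows "(\<lambda>j. b j * fc f (- int j)) sums (LINT \<zeta>|circle. H \<zeta> * f \<zeta>)"
proof -
  define g where "g = (\<lambda>j \<zeta>. b j * (\<zeta> powi (int j) * f \<zeta>))"
  have gi: "integrable circle (g k)" for k
    unfolding g_def by (intro integrable_mult_right integrable_power_int_mult f)
  have gn: "norm (g k \<zeta>) = norm (b k) * norm (f \<zeta>)" if "norm \<zeta> = 1" for k \<zeta>
    using that by (simp add: g_def norm_mult norm_power)
  have "(\<lambda>k. integral\<^sup>L circle (g k)) sums (LINT \<zeta>|circle. (\<Sum>k. g k \<zeta>))"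
  proof (rule sums_integral[OF gi])
    show "AE \<zeta> in circle. summable (\<lambda>k. norm (g k \<zeta>))"
      by (rule AE_I2) (simp add: gn summable_mult2[OF b])
    have "(LINT \<zeta>|circle. norm (g k \<zeta>)) = norm (b k) * (LINT \<zeta>|circle. norm (f \<zeta>))" for k
    proof -
      have "(LINT \<zeta>|circle. norm (g k \<zeta>)) = (LINT \<zeta>|circle. norm (b k) * norm (f \<zeta>))"
        by (rule Bochner_Integration.integral_cong) (simp_all add: gn)
      then show ?thesis by simp
    qed
    then show "summable (\<lambda>k. LINT \<zeta>|circle. norm (g k \<zeta>))" using summable_mult2[OF b] by simp
  qed
  moreover have "(LINT \<zeta>|circle. (\<Sum>k. g k \<zeta>)) = (LINT \<zeta>|circle. H \<zeta> * f \<zeta>)"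
  proof (rule Bochner_Integration.integral_cong[OF refl])
    fix \<zeta> assume "\<zeta> \<in> space circle"
    then have x: "norm \<zeta> = 1" by simp
    from sums_mult2[OF H[OF x], of "f \<zeta>"]
    have "(\<lambda>k. g k \<zeta>) sums (H \<zeta> * f \<zeta>)" by (simp add: g_def mult_ac)
    then show "(\<Sum>k. g k \<zeta>) = H \<zeta> * f \<zeta>" by (simp add: sums_iff)
  qed
  moreover have "integral\<^sup>L circle (g k) = b k * fc f (- int k)" for k
    unfolding g_def fc_def by simp
  ultimately show ?thesis by simp
qed

lemma holomorphic_radial_series:
  assumes G: "G holomorphic_on ball 0 1" and r: "0 < r" "r < 1"
  defines "a \<equiv> \<lambda>k. (deriv ^^ k) G 0 / fact k"
  shows "summable (\<lambda>j. norm (a j * of_real r ^ j))"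
    and "norm \<zeta> = 1 \<Longrightarrow> (\<lambda>j. (a j * of_real r ^ j) * \<zeta> ^ j) sums G (of_real r * \<zeta>)"
proof -
  define s where "s = (1 + r) / 2"
  have s: "r < s" "s < 1" "0 < s" using r by (auto simp: s_def)
  have ser: "(\<lambda>j. a j * z ^ j) sums G z" if "z \<in> ball 0 1" for z
    using holomorphic_power_series[OF G that] by (simp add: a_def)
  have "summable (\<lambda>j. a j * complex_of_real s ^ j)" using ser[of "of_real s"] s by (auto simp: sums_iff)
  then show "summable (\<lambda>j. norm (a j * of_real r ^ j))"
    by (rule powser_insidea) (use r s in simp)
  show "(\<lambda>j. (a j * of_real r ^ j) * \<zeta> ^ j) sums G (of_real r * \<zeta>)" if "norm \<zeta> = 1"
    using ser[OF radial_in_ball[OF r that]] by (simp add: power_mult_distrib mult.assoc)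
qed

lemma bdh_bounded:
  assumes "bdh F G" obtains C where "0 \<le> C" "\<And>z. z \<in> ball 0 1 \<Longrightarrow> norm (G z) \<le> C" "AE \<zeta> in circle. norm (F \<zeta>) \<le> C"
proof -
  have "\<exists>C. \<forall>z\<in>ball 0 1. norm (G z) \<le> C" using assms unfolding bdh_def by (elim conjE)
  then obtain C where "\<forall>z\<in>ball 0 1. norm (G z) \<le> C" by (elim exE)
  then have C: "\<And>z. z \<in> ball 0 1 \<Longrightarrow> norm (G z) \<le> C" by (rule bspec)
  have lim: "AE \<zeta> in circle. ((\<lambda>r. G (of_real r * \<zeta>)) \<longlongrightarrow> F \<zeta>) (at_left 1)" using assms by (simp add: bdh_def)
  have "AE \<zeta> in circle. norm (F \<zeta>) \<le> C"
  proof (rule AE_mp[OF lim], intro AE_I2 impI)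
    fix \<zeta> assume z: "\<zeta> \<in> space circle" and l: "((\<lambda>r. G (of_real r * \<zeta>)) \<longlongrightarrow> F \<zeta>) (at_left 1)"
    have "\<forall>\<^sub>F r in at_left 1. norm (G (of_real r * \<zeta>)) \<le> C"
      using at_left_1_interval by eventually_elim (use z C radial_in_ball in auto)
    then show "norm (F \<zeta>) \<le> C" by (rule tendsto_upperbound[OF tendsto_norm[OF l]]) simp
  qed
  moreover have "0 \<le> C" using order_trans[OF norm_ge_zero C[of 0]] by simp
  ultimately show ?thesis using that C by blast
qed

lemma bdh_radial: "bdh F G \<Longrightarrow> AE \<zeta> in circle. ((\<lambda>r. G (of_real r * \<zeta>)) \<longlongrightarrow> F \<zeta>) (at_left 1)"
  by (simp add: bdh_def)

lemma bdh_measurable: "bdh F G \<Longrightarrow> F \<in> borel_measurable circle"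
  by (simp add: bdh_def)

lemma bdh_integrable_mult:
  assumes FG: "bdh F G" and f: "integrable circle f" shows "integrable circle (\<lambda>\<zeta>. F \<zeta> * f \<zeta>)"
  using bdh_bounded[OF FG] integrable_bounded_mult[OF f bdh_measurable[OF FG]] by metis

text \<open>Bounded convergence along the radii \<open>1 - 1 / (n + 2)\<close>.\<close>

lemma bdh_integral_limit:
  assumes FG: "bdh F G" and f: "integrable circle f"
  shows "(\<lambda>n. LINT \<zeta>|circle. G (of_real (1 - 1 / real (n + 2)) * \<zeta>) * f \<zeta>) \<longlonglongrightarrow> (LINT \<zeta>|circle. F \<zeta> * f \<zeta>)"
proof -
  obtain C where C: "\<And>z. z \<in> ball 0 1 \<Longrightarrow> norm (G z) \<le> C" using bdh_bounded[OF FG] by metis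
  have cont: "continuous_on (ball 0 1) G" using FG by (auto simp: bdh_def holomorphic_on_imp_continuous_on)
  have lim: "AE \<zeta> in circle. ((\<lambda>r. G (of_real r * \<zeta>)) \<longlongrightarrow> F \<zeta>) (at_left 1)" using FG by (simp add: bdh_def)
  define r where "r = (\<lambda>n. 1 - 1 / real (n + 2))"
  have r: "0 < r n" "r n < 1" for n by (auto simp: r_def field_simps)
  have rm: "(\<lambda>\<zeta>. G (of_real (r n) * \<zeta>)) \<in> borel_measurable circle" for n by (rule radial_measurable[OF cont r])
  have "(\<lambda>n. LINT \<zeta>|circle. G (of_real (r n) * \<zeta>) * f \<zeta>) \<longlonglongrightarrow> (LINT \<zeta>|circle. F \<zeta> * f \<zeta>)"
  proof (rule integral_dominated_convergence[where w = "\<lambda>\<zeta>. C * norm (f \<zeta>)"])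
    show "(\<lambda>\<zeta>. F \<zeta> * f \<zeta>) \<in> borel_measurable circle" using bdh_integrable_mult[OF FG f] by simp
    show "(\<lambda>\<zeta>. G (of_real (r n) * \<zeta>) * f \<zeta>) \<in> borel_measurable circle" for n
      using rm[of n] f by measurable
    show "integrable circle (\<lambda>\<zeta>. C * norm (f \<zeta>))" using f by simp
    show "AE \<zeta> in circle. norm (G (of_real (r n) * \<zeta>) * f \<zeta>) \<le> C * norm (f \<zeta>)" for n
      using r[of n] by (intro AE_I2) (auto simp: norm_mult intro!: mult_right_mono C)
    show "AE \<zeta> in circle. (\<lambda>n. G (of_real (r n) * \<zeta>) * f \<zeta>) \<longlonglongrightarrow> F \<zeta> * f \<zeta>"
    proof (rule AE_mp[OF lim], intro AE_I2 impI)
      fix \<zeta> assume l: "((\<lambda>r. G (of_real r * \<zeta>)) \<longlongrightarrow> F \<zeta>) (at_left 1)"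
      have "(\<lambda>n. G (of_real (r n) * \<zeta>)) \<longlonglongrightarrow> F \<zeta>"
        using filterlim_compose[OF l at_left_1_seq] by (simp add: r_def)
      then show "(\<lambda>n. G (of_real (r n) * \<zeta>) * f \<zeta>) \<longlonglongrightarrow> F \<zeta> * f \<zeta>" by (intro tendsto_intros)
    qed
  qed
  then show ?thesis by (simp add: r_def)
qed

text \<open>On the circle of radius \<open>r\<close> the multiplier is an absolutely convergent Taylor series, so only nonnegative powers of \<open>\<zeta>\<close> multiply \<open>f\<close>; then let \<open>r\<close> tend to one.\<close>

lemma bdh_mult_coeffs:
  assumes FG: "bdh F G" and f: "integrable circle f" and neg: "\<And>k. k < 0 \<Longrightarrow> fc f k = 0"
  shows "k < 0 \<Longrightarrow> fc (\<lambda>\<zeta>. F \<zeta> * f \<zeta>) k = 0" and "fc (\<lambda>\<zeta>. F \<zeta> * f \<zeta>) 0 = G 0 * fc f 0"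
proof -
  have hol: "G holomorphic_on ball 0 1" using FG by (simp add: bdh_def)
  have key: "fc (\<lambda>\<zeta>. F \<zeta> * f \<zeta>) k = (if k = 0 then G 0 * fc f 0 else 0)" if k: "k \<le> 0" for k
  proof -
    define f' where "f' = (\<lambda>\<zeta>. \<zeta> powi (-k) * f \<zeta>)"
    have f'i: "integrable circle f'" unfolding f'_def by (rule integrable_power_int_mult[OF f])
    have f'c: "fc f' (- int j) = (if j = 0 then fc f k else 0)" for j
      using fc_shift[of "-k" f "- int j"] neg[of "k - int j"] k by (auto simp: f'_def)
    have e: "(LINT \<zeta>|circle. G (of_real r * \<zeta>) * f' \<zeta>) = G 0 * fc f k" if r: "0 < r" "r < 1" for r
    proof -
      have "(\<lambda>j. ((deriv ^^ j) G 0 / fact j * of_real r ^ j) * fc f' (- int j)) sums (LINT \<zeta>|circle. G (of_real r * \<zeta>) * f' \<zeta>)"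
        by (rule power_series_integral[OF f'i holomorphic_radial_series(1)[OF hol r] holomorphic_radial_series(2)[OF hol r]])
      moreover have "(\<lambda>j. ((deriv ^^ j) G 0 / fact j * of_real r ^ j) * fc f' (- int j)) = (\<lambda>j. if j = 0 then G 0 * fc f k else 0)"
        by (auto simp: f'c)
      ultimately show ?thesis using sums_single[of 0 "\<lambda>_. G 0 * fc f k"] sums_unique2 by metis
    qed
    have "(LINT \<zeta>|circle. F \<zeta> * f' \<zeta>) = G 0 * fc f k"
    proof (rule LIMSEQ_unique[OF bdh_integral_limit[OF FG f'i]])
      show "(\<lambda>n. LINT \<zeta>|circle. G (of_real (1 - 1 / real (n + 2)) * \<zeta>) * f' \<zeta>) \<longlonglongrightarrow> G 0 * fc f k"
        by (subst e) (auto simp: field_simps)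
    qed
    moreover have "fc (\<lambda>\<zeta>. F \<zeta> * f \<zeta>) k = (LINT \<zeta>|circle. F \<zeta> * f' \<zeta>)"
      unfolding fc_def f'_def by (simp add: mult.left_commute)
    ultimately show ?thesis using neg[of k] k by auto
  qed
  show "k < 0 \<Longrightarrow> fc (\<lambda>\<zeta>. F \<zeta> * f \<zeta>) k = 0" using key[of k] by simp
  show "fc (\<lambda>\<zeta>. F \<zeta> * f \<zeta>) 0 = G 0 * fc f 0" using key[of 0] by simp
qed

lemma bdh_mean_value: "bdh F G \<Longrightarrow> (LINT \<zeta>|circle. F \<zeta>) = G 0"
  using bdh_mult_coeffs(2)[of F G "\<lambda>_. 1"] fc_power_int[of 0] circle.prob_space by (simp add: fc_def)

text \<open>The antianalytic summand in \<open>poisson_cau\<close> reduces to a constant that cancels the mean value.\<close>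

lemma poisson_analytic:
  assumes f: "integrable circle f" and neg: "\<And>k. k < 0 \<Longrightarrow> fc f k = 0" and z: "norm z < 1"
  shows "(LINT \<xi>|circle. of_real (poisson_kernel z \<xi>) * f \<xi>) = cau f z"
proof -
  have fci: "integrable circle (\<lambda>\<xi>. cnj (f \<xi>))" using f by simp
  have "(\<lambda>k. fc (\<lambda>\<xi>. cnj (f \<xi>)) (int k) * z ^ k) = (\<lambda>k. if k = 0 then cnj (fc f 0) else 0)"
    using neg by (auto simp: fc_cnj)
  then have "cau (\<lambda>\<xi>. cnj (f \<xi>)) z = cnj (fc f 0)"
    using cau_sums[OF fci z] sums_single[of 0 "\<lambda>_. cnj (fc f 0)"] sums_unique2 by metis
  moreover have "fc f 0 = (LINT \<xi>|circle. f \<xi>)" by (simp add: fc_def)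
  ultimately show ?thesis using poisson_cau(1)[OF f z] by simp
qed

lemma analytic_radial_limit:
  assumes f: "integrable circle f" and neg: "\<And>k. k < 0 \<Longrightarrow> fc f k = 0"
  shows "AE \<zeta> in circle. ((\<lambda>r. cau f (of_real r * \<zeta>)) \<longlongrightarrow> f \<zeta>) (at_left 1)"
proof (rule AE_mp[OF fatou_radial_limit[OF f]], intro AE_I2 impI)
  fix \<zeta> assume z: "\<zeta> \<in> space circle"
    and l: "((\<lambda>r. LINT \<xi>|circle. of_real (poisson_kernel (of_real r * \<zeta>) \<xi>) * f \<xi>) \<longlongrightarrow> f \<zeta>) (at_left 1)"
  have "\<forall>\<^sub>F r in at_left 1. (LINT \<xi>|circle. of_real (poisson_kernel (of_real r * \<zeta>) \<xi>) * f \<xi>) = cau f (of_real r * \<zeta>)"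
    using at_left_1_interval
  proof eventually_elim
    case (elim r)
    then have nz: "norm (of_real r * \<zeta>) < 1" using z by (simp add: norm_mult)
    show ?case by (intro poisson_analytic f neg nz)
  qed
  then show "((\<lambda>r. cau f (of_real r * \<zeta>)) \<longlongrightarrow> f \<zeta>) (at_left 1)"
    using l by (rule Lim_transform_eventually[rotated])
qed

lemma norm_poisson_le:
  fixes f :: "complex \<Rightarrow> complex"
  assumes f: "integrable circle f" and C: "AE \<zeta> in circle. norm (f \<zeta>) \<le> C" and z: "norm z < 1"
  shows "norm (LINT \<xi>|circle. of_real (poisson_kernel z \<xi>) * f \<xi>) \<le> C"
proof -
  have "norm (LINT \<xi>|circle. of_real (poisson_kernel z \<xi>) * f \<xi>) \<le> (LINT \<xi>|circle. poisson_kernel z \<xi> * C)"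
  proof (rule norm_integral_le)
    show "integrable circle (\<lambda>\<xi>. poisson_kernel z \<xi> * C)" using integrable_poisson_kernel[OF z] by simp
    show "AE \<xi> in circle. norm (of_real (poisson_kernel z \<xi>) * f \<xi>) \<le> poisson_kernel z \<xi> * C"
      using C by (rule AE_mp) (auto intro!: AE_I2 mult_left_mono simp: norm_mult poisson_kernel_nonneg[OF z])
  qed
  then show ?thesis using integral_poisson_kernel[OF z] by simp
qed

text \<open>By Fatou the Cauchy transform of \<open>f\<close>, here equal to its Poisson integral, has radial limits \<open>f\<close> and inherits the bound of \<open>f\<close>.\<close>

lemma bounded_analytic_bdh:
  assumes m: "f \<in> borel_measurable circle" and C: "AE \<zeta> in circle. norm (f \<zeta>) \<le> C"
    and neg: "\<And>k. k < 0 \<Longrightarrow> fc f k = 0"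
  shows "bdh f (cau f)"
proof -
  have f: "integrable circle f" by (rule integrable_circle_bounded[OF m C])
  have "norm (cau f z) \<le> C" if "z \<in> ball 0 1" for z
    using norm_poisson_le[OF f C, of z] poisson_analytic[OF f neg, of z] that by simp
  then show ?thesis unfolding bdh_def
    using m cau_holomorphic[OF f] analytic_radial_limit[OF f neg] by blast
qed

text \<open>The Taylor coefficients of \<open>G\<close> are square summable because the means of \<open>|G|\<^sup>2\<close> over concentric circles are bounded. By Riesz and Fischer they are the Fourier coefficients of a function whose Cauchy transform is \<open>G\<close>, and Fatou supplies the radial limits.\<close>

theorem bounded_holomorphic_boundary:
  assumes hol: "G holomorphic_on ball 0 1" and C: "\<And>z. z \<in> ball 0 1 \<Longrightarrow> norm (G z) \<le> C"
  obtains F where "bdh F G"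
proof -
  define a where "a = (\<lambda>k. (deriv ^^ k) G 0 / fact k)"
  have C0: "0 \<le> C" using order_trans[OF norm_ge_zero C[of 0]] by simp
  have cont: "continuous_on (ball 0 1) G" using hol by (rule holomorphic_on_imp_continuous_on)
  have bnd: "(\<Sum>k<n. (norm (a k))\<^sup>2) \<le> C\<^sup>2" for n
  proof -
    have le: "(\<Sum>k<n. (norm (a k) * r ^ k)\<^sup>2) \<le> C\<^sup>2" if r: "0 < r" "r < 1" for r
    proof -
      define h where "h = (\<lambda>\<zeta>. G (of_real r * \<zeta>))"
      have hm: "h \<in> borel_measurable circle" unfolding h_def by (rule radial_measurable[OF cont r])
      have hC: "norm (h \<zeta>) \<le> C" if "\<zeta> \<in> space circle" for \<zeta>
        unfolding h_def using radial_in_ball[OF r] that by (intro C) simp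
      have sh: "sqi h" by (rule sqi_bounded[OF hm, of C]) (use hC in auto)
      have fch: "fc h (int k) = a k * of_real r ^ k" for k
      proof -
        have i: "integrable circle (\<lambda>\<zeta>. \<zeta> powi (- int k))" using integrable_trig_poly[of "\<lambda>_. 1" "- int k"] by simp
        have "(\<lambda>j. (a j * of_real r ^ j) * fc (\<lambda>\<zeta>. \<zeta> powi (- int k)) (- int j)) sums (LINT \<zeta>|circle. h \<zeta> * \<zeta> powi (- int k))"
          unfolding h_def a_def
          by (rule power_series_integral[OF i holomorphic_radial_series(1)[OF hol r] holomorphic_radial_series(2)[OF hol r]])
        moreover have "(\<lambda>j. (a j * of_real r ^ j) * fc (\<lambda>\<zeta>. \<zeta> powi (- int k)) (- int j)) = (\<lambda>j. if j = k then a j * of_real r ^ j else 0)"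
          by (auto simp: fc_power_int)
        ultimately have "(LINT \<zeta>|circle. h \<zeta> * \<zeta> powi (- int k)) = a k * of_real r ^ k"
          using sums_single[of k "\<lambda>j. a j * of_real r ^ j"] sums_unique2 by metis
        then show ?thesis by (simp add: fc_def mult.commute)
      qed
      have "(\<Sum>k<n. (norm (a k) * r ^ k)\<^sup>2) = (\<Sum>k\<in>int ` {..<n}. (norm (fc h k))\<^sup>2)"
        using r by (subst sum.reindex) (auto simp: fch norm_mult norm_power)
      also have "\<dots> \<le> (LINT \<zeta>|circle. (norm (h \<zeta>))\<^sup>2)" by (rule bessel[OF _ sh]) simp
      also have "\<dots> \<le> (LINT \<zeta>|circle. C\<^sup>2)"
        using sh hC by (intro integral_mono) (auto simp: sqi_def intro!: power_mono)
      also have "\<dots> = C\<^sup>2" using circle.prob_space by simp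
      finally show ?thesis .
    qed
    have "((\<lambda>r. \<Sum>k<n. (norm (a k) * r ^ k)\<^sup>2) \<longlongrightarrow> (\<Sum>k<n. (norm (a k) * 1 ^ k)\<^sup>2)) (at_left 1)"
      by (intro tendsto_intros)
    moreover have "\<forall>\<^sub>F r in at_left 1. (\<Sum>k<n. (norm (a k) * r ^ k)\<^sup>2) \<le> C\<^sup>2"
      using at_left_1_interval by eventually_elim (use le in blast)
    ultimately have "(\<Sum>k<n. (norm (a k) * 1 ^ k)\<^sup>2) \<le> C\<^sup>2" by (rule tendsto_upperbound) simp
    then show ?thesis by simp
  qed
  obtain F where F: "sqi F" "\<And>k. fc F (int k) = a k" "\<And>k. k < 0 \<Longrightarrow> fc F k = 0"
    using riesz_fischer[OF bnd] by metis
  have iF: "integrable circle F" by (rule sqi_integrable[OF F(1)])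
  have cF: "cau F z = G z" if z: "z \<in> ball 0 1" for z
  proof -
    have "(\<lambda>k. a k * z ^ k) sums cau F z" using cau_sums[OF iF, of z] z F(2) by simp
    moreover have "(\<lambda>k. a k * z ^ k) sums G z" using holomorphic_power_series[OF hol z] by (simp add: a_def)
    ultimately show ?thesis by (rule sums_unique2)
  qed
  have "AE \<zeta> in circle. ((\<lambda>r. G (of_real r * \<zeta>)) \<longlongrightarrow> F \<zeta>) (at_left 1)"
  proof (rule AE_mp[OF analytic_radial_limit[OF iF F(3)]], simp, intro AE_I2 impI)
    fix \<zeta> assume z: "\<zeta> \<in> space circle" and l: "((\<lambda>r. cau F (of_real r * \<zeta>)) \<longlongrightarrow> F \<zeta>) (at_left 1)"
    have "\<forall>\<^sub>F r in at_left 1. cau F (of_real r * \<zeta>) = G (of_real r * \<zeta>)"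
      using at_left_1_interval by eventually_elim (use z radial_in_ball cF in auto)
    then show "((\<lambda>r. G (of_real r * \<zeta>)) \<longlongrightarrow> F \<zeta>) (at_left 1)" using l by (rule Lim_transform_eventually[rotated])
  qed
  moreover have "\<exists>C. \<forall>z\<in>ball 0 1. norm (G z) \<le> C" using C by blast
  ultimately have "bdh F G" unfolding bdh_def using sqi_measurable[OF F(1)] hol by simp
  then show ?thesis by (rule that)
qed

text \<open>The function is \<open>exp U\<close>, where \<open>U = 2 * cau w - (mean of w)\<close> is the Herglotz transform: its real part is the Poisson integral of \<open>w\<close>, which is at most \<open>c\<close>, equals the mean of \<open>w\<close> at the origin, and has radial limits \<open>w\<close> by Fatou.\<close>

theorem outer_function:
  fixes w :: "complex \<Rightarrow> real"
  assumes w: "integrable circle w" and c: "AE \<zeta> in circle. w \<zeta> \<le> c"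
  obtains h H where "bdh h H" "AE \<zeta> in circle. norm (h \<zeta>) = exp (w \<zeta>)" "norm (H 0) = exp (LINT \<zeta>|circle. w \<zeta>)"
proof -
  define u where "u = (\<lambda>\<zeta>. complex_of_real (w \<zeta>))"
  have ui: "integrable circle u" using w by (simp add: u_def)
  have uc: "(\<lambda>\<zeta>. cnj (u \<zeta>)) = u" by (simp add: u_def)
  define m where "m = (LINT \<zeta>|circle. w \<zeta>)"
  have mu: "(LINT \<zeta>|circle. u \<zeta>) = of_real m" unfolding u_def m_def by (rule integral_complex_of_real)
  define U where "U = (\<lambda>z. 2 * cau u z - of_real m)"
  define H where "H = (\<lambda>z. exp (U z))"
  have hol: "H holomorphic_on ball 0 1"
    unfolding H_def U_def by (intro holomorphic_intros cau_holomorphic[OF ui])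
  have P: "complex_of_real (LINT \<xi>|circle. poisson_kernel z \<xi> * w \<xi>) = (LINT \<xi>|circle. of_real (poisson_kernel z \<xi>) * u \<xi>)" for z
    unfolding u_def of_real_mult[symmetric] by (rule integral_complex_of_real[symmetric])
  have nH: "norm (H z) = exp (LINT \<xi>|circle. poisson_kernel z \<xi> * w \<xi>)" if z: "norm z < 1" for z
  proof -
    have "complex_of_real (LINT \<xi>|circle. poisson_kernel z \<xi> * w \<xi>) = cau u z + cnj (cau u z) - of_real m"
      unfolding P using poisson_cau(1)[OF ui z] by (simp add: uc mu)
    then have "Re (complex_of_real (LINT \<xi>|circle. poisson_kernel z \<xi> * w \<xi>)) = Re (cau u z + cnj (cau u z) - of_real m)"
      by (rule arg_cong)
    then show ?thesis by (simp add: H_def U_def)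
  qed
  have ipw: "integrable circle (\<lambda>\<xi>. poisson_kernel z \<xi> * w \<xi>)" if z: "norm z < 1" for z
    using integrable_Re[OF poisson_cau(2)[OF ui z]] by (simp add: u_def)
  have bd: "norm (H z) \<le> exp c" if "z \<in> ball 0 1" for z
  proof -
    have z: "norm z < 1" using that by simp
    have "(LINT \<xi>|circle. poisson_kernel z \<xi> * w \<xi>) \<le> (LINT \<xi>|circle. poisson_kernel z \<xi> * c)"
    proof (rule integral_mono_AE[OF ipw[OF z]])
      show "integrable circle (\<lambda>\<xi>. poisson_kernel z \<xi> * c)" using integrable_poisson_kernel[OF z] by simp
      show "AE \<xi> in circle. poisson_kernel z \<xi> * w \<xi> \<le> poisson_kernel z \<xi> * c"
        using c by (rule AE_mp) (auto intro!: AE_I2 mult_left_mono poisson_kernel_nonneg[OF z])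
    qed
    also have "\<dots> = c" using integral_poisson_kernel[OF z] by simp
    finally show ?thesis unfolding nH[OF z] by simp
  qed
  obtain h where h: "bdh h H" using bounded_holomorphic_boundary[OF hol bd] by blast
  have hl: "AE \<zeta> in circle. ((\<lambda>r. H (of_real r * \<zeta>)) \<longlongrightarrow> h \<zeta>) (at_left 1)" using h by (simp add: bdh_def)
  have "AE \<zeta> in circle. norm (h \<zeta>) = exp (w \<zeta>)"
  proof (rule AE_mp[OF hl], rule AE_mp[OF fatou_radial_limit[OF ui]], intro AE_I2 impI)
    fix \<zeta> assume z: "\<zeta> \<in> space circle"
      and l1: "((\<lambda>r. LINT \<xi>|circle. of_real (poisson_kernel (of_real r * \<zeta>) \<xi>) * u \<xi>) \<longlongrightarrow> u \<zeta>) (at_left 1)"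
      and l2: "((\<lambda>r. H (of_real r * \<zeta>)) \<longlongrightarrow> h \<zeta>) (at_left 1)"
    have "((\<lambda>r. exp (LINT \<xi>|circle. poisson_kernel (of_real r * \<zeta>) \<xi> * w \<xi>)) \<longlongrightarrow> exp (w \<zeta>)) (at_left 1)"
      using tendsto_exp[OF tendsto_Re[OF l1]] unfolding P[symmetric] by (simp add: u_def)
    moreover have "\<forall>\<^sub>F r in at_left 1. exp (LINT \<xi>|circle. poisson_kernel (of_real r * \<zeta>) \<xi> * w \<xi>) = norm (H (of_real r * \<zeta>))"
      using at_left_1_interval by eventually_elim (use z in \<open>simp add: nH norm_mult\<close>)
    ultimately have "((\<lambda>r. norm (H (of_real r * \<zeta>))) \<longlongrightarrow> exp (w \<zeta>)) (at_left 1)"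
      by (rule Lim_transform_eventually)
    then show "norm (h \<zeta>) = exp (w \<zeta>)" using tendsto_norm[OF l2] tendsto_unique trivial_limit_at_left_real by blast
  qed
  moreover have "norm (H 0) = exp (LINT \<zeta>|circle. w \<zeta>)"
    by (simp add: H_def U_def cau_0 mu m_def)
  ultimately show ?thesis using that h by blast
qed

lemma bdh_const: "bdh (\<lambda>_. c) (\<lambda>_. c)"
  by (auto simp: bdh_def)

lemma bdh_add:
  assumes 1: "bdh F G" and 2: "bdh F' G'" shows "bdh (\<lambda>\<zeta>. F \<zeta> + F' \<zeta>) (\<lambda>z. G z + G' z)"
proof -
  obtain C where C: "\<And>z. z \<in> ball 0 1 \<Longrightarrow> norm (G z) \<le> C" using bdh_bounded[OF 1] by metis
  obtain C' where C': "\<And>z. z \<in> ball 0 1 \<Longrightarrow> norm (G' z) \<le> C'" using bdh_bounded[OF 2] by metis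
  have "\<forall>z\<in>ball 0 1. norm (G z + G' z) \<le> C + C'" using C C' by (auto intro!: norm_triangle_le add_mono)
  moreover have "AE \<zeta> in circle. ((\<lambda>r. G (of_real r * \<zeta>) + G' (of_real r * \<zeta>)) \<longlongrightarrow> F \<zeta> + F' \<zeta>) (at_left 1)"
    using bdh_radial[OF 1] bdh_radial[OF 2] by eventually_elim (rule tendsto_add)
  ultimately show ?thesis using 1 2 unfolding bdh_def by (auto intro!: holomorphic_intros)
qed

lemma bdh_mult:
  assumes 1: "bdh F G" and 2: "bdh F' G'" shows "bdh (\<lambda>\<zeta>. F \<zeta> * F' \<zeta>) (\<lambda>z. G z * G' z)"
proof -
  obtain C where C: "0 \<le> C" "\<And>z. z \<in> ball 0 1 \<Longrightarrow> norm (G z) \<le> C" using bdh_bounded[OF 1] by metis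
  obtain C' where C': "\<And>z. z \<in> ball 0 1 \<Longrightarrow> norm (G' z) \<le> C'" using bdh_bounded[OF 2] by metis
  have "\<forall>z\<in>ball 0 1. norm (G z * G' z) \<le> C * C'" using C C' by (auto simp: norm_mult intro!: mult_mono)
  moreover have "AE \<zeta> in circle. ((\<lambda>r. G (of_real r * \<zeta>) * G' (of_real r * \<zeta>)) \<longlongrightarrow> F \<zeta> * F' \<zeta>) (at_left 1)"
    using bdh_radial[OF 1] bdh_radial[OF 2] by eventually_elim (rule tendsto_mult)
  ultimately show ?thesis using 1 2 unfolding bdh_def by (auto intro!: holomorphic_intros)
qed

lemma bdh_sum: "finite I \<Longrightarrow> (\<And>i. i \<in> I \<Longrightarrow> bdh (F i) (G i)) \<Longrightarrow> bdh (\<lambda>\<zeta>. \<Sum>i\<in>I. F i \<zeta>) (\<lambda>z. \<Sum>i\<in>I. G i z)"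
  by (induction I rule: finite_induct) (simp_all add: bdh_const bdh_add)

lemma bdh_prod: "finite I \<Longrightarrow> (\<And>i. i \<in> I \<Longrightarrow> bdh (F i) (G i)) \<Longrightarrow> bdh (\<lambda>\<zeta>. \<Prod>i\<in>I. F i \<zeta>) (\<lambda>z. \<Prod>i\<in>I. G i z)"
  by (induction I rule: finite_induct) (simp_all add: bdh_const bdh_mult)

lemma bdh_det:
  fixes F G :: "'n::finite \<Rightarrow> 'n \<Rightarrow> complex \<Rightarrow> complex"
  assumes "\<And>i j. bdh (F i j) (G i j)"
  shows "bdh (\<lambda>\<zeta>. det (\<chi> i j. F i j \<zeta>)) (\<lambda>z. det (\<chi> i j. G i j z))"
  unfolding det_def vec_lambda_beta
  by (intro bdh_sum bdh_mult bdh_const bdh_prod assms finite_permutations finite)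

text \<open>Suppose \<open>D = 0\<close> on a set \<open>E\<close> of positive measure. Multiplying by an outer function of modulus \<open>exp k\<close> on
\<open>E\<close> and one elsewhere leaves the boundary modulus of \<open>D\<close> unchanged, but multiplies the modulus at the
origin by \<open>exp (k * prob E)\<close>. For large \<open>k\<close> this contradicts the mean value property.\<close>

theorem bdh_nonzero_AE:
  assumes D: "bdh D DG" and nz: "DG 0 \<noteq> 0"
  shows "AE \<zeta> in circle. D \<zeta> \<noteq> 0"
proof -
  have [measurable]: "D \<in> borel_measurable circle" by (rule bdh_measurable[OF D])
  define E where "E = {\<zeta> \<in> space circle. D \<zeta> = 0}"
  have E: "E \<in> sets circle" unfolding E_def by measurable
  obtain C where C: "AE \<zeta> in circle. norm (D \<zeta>) \<le> C" "0 \<le> C" using bdh_bounded[OF D] by metis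
  have "circle.prob E = 0"
  proof (rule ccontr)
    assume "circle.prob E \<noteq> 0"
    then have mu: "circle.prob E > 0" by (simp add: zero_less_measure_iff)
    \<comment> \<open>This \<open>k\<close> turns the growth factor at the origin into \<open>exp (C / norm (DG 0))\<close>, which exceeds \<open>C / norm (DG 0)\<close>.\<close>
    define k where "k = (C / norm (DG 0)) / circle.prob E"
    define w where "w = (\<lambda>\<zeta>. k * indicator E \<zeta> :: real)"
    have k0: "0 \<le> k" using C(2) by (simp add: k_def)
    have iE: "integrable circle (indicator E :: complex \<Rightarrow> real)"
      by (rule integrable_real_indicator[OF E]) (simp add: circle.emeasure_eq_measure)
    have wi: "integrable circle w" unfolding w_def by (intro integrable_mult_right iE)
    have ES: "E \<inter> sphere 0 1 = E" by (auto simp: E_def)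
    have wc: "AE \<zeta> in circle. w \<zeta> \<le> k" using k0 by (auto simp: w_def indicator_def)
    obtain h H where h: "bdh h H" "AE \<zeta> in circle. norm (h \<zeta>) = exp (w \<zeta>)" "norm (H 0) = exp (LINT \<zeta>|circle. w \<zeta>)"
      using outer_function[OF wi wc] by metis
    have "(LINT \<zeta>|circle. w \<zeta>) = k * circle.prob E" unfolding w_def using E by (simp add: ES)
    also have "\<dots> = C / norm (DG 0)" using mu by (simp add: k_def)
    finally have H0: "norm (H 0) = exp (C / norm (DG 0))" using h(3) by simp
    have "norm (DG 0 * H 0) = norm (LINT \<zeta>|circle. D \<zeta> * h \<zeta>)" using bdh_mean_value[OF bdh_mult[OF D h(1)]] by simp
    also have "\<dots> \<le> (LINT \<zeta>|circle. C)"
    proof (rule norm_integral_le)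
      show "AE \<zeta> in circle. norm (D \<zeta> * h \<zeta>) \<le> C"
        using C(1) h(2)
      proof eventually_elim
        case (elim \<zeta>)
        then show ?case using C(2) by (cases "D \<zeta> = 0") (auto simp: norm_mult w_def E_def indicator_def)
      qed
    qed simp
    also have "\<dots> = C" using circle.prob_space by simp
    finally have "norm (DG 0) * exp (C / norm (DG 0)) \<le> C" by (simp add: norm_mult H0)
    moreover have "norm (DG 0) * (1 + C / norm (DG 0)) \<le> norm (DG 0) * exp (C / norm (DG 0))"
      by (intro mult_left_mono exp_ge_add_one_self) simp
    moreover have "norm (DG 0) * (1 + C / norm (DG 0)) = norm (DG 0) + C" using nz by (simp add: distrib_left)
    moreover have "0 < norm (DG 0)" using nz by simp
    ultimately show False by linarith
  qed
  then have "E \<in> null_sets circle" using E by (simp add: null_setsI circle.emeasure_eq_measure)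
  then show ?thesis by (rule AE_I') (auto simp: E_def)
qed

section \<open>Vector-valued Hardy spaces\<close>

lemma norm_vscale: "norm (c *s (x::complex^'n)) = norm c * norm x"
  by (simp add: norm_vec_def norm_mult L2_set_right_distrib)

lemma norm_vec_square: "(norm (x::complex^'n))\<^sup>2 = (\<Sum>i\<in>UNIV. (norm (x $ i))\<^sup>2)"
  by (simp add: norm_vec_def L2_set_def sum_nonneg)

lemma inner_vscale: "(c *s x) \<bullet> (c *s y) = (norm c)\<^sup>2 * (x \<bullet> (y::complex^'n))"
proof -
  have "inner (c * a) (c * b) = (norm c)\<^sup>2 * inner a b" for a b :: complex
    by (simp only: inner_complex_def cmod_power2 times_complex.sel) (simp add: power2_eq_square algebra_simps)
  then show ?thesis by (simp add: inner_vec_def sum_distrib_left)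
qed

text \<open>The complex inner product is recovered from the real one of the Euclidean space, which has the analytic facts attached to it.\<close>

lemma vec_cinner_eq: "vec_cinner x y = of_real (x \<bullet> y) + \<i> * of_real (x \<bullet> (\<i> *s y))"
  by (rule complex_eqI) (simp_all add: vec_cinner_def inner_vec_def inner_complex_def algebra_simps sum_subtractf)

lemma vec_nth_measurable [measurable]: "(\<lambda>x. x $ i) \<in> borel_measurable borel"
  by (intro borel_measurable_continuous_onI continuous_intros)

lemma vec_nth_measurable_comp:
  "f \<in> borel_measurable M \<Longrightarrow> (\<lambda>x. f x $ i) \<in> borel_measurable M"
  by (rule measurable_compose[OF _ vec_nth_measurable])

lemma vec_lambda_measurable:
  fixes f :: "'i::finite \<Rightarrow> 'a \<Rightarrow> 'b::euclidean_space"
  assumes "\<And>i. f i \<in> borel_measurable M" shows "(\<lambda>x. \<chi> i. f i x) \<in> borel_measurable M"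
proof -
  have "(\<chi> i. f i x) = (\<Sum>i\<in>UNIV. axis i (f i x))" for x
    by (simp add: vec_eq_iff axis_def)
  moreover have "(\<lambda>x. axis i (f i x)) \<in> borel_measurable M" for i
  proof (rule measurable_compose[OF assms])
    show "axis i \<in> borel_measurable borel"
      unfolding axis_def
    proof (intro borel_measurable_continuous_onI continuous_on_vec_lambda)
      show "continuous_on UNIV (\<lambda>x. if j = i then x else 0)" for j by (cases "j = i") simp_all
    qed
  qed
  ultimately show ?thesis by simp
qed

lemma vscale_measurable:
  fixes f :: "'a \<Rightarrow> complex^'n"
  assumes "c \<in> borel_measurable M" "f \<in> borel_measurable M" shows "(\<lambda>x. c x *s f x) \<in> borel_measurable M"
  unfolding vector_scalar_mult_def
  by (intro vec_lambda_measurable borel_measurable_times assms vec_nth_measurable_comp)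

lemma mv_measurable:
  fixes A :: "'a \<Rightarrow> complex^'n^'m"
  assumes "A \<in> borel_measurable M" "f \<in> borel_measurable M" shows "(\<lambda>x. A x *v f x) \<in> borel_measurable M"
  unfolding matrix_vector_mult_def
  by (intro vec_lambda_measurable borel_measurable_times borel_measurable_sum assms vec_nth_measurable_comp)

lemma cnj_measurable_circle [measurable]: "cnj \<in> borel_measurable circle"
  by (intro measurable_circleI borel_measurable_continuous_onI continuous_intros)

lemma L2_iff_sqi: "f \<in> L2 \<longleftrightarrow> sqi f"
  by (simp add: L2_def sqi_def)

lemma sqi_nth: "sqi f \<Longrightarrow> sqi (\<lambda>\<zeta>. (f \<zeta> :: complex^'n) $ i)"
  by (rule sqi_bounded_image[where C = 1])
     (auto intro!: AE_I2 vec_nth_measurable_comp Finite_Cartesian_Product.norm_nth_le simp: sqi_def)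

lemma sqi_vscale:
  fixes f :: "complex \<Rightarrow> complex^'n"
  assumes f: "sqi f" and c: "c \<in> borel_measurable circle" "\<And>\<zeta>. norm \<zeta> = 1 \<Longrightarrow> norm (c \<zeta>) \<le> C"
  shows "sqi (\<lambda>\<zeta>. c \<zeta> *s f \<zeta>)"
proof (rule sqi_bounded_image[OF f, where C = C])
  show "(\<lambda>\<zeta>. c \<zeta> *s f \<zeta>) \<in> borel_measurable circle" using f c by (intro vscale_measurable) (auto simp: sqi_def)
  show "AE \<zeta> in circle. norm (c \<zeta> *s f \<zeta>) \<le> C * norm (f \<zeta>)"
    using c(2) by (intro AE_I2) (simp add: norm_vscale mult_right_mono)
qed

lemma sqi_vscale_const: "sqi f \<Longrightarrow> sqi (\<lambda>\<zeta>. c *s (f \<zeta> :: complex^'n))"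
  by (rule sqi_vscale[where C = "norm c"]) auto

lemma sqi_vscale_id: "sqi f \<Longrightarrow> sqi (\<lambda>\<zeta>. \<zeta> *s (f \<zeta> :: complex^'n))"
  by (rule sqi_vscale[where C = 1]) auto

lemma sqi_vscale_cnj: "sqi f \<Longrightarrow> sqi (\<lambda>\<zeta>. cnj \<zeta> *s (f \<zeta> :: complex^'n))"
  by (rule sqi_vscale[where C = 1]) auto

lemma sqi_const: "sqi (\<lambda>_. v)"
  by (simp add: sqi_def)

text \<open>The real part of the inner product of \<open>L2\<close>. Real forms suffice, since all subspaces involved are invariant under multiplication by the imaginary unit.\<close>

definition ip :: "(complex \<Rightarrow> complex^'n) \<Rightarrow> (complex \<Rightarrow> complex^'n) \<Rightarrow> real" where
  "ip f g = (LINT \<zeta>|circle. f \<zeta> \<bullet> g \<zeta>)"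

lemma integrable_inner:
  assumes f: "sqi f" and g: "sqi g" shows "integrable circle (\<lambda>\<zeta>. f \<zeta> \<bullet> g \<zeta>)"
proof (rule Bochner_Integration.integrable_bound)
  show "integrable circle (\<lambda>\<zeta>. (norm (f \<zeta>))\<^sup>2 + (norm (g \<zeta>))\<^sup>2)" using f g by (simp add: sqi_def)
  show "(\<lambda>\<zeta>. f \<zeta> \<bullet> g \<zeta>) \<in> borel_measurable circle"
    using f g by (intro borel_measurable_inner) (simp_all add: sqi_def)
  show "AE \<zeta> in circle. norm (f \<zeta> \<bullet> g \<zeta>) \<le> norm ((norm (f \<zeta>))\<^sup>2 + (norm (g \<zeta>))\<^sup>2)"
  proof (rule AE_I2)
    fix \<zeta>
    have "\<bar>f \<zeta> \<bullet> g \<zeta>\<bar> \<le> norm (f \<zeta>) * norm (g \<zeta>)" by (rule Cauchy_Schwarz_ineq2)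
    also have "\<dots> \<le> (norm (f \<zeta>))\<^sup>2 + (norm (g \<zeta>))\<^sup>2"
    proof -
      have "2 * (norm (f \<zeta>) * norm (g \<zeta>)) \<le> (norm (f \<zeta>))\<^sup>2 + (norm (g \<zeta>))\<^sup>2"
        using sum_squares_bound[of "norm (f \<zeta>)" "norm (g \<zeta>)"] by (simp only: mult.assoc)
      moreover have "0 \<le> norm (f \<zeta>) * norm (g \<zeta>)" by simp
      ultimately show ?thesis by linarith
    qed
    finally show "norm (f \<zeta> \<bullet> g \<zeta>) \<le> norm ((norm (f \<zeta>))\<^sup>2 + (norm (g \<zeta>))\<^sup>2)" by simp
  qed
qed

lemma ip_square: "ip f f = (LINT \<zeta>|circle. (norm (f \<zeta>))\<^sup>2)"
  by (simp add: ip_def dot_square_norm)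

lemma L2_norm_ip: "L2_norm f = sqrt (ip f f)"
  by (simp add: L2_norm_def ip_square)

lemma ip_sym: "ip f g = ip g f"
  by (simp add: ip_def inner_commute)

lemma sqi_scaleR: "sqi f \<Longrightarrow> sqi (\<lambda>\<zeta>. c *\<^sub>R f \<zeta>)"
  using borel_measurable_scaleR[OF borel_measurable_const[of c], of f circle] by (simp add: sqi_def power_mult_distrib)

lemma subspace_L2: "subspace L2"
proof (rule subspaceI)
  show "0 \<in> L2" using sqi_const[of 0] by (simp add: L2_iff_sqi zero_fun_def)
  show "f + g \<in> L2" if "f \<in> L2" "g \<in> L2" for f g
    using that sqi_add unfolding L2_iff_sqi plus_fun_def by blast
  show "c *\<^sub>R f \<in> L2" if "f \<in> L2" for c f
    using that unfolding L2_iff_sqi scaleR_fun_def by (rule sqi_scaleR)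
qed

interpretation L2: psd_form L2 ip
proof
  show "subspace L2" by (rule subspace_L2)
  show "ip x y = ip y x" for x y by (rule ip_sym)
  show "ip (x + y) z = ip x z + ip y z" if "x \<in> L2" "y \<in> L2" "z \<in> L2" for x y z
    using that unfolding ip_def L2_iff_sqi plus_fun_def
    by (simp add: inner_add_left integrable_inner)
  show "ip (c *\<^sub>R x) y = c * ip x y" for c x y
    unfolding ip_def scaleR_fun_def by simp
  show "0 \<le> ip x x" for x unfolding ip_square by simp
qed

lemma ip_zero_AE: "f \<in> L2 \<Longrightarrow> ip f f = 0 \<longleftrightarrow> (AE \<zeta> in circle. f \<zeta> = 0)"
  unfolding ip_square L2_iff_sqi sqi_def
  by (subst integral_nonneg_eq_0_iff_AE) auto

lemma ip_vscale: "(\<And>\<zeta>. norm \<zeta> = 1 \<Longrightarrow> norm (c \<zeta>) = 1) \<Longrightarrow> ip (\<lambda>\<zeta>. c \<zeta> *s f \<zeta>) (\<lambda>\<zeta>. c \<zeta> *s g \<zeta>) = ip f g"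
  unfolding ip_def by (rule Bochner_Integration.integral_cong) (simp_all add: inner_vscale)

lemma form_complete_L2: "L2.form_complete L2"
  unfolding L2.form_complete_def
proof (intro allI impI)
  fix y :: "nat \<Rightarrow> complex \<Rightarrow> complex^'n" assume y: "(\<forall>k. y k \<in> L2) \<and> L2.form_cauchy y"
  have ys: "sqi (y k)" for k using y by (simp add: L2_iff_sqi)
  have yc: "\<exists>N. \<forall>m\<ge>N. \<forall>n\<ge>N. (LINT \<zeta>|circle. (norm (y m \<zeta> - y n \<zeta>))\<^sup>2) < e" if "0 < e" for e
    using conjunct2[OF y, unfolded L2.form_cauchy_def, THEN spec, THEN mp, OF that] by (simp add: ip_square)
  obtain g where g: "sqi g" "(\<lambda>n. LINT \<zeta>|circle. (norm (y n \<zeta> - g \<zeta>))\<^sup>2) \<longlonglongrightarrow> 0"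
    by (rule L2_complete[OF ys yc])
  show "\<exists>z\<in>L2. (\<lambda>k. ip (y k - z) (y k - z)) \<longlonglongrightarrow> 0"
    using g by (intro bexI[of _ g]) (simp_all add: ip_square L2_iff_sqi)
qed

lemma fourier_coeff_nth:
  assumes f: "sqi f" shows "fourier_coeff f k $ i = fc (\<lambda>\<zeta>. f \<zeta> $ i) k"
proof -
  have "sqi (\<lambda>\<zeta>. \<zeta> powi (-k) *s f \<zeta>)"
    by (rule sqi_vscale[OF f, where C = 1]) (auto simp: norm_power_int)
  from integral_bounded_linear[OF bounded_linear_vec_nth sqi_integrable[OF this], of i]
  show ?thesis by (simp add: fourier_coeff_def fc_def)
qed

lemma H2_iff: "f \<in> H2 \<longleftrightarrow> f \<in> L2 \<and> (\<forall>i k. k < 0 \<longrightarrow> fc (\<lambda>\<zeta>. f \<zeta> $ i) k = 0)"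
proof (cases "f \<in> L2")
  case True
  then show ?thesis by (auto simp: H2_def vec_eq_iff L2_iff_sqi fourier_coeff_nth)
qed (simp add: H2_def)

lemma H2_L2: "f \<in> H2 \<Longrightarrow> f \<in> L2" by (simp add: H2_def)

lemma H2_sqi: "f \<in> H2 \<Longrightarrow> sqi f" by (simp add: H2_def L2_iff_sqi)

lemma H2_fc: "f \<in> H2 \<Longrightarrow> k < 0 \<Longrightarrow> fc (\<lambda>\<zeta>. f \<zeta> $ i) k = 0" by (simp add: H2_iff)

lemma H2I: "sqi f \<Longrightarrow> (\<And>i k. k < 0 \<Longrightarrow> fc (\<lambda>\<zeta>. f \<zeta> $ i) k = 0) \<Longrightarrow> f \<in> H2"
  by (simp add: H2_iff L2_iff_sqi)

lemma fc_cong: "(\<And>\<zeta>. norm \<zeta> = 1 \<Longrightarrow> f \<zeta> = g \<zeta>) \<Longrightarrow> fc f k = fc g k"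
  unfolding fc_def by (rule Bochner_Integration.integral_cong) simp_all

lemma fc_const: "fc (\<lambda>_. c) k = (if k = 0 then c else 0)"
  using integral_circle_power_int[of "- k"] by (simp add: fc_def)

lemma fc_mult_id: "fc (\<lambda>\<zeta>. \<zeta> * f \<zeta>) k = fc f (k - 1)"
  using fc_shift[of 1 f k] by simp

lemma fc_mult_cnj: "fc (\<lambda>\<zeta>. cnj \<zeta> * f \<zeta>) k = fc f (k + 1)"
proof -
  have "fc (\<lambda>\<zeta>. cnj \<zeta> * f \<zeta>) k = fc (\<lambda>\<zeta>. \<zeta> powi (-1) * f \<zeta>) k"
    by (rule fc_cong) (simp add: inverse_on_circle power_int_minus)
  then show ?thesis using fc_shift[of "-1" f k] by simp
qed

lemma sqi_nth_integrable: "sqi f \<Longrightarrow> integrable circle (\<lambda>\<zeta>. (f \<zeta> :: complex^'n) $ i)"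
  by (rule sqi_integrable[OF sqi_nth])

lemma H2_add: "f \<in> H2 \<Longrightarrow> g \<in> H2 \<Longrightarrow> (\<lambda>\<zeta>. f \<zeta> + g \<zeta>) \<in> H2"
  by (rule H2I) (simp_all add: H2_sqi sqi_add fc_add sqi_nth_integrable H2_fc)

lemma H2_diff: "f \<in> H2 \<Longrightarrow> g \<in> H2 \<Longrightarrow> (\<lambda>\<zeta>. f \<zeta> - g \<zeta>) \<in> H2"
  by (rule H2I) (simp_all add: H2_sqi sqi_diff fc_diff sqi_nth_integrable H2_fc)

lemma H2_vscale: "f \<in> H2 \<Longrightarrow> (\<lambda>\<zeta>. c *s f \<zeta>) \<in> H2"
  by (rule H2I) (simp_all add: H2_sqi sqi_vscale_const fc_mult_left H2_fc)

lemma scaleR_vscale: "r *\<^sub>R (x::complex^'n) = complex_of_real r *s x"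
  unfolding vec_eq_iff vector_scaleR_component vector_smult_component by (simp add: scaleR_conv_of_real)

lemma H2_scaleR: "f \<in> H2 \<Longrightarrow> (\<lambda>\<zeta>. r *\<^sub>R f \<zeta>) \<in> H2"
  unfolding scaleR_vscale by (rule H2_vscale)

lemma H2_const: "(\<lambda>_. v) \<in> H2"
  by (rule H2I) (simp_all add: sqi_const fc_const)

lemma H2_shift: "f \<in> H2 \<Longrightarrow> (\<lambda>\<zeta>. \<zeta> *s f \<zeta>) \<in> H2"
  by (rule H2I) (simp_all add: H2_sqi sqi_vscale_id fc_mult_id H2_fc)

lemma H2_backshift:
  assumes f: "f \<in> H2" and 0: "\<And>i. fc (\<lambda>\<zeta>. f \<zeta> $ i) 0 = 0" shows "(\<lambda>\<zeta>. cnj \<zeta> *s f \<zeta>) \<in> H2"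
proof (rule H2I)
  show "sqi (\<lambda>\<zeta>. cnj \<zeta> *s f \<zeta>)" by (rule sqi_vscale_cnj[OF H2_sqi[OF f]])
  show "fc (\<lambda>\<zeta>. (cnj \<zeta> *s f \<zeta>) $ i) k = 0" if "k < 0" for i k
    using H2_fc[OF f, of "k + 1" i] 0[of i] that by (cases "k = -1") (simp_all add: fc_mult_cnj)
qed

lemma subspace_H2: "subspace H2"
proof (rule subspaceI)
  show "0 \<in> H2" using H2_const[of 0] by (simp add: zero_fun_def)
qed (simp_all add: plus_fun_def scaleR_fun_def H2_add H2_scaleR)

lemma H2_subset_L2: "H2 \<subseteq> L2" by (auto simp: H2_def)

lemma fc_limit_vec:
  assumes f: "\<And>n. sqi (f n)" and g: "sqi (g :: complex \<Rightarrow> complex^'n)"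
    and lim: "(\<lambda>n. LINT \<zeta>|circle. (norm (f n \<zeta> - g \<zeta>))\<^sup>2) \<longlonglongrightarrow> 0"
  shows "(\<lambda>n. fc (\<lambda>\<zeta>. f n \<zeta> $ i) k) \<longlonglongrightarrow> fc (\<lambda>\<zeta>. g \<zeta> $ i) k"
proof (rule fc_limit)
  show "sqi (\<lambda>\<zeta>. f n \<zeta> $ i)" for n by (rule sqi_nth[OF f])
  show "sqi (\<lambda>\<zeta>. g \<zeta> $ i)" by (rule sqi_nth[OF g])
  show "(\<lambda>n. LINT \<zeta>|circle. (norm (f n \<zeta> $ i - g \<zeta> $ i))\<^sup>2) \<longlonglongrightarrow> 0"
  proof (rule null_seq_squeeze[OF _ lim])
    fix n
    have s: "sqi (\<lambda>\<zeta>. f n \<zeta> - g \<zeta>)" by (rule sqi_diff[OF f g])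
    have "(LINT \<zeta>|circle. (norm ((f n \<zeta> - g \<zeta>) $ i))\<^sup>2) \<le> (LINT \<zeta>|circle. (norm (f n \<zeta> - g \<zeta>))\<^sup>2)"
    proof (rule integral_mono)
      show "integrable circle (\<lambda>\<zeta>. (norm ((f n \<zeta> - g \<zeta>) $ i))\<^sup>2)" using sqi_nth[OF s, of i] by (simp only: sqi_def)
      show "integrable circle (\<lambda>\<zeta>. (norm (f n \<zeta> - g \<zeta>))\<^sup>2)" using s by (simp only: sqi_def)
      show "(norm ((f n \<zeta> - g \<zeta>) $ i))\<^sup>2 \<le> (norm (f n \<zeta> - g \<zeta>))\<^sup>2" for \<zeta>
        by (intro power_mono Finite_Cartesian_Product.norm_nth_le norm_ge_zero)
    qed
    then show "\<bar>LINT \<zeta>|circle. (norm (f n \<zeta> $ i - g \<zeta> $ i))\<^sup>2\<bar> \<le> (LINT \<zeta>|circle. (norm (f n \<zeta> - g \<zeta>))\<^sup>2)"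
      by simp
  qed
qed

lemma form_complete_closed:
  assumes W: "W \<subseteq> L2" and closed: "\<And>y g. (\<And>k::nat. y k \<in> W) \<Longrightarrow> g \<in> L2 \<Longrightarrow> (\<lambda>n. LINT \<zeta>|circle. (norm (y n \<zeta> - g \<zeta>))\<^sup>2) \<longlonglongrightarrow> 0 \<Longrightarrow> g \<in> W"
  shows "L2.form_complete W"
  unfolding L2.form_complete_def
proof (intro allI impI)
  fix y assume y: "(\<forall>k. y k \<in> W) \<and> L2.form_cauchy y"
  have yL: "y k \<in> L2" for k using y W by auto
  obtain z where z: "z \<in> L2" "(\<lambda>k. ip (y k - z) (y k - z)) \<longlonglongrightarrow> 0"
    by (rule L2.form_completeE[OF form_complete_L2 yL conjunct2[OF y]])
  have "z \<in> W" by (rule closed[of y]) (use y z in \<open>simp_all add: ip_square\<close>)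
  with z(2) show "\<exists>z\<in>W. (\<lambda>k. ip (y k - z) (y k - z)) \<longlonglongrightarrow> 0" by (rule bexI)
qed

lemma H2_closed:
  assumes y: "\<And>k::nat. y k \<in> H2" and g: "g \<in> L2" and lim: "(\<lambda>n. LINT \<zeta>|circle. (norm (y n \<zeta> - g \<zeta>))\<^sup>2) \<longlonglongrightarrow> 0"
  shows "g \<in> H2"
proof (rule H2I)
  show sg: "sqi g" using g by (simp add: L2_iff_sqi)
  fix i and k :: int assume k: "k < 0"
  have "(\<lambda>n. fc (\<lambda>\<zeta>. y n \<zeta> $ i) k) \<longlonglongrightarrow> fc (\<lambda>\<zeta>. g \<zeta> $ i) k"
    by (rule fc_limit_vec[OF H2_sqi[OF y] sg lim])
  then have "(\<lambda>n. 0) \<longlonglongrightarrow> fc (\<lambda>\<zeta>. g \<zeta> $ i) k" by (simp add: H2_fc[OF y k])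
  then show "fc (\<lambda>\<zeta>. g \<zeta> $ i) k = 0" by (simp add: LIMSEQ_const_iff)
qed

lemma form_complete_H2: "L2.form_complete H2"
  by (rule form_complete_closed[OF H2_subset_L2 H2_closed])

lemma L2_inner_eq:
  assumes f: "f \<in> L2" and g: "g \<in> L2"
  shows "L2_inner f g = of_real (ip f g) + \<i> * of_real (ip f (\<lambda>\<zeta>. \<i> *s g \<zeta>))"
proof -
  have 1: "integrable circle (\<lambda>\<zeta>. f \<zeta> \<bullet> g \<zeta>)" and 2: "integrable circle (\<lambda>\<zeta>. f \<zeta> \<bullet> (\<i> *s g \<zeta>))"
    using f g by (simp_all add: L2_iff_sqi integrable_inner sqi_vscale_const)
  show ?thesis unfolding L2_inner_def vec_cinner_eq ip_def
    using 1 2 by (simp add: integral_complex_of_real)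
qed

text \<open>The real inner product detects complex orthogonality, because \<open>H2\<close> is closed under multiplication by the imaginary unit.\<close>

lemma H2_minus_iff:
  fixes g :: "complex \<Rightarrow> complex^'a"
  shows "g \<in> H2_minus \<longleftrightarrow> g \<in> L2 \<and> (\<forall>h\<in>H2. ip g h = 0)"
proof (cases "g \<in> L2")
  case True
  have "(\<forall>h\<in>H2. L2_inner g h = 0) \<longleftrightarrow> (\<forall>h\<in>H2. ip g h = 0)"
  proof
    assume "\<forall>h\<in>H2. L2_inner g h = 0"
    then show "\<forall>h\<in>H2. ip g h = 0" using L2_inner_eq[OF True H2_L2] by (metis complex_eq_iff Complex_eq complex.sel(1) zero_complex.sel(1))
  next
    assume z: "\<forall>h\<in>H2. ip g h = 0"
    show "\<forall>h\<in>H2. L2_inner g h = 0"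
    proof
      fix h :: "complex \<Rightarrow> complex^'a" assume h: "h \<in> H2"
      have "ip g h = 0" using z h by (rule bspec)
      moreover have "ip g (\<lambda>\<zeta>. \<i> *s h \<zeta>) = 0" using z H2_vscale[OF h] by (rule bspec)
      ultimately show "L2_inner g h = 0" using L2_inner_eq[OF True H2_L2[OF h]] by simp
    qed
  qed
  then show ?thesis using True by (simp add: H2_minus_def)
qed (simp add: H2_minus_def)

lemma L2_inner_zero_iff:
  assumes f: "f \<in> L2" shows "(\<forall>h\<in>H2. L2_inner f h = 0) \<longleftrightarrow> (\<forall>h\<in>H2. ip f h = 0)"
  using H2_minus_iff[of f] f by (simp add: H2_minus_def)

lemma L2_add: "f \<in> L2 \<Longrightarrow> g \<in> L2 \<Longrightarrow> (\<lambda>\<zeta>. f \<zeta> + g \<zeta>) \<in> L2"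
  by (simp add: L2_iff_sqi sqi_add)

lemma L2_diff: "f \<in> L2 \<Longrightarrow> g \<in> L2 \<Longrightarrow> (\<lambda>\<zeta>. f \<zeta> - g \<zeta>) \<in> L2"
  by (simp add: L2_iff_sqi sqi_diff)

lemma ip_add_left: "f \<in> L2 \<Longrightarrow> g \<in> L2 \<Longrightarrow> h \<in> L2 \<Longrightarrow> ip (\<lambda>\<zeta>. f \<zeta> + g \<zeta>) h = ip f h + ip g h"
  using L2.add[of f g h] by (simp add: plus_fun_def)

lemma ip_add_right: "f \<in> L2 \<Longrightarrow> g \<in> L2 \<Longrightarrow> h \<in> L2 \<Longrightarrow> ip h (\<lambda>\<zeta>. f \<zeta> + g \<zeta>) = ip h f + ip h g"
  using ip_add_left[of f g h] by (simp add: ip_sym)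

lemma ip_diff_left: "f \<in> L2 \<Longrightarrow> g \<in> L2 \<Longrightarrow> h \<in> L2 \<Longrightarrow> ip (\<lambda>\<zeta>. f \<zeta> - g \<zeta>) h = ip f h - ip g h"
  using L2.diff[of f g h] by (simp add: fun_diff_def)

lemma ip_diff_right: "f \<in> L2 \<Longrightarrow> g \<in> L2 \<Longrightarrow> h \<in> L2 \<Longrightarrow> ip h (\<lambda>\<zeta>. f \<zeta> - g \<zeta>) = ip h f - ip h g"
  using ip_diff_left[of f g h] by (simp add: ip_sym)

lemma L2_projI:
  assumes y: "y \<in> S \<and> (\<forall>h\<in>S. L2_inner (\<lambda>\<zeta>. f \<zeta> - y \<zeta>) h = 0)"
  shows "L2_proj S f \<in> S \<and> (\<forall>h\<in>S. L2_inner (\<lambda>\<zeta>. f \<zeta> - L2_proj S f \<zeta>) h = 0)"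
  unfolding L2_proj_def
  by (rule someI[where P = "\<lambda>g. g \<in> S \<and> (\<forall>h\<in>S. L2_inner (\<lambda>\<zeta>. f \<zeta> - g \<zeta>) h = 0)"]) (rule y)

lemma L2_proj_H2:
  assumes f: "f \<in> L2"
  shows "L2_proj H2 f \<in> H2" and "(\<lambda>\<zeta>. f \<zeta> - L2_proj H2 f \<zeta>) \<in> H2_minus"
proof -
  obtain y where y: "y \<in> H2" "\<And>z. z \<in> H2 \<Longrightarrow> ip (f - y) z = 0"
    using L2.projection[OF subspace_H2 H2_subset_L2 form_complete_H2 f] by metis
  have d: "(\<lambda>\<zeta>. f \<zeta> - y \<zeta>) \<in> L2" by (rule L2_diff[OF f H2_L2[OF y(1)]])
  have "y \<in> H2 \<and> (\<forall>h\<in>H2. L2_inner (\<lambda>\<zeta>. f \<zeta> - y \<zeta>) h = 0)"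
    using y unfolding L2_inner_zero_iff[OF d] by (simp add: fun_diff_def)
  then have *: "L2_proj H2 f \<in> H2 \<and> (\<forall>h\<in>H2. L2_inner (\<lambda>\<zeta>. f \<zeta> - L2_proj H2 f \<zeta>) h = 0)"
    by (rule L2_projI)
  then show "L2_proj H2 f \<in> H2" by simp
  then show "(\<lambda>\<zeta>. f \<zeta> - L2_proj H2 f \<zeta>) \<in> H2_minus"
    using * L2_diff[OF f H2_L2] by (simp add: H2_minus_def)
qed

text \<open>The complementary projection, onto \<open>H2_minus\<close>.\<close>

definition Pm :: "(complex \<Rightarrow> complex^'n) \<Rightarrow> (complex \<Rightarrow> complex^'n)" where
  "Pm f = (\<lambda>\<zeta>. f \<zeta> - L2_proj H2 f \<zeta>)"

lemma Pm_H2_minus: "f \<in> L2 \<Longrightarrow> Pm f \<in> H2_minus"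
  using L2_proj_H2 by (simp add: Pm_def)

lemma H2_minus_L2: "f \<in> H2_minus \<Longrightarrow> f \<in> L2" by (simp add: H2_minus_def)

lemma H2_minus_ip: "f \<in> H2_minus \<Longrightarrow> h \<in> H2 \<Longrightarrow> ip f h = 0" by (simp add: H2_minus_iff)

lemma Pm_L2: "f \<in> L2 \<Longrightarrow> Pm f \<in> L2" by (rule H2_minus_L2[OF Pm_H2_minus])

lemma split_Pm: "f = (\<lambda>\<zeta>. Pm f \<zeta> + L2_proj H2 f \<zeta>)"
  by (simp add: Pm_def)

lemma ip_Pm:
  assumes f: "f \<in> L2" and g: "g \<in> L2" shows "ip (Pm f) (Pm g) = ip (Pm f) g"
proof -
  have "ip (Pm f) (\<lambda>\<zeta>. g \<zeta> - L2_proj H2 g \<zeta>) = ip (Pm f) g - ip (Pm f) (L2_proj H2 g)"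
    by (rule ip_diff_right[OF g H2_L2[OF L2_proj_H2(1)[OF g]] Pm_L2[OF f]])
  then show ?thesis using H2_minus_ip[OF Pm_H2_minus[OF f] L2_proj_H2(1)[OF g]] by (simp add: Pm_def[of g])
qed

lemma pythagoras:
  assumes p: "p \<in> H2" and m: "m \<in> H2_minus"
  shows "ip (\<lambda>\<zeta>. m \<zeta> + p \<zeta>) (\<lambda>\<zeta>. m \<zeta> + p \<zeta>) = ip m m + ip p p"
  using L2.square_add[OF H2_minus_L2[OF m] H2_L2[OF p]] H2_minus_ip[OF m p] by (simp add: plus_fun_def)

lemma pythagoras_Pm: "f \<in> L2 \<Longrightarrow> ip f f = ip (Pm f) (Pm f) + ip (L2_proj H2 f) (L2_proj H2 f)"
  using pythagoras[OF L2_proj_H2(1) Pm_H2_minus, of f f] split_Pm[of f] by simp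

lemma H2_inter_H2_minus: "f \<in> H2 \<Longrightarrow> f \<in> H2_minus \<Longrightarrow> ip f f = 0"
  by (rule H2_minus_ip)

lemma H2_minus_diff: "f \<in> H2_minus \<Longrightarrow> g \<in> H2_minus \<Longrightarrow> (\<lambda>\<zeta>. f \<zeta> - g \<zeta>) \<in> H2_minus"
  by (simp add: H2_minus_iff L2_diff ip_diff_left H2_L2)

lemma H2_minus_add: "f \<in> H2_minus \<Longrightarrow> g \<in> H2_minus \<Longrightarrow> (\<lambda>\<zeta>. f \<zeta> + g \<zeta>) \<in> H2_minus"
  by (simp add: H2_minus_iff L2_add ip_add_left H2_L2)

text \<open>The difference of two decompositions lies both in \<open>H2\<close> and in \<open>H2_minus\<close>, hence has norm zero. The representative chosen by \<open>L2_proj\<close> is known only up to a null set.\<close>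

lemma projection_unique:
  assumes p: "p \<in> H2" and m: "m \<in> H2_minus" and f: "f = (\<lambda>\<zeta>. m \<zeta> + p \<zeta>)"
  shows "AE \<zeta> in circle. L2_proj H2 f \<zeta> = p \<zeta>" "AE \<zeta> in circle. Pm f \<zeta> = m \<zeta>"
proof -
  have fL: "f \<in> L2" unfolding f by (rule L2_add[OF H2_minus_L2[OF m] H2_L2[OF p]])
  define d where "d = (\<lambda>\<zeta>. L2_proj H2 f \<zeta> - p \<zeta>)"
  have dH: "d \<in> H2" unfolding d_def by (rule H2_diff[OF L2_proj_H2(1)[OF fL] p])
  have "d = (\<lambda>\<zeta>. m \<zeta> - Pm f \<zeta>)" by (simp add: d_def Pm_def f fun_eq_iff)
  then have "d \<in> H2_minus" using H2_minus_diff[OF m Pm_H2_minus[OF fL]] by simp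
  then have "ip d d = 0" by (rule H2_inter_H2_minus[OF dH])
  then have ae: "AE \<zeta> in circle. d \<zeta> = 0" using ip_zero_AE[OF H2_L2[OF dH]] by simp
  then show "AE \<zeta> in circle. L2_proj H2 f \<zeta> = p \<zeta>" by (simp add: d_def)
  show "AE \<zeta> in circle. Pm f \<zeta> = m \<zeta>"
    using ae by (rule AE_mp) (auto simp: d_def Pm_def f intro!: AE_I2)
qed

lemma ip_cong_AE:
  assumes "AE \<zeta> in circle. f \<zeta> = f' \<zeta>" "f \<in> L2" "f' \<in> L2" shows "ip f f = ip f' f'"
  unfolding ip_square
  by (rule integral_cong_AE) (use assms in \<open>auto simp: L2_def\<close>)

text \<open>\<open>hankel\<close> is defined by projecting onto \<open>H2_minus\<close>; the projection exists because \<open>Pm\<close> provides it.\<close>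

lemma hankel_AE:
  fixes \<Phi> :: "complex \<Rightarrow> complex^'n^'m"
  assumes a: "(\<lambda>\<zeta>. \<Phi> \<zeta> *v f \<zeta>) \<in> L2"
  shows "AE \<zeta> in circle. hankel \<Phi> f \<zeta> = Pm (\<lambda>\<zeta>. \<Phi> \<zeta> *v f \<zeta>) \<zeta>" and "hankel \<Phi> f \<in> H2_minus"
proof -
  define a where "a = (\<lambda>\<zeta>. \<Phi> \<zeta> *v f \<zeta>)"
  have aL: "a \<in> L2" using a by (simp add: a_def)
  have "Pm a \<in> H2_minus \<and> (\<forall>h\<in>H2_minus. L2_inner (\<lambda>\<zeta>. a \<zeta> - Pm a \<zeta>) h = 0)"
  proof (intro conjI ballI)
    show "Pm a \<in> H2_minus" by (rule Pm_H2_minus[OF aL])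
    fix h :: "complex \<Rightarrow> complex^'m" assume h: "h \<in> H2_minus"
    have p: "L2_proj H2 a \<in> H2" by (rule L2_proj_H2(1)[OF aL])
    have "cnj (L2_inner h (L2_proj H2 a)) = 0" using h p by (simp add: H2_minus_def)
    moreover have "L2_inner (L2_proj H2 a) h = cnj (L2_inner h (L2_proj H2 a))"
    proof -
      have "L2_inner (L2_proj H2 a) h = (LINT \<zeta>|circle. cnj (vec_cinner (h \<zeta>) (L2_proj H2 a \<zeta>)))"
        unfolding L2_inner_def by (rule Bochner_Integration.integral_cong) (simp_all add: vec_cinner_def mult.commute)
      also have "\<dots> = cnj (LINT \<zeta>|circle. vec_cinner (h \<zeta>) (L2_proj H2 a \<zeta>))"
        by (metis Bochner_Integration.integral_cnj)
      finally show ?thesis by (simp add: L2_inner_def)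
    qed
    ultimately show "L2_inner (\<lambda>\<zeta>. a \<zeta> - Pm a \<zeta>) h = 0" by (simp add: Pm_def)
  qed
  then have *: "L2_proj H2_minus a \<in> H2_minus \<and> (\<forall>h\<in>H2_minus. L2_inner (\<lambda>\<zeta>. a \<zeta> - L2_proj H2_minus a \<zeta>) h = 0)"
    by (rule L2_projI)
  define q where "q = L2_proj H2_minus a"
  have q: "q \<in> H2_minus" "\<And>h. h \<in> H2_minus \<Longrightarrow> L2_inner (\<lambda>\<zeta>. a \<zeta> - q \<zeta>) h = 0" using * by (auto simp: q_def)
  define d where "d = (\<lambda>\<zeta>. Pm a \<zeta> - q \<zeta>)"
  have d: "d \<in> (H2_minus :: (complex \<Rightarrow> complex^'m) set)" unfolding d_def by (rule H2_minus_diff[OF Pm_H2_minus[OF aL] q(1)])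
  have dL: "d \<in> L2" by (rule H2_minus_L2[OF d])
  have aq: "(\<lambda>\<zeta>. a \<zeta> - q \<zeta>) \<in> L2" by (rule L2_diff[OF aL H2_minus_L2[OF q(1)]])
  have "Re (L2_inner (\<lambda>\<zeta>. a \<zeta> - q \<zeta>) d) = 0" using q(2)[OF d] by simp
  then have "ip (\<lambda>\<zeta>. a \<zeta> - q \<zeta>) d = 0" unfolding L2_inner_eq[OF aq dL] by simp
  moreover have "(\<lambda>\<zeta>. a \<zeta> - q \<zeta>) = (\<lambda>\<zeta>. d \<zeta> + L2_proj H2 a \<zeta>)" by (simp add: d_def Pm_def)
  moreover have "ip (\<lambda>\<zeta>. d \<zeta> + L2_proj H2 a \<zeta>) d = ip d d + ip (L2_proj H2 a) d"
    by (rule ip_add_left[OF dL H2_L2[OF L2_proj_H2(1)[OF aL]] dL])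
  moreover have "ip (L2_proj H2 a) d = 0" using H2_minus_ip[OF d L2_proj_H2(1)[OF aL]] by (simp add: ip_sym)
  ultimately have "ip d d = 0" by simp
  then have "AE \<zeta> in circle. d \<zeta> = 0" using ip_zero_AE[OF dL] by simp
  then show "AE \<zeta> in circle. hankel \<Phi> f \<zeta> = Pm (\<lambda>\<zeta>. \<Phi> \<zeta> *v f \<zeta>) \<zeta>"
    by (rule AE_mp) (auto simp: d_def q_def hankel_def a_def[symmetric] intro!: AE_I2)
  show "hankel \<Phi> f \<in> H2_minus" using q(1) by (simp add: hankel_def q_def a_def)
qed

section \<open>The Hankel form\<close>

lemma mat_bounded_linear: "bounded_linear ((*v) (A :: complex^'n^'m))"
proof -
  have "linear ((*v) A)"
    by (rule linearI) (simp_all add: matrix_vector_right_distrib scaleR_vscale vector_scalar_commute)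
  then show ?thesis by (simp add: linear_conv_bounded_linear)
qed

definition ess_bounded :: "(complex \<Rightarrow> complex^'n^'m) set" where
  "ess_bounded = {\<Psi> \<in> borel_measurable circle. \<exists>c. AE \<zeta> in circle. \<forall>x. norm (\<Psi> \<zeta> *v x) \<le> c * norm x}"

definition mv :: "(complex \<Rightarrow> complex^'n^'m) \<Rightarrow> (complex \<Rightarrow> complex^'n) \<Rightarrow> complex \<Rightarrow> complex^'m" where
  "mv \<Psi> f = (\<lambda>\<zeta>. \<Psi> \<zeta> *v f \<zeta>)"

lemma mv_L2:
  assumes P: "\<Psi> \<in> ess_bounded" and f: "f \<in> L2" shows "mv \<Psi> f \<in> L2"
proof -
  obtain c where c: "AE \<zeta> in circle. \<forall>x. norm (\<Psi> \<zeta> *v x) \<le> c * norm x" using P by (auto simp: ess_bounded_def)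
  show ?thesis unfolding L2_iff_sqi mv_def
  proof (rule sqi_bounded_image)
    show "sqi f" using f by (simp add: L2_iff_sqi)
    show "(\<lambda>\<zeta>. \<Psi> \<zeta> *v f \<zeta>) \<in> borel_measurable circle"
      using P f by (intro mv_measurable) (auto simp: ess_bounded_def L2_def)
    show "AE \<zeta> in circle. norm (\<Psi> \<zeta> *v f \<zeta>) \<le> c * norm (f \<zeta>)" using c by eventually_elim simp
  qed
qed

lemma mv_add: "mv \<Psi> (\<lambda>\<zeta>. f \<zeta> + g \<zeta>) = (\<lambda>\<zeta>. mv \<Psi> f \<zeta> + mv \<Psi> g \<zeta>)"
  by (simp add: mv_def matrix_vector_right_distrib)

lemma mv_vscale: "mv \<Psi> (\<lambda>\<zeta>. c \<zeta> *s f \<zeta>) = (\<lambda>\<zeta>. c \<zeta> *s mv \<Psi> f \<zeta>)"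
  by (simp add: mv_def vector_scalar_commute)

text \<open>This agrees with \<open>hankel\<close> almost everywhere, by \<open>hankel_AE\<close>; projecting onto \<open>H2\<close> and subtracting is easier to compute with than projecting onto \<open>H2_minus\<close>.\<close>

definition hankel_part :: "(complex \<Rightarrow> complex^'n^'m) \<Rightarrow> (complex \<Rightarrow> complex^'n) \<Rightarrow> complex \<Rightarrow> complex^'m" where
  "hankel_part \<Psi> f = Pm (mv \<Psi> f)"

text \<open>The polarized form of \<open>|f|\<^sup>2 - |H f|\<^sup>2\<close>.\<close>

definition hform :: "(complex \<Rightarrow> complex^'n^'m) \<Rightarrow> (complex \<Rightarrow> complex^'n) \<Rightarrow> (complex \<Rightarrow> complex^'n) \<Rightarrow> real" where
  "hform \<Psi> f g = ip f g - ip (hankel_part \<Psi> f) (hankel_part \<Psi> g)"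

definition hankel_contractive :: "(complex \<Rightarrow> complex^'n^'m) \<Rightarrow> bool" where
  "hankel_contractive \<Psi> \<longleftrightarrow> (\<forall>f\<in>H2. ip (hankel_part \<Psi> f) (hankel_part \<Psi> f) \<le> ip f f)"

lemma hankel_part_H2_minus: "\<Psi> \<in> ess_bounded \<Longrightarrow> f \<in> L2 \<Longrightarrow> hankel_part \<Psi> f \<in> H2_minus"
  unfolding hankel_part_def by (intro Pm_H2_minus mv_L2)

lemma hform_alt: "\<Psi> \<in> ess_bounded \<Longrightarrow> f \<in> L2 \<Longrightarrow> g \<in> L2 \<Longrightarrow> hform \<Psi> f g = ip f g - ip (hankel_part \<Psi> g) (mv \<Psi> f)"
  unfolding hform_def hankel_part_def ip_sym[of "Pm (mv \<Psi> f)"] by (simp add: ip_Pm mv_L2)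

lemma psd_hform:
  assumes P: "\<Psi> \<in> ess_bounded" and H: "hankel_contractive \<Psi>" shows "psd_form H2 (hform \<Psi>)"
proof
  show "subspace H2" by (rule subspace_H2)
  show "hform \<Psi> x y = hform \<Psi> y x" for x y unfolding hform_def by (simp add: ip_sym)
  show "hform \<Psi> (x + y) z = hform \<Psi> x z + hform \<Psi> y z" if "x \<in> H2" "y \<in> H2" "z \<in> H2" for x y z
  proof -
    note L = H2_L2[OF that(1)] H2_L2[OF that(2)] H2_L2[OF that(3)]
    have "ip (hankel_part \<Psi> z) (mv \<Psi> (x + y)) = ip (hankel_part \<Psi> z) (mv \<Psi> x) + ip (hankel_part \<Psi> z) (mv \<Psi> y)"
      unfolding plus_fun_def mv_add by (rule ip_add_right[OF mv_L2[OF P L(1)] mv_L2[OF P L(2)] H2_minus_L2[OF hankel_part_H2_minus[OF P L(3)]]])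
    moreover have "ip (x + y) z = ip x z + ip y z" by (rule L2.add[OF L])
    ultimately show ?thesis using hform_alt[OF P] L L2.closed(1)[OF L(1,2)] by simp
  qed
  show "hform \<Psi> (c *\<^sub>R x) y = c * hform \<Psi> x y" if "x \<in> H2" "y \<in> H2" for c x y
  proof -
    note L = H2_L2[OF that(1)] H2_L2[OF that(2)]
    have "mv \<Psi> (c *\<^sub>R x) = c *\<^sub>R mv \<Psi> x"
      unfolding scaleR_fun_def scaleR_vscale by (rule mv_vscale)
    then have "ip (hankel_part \<Psi> y) (mv \<Psi> (c *\<^sub>R x)) = c * ip (hankel_part \<Psi> y) (mv \<Psi> x)"
      using L2.scale_right[OF mv_L2[OF P L(1)] H2_minus_L2[OF hankel_part_H2_minus[OF P L(2)]]] by simp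
    moreover have "ip (c *\<^sub>R x) y = c * ip x y" by (rule L2.scale[OF L])
    ultimately show ?thesis using hform_alt[OF P] L L2.closed(3)[OF L(1)] by (simp add: right_diff_distrib)
  qed
  show "0 \<le> hform \<Psi> x x" if "x \<in> H2" for x using H that by (simp add: hform_def hankel_contractive_def)
qed

lemma inner_vscale_left: "(c *s x) \<bullet> y = x \<bullet> (cnj c *s (y::complex^'n))"
proof -
  have "inner (c * a) b = inner a (cnj c * b)" for a b :: complex
    by (simp add: inner_complex_def algebra_simps)
  then show ?thesis by (simp add: inner_vec_def)
qed

lemma ip_vscale_left: "ip (\<lambda>\<zeta>. c *s f \<zeta>) g = ip f (\<lambda>\<zeta>. cnj c *s g \<zeta>)"
  by (simp add: ip_def inner_vscale_left)

lemma H2_minus_vscale: "m \<in> H2_minus \<Longrightarrow> (\<lambda>\<zeta>. c *s m \<zeta>) \<in> H2_minus"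
  by (simp add: H2_minus_iff ip_vscale_left H2_vscale L2_iff_sqi sqi_vscale_const)

lemma ip_H2_minus_Pm: "m \<in> H2_minus \<Longrightarrow> f \<in> L2 \<Longrightarrow> ip m (Pm f) = ip m f"
  using ip_diff_right[OF _ H2_L2[OF L2_proj_H2(1)] H2_minus_L2, of f f m] H2_minus_ip[of m "L2_proj H2 f"] L2_proj_H2(1)[of f]
  by (simp add: Pm_def)

lemma L2_vscale: "f \<in> L2 \<Longrightarrow> (\<lambda>\<zeta>. c *s f \<zeta>) \<in> L2"
  by (simp add: L2_iff_sqi sqi_vscale_const)

lemma hform_vscale_left:
  assumes P: "\<Psi> \<in> ess_bounded" and f: "f \<in> L2" and g: "g \<in> L2"
  shows "hform \<Psi> (\<lambda>\<zeta>. c *s f \<zeta>) g = hform \<Psi> f (\<lambda>\<zeta>. cnj c *s g \<zeta>)"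
proof -
  have Hg: "hankel_part \<Psi> g \<in> H2_minus" and Hf: "hankel_part \<Psi> f \<in> H2_minus" using P f g by (auto intro: hankel_part_H2_minus)
  have "ip (hankel_part \<Psi> g) (mv \<Psi> (\<lambda>\<zeta>. c *s f \<zeta>)) = ip (\<lambda>\<zeta>. cnj c *s hankel_part \<Psi> g \<zeta>) (mv \<Psi> f)"
    unfolding mv_vscale using ip_vscale_left[of "cnj c" "hankel_part \<Psi> g" "mv \<Psi> f"] by simp
  also have "\<dots> = ip (\<lambda>\<zeta>. cnj c *s hankel_part \<Psi> g \<zeta>) (hankel_part \<Psi> f)"
    unfolding hankel_part_def[of \<Psi> f] by (rule ip_H2_minus_Pm[OF H2_minus_vscale[OF Hg] mv_L2[OF P f], symmetric])
  also have "\<dots> = ip (\<lambda>\<zeta>. c *s hankel_part \<Psi> f \<zeta>) (hankel_part \<Psi> g)"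
    using ip_vscale_left[of c "hankel_part \<Psi> f" "hankel_part \<Psi> g"] by (simp add: ip_sym)
  also have "\<dots> = ip (\<lambda>\<zeta>. c *s hankel_part \<Psi> f \<zeta>) (mv \<Psi> g)"
    unfolding hankel_part_def[of \<Psi> g] by (rule ip_H2_minus_Pm[OF H2_minus_vscale[OF Hf] mv_L2[OF P g]])
  also have "\<dots> = ip (hankel_part \<Psi> f) (mv \<Psi> (\<lambda>\<zeta>. cnj c *s g \<zeta>))" unfolding mv_vscale by (rule ip_vscale_left)
  also have "\<dots> = ip (hankel_part \<Psi> f) (hankel_part \<Psi> (\<lambda>\<zeta>. cnj c *s g \<zeta>))"
    unfolding hankel_part_def[of \<Psi> "\<lambda>\<zeta>. cnj c *s g \<zeta>"] by (rule ip_H2_minus_Pm[OF Hf mv_L2[OF P L2_vscale[OF g]], symmetric])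
  finally have "ip (hankel_part \<Psi> g) (mv \<Psi> (\<lambda>\<zeta>. c *s f \<zeta>)) = ip (hankel_part \<Psi> f) (hankel_part \<Psi> (\<lambda>\<zeta>. cnj c *s g \<zeta>))" .
  then show ?thesis
    unfolding hform_alt[OF P L2_vscale[OF f] g] hform_def[of \<Psi> f] by (simp add: ip_vscale_left)
qed

section \<open>Zeroth coefficients and one-step extensions\<close>

text \<open>For a function in \<open>H2\<close> this is its value at the origin.\<close>

definition c0 :: "(complex \<Rightarrow> complex^'n) \<Rightarrow> complex^'n" where "c0 f = fourier_coeff f 0"

lemma c0_integral: "c0 f = (LINT \<zeta>|circle. f \<zeta>)"
  by (simp add: c0_def fourier_coeff_def)

lemma c0_nth: "f \<in> L2 \<Longrightarrow> c0 f $ i = fc (\<lambda>\<zeta>. f \<zeta> $ i) 0"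
  by (simp add: c0_def fourier_coeff_nth L2_iff_sqi)

lemma c0_add: "f \<in> L2 \<Longrightarrow> g \<in> L2 \<Longrightarrow> c0 (\<lambda>\<zeta>. f \<zeta> + g \<zeta>) = c0 f + c0 g"
  unfolding c0_integral L2_iff_sqi by (intro Bochner_Integration.integral_add sqi_integrable)

lemma c0_diff: "f \<in> L2 \<Longrightarrow> g \<in> L2 \<Longrightarrow> c0 (\<lambda>\<zeta>. f \<zeta> - g \<zeta>) = c0 f - c0 g"
  unfolding c0_integral L2_iff_sqi by (intro Bochner_Integration.integral_diff sqi_integrable)

lemma c0_mat: "f \<in> L2 \<Longrightarrow> c0 (\<lambda>\<zeta>. A *v f \<zeta>) = A *v c0 f"
  unfolding c0_integral L2_iff_sqi by (intro integral_bounded_linear mat_bounded_linear sqi_integrable)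

lemma vscale_bounded_linear: "bounded_linear (\<lambda>x::complex^'n. c *s x)"
proof -
  have "linear (\<lambda>x::complex^'n. c *s x)"
    by (rule linearI) (simp_all add: scaleR_vscale mult.commute vector_add_ldistrib vector_smult_assoc)
  then show ?thesis by (simp add: linear_conv_bounded_linear)
qed

lemma c0_vscale: "f \<in> L2 \<Longrightarrow> c0 (\<lambda>\<zeta>. c *s f \<zeta>) = c *s c0 f"
  unfolding c0_integral L2_iff_sqi by (intro integral_bounded_linear vscale_bounded_linear sqi_integrable)

lemma c0_const: "c0 (\<lambda>_. v) = v"
  using circle.prob_space by (simp add: c0_integral)

text \<open>Hence the zeroth coefficient is the orthogonal projection onto the constant functions.\<close>

lemma c0_inner: "f \<in> L2 \<Longrightarrow> ip f (\<lambda>_. v) = c0 f \<bullet> v"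
  unfolding ip_def c0_integral L2_iff_sqi by (rule integral_inner_left) (rule sqi_integrable)

lemma ip_const: "ip (\<lambda>_. u) (\<lambda>_. v) = u \<bullet> v"
  using circle.prob_space by (simp add: ip_def)

lemma c0_shift: "f \<in> H2 \<Longrightarrow> c0 (\<lambda>\<zeta>. \<zeta> *s f \<zeta>) = 0"
  using H2_fc[of f "-1"] H2_L2[OF H2_shift[of f]] by (simp add: vec_eq_iff c0_nth fc_mult_id)

lemma c0_H2_minus:
  assumes "m \<in> H2_minus" shows "c0 m = 0"
proof -
  have "c0 m \<bullet> c0 m = 0" using c0_inner[OF H2_minus_L2[OF assms], of "c0 m"] H2_minus_ip[OF assms H2_const] by simp
  then show ?thesis by simp
qed

lemma const_L2: "(\<lambda>_. v) \<in> L2" by (rule H2_L2[OF H2_const])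

lemma norm_c0_le:
  assumes f: "f \<in> L2" shows "(norm (c0 f))\<^sup>2 \<le> ip f f"
proof -
  have "0 \<le> ip (f - (\<lambda>_. c0 f)) (f - (\<lambda>_. c0 f))" by (intro L2.nonneg L2.closed f const_L2)
  also have "\<dots> = ip f f - (norm (c0 f))\<^sup>2"
    unfolding L2.square_diff[OF f const_L2] c0_inner[OF f] ip_const by (simp add: dot_square_norm)
  finally show ?thesis by simp
qed

definition L0 :: "(complex \<Rightarrow> complex^'n^'m) \<Rightarrow> (complex \<Rightarrow> complex^'n) \<Rightarrow> complex^'m" where
  "L0 \<Psi> f = c0 (mv \<Psi> f)"

lemma L0_add: "\<Psi> \<in> ess_bounded \<Longrightarrow> f \<in> L2 \<Longrightarrow> g \<in> L2 \<Longrightarrow> L0 \<Psi> (\<lambda>\<zeta>. f \<zeta> + g \<zeta>) = L0 \<Psi> f + L0 \<Psi> g"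
  by (simp add: L0_def mv_add c0_add mv_L2)

lemma L0_vscale: "\<Psi> \<in> ess_bounded \<Longrightarrow> f \<in> L2 \<Longrightarrow> L0 \<Psi> (\<lambda>\<zeta>. c *s f \<zeta>) = c *s L0 \<Psi> f"
  by (simp add: L0_def mv_vscale c0_vscale mv_L2)

lemma L0_diff: "\<Psi> \<in> ess_bounded \<Longrightarrow> f \<in> L2 \<Longrightarrow> g \<in> L2 \<Longrightarrow> L0 \<Psi> (\<lambda>\<zeta>. f \<zeta> - g \<zeta>) = L0 \<Psi> f - L0 \<Psi> g"
  by (simp add: L0_def mv_def matrix_vector_mult_diff_distrib c0_diff mv_L2[unfolded mv_def])

text \<open>One step of coefficient extraction: if \<open>C\<close> is the value of \<open>F\<close> at the origin, then \<open>\<Psi> - F = \<zeta> (step \<Psi> C - F\<^sub>1)\<close> with \<open>F\<^sub>1\<close> the backward shift of \<open>F\<close>.\<close>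

definition step :: "(complex \<Rightarrow> complex^'n^'m) \<Rightarrow> complex^'n^'m \<Rightarrow> complex \<Rightarrow> complex^'n^'m" where
  "step \<Psi> C = (\<lambda>\<zeta>. \<chi> i j. cnj \<zeta> * (\<Psi> \<zeta> $ i $ j - C $ i $ j))"

lemma step_mult: "step \<Psi> C \<zeta> *v x = cnj \<zeta> *s (\<Psi> \<zeta> *v x - C *v x)"
  by (simp add: step_def vec_eq_iff matrix_vector_mult_def sum_distrib_left sum_subtractf algebra_simps)

lemma step_mv: "mv (step \<Psi> C) f = (\<lambda>\<zeta>. cnj \<zeta> *s (mv \<Psi> f \<zeta> - C *v f \<zeta>))"
  by (simp add: mv_def step_mult)

lemma step_ess_bounded:
  assumes P: "\<Psi> \<in> ess_bounded" shows "step \<Psi> C \<in> ess_bounded"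
proof -
  obtain c where c: "AE \<zeta> in circle. \<forall>x. norm (\<Psi> \<zeta> *v x) \<le> c * norm x" using P by (auto simp: ess_bounded_def)
  obtain K where K: "\<And>x. norm (C *v x) \<le> norm x * K"
    using bounded_linear.bounded[OF mat_bounded_linear[of C]] by auto
  have m: "\<Psi> \<in> borel_measurable circle" using P by (simp add: ess_bounded_def)
  have "AE \<zeta> in circle. norm \<zeta> = 1" by (rule AE_I2) simp
  then have "AE \<zeta> in circle. \<forall>x. norm (step \<Psi> C \<zeta> *v x) \<le> (c + K) * norm x"
    using c
  proof eventually_elim
    case (elim \<zeta>)
    show ?case
    proof
      fix x
      have "norm (\<Psi> \<zeta> *v x - C *v x) \<le> c * norm x + norm x * K"
        using elim(2) K by (intro norm_triangle_le_diff add_mono) auto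
      moreover have "norm (step \<Psi> C \<zeta> *v x) = norm (\<Psi> \<zeta> *v x - C *v x)"
        using elim(1) by (simp only: step_mult norm_vscale complex_mod_cnj mult_1)
      ultimately show "norm (step \<Psi> C \<zeta> *v x) \<le> (c + K) * norm x"
        by (simp add: algebra_simps)
    qed
  qed
  moreover have "step \<Psi> C \<in> borel_measurable circle"
    unfolding step_def
    by (intro vec_lambda_measurable borel_measurable_times cnj_measurable_circle borel_measurable_diff borel_measurable_const vec_nth_measurable_comp m)
  ultimately show ?thesis unfolding ess_bounded_def by blast
qed

lemma H2_mat:
  assumes f: "f \<in> H2" shows "(\<lambda>\<zeta>. A *v f \<zeta>) \<in> H2"
proof (rule H2I)
  obtain K where K: "\<And>x. norm (A *v x) \<le> norm x * K"
    using bounded_linear.bounded[OF mat_bounded_linear[of A]] by auto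
  show "sqi (\<lambda>\<zeta>. A *v f \<zeta>)"
    by (rule sqi_bounded_image[OF H2_sqi[OF f], of _ K])
       (use H2_sqi[OF f] K in \<open>auto intro!: mv_measurable simp: sqi_def mult.commute\<close>)
  show "fc (\<lambda>\<zeta>. (A *v f \<zeta>) $ i) k = 0" if "k < 0" for i k
    unfolding matrix_vector_mult_def vec_lambda_beta
    by (subst fc_sum) (simp_all add: fc_mult_left H2_fc[OF f that] sqi_nth_integrable[OF H2_sqi[OF f]])
qed

text \<open>Moving the constant \<open>u\<close> to the frequency \<open>-1\<close> puts it into \<open>H2_minus\<close>.\<close>

lemma H2_minus_backshift:
  assumes m: "m \<in> H2_minus" shows "(\<lambda>\<zeta>. cnj \<zeta> *s (m \<zeta> + u)) \<in> H2_minus"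
  unfolding H2_minus_iff
proof (intro conjI ballI)
  have mL: "m \<in> L2" by (rule H2_minus_L2[OF m])
  show "(\<lambda>\<zeta>. cnj \<zeta> *s (m \<zeta> + u)) \<in> L2"
    using L2_add[OF mL const_L2] unfolding L2_iff_sqi by (rule sqi_vscale_cnj)
  fix h :: "complex \<Rightarrow> complex^'a" assume h: "h \<in> H2"
  have zh: "(\<lambda>\<zeta>. \<zeta> *s h \<zeta>) \<in> H2" by (rule H2_shift[OF h])
  have "ip (\<lambda>\<zeta>. cnj \<zeta> *s (m \<zeta> + u)) h = ip (\<lambda>\<zeta>. m \<zeta> + u) (\<lambda>\<zeta>. \<zeta> *s h \<zeta>)"
    by (simp only: ip_def inner_vscale_left complex_cnj_cnj)
  also have "\<dots> = ip m (\<lambda>\<zeta>. \<zeta> *s h \<zeta>) + ip (\<lambda>_. u) (\<lambda>\<zeta>. \<zeta> *s h \<zeta>)"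
    by (rule ip_add_left[OF mL const_L2 H2_L2[OF zh]])
  also have "\<dots> = 0" using H2_minus_ip[OF m zh] c0_inner[OF H2_L2[OF zh], of u] c0_shift[OF h] by (simp add: ip_sym)
  finally show "ip (\<lambda>\<zeta>. cnj \<zeta> *s (m \<zeta> + u)) h = 0" .
qed

text \<open>Multiplication by \<open>cnj \<zeta>\<close> shifts frequencies down by one. The antianalytic part of \<open>\<Psi> f - C f\<close> grows by its zeroth coefficient \<open>L0 \<Psi> f - C f(0)\<close>, which is orthogonal to what was there before.\<close>

lemma step_identity:
  assumes P: "\<Psi> \<in> ess_bounded" and f: "f \<in> H2"
  shows "ip (hankel_part (step \<Psi> C) f) (hankel_part (step \<Psi> C) f) = ip (hankel_part \<Psi> f) (hankel_part \<Psi> f) + (norm (L0 \<Psi> f - C *v c0 f))\<^sup>2"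
proof -
  define a where "a = mv \<Psi> f"
  define p where "p = L2_proj H2 a"
  define u where "u = L0 \<Psi> f - C *v c0 f"
  have fL: "f \<in> L2" by (rule H2_L2[OF f])
  have aL: "a \<in> L2" unfolding a_def by (rule mv_L2[OF P fL])
  have pH: "p \<in> H2" unfolding p_def by (rule L2_proj_H2(1)[OF aL])
  have mH: "Pm a \<in> H2_minus" by (rule Pm_H2_minus[OF aL])
  have split: "a \<zeta> = Pm a \<zeta> + p \<zeta>" for \<zeta> by (simp add: Pm_def p_def)
  define q where "q = (\<lambda>\<zeta>. (p \<zeta> - C *v f \<zeta>) - u)"
  have qH: "q \<in> H2" unfolding q_def by (intro H2_diff pH H2_mat f H2_const)
  have "c0 a = c0 (\<lambda>\<zeta>. Pm a \<zeta> + p \<zeta>)" by (rule arg_cong[where f = c0], rule ext, rule split)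
  then have "c0 p = c0 a" using c0_add[OF Pm_L2[OF aL] H2_L2[OF pH]] c0_H2_minus[OF mH] by simp
  moreover have "c0 q = c0 p - C *v c0 f - u"
    unfolding q_def
    using c0_diff[OF L2_diff[OF H2_L2[OF pH] H2_L2[OF H2_mat[OF f]]] const_L2, of C u]
      c0_diff[OF H2_L2[OF pH] H2_L2[OF H2_mat[OF f]], of C] c0_mat[OF fL, of C] by (simp add: c0_const)
  ultimately have "c0 q = 0" by (simp add: u_def L0_def a_def)
  then have "fc (\<lambda>\<zeta>. q \<zeta> $ i) 0 = 0" for i using c0_nth[OF H2_L2[OF qH], of i] by simp
  then have p'H: "(\<lambda>\<zeta>. cnj \<zeta> *s q \<zeta>) \<in> H2" by (rule H2_backshift[OF qH])
  have m'H: "(\<lambda>\<zeta>. cnj \<zeta> *s (Pm a \<zeta> + u)) \<in> H2_minus" by (rule H2_minus_backshift[OF mH])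
  have eq: "mv (step \<Psi> C) f = (\<lambda>\<zeta>. cnj \<zeta> *s (Pm a \<zeta> + u) + cnj \<zeta> *s q \<zeta>)"
  proof (rule ext)
    fix \<zeta>
    have "mv (step \<Psi> C) f \<zeta> = cnj \<zeta> *s ((Pm a \<zeta> + p \<zeta>) - C *v f \<zeta>)" unfolding step_mv a_def[symmetric] by (subst split) (rule refl)
    also have "\<dots> = cnj \<zeta> *s ((Pm a \<zeta> + u) + q \<zeta>)" by (simp add: q_def)
    also have "\<dots> = cnj \<zeta> *s (Pm a \<zeta> + u) + cnj \<zeta> *s q \<zeta>" by (rule vector_add_ldistrib)
    finally show "mv (step \<Psi> C) f \<zeta> = cnj \<zeta> *s (Pm a \<zeta> + u) + cnj \<zeta> *s q \<zeta>" .
  qed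
  have "ip (hankel_part (step \<Psi> C) f) (hankel_part (step \<Psi> C) f) = ip (\<lambda>\<zeta>. cnj \<zeta> *s (Pm a \<zeta> + u)) (\<lambda>\<zeta>. cnj \<zeta> *s (Pm a \<zeta> + u))"
    unfolding hankel_part_def
  proof (rule ip_cong_AE)
    show "AE \<zeta> in circle. Pm (mv (step \<Psi> C) f) \<zeta> = cnj \<zeta> *s (Pm a \<zeta> + u)" by (rule projection_unique(2)[OF p'H m'H eq])
    show "Pm (mv (step \<Psi> C) f) \<in> L2" by (rule Pm_L2[OF mv_L2[OF step_ess_bounded[OF P] fL]])
    show "(\<lambda>\<zeta>. cnj \<zeta> *s (Pm a \<zeta> + u)) \<in> L2" by (rule H2_minus_L2[OF m'H])
  qed
  also have "\<dots> = ip (\<lambda>\<zeta>. Pm a \<zeta> + u) (\<lambda>\<zeta>. Pm a \<zeta> + u)" by (rule ip_vscale) simp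
  also have "\<dots> = ip (Pm a) (Pm a) + ip (\<lambda>_. u) (\<lambda>_. u)" by (rule pythagoras[OF H2_const mH])
  finally show ?thesis by (simp add: ip_const dot_square_norm u_def hankel_part_def a_def)
qed

lemma hankel_contractive_step_iff:
  assumes P: "\<Psi> \<in> ess_bounded"
  shows "hankel_contractive (step \<Psi> C) \<longleftrightarrow> (\<forall>f\<in>H2. (norm (L0 \<Psi> f - C *v c0 f))\<^sup>2 \<le> hform \<Psi> f f)"
  unfolding hankel_contractive_def hform_def by (intro ball_cong refl) (simp add: step_identity[OF P] algebra_simps)

text \<open>If \<open>y\<close> vanishes at the origin, then \<open>cnj \<zeta> y\<close> is again in \<open>H2\<close> and has the same norm; apply the contraction property to it and \<open>step_identity\<close> with \<open>C = 0\<close>.\<close>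

lemma L0_bound_shift:
  assumes P: "\<Psi> \<in> ess_bounded" and H: "hankel_contractive \<Psi>" and y: "y \<in> H2" and y0: "c0 y = 0"
  shows "(norm (L0 \<Psi> y))\<^sup>2 \<le> hform \<Psi> y y"
proof -
  have g: "(\<lambda>\<zeta>. cnj \<zeta> *s y \<zeta>) \<in> H2" by (rule H2_backshift[OF y]) (use y0 c0_nth[OF H2_L2[OF y]] in \<open>metis zero_index\<close>)
  have "mv (step \<Psi> 0) y = mv \<Psi> (\<lambda>\<zeta>. cnj \<zeta> *s y \<zeta>)" unfolding step_mv mv_vscale by simp
  then have "hankel_part (step \<Psi> 0) y = hankel_part \<Psi> (\<lambda>\<zeta>. cnj \<zeta> *s y \<zeta>)" by (simp add: hankel_part_def)
  then have "ip (hankel_part (step \<Psi> 0) y) (hankel_part (step \<Psi> 0) y) \<le> ip (\<lambda>\<zeta>. cnj \<zeta> *s y \<zeta>) (\<lambda>\<zeta>. cnj \<zeta> *s y \<zeta>)"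
    using H g by (simp add: hankel_contractive_def)
  also have "\<dots> = ip y y" by (rule ip_vscale) simp
  finally show ?thesis using step_identity[OF P y, of 0] by (simp add: hform_def)
qed

definition zH2 :: "(complex \<Rightarrow> complex^'n) set" where "zH2 = {f \<in> H2. c0 f = 0}"

lemma zH2_H2: "f \<in> zH2 \<Longrightarrow> f \<in> H2" by (simp add: zH2_def)

lemma zH2_vscale: "f \<in> zH2 \<Longrightarrow> (\<lambda>\<zeta>. c *s f \<zeta>) \<in> zH2"
  by (simp add: zH2_def H2_vscale c0_vscale H2_L2)

lemma zH2_add: "f \<in> zH2 \<Longrightarrow> g \<in> zH2 \<Longrightarrow> (\<lambda>\<zeta>. f \<zeta> + g \<zeta>) \<in> zH2"
  by (simp add: zH2_def H2_add c0_add H2_L2)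

lemma subspace_zH2: "subspace zH2"
proof (rule subspaceI)
  show "0 \<in> zH2" using H2_const[of 0] c0_const[of 0] by (simp add: zH2_def zero_fun_def)
  show "x + y \<in> zH2" if "x \<in> zH2" "y \<in> zH2" for x y using zH2_add[OF that] by (simp add: plus_fun_def)
  show "c *\<^sub>R x \<in> zH2" if "x \<in> zH2" for c x
    using zH2_vscale[OF that, of "of_real c"] by (simp add: scaleR_fun_def scaleR_vscale)
qed

lemma zH2_subset: "zH2 \<subseteq> H2" by (auto simp: zH2_def)

text \<open>Ideally \<open>C\<close> maps a vector \<open>v\<close> to \<open>L0 \<Psi> x\<close>, where \<open>x\<close> is the function with value \<open>v\<close> at the origin that is
orthogonal to \<open>zH2\<close> for the Hankel form. The form need not be complete, so \<open>x\<close> is replaced by a Cauchy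
sequence asymptotically orthogonal to \<open>zH2\<close>; its images under \<open>L0 \<Psi>\<close> converge by \<open>L0_bound_shift\<close>.
For general \<open>f\<close> subtract the sequence belonging to \<open>v = f(0)\<close>: the difference lies in \<open>zH2\<close>, where
\<open>L0_bound_shift\<close> applies, and asymptotically is no longer than \<open>f\<close>.\<close>

theorem parrott_step:
  fixes \<Psi> :: "complex \<Rightarrow> complex^'n^'m"
  assumes P: "\<Psi> \<in> ess_bounded" and H: "hankel_contractive \<Psi>"
  shows "\<exists>C. hankel_contractive (step \<Psi> C)"
proof -
  interpret Q: psd_form H2 "hform \<Psi>" by (rule psd_hform[OF P H])
  define wn where "wn = Q.weak_null_cauchy zH2"
  have wnH: "x k \<in> H2" if "wn x" for x k using that by (simp add: wn_def Q.weak_null_cauchy_def)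
  have basis: "\<exists>x. wn x \<and> (\<forall>k. c0 (x k) = v)" for v :: "complex^'n"
  proof -
    define l where "l = hform \<Psi> (\<lambda>_. v)"
    have l1: "l (x + y) = l x + l y" if "x \<in> zH2" "y \<in> zH2" for x y
      unfolding l_def by (rule Q.add_right[OF zH2_H2[OF that(1)] zH2_H2[OF that(2)] H2_const])
    have l2: "l (c *\<^sub>R x) = c * l x" if "x \<in> zH2" for c x
      unfolding l_def by (rule Q.scale_right[OF zH2_H2[OF that] H2_const])
    have l3: "(l x)\<^sup>2 \<le> l (\<lambda>_. v) * hform \<Psi> x x" if "x \<in> zH2" for x
      unfolding l_def by (rule Q.cauchy_schwarz[OF H2_const zH2_H2[OF that]])
    have l4: "0 \<le> l (\<lambda>_. v)" unfolding l_def by (rule Q.nonneg[OF H2_const])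
    obtain y where y0: "\<And>k. y k \<in> zH2" "Q.form_cauchy y" "\<And>z. z \<in> zH2 \<Longrightarrow> (\<lambda>k. hform \<Psi> (y k) z) \<longlonglongrightarrow> l z"
      using Q.approximate_riesz[OF subspace_zH2 zH2_subset l1 l2 l3 l4] by blast
    note y = y0(1,2) y0(3)[unfolded l_def]
    define x where "x = (\<lambda>k. (\<lambda>_. v) - y k)"
    have yH: "y k \<in> H2" for k by (rule zH2_H2[OF y(1)])
    have xH: "x k \<in> H2" for k unfolding x_def by (rule Q.closed(2)[OF H2_const yH])
    have "Q.form_cauchy x" unfolding Q.form_cauchy_def
    proof (intro allI impI)
      fix e :: real assume e: "0 < e"
      obtain N where N: "\<And>j k. j \<ge> N \<Longrightarrow> k \<ge> N \<Longrightarrow> hform \<Psi> (y j - y k) (y j - y k) < e" using Q.form_cauchy_ex[OF y(2) e] by blast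
      have "hform \<Psi> (x j - x k) (x j - x k) < e" if "j \<ge> N" "k \<ge> N" for j k
      proof -
        have "x j - x k = y k - y j" by (simp add: x_def)
        then show ?thesis using N[OF that(2,1)] by simp
      qed
      then show "\<exists>N. \<forall>j\<ge>N. \<forall>k\<ge>N. hform \<Psi> (x j - x k) (x j - x k) < e" by blast
    qed
    moreover have "(\<lambda>k. hform \<Psi> (x k) z) \<longlonglongrightarrow> 0" if z: "z \<in> zH2" for z
    proof -
      have "(\<lambda>k. hform \<Psi> (\<lambda>_. v) z - hform \<Psi> (y k) z) \<longlonglongrightarrow> hform \<Psi> (\<lambda>_. v) z - hform \<Psi> (\<lambda>_. v) z"
        by (intro tendsto_diff tendsto_const y(3) z)
      then show ?thesis unfolding x_def using Q.diff[OF H2_const yH zH2_H2[OF z]] by simp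
    qed
    ultimately have "wn x" unfolding wn_def Q.weak_null_cauchy_def using xH by blast
    moreover have "c0 (x k) = v" for k
    proof -
      have "c0 (y k) = 0" using y(1)[of k] by (simp add: zH2_def)
      then show ?thesis unfolding x_def fun_diff_def using c0_diff[OF const_L2 H2_L2[OF yH], of v k] by (simp add: c0_const)
    qed
    ultimately show ?thesis by blast
  qed
  have "\<forall>i. \<exists>x. wn x \<and> (\<forall>k. c0 (x k) = axis i (1::complex))" using basis by blast
  then obtain X where X: "\<And>i. wn (X i)" "\<And>i k. c0 (X i k) = axis i 1" by metis
  have XH: "X i k \<in> H2" for i k by (rule wnH[OF X(1)])
  have conv: "convergent (\<lambda>k. L0 \<Psi> (X i k))" for i
  proof (rule Cauchy_convergent, rule metric_CauchyI)
    fix e :: real assume e: "0 < e"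
    have "Q.form_cauchy (X i)" using X(1)[of i] by (simp add: wn_def Q.weak_null_cauchy_def)
    moreover have "0 < e\<^sup>2" using e by simp
    ultimately have "\<exists>N. \<forall>j\<ge>N. \<forall>k\<ge>N. hform \<Psi> (X i j - X i k) (X i j - X i k) < e\<^sup>2" by (rule Q.form_cauchy_ex)
    then obtain N where N: "\<And>j k. j \<ge> N \<Longrightarrow> k \<ge> N \<Longrightarrow> hform \<Psi> (X i j - X i k) (X i j - X i k) < e\<^sup>2" by blast
    have "dist (L0 \<Psi> (X i j)) (L0 \<Psi> (X i k)) < e" if jk: "j \<ge> N" "k \<ge> N" for j k
    proof -
      have d: "X i j - X i k \<in> H2" by (rule Q.closed(2)[OF XH XH])
      have dz: "c0 (X i j - X i k) = 0"
        unfolding fun_diff_def using c0_diff[OF H2_L2[OF XH] H2_L2[OF XH], of i j i k] by (simp add: X(2))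
      have "L0 \<Psi> (X i j - X i k) = L0 \<Psi> (X i j) - L0 \<Psi> (X i k)"
        unfolding fun_diff_def by (rule L0_diff[OF P H2_L2[OF XH] H2_L2[OF XH]])
      then have "(norm (L0 \<Psi> (X i j) - L0 \<Psi> (X i k)))\<^sup>2 < e\<^sup>2"
        using L0_bound_shift[OF P H d dz] N[OF jk] by simp
      then show ?thesis using e by (simp add: dist_norm power_less_imp_less_base)
    qed
    then show "\<exists>M. \<forall>m\<ge>M. \<forall>n\<ge>M. dist (L0 \<Psi> (X i m)) (L0 \<Psi> (X i n)) < e" by blast
  qed
  define w where "w = (\<lambda>i. lim (\<lambda>k. L0 \<Psi> (X i k)))"
  have w: "(\<lambda>k. L0 \<Psi> (X i k)) \<longlonglongrightarrow> w i" for i unfolding w_def using conv by (simp add: convergent_LIMSEQ_iff)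
  define C :: "complex^'n^'m" where "C = (\<chi> a i. w i $ a)"
  have Cmul: "C *v c = (\<Sum>i\<in>UNIV. c $ i *s w i)" for c
    by (simp add: C_def vec_eq_iff matrix_vector_mult_def mult.commute)
  have scale_wn: "wn (\<lambda>k \<zeta>. c *s x k \<zeta>)" if x: "wn x" for c x
  proof -
    have xH: "x k \<in> H2" for k by (rule wnH[OF x])
    have "Q.form_cauchy (\<lambda>k \<zeta>. c *s x k \<zeta>)" unfolding Q.form_cauchy_def
    proof (intro allI impI)
      fix e :: real assume e: "0 < e"
      have cau: "Q.form_cauchy x" using x by (simp add: wn_def Q.weak_null_cauchy_def)
      have "0 < e / ((norm c)\<^sup>2 + 1)" using e by (intro divide_pos_pos add_nonneg_pos) auto
      from Q.form_cauchyD[OF cau this]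
      obtain N where N: "\<And>j k. j \<ge> N \<Longrightarrow> k \<ge> N \<Longrightarrow> hform \<Psi> (x j - x k) (x j - x k) < e / ((norm c)\<^sup>2 + 1)" by metis
      have "hform \<Psi> ((\<lambda>\<zeta>. c *s x j \<zeta>) - (\<lambda>\<zeta>. c *s x k \<zeta>)) ((\<lambda>\<zeta>. c *s x j \<zeta>) - (\<lambda>\<zeta>. c *s x k \<zeta>)) < e" if jk: "j \<ge> N" "k \<ge> N" for j k
      proof -
        define d where "d = x j - x k"
        have dH: "d \<in> H2" unfolding d_def by (rule Q.closed(2)[OF xH xH])
        have e1: "(\<lambda>\<zeta>. c *s x j \<zeta>) - (\<lambda>\<zeta>. c *s x k \<zeta>) = (\<lambda>\<zeta>. c *s d \<zeta>)"
          by (simp add: d_def fun_eq_iff vec_eq_iff algebra_simps)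
        have "hform \<Psi> (\<lambda>\<zeta>. c *s d \<zeta>) (\<lambda>\<zeta>. c *s d \<zeta>) = hform \<Psi> d (\<lambda>\<zeta>. cnj c *s (c *s d \<zeta>))"
          by (rule hform_vscale_left[OF P H2_L2[OF dH] L2_vscale[OF H2_L2[OF dH]]])
        also have "(\<lambda>\<zeta>. cnj c *s (c *s d \<zeta>)) = (norm c)\<^sup>2 *\<^sub>R d"
          by (simp add: fun_eq_iff scaleR_vscale vector_smult_assoc complex_norm_square mult.commute flip: of_real_power)
        also have "hform \<Psi> d ((norm c)\<^sup>2 *\<^sub>R d) = (norm c)\<^sup>2 * hform \<Psi> d d" by (rule Q.scale_right[OF dH dH])
        also have "\<dots> \<le> ((norm c)\<^sup>2 + 1) * hform \<Psi> d d" using Q.nonneg[OF dH] by (intro mult_right_mono) auto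
        also have "\<dots> < e"
        proof -
          have pos: "0 < (norm c)\<^sup>2 + 1" by (intro add_nonneg_pos) auto
          have "hform \<Psi> d d < e / ((norm c)\<^sup>2 + 1)" using N[OF jk] by (simp only: d_def)
          then show ?thesis using pos_less_divide_eq[OF pos] by (simp add: mult.commute)
        qed
        finally show ?thesis unfolding e1 .
      qed
      then show "\<exists>N. \<forall>j\<ge>N. \<forall>k\<ge>N. hform \<Psi> ((\<lambda>\<zeta>. c *s x j \<zeta>) - (\<lambda>\<zeta>. c *s x k \<zeta>)) ((\<lambda>\<zeta>. c *s x j \<zeta>) - (\<lambda>\<zeta>. c *s x k \<zeta>)) < e" by blast
    qed
    moreover have "(\<lambda>k. hform \<Psi> (\<lambda>\<zeta>. c *s x k \<zeta>) z) \<longlonglongrightarrow> 0" if z: "z \<in> zH2" for z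
    proof -
      have "hform \<Psi> (\<lambda>\<zeta>. c *s x k \<zeta>) z = hform \<Psi> (x k) (\<lambda>\<zeta>. cnj c *s z \<zeta>)" for k
        by (rule hform_vscale_left[OF P H2_L2[OF xH] H2_L2[OF zH2_H2[OF z]]])
      then show ?thesis using x zH2_vscale[OF z, of "cnj c"] by (simp add: wn_def Q.weak_null_cauchy_def)
    qed
    ultimately show ?thesis unfolding wn_def Q.weak_null_cauchy_def using H2_vscale[OF xH] by blast
  qed
  \<comment> \<open>By linearity the sequences for the unit vectors combine to one with prescribed value at the origin.\<close>
  have combo: "\<exists>Z. wn Z \<and> (\<forall>k. c0 (Z k) = (\<Sum>i\<in>S. c $ i *s axis i 1)) \<and> (\<lambda>k. L0 \<Psi> (Z k)) \<longlonglongrightarrow> (\<Sum>i\<in>S. c $ i *s w i)"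
    if "finite S" for S and c :: "complex^'n" using that
  proof (induction S rule: finite_induct)
    case empty
    have "wn (\<lambda>_. (\<lambda>_. 0))"
      using scale_wn[OF X(1), of 0] by simp
    moreover have "L0 \<Psi> (\<lambda>_. 0) = 0" by (simp add: L0_def mv_def c0_const)
    ultimately show ?case by (intro exI[of _ "\<lambda>_ _. 0"]) (simp add: c0_const)
  next
    case (insert i S)
    then obtain Z where Z: "wn Z" "\<And>k. c0 (Z k) = (\<Sum>i\<in>S. c $ i *s axis i 1)" "(\<lambda>k. L0 \<Psi> (Z k)) \<longlonglongrightarrow> (\<Sum>i\<in>S. c $ i *s w i)"
      by blast
    define Z' where "Z' = (\<lambda>k \<zeta>. c $ i *s X i k \<zeta> + Z k \<zeta>)"
    have ZH: "Z k \<in> H2" for k by (rule wnH[OF Z(1)])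
    have sL: "(\<lambda>\<zeta>. c $ i *s X i k \<zeta>) \<in> L2" for k by (rule L2_vscale[OF H2_L2[OF XH]])
    have "wn (\<lambda>k. (\<lambda>\<zeta>. c $ i *s X i k \<zeta>) + Z k)"
      unfolding wn_def by (rule Q.weak_null_cauchy_add[OF zH2_subset scale_wn[OF X(1), unfolded wn_def] Z(1)[unfolded wn_def]])
    then have "wn Z'" by (simp add: Z'_def plus_fun_def)
    moreover have "c0 (Z' k) = (\<Sum>i\<in>insert i S. c $ i *s axis i 1)" for k
      unfolding Z'_def c0_add[OF sL H2_L2[OF ZH]] c0_vscale[OF H2_L2[OF XH]] X(2) Z(2) using insert by simp
    moreover have "(\<lambda>k. L0 \<Psi> (Z' k)) \<longlonglongrightarrow> (\<Sum>i\<in>insert i S. c $ i *s w i)"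
    proof -
      have "L0 \<Psi> (Z' k) = c $ i *s L0 \<Psi> (X i k) + L0 \<Psi> (Z k)" for k
        unfolding Z'_def L0_add[OF P sL H2_L2[OF ZH]] L0_vscale[OF P H2_L2[OF XH]] ..
      moreover have "(\<lambda>k. c $ i *s L0 \<Psi> (X i k) + L0 \<Psi> (Z k)) \<longlonglongrightarrow> c $ i *s w i + (\<Sum>i\<in>S. c $ i *s w i)"
        by (intro tendsto_add bounded_linear.tendsto[OF vscale_bounded_linear] w Z(3))
      ultimately show ?thesis using insert by simp
    qed
    ultimately show ?case by blast
  qed
  have "(norm (L0 \<Psi> f - C *v c0 f))\<^sup>2 \<le> hform \<Psi> f f" if f: "f \<in> H2" for f
  proof -
    define c where "c = c0 f"
    obtain Z where Z: "wn Z" "\<And>k. c0 (Z k) = (\<Sum>i\<in>UNIV. c $ i *s axis i 1)" "(\<lambda>k. L0 \<Psi> (Z k)) \<longlonglongrightarrow> (\<Sum>i\<in>UNIV. c $ i *s w i)"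
      using combo[OF finite[of UNIV]] by blast
    have ZH: "Z k \<in> H2" for k by (rule wnH[OF Z(1)])
    have "(\<Sum>i\<in>UNIV. c $ i *s axis i 1) = c" by (simp add: vec_eq_iff axis_def if_distrib cong: if_cong)
    then have Zc: "c0 (Z k) = c" for k using Z(2) by simp
    have fZ: "f - Z k \<in> zH2" for k
    proof -
      have "f - Z k \<in> H2" by (rule Q.closed(2)[OF f ZH])
      moreover have "c0 (f - Z k) = 0" unfolding fun_diff_def c0_diff[OF H2_L2[OF f] H2_L2[OF ZH]] Zc by (simp add: c_def)
      ultimately show ?thesis by (simp add: zH2_def)
    qed
    have cross: "(\<lambda>k. hform \<Psi> (f - Z k) (Z k)) \<longlonglongrightarrow> 0"
      by (rule Q.weak_null_cross[OF zH2_subset Z(1)[unfolded wn_def] f fZ])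
    have le: "(norm (L0 \<Psi> f - L0 \<Psi> (Z k)))\<^sup>2 \<le> hform \<Psi> f f - 2 * hform \<Psi> (f - Z k) (Z k)" for k
    proof -
      have zz: "f - Z k \<in> H2" "c0 (f - Z k) = 0" using fZ[of k] by (auto simp: zH2_def)
      have "L0 \<Psi> f - L0 \<Psi> (Z k) = L0 \<Psi> (f - Z k)" unfolding fun_diff_def L0_diff[OF P H2_L2[OF f] H2_L2[OF ZH]] ..
      then have "(norm (L0 \<Psi> f - L0 \<Psi> (Z k)))\<^sup>2 \<le> hform \<Psi> (f - Z k) (f - Z k)" using L0_bound_shift[OF P H zz] by simp
      also have "\<dots> = hform \<Psi> ((f - Z k) + Z k) ((f - Z k) + Z k) - 2 * hform \<Psi> (f - Z k) (Z k) - hform \<Psi> (Z k) (Z k)"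
        unfolding Q.square_add[OF zz(1) ZH] by simp
      also have "\<dots> \<le> hform \<Psi> f f - 2 * hform \<Psi> (f - Z k) (Z k)" using Q.nonneg[OF ZH, of k] by simp
      finally show ?thesis .
    qed
    have "(\<lambda>k. (norm (L0 \<Psi> f - L0 \<Psi> (Z k)))\<^sup>2) \<longlonglongrightarrow> (norm (L0 \<Psi> f - C *v c))\<^sup>2"
      unfolding Cmul by (intro tendsto_intros Z(3))
    moreover have "(\<lambda>k. hform \<Psi> f f - 2 * hform \<Psi> (f - Z k) (Z k)) \<longlonglongrightarrow> hform \<Psi> f f - 2 * 0"
      by (intro tendsto_intros cross)
    ultimately have "(norm (L0 \<Psi> f - C *v c))\<^sup>2 \<le> hform \<Psi> f f - 2 * 0"
      by (rule LIMSEQ_le) (use le in blast)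
    then show ?thesis by (simp add: c_def)
  qed
  then show ?thesis using hankel_contractive_step_iff[OF P] by blast
qed

section \<open>Operator norms and bounded analytic matrix functions\<close>

lemma mat_axis_nth: "(A *v axis i 1) $ a = (A $ a $ i :: complex)"
  by (simp add: matrix_vector_mult_def axis_def if_distrib cong: if_cong)

lemma norm_axis_one: "norm (axis i (1::complex)) = 1"
  proof -
  have "(norm (axis i (1::complex) $ j))\<^sup>2 = (if j = i then 1 else 0)" for j by (simp add: axis_def)
  then show ?thesis by (simp add: norm_vec_def L2_set_def)
qed

lemma norm_mat_entry_le:
  assumes "\<And>x. norm (A *v x) \<le> c * norm x" shows "norm ((A :: complex^'n^'m) $ a $ i) \<le> c"
proof -
  have "norm (A $ a $ i) = norm ((A *v axis i 1) $ a)" by (simp add: mat_axis_nth)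
  also have "\<dots> \<le> norm (A *v axis i 1)" by (rule Finite_Cartesian_Product.norm_nth_le)
  also have "\<dots> \<le> c * norm (axis i (1::complex))" by (rule assms)
  finally show ?thesis by (simp add: norm_axis_one)
qed

lemma norm_mat_le_sum: "norm ((A :: complex^'n^'m) *v x) \<le> (\<Sum>a\<in>UNIV. \<Sum>i\<in>UNIV. norm (A $ a $ i)) * norm x"
proof -
  have "norm (A *v x) \<le> (\<Sum>a\<in>UNIV. norm ((A *v x) $ a))"
    unfolding norm_vec_def by (rule L2_set_le_sum) simp
  also have "\<dots> \<le> (\<Sum>a\<in>UNIV. \<Sum>i\<in>UNIV. norm (A $ a $ i) * norm x)"
  proof (rule sum_mono)
    fix a
    have "norm ((A *v x) $ a) \<le> (\<Sum>i\<in>UNIV. norm (A $ a $ i * x $ i))"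
      unfolding matrix_vector_mult_def vec_lambda_beta by (rule norm_sum)
    also have "\<dots> \<le> (\<Sum>i\<in>UNIV. norm (A $ a $ i) * norm x)"
      unfolding norm_mult by (intro sum_mono mult_left_mono Finite_Cartesian_Product.norm_nth_le) simp
    finally show "norm ((A *v x) $ a) \<le> (\<Sum>i\<in>UNIV. norm (A $ a $ i) * norm x)" .
  qed
  finally show ?thesis by (simp add: sum_distrib_right)
qed

text \<open>The operator norm is continuous in the matrix, since it is a seminorm dominated by the sum of the moduli of the entries.\<close>

lemma onorm_measurable:
  assumes F: "F \<in> borel_measurable M" shows "(\<lambda>\<zeta>. onorm ((*v) (F \<zeta> :: complex^'n^'m))) \<in> borel_measurable M"
proof (rule measurable_compose[OF F borel_measurable_continuous_onI])
  let ?S = "\<lambda>A :: complex^'n^'m. \<Sum>a\<in>UNIV. \<Sum>i\<in>UNIV. norm (A $ a $ i)"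
  have le: "onorm ((*v) A) \<le> onorm ((*v) B) + ?S (A - B)" for A B :: "complex^'n^'m"
  proof (rule onorm_bound)
    show "0 \<le> onorm ((*v) B) + ?S (A - B)"
      by (intro add_nonneg_nonneg onorm_pos_le mat_bounded_linear sum_nonneg) simp
    fix x
    have "A *v x = B *v x + (A - B) *v x" by (simp add: matrix_vector_mult_diff_rdistrib)
    then have "norm (A *v x) \<le> onorm ((*v) B) * norm x + ?S (A - B) * norm x"
      using onorm[OF mat_bounded_linear, of B x] norm_mat_le_sum[of "A - B" x]
      by (metis norm_triangle_le add_mono)
    then show "norm (A *v x) \<le> (onorm ((*v) B) + ?S (A - B)) * norm x" by (simp only: distrib_right)
  qed
  show "continuous_on UNIV (\<lambda>A :: complex^'n^'m. onorm ((*v) A))"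
    unfolding continuous_on_def
  proof
    fix B :: "complex^'n^'m"
    have "((\<lambda>A. ?S (A - B)) \<longlongrightarrow> ?S (B - B)) (at B within UNIV)"
      by (intro tendsto_intros)
    then have S0: "((\<lambda>A. ?S (A - B)) \<longlongrightarrow> 0) (at B within UNIV)" by simp
    have "((\<lambda>A. onorm ((*v) A) - onorm ((*v) B)) \<longlongrightarrow> 0) (at B within UNIV)"
    proof (rule Lim_null_comparison[OF _ S0], rule always_eventually, rule allI)
      fix A :: "complex^'n^'m"
      have "?S (B - A) = ?S (A - B)" by (simp add: norm_minus_commute)
      then show "norm (onorm ((*v) A) - onorm ((*v) B)) \<le> ?S (A - B)" using le[of A B] le[of B A] by simp
    qed
    then show "((\<lambda>A. onorm ((*v) A)) \<longlongrightarrow> onorm ((*v) B)) (at B within UNIV)" by (rule LIM_zero_cancel)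
  qed
qed

lemma onorm_le_iff: "0 \<le> c \<Longrightarrow> onorm ((*v) (A :: complex^'n^'m)) \<le> c \<longleftrightarrow> (\<forall>x. norm (A *v x) \<le> c * norm x)"
proof
  assume "onorm ((*v) A) \<le> c"
  then show "\<forall>x. norm (A *v x) \<le> c * norm x"
    using onorm[OF mat_bounded_linear, of A] by (meson mult_right_mono norm_ge_zero order_trans)
qed (auto intro: onorm_bound)

lemma Linf_norm_le_iff:
  assumes F: "F \<in> borel_measurable circle" and c: "0 \<le> c"
  shows "Linf_norm F \<le> ennreal c \<longleftrightarrow> (AE \<zeta> in circle. \<forall>x. norm (F \<zeta> *v x) \<le> c * norm x)"
proof -
  have m: "(\<lambda>\<zeta>. ennreal (onorm ((*v) (F \<zeta>)))) \<in> borel_measurable circle"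
    using onorm_measurable[OF F] by measurable
  have "Linf_norm F \<le> ennreal c \<longleftrightarrow> (AE \<zeta> in circle. ennreal (onorm ((*v) (F \<zeta>))) \<le> ennreal c)"
  proof
    assume "Linf_norm F \<le> ennreal c"
    moreover have "AE \<zeta> in circle. ennreal (onorm ((*v) (F \<zeta>))) \<le> Linf_norm F"
      unfolding Linf_norm_def by (rule esssup_AE)
    ultimately show "AE \<zeta> in circle. ennreal (onorm ((*v) (F \<zeta>))) \<le> ennreal c" by (auto elim: eventually_mono)
  next
    assume "AE \<zeta> in circle. ennreal (onorm ((*v) (F \<zeta>))) \<le> ennreal c"
    then show "Linf_norm F \<le> ennreal c" unfolding Linf_norm_def by (rule esssup_I[OF m])
  qed
  then show ?thesis using c by (simp add: ennreal_le_iff onorm_le_iff)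
qed

lemma Linf_eq_ess_bounded: "Linf = ess_bounded"
proof (intro set_eqI iffI)
  fix F :: "complex \<Rightarrow> complex^'n^'m"
  assume F: "F \<in> Linf"
  then have m: "F \<in> borel_measurable circle" and "Linf_norm F < \<infinity>" by (auto simp: Linf_def)
  then obtain c where "0 \<le> c" "Linf_norm F = ennreal c" by (cases "Linf_norm F") auto
  then show "F \<in> ess_bounded" using Linf_norm_le_iff[OF m, of c] m by (auto simp: ess_bounded_def)
next
  fix F :: "complex \<Rightarrow> complex^'n^'m"
  assume F: "F \<in> ess_bounded"
  then obtain c where m: "F \<in> borel_measurable circle" and c: "AE \<zeta> in circle. \<forall>x. norm (F \<zeta> *v x) \<le> c * norm x"
    by (auto simp: ess_bounded_def)
  have "AE \<zeta> in circle. \<forall>x. norm (F \<zeta> *v x) \<le> \<bar>c\<bar> * norm x"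
    using c by eventually_elim (meson abs_ge_self mult_right_mono norm_ge_zero order_trans)
  then have "Linf_norm F \<le> ennreal \<bar>c\<bar>" using Linf_norm_le_iff[OF m, of "\<bar>c\<bar>"] by simp
  then show "F \<in> Linf" using m by (auto simp: Linf_def intro: le_less_trans)
qed

lemma mat_entry_measurable: "F \<in> borel_measurable M \<Longrightarrow> (\<lambda>\<zeta>. F \<zeta> $ a $ i) \<in> borel_measurable M"
  by (intro vec_nth_measurable_comp)

lemma Hinf_I:
  fixes F :: "complex \<Rightarrow> complex^'n^'m"
  assumes bdh: "\<And>a i. bdh (\<lambda>\<zeta>. F \<zeta> $ a $ i) (G a i)"
  shows "F \<in> Hinf"
proof -
  have "(\<lambda>\<zeta>. \<chi> a i. F \<zeta> $ a $ i) \<in> borel_measurable circle"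
    by (intro vec_lambda_measurable bdh_measurable[OF bdh])
  then have m: "F \<in> borel_measurable circle" by simp
  have "\<forall>a i. \<exists>C. (\<forall>z\<in>ball 0 1. norm (G a i z) \<le> C) \<and> (AE \<zeta> in circle. norm (F \<zeta> $ a $ i) \<le> C)"
    using bdh_bounded[OF bdh] by metis
  then obtain C where C: "\<And>a i z. z \<in> ball 0 1 \<Longrightarrow> norm (G a i z) \<le> C a i"
     "\<And>a i. AE \<zeta> in circle. norm (F \<zeta> $ a $ i) \<le> C a i" by metis
  have "AE \<zeta> in circle. \<forall>a\<in>UNIV. \<forall>i\<in>UNIV. norm (F \<zeta> $ a $ i) \<le> C a i"
    by (intro AE_finite_allI finite C(2))
  then have "AE \<zeta> in circle. \<forall>x. norm (F \<zeta> *v x) \<le> (\<Sum>a\<in>UNIV. \<Sum>i\<in>UNIV. C a i) * norm x"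
  proof eventually_elim
    case (elim \<zeta>)
    then show ?case
      by (intro allI order_trans[OF norm_mat_le_sum] mult_right_mono sum_mono) auto
  qed
  then have "F \<in> Linf" unfolding Linf_eq_ess_bounded ess_bounded_def using m by blast
  moreover define GG where "GG = (\<lambda>z. (\<chi> a i. G a i z) :: complex^'n^'m)"
  have "\<forall>i j. (\<lambda>z. GG z $ i $ j) holomorphic_on ball 0 1" using bdh by (simp add: GG_def bdh_def)
  moreover have "bounded (GG ` ball 0 1)"
    unfolding bounded_iff
  proof (intro exI ballI)
    fix A assume "A \<in> GG ` ball 0 1"
    then obtain z where z: "z \<in> ball 0 1" "A = GG z" by auto
    have "norm A \<le> (\<Sum>a\<in>UNIV. norm (A $ a))" unfolding norm_vec_def[of A] by (rule L2_set_le_sum) simp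
    also have "\<dots> \<le> (\<Sum>a\<in>UNIV. \<Sum>i\<in>UNIV. C a i)"
    proof (rule sum_mono)
      fix a
      have "norm (A $ a) \<le> (\<Sum>i\<in>UNIV. norm (A $ a $ i))" unfolding norm_vec_def[of "A $ a"] by (rule L2_set_le_sum) simp
      also have "\<dots> \<le> (\<Sum>i\<in>UNIV. C a i)" using C(1)[OF z(1)] z(2) by (intro sum_mono) (simp add: GG_def)
      finally show "norm (A $ a) \<le> (\<Sum>i\<in>UNIV. C a i)" .
    qed
    finally show "norm A \<le> (\<Sum>a\<in>UNIV. \<Sum>i\<in>UNIV. C a i)" .
  qed
  moreover have "AE \<zeta> in circle. ((\<lambda>r. GG (complex_of_real r * \<zeta>)) \<longlongrightarrow> F \<zeta>) (at_left 1)"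
  proof -
    have "AE \<zeta> in circle. \<forall>a\<in>UNIV. \<forall>i\<in>UNIV. ((\<lambda>r. G a i (of_real r * \<zeta>)) \<longlongrightarrow> F \<zeta> $ a $ i) (at_left 1)"
      by (intro AE_finite_allI finite bdh_radial bdh)
    then show ?thesis by eventually_elim (intro vec_tendstoI, simp add: GG_def)
  qed
  ultimately show ?thesis unfolding Hinf_def by blast
qed

lemma Hinf_D:
  fixes F :: "complex \<Rightarrow> complex^'n^'m"
  assumes "F \<in> Hinf" obtains G where "\<And>a i. bdh (\<lambda>\<zeta>. F \<zeta> $ a $ i) (G a i)"
proof -
  obtain G where G: "\<forall>i j. (\<lambda>z. G z $ i $ j) holomorphic_on ball 0 1" "bounded (G ` ball 0 1)"
     "AE \<zeta> in circle. ((\<lambda>r. G (complex_of_real r * \<zeta>)) \<longlongrightarrow> F \<zeta>) (at_left 1)" and m: "F \<in> borel_measurable circle"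
    using assms by (auto simp: Hinf_def Linf_def)
  obtain K where K: "\<And>z. z \<in> ball 0 1 \<Longrightarrow> norm (G z) \<le> K" using G(2) unfolding bounded_iff by blast
  have "bdh (\<lambda>\<zeta>. F \<zeta> $ a $ i) (\<lambda>z. G z $ a $ i)" for a i
    unfolding bdh_def
  proof (intro conjI)
    show "(\<lambda>\<zeta>. F \<zeta> $ a $ i) \<in> borel_measurable circle" by (rule mat_entry_measurable[OF m])
    show "(\<lambda>z. G z $ a $ i) holomorphic_on ball 0 1" using G(1) by simp
    show "\<exists>C. \<forall>z\<in>ball 0 1. norm (G z $ a $ i) \<le> C"
    proof (intro exI[of _ K] ballI)
      fix z assume "z \<in> ball (0::complex) 1"
      then show "norm (G z $ a $ i) \<le> K"
        using order_trans[OF Finite_Cartesian_Product.norm_nth_le[of "G z $ a" i] Finite_Cartesian_Product.norm_nth_le[of "G z" a]] K order_trans by blast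
    qed
    show "AE \<zeta> in circle. ((\<lambda>r. G (complex_of_real r * \<zeta>) $ a $ i) \<longlongrightarrow> F \<zeta> $ a $ i) (at_left 1)"
      using G(3) by eventually_elim (intro tendsto_vec_nth)
  qed
  then show ?thesis by (rule that)
qed

section \<open>Nehari's theorem\<close>

text \<open>\<open>C N\<close> will be the Taylor coefficient of index \<open>N\<close> of the approximating function.\<close>

lemma step_sequence:
  fixes \<Psi> :: "complex \<Rightarrow> complex^'n^'m"
  assumes P: "\<Psi> \<in> ess_bounded" and H: "hankel_contractive \<Psi>"
  shows "\<exists>Psi C. Psi 0 = \<Psi> \<and> (\<forall>N. Psi (Suc N) = step (Psi N) (C N)) \<and> (\<forall>N. Psi N \<in> ess_bounded \<and> hankel_contractive (Psi N))"
proof -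
  define pick where "pick = (\<lambda>P :: complex \<Rightarrow> complex^'n^'m. SOME C. hankel_contractive (step P C))"
  define Psi where "Psi = rec_nat \<Psi> (\<lambda>_ P. step P (pick P))"
  have 0: "Psi 0 = \<Psi>" and S: "\<And>N. Psi (Suc N) = step (Psi N) (pick (Psi N))" by (simp_all add: Psi_def)
  have "Psi N \<in> ess_bounded \<and> hankel_contractive (Psi N)" for N
  proof (induction N)
    case 0
    then show ?case using P H by (simp add: \<open>Psi 0 = \<Psi>\<close>)
  next
    case (Suc N)
    then have "hankel_contractive (step (Psi N) (pick (Psi N)))"
      unfolding pick_def using someI_ex[OF parrott_step[of "Psi N"]] by simp
    then show ?case unfolding S using step_ess_bounded Suc by blast
  qed
  then show ?thesis using 0 S by (intro exI[of _ Psi] exI[of _ "\<lambda>N. pick (Psi N)"] conjI allI) simp_all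
qed

lemma step_sequence_formula:
  fixes Psi :: "nat \<Rightarrow> complex \<Rightarrow> complex^'n^'m"
  assumes S: "\<And>N. Psi (Suc N) = step (Psi N) (C N)" and z: "norm \<zeta> = 1"
  shows "Psi N \<zeta> *v x = (cnj \<zeta> ^ N) *s (Psi 0 \<zeta> *v x - (\<Sum>j<N. \<zeta> ^ j *s (C j *v x)))"
proof (induction N)
  case (Suc N)
  have "\<zeta> * cnj \<zeta> = 1" using z by (simp flip: complex_norm_square)
  then have one: "cnj \<zeta> ^ N * \<zeta> ^ N = 1" by (simp flip: power_mult_distrib add: mult.commute)
  have alg: "cnj \<zeta> * (cnj \<zeta> ^ N * y - c) = cnj \<zeta> ^ Suc N * (y - \<zeta> ^ N * c)" for y c
  proof -
    have "cnj \<zeta> ^ Suc N * (y - \<zeta> ^ N * c) = cnj \<zeta> * (cnj \<zeta> ^ N * y - (cnj \<zeta> ^ N * \<zeta> ^ N) * c)"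
      by (simp add: algebra_simps)
    then show ?thesis unfolding one mult_1_left by (rule sym)
  qed
  have "Psi (Suc N) \<zeta> *v x = cnj \<zeta> *s (cnj \<zeta> ^ N *s (Psi 0 \<zeta> *v x - (\<Sum>j<N. \<zeta> ^ j *s (C j *v x))) - C N *v x)"
    unfolding S step_mult Suc.IH ..
  also have "\<dots> = (cnj \<zeta> ^ Suc N) *s ((Psi 0 \<zeta> *v x - (\<Sum>j<N. \<zeta> ^ j *s (C j *v x))) - \<zeta> ^ N *s (C N *v x))"
    unfolding vec_eq_iff by (simp only: vector_smult_component vector_minus_component alg simp_thms)
  also have "\<dots> = (cnj \<zeta> ^ Suc N) *s (Psi 0 \<zeta> *v x - (\<Sum>j<Suc N. \<zeta> ^ j *s (C j *v x)))" by (simp add: algebra_simps)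
  finally show ?case .
qed simp

lemma ess_bounded_entry_bounded:
  fixes \<Psi> :: "complex \<Rightarrow> complex^'n^'m"
  assumes P: "\<Psi> \<in> ess_bounded" obtains c where "AE \<zeta> in circle. norm (\<Psi> \<zeta> $ a $ i) \<le> c"
proof -
  obtain c where c: "AE \<zeta> in circle. \<forall>x. norm (\<Psi> \<zeta> *v x) \<le> c * norm x" using P by (auto simp: ess_bounded_def)
  have "AE \<zeta> in circle. norm (\<Psi> \<zeta> $ a $ i) \<le> c" using c by eventually_elim (rule norm_mat_entry_le, blast)
  then show ?thesis by (rule that)
qed

lemma ess_bounded_entry_sqi:
  fixes \<Psi> :: "complex \<Rightarrow> complex^'n^'m"
  assumes P: "\<Psi> \<in> ess_bounded" shows "sqi (\<lambda>\<zeta>. \<Psi> \<zeta> $ a $ i)"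
proof -
  obtain c where "AE \<zeta> in circle. norm (\<Psi> \<zeta> $ a $ i) \<le> c" using ess_bounded_entry_bounded[OF P] by blast
  then show ?thesis using P by (intro sqi_bounded mat_entry_measurable) (auto simp: ess_bounded_def)
qed

text \<open>The column of \<open>Psi N\<close> applied to a constant vector has, at the frequencies \<open>-N, \<dots>, -1\<close>, the
differences between the Fourier coefficients of \<open>\<Psi>\<close> and the chosen coefficients. Contractivity of the
Hankel operator bounds them in square sum by one, and Bessel's inequality bounds those of \<open>\<Psi>\<close>.\<close>

lemma step_coefficients_bound:
  fixes Psi :: "nat \<Rightarrow> complex \<Rightarrow> complex^'n^'m"
  assumes S: "\<And>N. Psi (Suc N) = step (Psi N) (C N)" and PL: "\<And>N. Psi N \<in> ess_bounded" and H: "\<And>N. hankel_contractive (Psi N)"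
  shows "(\<Sum>j<N. (norm (C j $ a $ i))\<^sup>2) \<le> 2 * (LINT \<zeta>|circle. (norm (Psi 0 \<zeta> $ a $ i))\<^sup>2) + 2"
proof -
  define e :: "complex^'n" where "e = axis i 1"
  define h where "h = mv (Psi N) (\<lambda>_. e)"
  define \<beta> where "\<beta> = (\<lambda>j. fc (\<lambda>\<zeta>. Psi 0 \<zeta> $ a $ i) (int j))"
  have hL: "h \<in> L2" unfolding h_def by (rule mv_L2[OF PL const_L2])
  have sP: "sqi (\<lambda>\<zeta>. Psi 0 \<zeta> $ a $ i)" by (rule ess_bounded_entry_sqi[OF PL])
  define c where "c = (\<lambda>k::int. C (nat k) $ a $ i)"
  have hform: "h \<zeta> $ a = \<zeta> powi (- int N) * (Psi 0 \<zeta> $ a $ i - (\<Sum>k\<in>int ` {..<N}. c k * \<zeta> powi k))" if z: "norm \<zeta> = 1" for \<zeta>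
  proof -
    have "h \<zeta> $ a = cnj \<zeta> ^ N * (Psi 0 \<zeta> $ a $ i - (\<Sum>j<N. \<zeta> ^ j * C j $ a $ i))"
      unfolding h_def mv_def step_sequence_formula[of Psi C \<zeta> N, OF S z] e_def
      by (simp only: vector_smult_component vector_minus_component sum_component mat_axis_nth)
    also have "(\<Sum>j<N. \<zeta> ^ j * C j $ a $ i) = (\<Sum>k\<in>int ` {..<N}. c k * \<zeta> powi k)"
      by (subst sum.reindex) (simp_all add: c_def mult.commute)
    finally show ?thesis unfolding power_int_on_circle[OF z] .
  qed
  have coeff: "fc (\<lambda>\<zeta>. h \<zeta> $ a) (int j - int N) = \<beta> j - C j $ a $ i" if "j < N" for j
  proof -
    have "fc (\<lambda>\<zeta>. h \<zeta> $ a) (int j - int N)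
       = fc (\<lambda>\<zeta>. \<zeta> powi (- int N) * (Psi 0 \<zeta> $ a $ i - (\<Sum>k\<in>int ` {..<N}. c k * \<zeta> powi k))) (int j - int N)"
      by (rule fc_cong[OF hform])
    also have "\<dots> = fc (\<lambda>\<zeta>. Psi 0 \<zeta> $ a $ i - (\<Sum>k\<in>int ` {..<N}. c k * \<zeta> powi k)) (int j)"
      unfolding fc_shift by simp
    also have "\<dots> = \<beta> j - fc (\<lambda>\<zeta>. \<Sum>k\<in>int ` {..<N}. c k * \<zeta> powi k) (int j)"
      unfolding \<beta>_def by (rule fc_diff[OF sqi_integrable[OF sP] sqi_integrable[OF sqi_trig_poly]])
    also have "fc (\<lambda>\<zeta>. \<Sum>k\<in>int ` {..<N}. c k * \<zeta> powi k) (int j) = C j $ a $ i"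
      using that by (subst fc_trig_poly) (simp_all add: c_def)
    finally show ?thesis .
  qed
  define m where "m = hankel_part (Psi N) (\<lambda>_. e)"
  have mH: "m \<in> H2_minus" unfolding m_def by (rule hankel_part_H2_minus[OF PL const_L2])
  have sm: "sqi (\<lambda>\<zeta>. m \<zeta> $ a)" using H2_minus_L2[OF mH] by (simp add: L2_iff_sqi sqi_nth)
  have mcoeff: "fc (\<lambda>\<zeta>. m \<zeta> $ a) k = fc (\<lambda>\<zeta>. h \<zeta> $ a) k" if k: "k < 0" for k
  proof -
    have p: "L2_proj H2 h \<in> H2" by (rule L2_proj_H2(1)[OF hL])
    have "fc (\<lambda>\<zeta>. m \<zeta> $ a) k = fc (\<lambda>\<zeta>. h \<zeta> $ a) k - fc (\<lambda>\<zeta>. L2_proj H2 h \<zeta> $ a) k"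
      unfolding m_def hankel_part_def h_def[symmetric] Pm_def vector_minus_component
      using hL p by (intro fc_diff sqi_nth_integrable) (simp_all add: L2_iff_sqi H2_sqi)
    then show ?thesis using H2_fc[OF p k] by simp
  qed
  have inj: "inj_on (\<lambda>j. int j - int N) {..<N}" by (rule inj_onI) simp
  have "(\<Sum>j<N. (norm (\<beta> j - C j $ a $ i))\<^sup>2) = (\<Sum>k\<in>(\<lambda>j. int j - int N) ` {..<N}. (norm (fc (\<lambda>\<zeta>. m \<zeta> $ a) k))\<^sup>2)"
    by (subst sum.reindex[OF inj]) (simp add: mcoeff coeff)
  also have "\<dots> \<le> (LINT \<zeta>|circle. (norm (m \<zeta> $ a))\<^sup>2)" by (rule bessel[OF _ sm]) simp
  also have "\<dots> \<le> (LINT \<zeta>|circle. (norm (m \<zeta>))\<^sup>2)"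
    using sm H2_minus_L2[OF mH] by (intro integral_mono) (simp_all add: sqi_def L2_def power_mono Finite_Cartesian_Product.norm_nth_le)
  also have "\<dots> = ip m m" by (simp add: ip_square)
  also have "\<dots> \<le> ip (\<lambda>_. e) (\<lambda>_. e)" unfolding m_def using H[of N, unfolded hankel_contractive_def] H2_const by (rule bspec)
  also have "\<dots> = 1" by (simp add: ip_const e_def dot_square_norm norm_axis_one)
  finally have 1: "(\<Sum>j<N. (norm (\<beta> j - C j $ a $ i))\<^sup>2) \<le> 1" .
  have "(\<Sum>j<N. (norm (\<beta> j))\<^sup>2) = (\<Sum>k\<in>int ` {..<N}. (norm (fc (\<lambda>\<zeta>. Psi 0 \<zeta> $ a $ i) k))\<^sup>2)"
    by (subst sum.reindex) (simp_all add: \<beta>_def)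
  also have "\<dots> \<le> (LINT \<zeta>|circle. (norm (Psi 0 \<zeta> $ a $ i))\<^sup>2)" by (rule bessel[OF _ sP]) simp
  finally have 2: "(\<Sum>j<N. (norm (\<beta> j))\<^sup>2) \<le> (LINT \<zeta>|circle. (norm (Psi 0 \<zeta> $ a $ i))\<^sup>2)" .
  have "(norm (C j $ a $ i))\<^sup>2 \<le> 2 * (norm (\<beta> j))\<^sup>2 + 2 * (norm (\<beta> j - C j $ a $ i))\<^sup>2" for j
    using norm_add_square_le[of "\<beta> j" "- (\<beta> j - C j $ a $ i)"] by (simp add: norm_minus_commute)
  then have "(\<Sum>j<N. (norm (C j $ a $ i))\<^sup>2) \<le> (\<Sum>j<N. 2 * (norm (\<beta> j))\<^sup>2 + 2 * (norm (\<beta> j - C j $ a $ i))\<^sup>2)"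
    by (rule sum_mono)
  also have "\<dots> = 2 * (\<Sum>j<N. (norm (\<beta> j))\<^sup>2) + 2 * (\<Sum>j<N. (norm (\<beta> j - C j $ a $ i))\<^sup>2)"
    by (simp only: sum.distrib sum_distrib_left)
  finally show ?thesis using 1 2 by linarith
qed

lemma sqi_cmult:
  fixes f :: "complex \<Rightarrow> complex" assumes f: "sqi f" shows "sqi (\<lambda>\<zeta>. c * f \<zeta>)"
proof (rule sqi_bounded_image[OF f, of _ "norm c"])
  have "f \<in> borel_measurable circle" using f by (simp add: sqi_def)
  then show "(\<lambda>\<zeta>. c * f \<zeta>) \<in> borel_measurable circle" by (intro borel_measurable_times) simp_all
qed (simp add: norm_mult)

text \<open>Convergence to zero in the mean of order two; the members are required to be square integrable.\<close>

definition l2null :: "(nat \<Rightarrow> complex \<Rightarrow> 'b::euclidean_space) \<Rightarrow> bool" where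
  "l2null u \<longleftrightarrow> (\<forall>n. sqi (u n)) \<and> (\<lambda>n. LINT \<zeta>|circle. (norm (u n \<zeta>))\<^sup>2) \<longlonglongrightarrow> 0"

lemma l2null_le:
  assumes v: "\<And>n. sqi (v n)" and u: "l2null u" and le: "\<And>n \<zeta>. norm \<zeta> = 1 \<Longrightarrow> norm (v n \<zeta>) \<le> K * norm (u n \<zeta>)"
  shows "l2null v"
  unfolding l2null_def
proof (intro conjI allI v)
  have "(\<lambda>n. K\<^sup>2 * (LINT \<zeta>|circle. (norm (u n \<zeta>))\<^sup>2)) \<longlonglongrightarrow> K\<^sup>2 * 0"
    using u by (intro tendsto_mult tendsto_const) (simp add: l2null_def)
  then have lim: "(\<lambda>n. K\<^sup>2 * (LINT \<zeta>|circle. (norm (u n \<zeta>))\<^sup>2)) \<longlonglongrightarrow> 0" by simp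
  show "(\<lambda>n. LINT \<zeta>|circle. (norm (v n \<zeta>))\<^sup>2) \<longlonglongrightarrow> 0"
  proof (rule null_seq_squeeze[OF _ lim])
    fix n
    have "(LINT \<zeta>|circle. (norm (v n \<zeta>))\<^sup>2) \<le> (LINT \<zeta>|circle. K\<^sup>2 * (norm (u n \<zeta>))\<^sup>2)"
    proof (rule integral_mono)
      show "integrable circle (\<lambda>\<zeta>. (norm (v n \<zeta>))\<^sup>2)" using v by (simp add: sqi_def)
      show "integrable circle (\<lambda>\<zeta>. K\<^sup>2 * (norm (u n \<zeta>))\<^sup>2)" using u by (simp add: l2null_def sqi_def)
      show "(norm (v n \<zeta>))\<^sup>2 \<le> K\<^sup>2 * (norm (u n \<zeta>))\<^sup>2" if "\<zeta> \<in> space circle" for \<zeta>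
        unfolding power_mult_distrib[symmetric] using that by (intro power_mono le) simp_all
    qed
    then show "\<bar>LINT \<zeta>|circle. (norm (v n \<zeta>))\<^sup>2\<bar> \<le> K\<^sup>2 * (LINT \<zeta>|circle. (norm (u n \<zeta>))\<^sup>2)" by simp
  qed
qed

lemma l2null_add:
  assumes u: "l2null u" and v: "l2null v" shows "l2null (\<lambda>n \<zeta>. u n \<zeta> + v n \<zeta>)"
  unfolding l2null_def
proof (intro conjI allI)
  have s: "sqi (u n)" "sqi (v n)" for n using u v by (simp_all add: l2null_def)
  show s3: "sqi (\<lambda>\<zeta>. u n \<zeta> + v n \<zeta>)" for n by (rule sqi_add[OF s])
  have "(\<lambda>n. 2 * (LINT \<zeta>|circle. (norm (u n \<zeta>))\<^sup>2) + 2 * (LINT \<zeta>|circle. (norm (v n \<zeta>))\<^sup>2)) \<longlonglongrightarrow> 2 * 0 + 2 * 0"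
    using u v by (intro tendsto_intros) (simp_all add: l2null_def)
  then have lim: "(\<lambda>n. 2 * (LINT \<zeta>|circle. (norm (u n \<zeta>))\<^sup>2) + 2 * (LINT \<zeta>|circle. (norm (v n \<zeta>))\<^sup>2)) \<longlonglongrightarrow> 0" by simp
  show "(\<lambda>n. LINT \<zeta>|circle. (norm (u n \<zeta> + v n \<zeta>))\<^sup>2) \<longlonglongrightarrow> 0"
  proof (rule null_seq_squeeze[OF _ lim])
    fix n
    have i: "integrable circle (\<lambda>\<zeta>. (norm (u n \<zeta>))\<^sup>2)" "integrable circle (\<lambda>\<zeta>. (norm (v n \<zeta>))\<^sup>2)" using s by (simp_all add: sqi_def)
    have "(LINT \<zeta>|circle. (norm (u n \<zeta> + v n \<zeta>))\<^sup>2) \<le> (LINT \<zeta>|circle. 2 * (norm (u n \<zeta>))\<^sup>2 + 2 * (norm (v n \<zeta>))\<^sup>2)"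
      using s3[of n] i by (intro integral_mono norm_add_square_le) (simp_all add: sqi_def)
    then show "\<bar>LINT \<zeta>|circle. (norm (u n \<zeta> + v n \<zeta>))\<^sup>2\<bar>
      \<le> 2 * (LINT \<zeta>|circle. (norm (u n \<zeta>))\<^sup>2) + 2 * (LINT \<zeta>|circle. (norm (v n \<zeta>))\<^sup>2)" using i by simp
  qed
qed

lemma l2null_sum: "finite I \<Longrightarrow> (\<And>i. i \<in> I \<Longrightarrow> l2null (u i)) \<Longrightarrow> l2null (\<lambda>n \<zeta>. \<Sum>i\<in>I. u i n \<zeta>)"
proof (induction I rule: finite_induct)
  case empty
  then show ?case by (simp add: l2null_def sqi_def)
qed (simp add: l2null_add)

lemma l2null_vec:
  fixes u :: "nat \<Rightarrow> complex \<Rightarrow> complex^'m"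
  assumes u: "\<And>a. l2null (\<lambda>n \<zeta>. u n \<zeta> $ a)" shows "l2null u"
proof -
  have s: "sqi (\<lambda>\<zeta>. u n \<zeta> $ a)" for n a using u by (simp add: l2null_def)
  have i: "integrable circle (\<lambda>\<zeta>. (norm (u n \<zeta> $ a))\<^sup>2)" for n a using s by (simp add: sqi_def)
  have e: "(LINT \<zeta>|circle. (norm (u n \<zeta>))\<^sup>2) = (\<Sum>a\<in>UNIV. LINT \<zeta>|circle. (norm (u n \<zeta> $ a))\<^sup>2)" for n
    unfolding norm_vec_square by (rule Bochner_Integration.integral_sum[OF i])
  have "(\<lambda>\<zeta>. \<chi> a. u n \<zeta> $ a) \<in> borel_measurable circle" for n
    by (rule vec_lambda_measurable) (use s in \<open>simp add: sqi_def\<close>)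
  then have "sqi (u n)" for n unfolding sqi_def norm_vec_square using i by simp
  moreover have "(\<lambda>n. \<Sum>a\<in>UNIV. LINT \<zeta>|circle. (norm (u n \<zeta> $ a))\<^sup>2) \<longlonglongrightarrow> (\<Sum>a\<in>(UNIV::'m set). 0)"
    using u by (intro tendsto_sum) (simp add: l2null_def)
  ultimately show ?thesis unfolding l2null_def e by simp
qed

text \<open>The third fact says that the squared modulus of the Szego kernel is a constant multiple of the Poisson kernel; this is what turns inner products of Szego kernels into Poisson integrals.\<close>

lemma szego_bound:
  assumes z: "norm z < 1" and x: "norm \<zeta> = 1"
  shows "norm (1 / (1 - cnj z * \<zeta>)) \<le> 1 / (1 - norm z)"
    and "norm (1 / (1 - cnj z * \<zeta>) - (\<Sum>k<N. (cnj z * \<zeta>) ^ k)) \<le> norm z ^ N / (1 - norm z)"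
    and "(norm (1 / (1 - cnj z * \<zeta>)))\<^sup>2 = poisson_kernel z \<zeta> / (1 - (norm z)\<^sup>2)"
proof -
  have n: "norm (cnj z * \<zeta>) = norm z" using x by (simp add: norm_mult)
  then have ge: "1 - norm z \<le> norm (1 - cnj z * \<zeta>)"
    using norm_triangle_ineq2[of 1 "cnj z * \<zeta>"] by simp
  then show b: "norm (1 / (1 - cnj z * \<zeta>)) \<le> 1 / (1 - norm z)" using z by (simp add: norm_divide frac_le)
  have nz: "cnj z * \<zeta> \<noteq> 1" using n z by auto
  have "1 / (1 - cnj z * \<zeta>) - (\<Sum>k<N. (cnj z * \<zeta>) ^ k) = (cnj z * \<zeta>) ^ N * (1 / (1 - cnj z * \<zeta>))"
    unfolding geometric_sum[OF nz] using nz by (simp add: field_simps)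
  also have "norm \<dots> = norm z ^ N * norm (1 / (1 - cnj z * \<zeta>))" unfolding norm_mult[of "(cnj z * \<zeta>) ^ N"] norm_power n ..
  also have "\<dots> \<le> norm z ^ N * (1 / (1 - norm z))" by (intro mult_left_mono b) simp
  finally show "norm (1 / (1 - cnj z * \<zeta>) - (\<Sum>k<N. (cnj z * \<zeta>) ^ k)) \<le> norm z ^ N / (1 - norm z)" by simp
  have xx: "\<zeta> * cnj \<zeta> = 1" using x by (simp flip: complex_norm_square)
  have "\<zeta> - z = \<zeta> * cnj (1 - cnj z * \<zeta>)" using xx by (simp add: algebra_simps)
  then have "norm (\<zeta> - z) = norm (1 - cnj z * \<zeta>)" using x by (simp only: norm_mult complex_mod_cnj)
  moreover have "1 - (norm z)\<^sup>2 \<noteq> 0" using z norm_ge_zero[of z] by (auto simp: power2_eq_1_iff simp del: norm_ge_zero)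
  ultimately show "(norm (1 / (1 - cnj z * \<zeta>)))\<^sup>2 = poisson_kernel z \<zeta> / (1 - (norm z)\<^sup>2)"
    by (simp add: poisson_kernel_def norm_divide power_divide)
qed

lemma szego_H2:
  assumes z: "norm z < 1" shows "(\<lambda>\<zeta>. (1 / (1 - cnj z * \<zeta>)) *s v) \<in> H2"
proof (rule H2I)
  have m: "(\<lambda>\<zeta>. 1 / (1 - cnj z * \<zeta>)) \<in> borel_measurable circle" by measurable
  show "sqi (\<lambda>\<zeta>. (1 / (1 - cnj z * \<zeta>)) *s v)"
    by (rule sqi_vscale[OF sqi_const m szego_bound(1)[OF z]])
  fix i and k :: int assume k: "k < 0"
  have i: "integrable circle (\<lambda>\<zeta>. \<zeta> powi (- k))" using integrable_trig_poly[of "\<lambda>_. 1" "- k"] by simp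
  have "(\<lambda>j. cnj z ^ j * fc (\<lambda>\<zeta>. \<zeta> powi (- k)) (- int j)) sums (LINT \<zeta>|circle. (1 / (1 - cnj z * \<zeta>)) * \<zeta> powi (- k))"
  proof (rule power_series_integral[OF i])
    show "summable (\<lambda>j. norm (cnj z ^ j))" using z by (simp add: norm_power)
    fix \<zeta> :: complex assume "norm \<zeta> = 1"
    then have "norm (cnj z * \<zeta>) < 1" using z by (simp add: norm_mult)
    from geometric_sums[OF this] show "(\<lambda>j. cnj z ^ j * \<zeta> ^ j) sums (1 / (1 - cnj z * \<zeta>))" by (simp add: power_mult_distrib)
  qed
  moreover have "fc (\<lambda>\<zeta>. \<zeta> powi (- k)) (- int j) = 0" for j using k by (simp add: fc_power_int)
  ultimately have "(\<lambda>j::nat. 0) sums (LINT \<zeta>|circle. (1 / (1 - cnj z * \<zeta>)) * \<zeta> powi (- k))" by (simp only: mult_zero_right)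
  then have "(LINT \<zeta>|circle. (1 / (1 - cnj z * \<zeta>)) * \<zeta> powi (- k)) = 0" by (rule sums_unique2) (rule sums_zero)
  then have "fc (\<lambda>\<zeta>. 1 / (1 - cnj z * \<zeta>)) k = 0" by (simp add: fc_def mult.commute)
  then show "fc (\<lambda>\<zeta>. ((1 / (1 - cnj z * \<zeta>)) *s v) $ i) k = 0"
    using fc_mult_left[of "v $ i" "\<lambda>\<zeta>. 1 / (1 - cnj z * \<zeta>)" k] by (simp add: mult.commute)
qed

lemma cnj_power_H2_minus: "(\<lambda>\<zeta>. cnj \<zeta> ^ Suc N *s v) \<in> H2_minus"
proof (induction N)
  case 0
  have "(\<lambda>_. 0) \<in> H2_minus" using const_L2[of 0] by (simp add: H2_minus_iff ip_def)
  from H2_minus_backshift[OF this, of v] show ?case by simp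
next
  case (Suc N)
  from H2_minus_backshift[OF this, of 0] show ?case by (simp add: vector_smult_assoc)
qed

lemma H2_minus_sum: "finite I \<Longrightarrow> (\<And>i. i \<in> I \<Longrightarrow> f i \<in> H2_minus) \<Longrightarrow> (\<lambda>\<zeta>. \<Sum>i\<in>I. f i \<zeta>) \<in> H2_minus"
proof (induction I rule: finite_induct)
  case empty
  then show ?case using const_L2[of 0] by (simp add: H2_minus_iff ip_def)
qed (simp add: H2_minus_add)

lemma ip_cong: "(\<And>\<zeta>. norm \<zeta> = 1 \<Longrightarrow> f \<zeta> = f' \<zeta>) \<Longrightarrow> (\<And>\<zeta>. norm \<zeta> = 1 \<Longrightarrow> g \<zeta> = g' \<zeta>) \<Longrightarrow> ip f g = ip f' g'"
  unfolding ip_def by (rule Bochner_Integration.integral_cong) simp_all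

text \<open>Test the Hankel operator of \<open>Psi N\<close> on the Szego kernel at \<open>z\<close> times \<open>\<xi>\<close>, against \<open>cnj \<zeta> ^ N\<close> times a
partial sum of the Szego kernel times \<open>\<eta>\<close>; the latter lies in \<open>H2_minus\<close> because only powers below \<open>N\<close>
occur in the partial sum. The unimodular factors \<open>cnj \<zeta> ^ N\<close> cancel in the inner product, and in the
limit it becomes the Poisson integral at \<open>z\<close> of the pairing of \<open>D\<close> with \<open>\<eta>\<close>.\<close>

lemma hankel_kernel_estimate:
  fixes Psi :: "nat \<Rightarrow> complex \<Rightarrow> complex^'n^'m"
  assumes S: "\<And>N. Psi (Suc N) = step (Psi N) (C N)" and PL: "\<And>N. Psi N \<in> ess_bounded" and H: "\<And>N. hankel_contractive (Psi N)"
    and D: "l2null (\<lambda>N \<zeta>. (Psi 0 \<zeta> *v \<xi> - (\<Sum>j<N. \<zeta> ^ j *s (C j *v \<xi>))) - D \<zeta>)" and DL: "sqi D"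
    and z: "norm z < 1"
  shows "\<bar>LINT \<zeta>|circle. poisson_kernel z \<zeta> * (D \<zeta> \<bullet> \<eta>)\<bar> \<le> norm \<xi> * norm \<eta>"
proof -
  define s where "s = (\<lambda>\<zeta>. 1 / (1 - cnj z * \<zeta>))"
  define sN where "sN = (\<lambda>N \<zeta>. \<Sum>k<N. (cnj z * \<zeta>) ^ k)"
  define DN where "DN = (\<lambda>N \<zeta>. Psi 0 \<zeta> *v \<xi> - (\<Sum>j<N. \<zeta> ^ j *s (C j *v \<xi>)))"
  define f0 where "f0 = (\<lambda>\<zeta>. s \<zeta> *s \<xi>)"
  define gN where "gN = (\<lambda>N \<zeta>. \<Sum>k<N. cnj z ^ k *s (cnj \<zeta> ^ (N - k) *s \<eta>))"
  have sm: "s \<in> borel_measurable circle" unfolding s_def by measurable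
  have sNm: "sN N \<in> borel_measurable circle" for N unfolding sN_def by measurable
  have sb: "norm (s \<zeta>) \<le> 1 / (1 - norm z)" if "norm \<zeta> = 1" for \<zeta> unfolding s_def by (rule szego_bound(1)[OF z that])
  have f0H: "f0 \<in> H2" unfolding f0_def s_def by (rule szego_H2[OF z])
  have f0L: "f0 \<in> L2" by (rule H2_L2[OF f0H])
  have gNH: "gN N \<in> H2_minus" for N unfolding gN_def
  proof (rule H2_minus_sum)
    fix k assume "k \<in> {..<N}"
    then have "N - k = Suc (N - k - 1)" by simp
    then show "(\<lambda>\<zeta>. cnj z ^ k *s (cnj \<zeta> ^ (N - k) *s \<eta>)) \<in> H2_minus"
      using H2_minus_vscale[OF cnj_power_H2_minus] by metis
  qed simp
  have gN_eq: "gN N \<zeta> = cnj \<zeta> ^ N *s (sN N \<zeta> *s \<eta>)" if x: "norm \<zeta> = 1" for N \<zeta>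
  proof -
    have xx: "cnj \<zeta> * \<zeta> = 1" using x by (simp flip: complex_norm_square add: mult.commute)
    have "cnj z ^ k * cnj \<zeta> ^ (N - k) = cnj \<zeta> ^ N * (cnj z * \<zeta>) ^ k" if "k < N" for k
    proof -
      have "cnj \<zeta> ^ N = cnj \<zeta> ^ (N - k) * cnj \<zeta> ^ k" using that by (simp flip: power_add)
      then have "cnj \<zeta> ^ N * (cnj z * \<zeta>) ^ k = cnj z ^ k * cnj \<zeta> ^ (N - k) * (cnj \<zeta> * \<zeta>) ^ k"
        by (simp add: power_mult_distrib mult_ac)
      then show ?thesis by (simp add: xx)
    qed
    then have "gN N \<zeta> = (\<Sum>k<N. (cnj \<zeta> ^ N * (cnj z * \<zeta>) ^ k) *s \<eta>)"
      unfolding gN_def by (intro sum.cong) (simp_all add: vector_smult_assoc)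
    also have "\<dots> = cnj \<zeta> ^ N *s (sN N \<zeta> *s \<eta>)"
      unfolding sN_def by (simp add: vec_eq_iff sum_distrib_left sum_distrib_right mult_ac)
    finally show ?thesis .
  qed
  have DNL: "DN N \<in> L2" for N
  proof -
    have "(\<lambda>\<zeta>. mv (Psi 0) (\<lambda>_. \<xi>) \<zeta> - (\<Sum>j<N. \<zeta> ^ j *s (C j *v \<xi>))) \<in> L2"
    proof (rule L2_diff[OF mv_L2[OF PL const_L2]])
      have "sqi (\<lambda>\<zeta>. \<Sum>j\<in>J. \<zeta> ^ j *s (C j *v \<xi>))" if "finite J" for J :: "nat set" using that
      proof (induction J rule: finite_induct)
        case (insert j J)
        have "sqi (\<lambda>\<zeta>. \<zeta> ^ j *s (C j *v \<xi>))"
          by (rule sqi_vscale[OF sqi_const, where C = 1]) (auto simp: norm_power)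
        then show ?case using insert by (simp add: sqi_add)
      qed (simp add: sqi_const)
      then show "(\<lambda>\<zeta>. \<Sum>j<N. \<zeta> ^ j *s (C j *v \<xi>)) \<in> L2" by (simp add: L2_iff_sqi)
    qed
    then show ?thesis by (simp add: DN_def mv_def)
  qed
  have mvN: "mv (Psi N) f0 \<zeta> = cnj \<zeta> ^ N *s (s \<zeta> *s DN N \<zeta>)" if x: "norm \<zeta> = 1" for N \<zeta>
    unfolding mv_def f0_def vector_scalar_commute step_sequence_formula[of Psi C \<zeta> N, OF S x] DN_def
    by (simp add: vector_smult_assoc mult.commute)
  have cn: "norm (cnj \<zeta> ^ N) = 1" if "norm \<zeta> = 1" for \<zeta> N using that by (simp add: norm_power)
  define uN where "uN = (\<lambda>N \<zeta>. s \<zeta> *s DN N \<zeta>)"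
  define vN where "vN = (\<lambda>N \<zeta>. sN N \<zeta> *s \<eta>)"
  define u where "u = (\<lambda>\<zeta>. s \<zeta> *s D \<zeta>)"
  define v where "v = (\<lambda>\<zeta>. s \<zeta> *s \<eta>)"
  have est: "\<bar>ip (uN N) (vN N)\<bar> \<le> sqrt (ip f0 f0) * sqrt (ip (vN N) (vN N))" for N
  proof -
    have "ip (uN N) (vN N) = ip (\<lambda>\<zeta>. cnj \<zeta> ^ N *s uN N \<zeta>) (\<lambda>\<zeta>. cnj \<zeta> ^ N *s vN N \<zeta>)"
      by (rule ip_vscale[symmetric]) (rule cn)
    also have "\<dots> = ip (mv (Psi N) f0) (gN N)" by (rule ip_cong) (simp_all add: mvN gN_eq uN_def vN_def)
    also have "\<dots> = ip (hankel_part (Psi N) f0) (gN N)"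
      unfolding hankel_part_def using ip_H2_minus_Pm[OF gNH mv_L2[OF PL f0L]] by (simp add: ip_sym)
    finally have "\<bar>ip (uN N) (vN N)\<bar> \<le> sqrt (ip (hankel_part (Psi N) f0) (hankel_part (Psi N) f0)) * sqrt (ip (gN N) (gN N))"
      using L2.cauchy_schwarz_abs[OF H2_minus_L2[OF hankel_part_H2_minus[OF PL f0L]] H2_minus_L2[OF gNH]] by simp
    also have "\<dots> \<le> sqrt (ip f0 f0) * sqrt (ip (gN N) (gN N))"
      using H[of N] f0H L2.nonneg[OF H2_minus_L2[OF gNH]] by (intro mult_right_mono) (simp_all add: hankel_contractive_def)
    also have "ip (gN N) (gN N) = ip (\<lambda>\<zeta>. cnj \<zeta> ^ N *s vN N \<zeta>) (\<lambda>\<zeta>. cnj \<zeta> ^ N *s vN N \<zeta>)"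
      by (rule ip_cong) (simp_all add: gN_eq vN_def)
    also have "\<dots> = ip (vN N) (vN N)" by (rule ip_vscale) (rule cn)
    finally show ?thesis .
  qed
  have uL: "uN N \<in> L2" "u \<in> L2" for N
    using DNL DL unfolding uN_def u_def L2_iff_sqi by (auto intro!: sqi_vscale[OF _ sm sb])
  have vL: "vN N \<in> L2" "v \<in> L2" for N
  proof -
    have "norm (sN N \<zeta>) \<le> (\<Sum>k<N. 1)" if "norm \<zeta> = 1" for \<zeta>
      unfolding sN_def
    proof (rule sum_norm_le)
      fix k
      show "norm ((cnj z * \<zeta>) ^ k) \<le> 1" using z that by (simp add: norm_power norm_mult power_le_one)
    qed
    then show "vN N \<in> L2" unfolding vN_def L2_iff_sqi by (rule sqi_vscale[OF sqi_const sNm])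
    show "v \<in> L2" unfolding v_def L2_iff_sqi by (rule sqi_vscale[OF sqi_const sm sb])
  qed
  have u_lim: "(\<lambda>N. ip (uN N - u) (uN N - u)) \<longlonglongrightarrow> 0"
  proof -
    have "l2null (\<lambda>N \<zeta>. uN N \<zeta> - u \<zeta>)"
    proof (rule l2null_le[OF _ D])
      show "sqi (\<lambda>\<zeta>. uN N \<zeta> - u \<zeta>)" for N using L2_diff[OF uL] by (simp add: L2_iff_sqi)
      fix N and \<zeta> :: complex assume x: "norm \<zeta> = 1"
      have "uN N \<zeta> - u \<zeta> = s \<zeta> *s (DN N \<zeta> - D \<zeta>)" by (simp add: uN_def u_def vec_eq_iff algebra_simps)
      then have "norm (uN N \<zeta> - u \<zeta>) = norm (s \<zeta>) * norm (DN N \<zeta> - D \<zeta>)" by (simp only: norm_vscale)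
      also have "\<dots> \<le> 1 / (1 - norm z) * norm (DN N \<zeta> - D \<zeta>)" by (intro mult_right_mono sb[OF x]) simp
      finally show "norm (uN N \<zeta> - u \<zeta>) \<le> 1 / (1 - norm z) * norm (Psi 0 \<zeta> *v \<xi> - (\<Sum>j<N. \<zeta> ^ j *s (C j *v \<xi>)) - D \<zeta>)"
        by (simp only: DN_def)
    qed
    then show ?thesis by (simp add: l2null_def ip_square)
  qed
  have v_lim: "(\<lambda>N. ip (vN N - v) (vN N - v)) \<longlonglongrightarrow> 0"
  proof -
    have "(\<lambda>N. (norm z ^ N / (1 - norm z) * norm \<eta>)\<^sup>2) \<longlonglongrightarrow> (0 / (1 - norm z) * norm \<eta>)\<^sup>2"
      using z by (intro tendsto_intros LIMSEQ_power_zero) simp_all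
    then have lim: "(\<lambda>N. (norm z ^ N / (1 - norm z) * norm \<eta>)\<^sup>2) \<longlonglongrightarrow> 0" by simp
    show ?thesis
    proof (rule null_seq_squeeze[OF _ lim])
      fix N
      have d: "vN N - v \<in> L2" by (rule L2.closed(2)[OF vL])
      have "ip (vN N - v) (vN N - v) \<le> (LINT \<zeta>|circle. (norm z ^ N / (1 - norm z) * norm \<eta>)\<^sup>2)"
        unfolding ip_square
      proof (rule integral_mono)
        show "integrable circle (\<lambda>\<zeta>. (norm ((vN N - v) \<zeta>))\<^sup>2)" using d by (simp add: L2_def)
        fix \<zeta> assume "\<zeta> \<in> space circle"
        then have x: "norm \<zeta> = 1" by simp
        have "(vN N - v) \<zeta> = (sN N \<zeta> - s \<zeta>) *s \<eta>" by (simp add: vN_def v_def vec_eq_iff algebra_simps)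
        then have "norm ((vN N - v) \<zeta>) = norm (s \<zeta> - sN N \<zeta>) * norm \<eta>" by (simp only: norm_vscale norm_minus_commute)
        also have "\<dots> \<le> norm z ^ N / (1 - norm z) * norm \<eta>"
          unfolding s_def sN_def by (intro mult_right_mono szego_bound(2)[OF z x]) simp
        finally show "(norm ((vN N - v) \<zeta>))\<^sup>2 \<le> (norm z ^ N / (1 - norm z) * norm \<eta>)\<^sup>2" by (intro power_mono) simp_all
      qed simp
      then show "\<bar>ip (vN N - v) (vN N - v)\<bar> \<le> (norm z ^ N / (1 - norm z) * norm \<eta>)\<^sup>2"
        using L2.nonneg[OF d] circle.prob_space by simp
    qed
  qed
  have "(\<lambda>N. \<bar>ip (uN N) (vN N)\<bar>) \<longlonglongrightarrow> \<bar>ip u v\<bar>"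
    by (intro tendsto_rabs L2.form_tendsto uL vL u_lim v_lim)
  moreover have "(\<lambda>N. sqrt (ip f0 f0) * sqrt (ip (vN N) (vN N))) \<longlonglongrightarrow> sqrt (ip f0 f0) * sqrt (ip v v)"
    by (intro tendsto_mult tendsto_const tendsto_real_sqrt L2.form_tendsto vL v_lim)
  ultimately have main: "\<bar>ip u v\<bar> \<le> sqrt (ip f0 f0) * sqrt (ip v v)"
    by (rule LIMSEQ_le) (use est in blast)
  define q where "q = 1 / (1 - (norm z)\<^sup>2)"
  have q0: "0 < q" using z by (simp add: q_def power_less_one_iff abs_square_less_1)
  have s2: "(norm (s \<zeta>))\<^sup>2 = q * poisson_kernel z \<zeta>" if "norm \<zeta> = 1" for \<zeta>
    using szego_bound(3)[OF z that] by (simp add: s_def q_def)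
  have const: "ip (\<lambda>\<zeta>. s \<zeta> *s w) (\<lambda>\<zeta>. s \<zeta> *s w) = q * (norm w)\<^sup>2" for w :: "complex^'k"
  proof -
    have "ip (\<lambda>\<zeta>. s \<zeta> *s w) (\<lambda>\<zeta>. s \<zeta> *s w) = (LINT \<zeta>|circle. (q * (norm w)\<^sup>2) * poisson_kernel z \<zeta>)"
      unfolding ip_def by (rule Bochner_Integration.integral_cong) (simp_all add: inner_vscale s2 norm_vscale power_mult_distrib dot_square_norm)
    then show ?thesis using integral_poisson_kernel[OF z] by simp
  qed
  have "ip u v = (LINT \<zeta>|circle. q * (poisson_kernel z \<zeta> * (D \<zeta> \<bullet> \<eta>)))"
    unfolding ip_def u_def v_def by (rule Bochner_Integration.integral_cong) (simp_all add: inner_vscale s2)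
  then have "\<bar>ip u v\<bar> = q * \<bar>LINT \<zeta>|circle. poisson_kernel z \<zeta> * (D \<zeta> \<bullet> \<eta>)\<bar>" using q0 by (simp add: abs_mult)
  moreover have "sqrt (ip f0 f0) * sqrt (ip v v) = q * (norm \<xi> * norm \<eta>)"
    unfolding f0_def v_def const real_sqrt_mult[symmetric]
    using q0 by (intro real_sqrt_unique) (simp_all add: power2_eq_square)
  ultimately show ?thesis using main q0 by simp
qed

text \<open>The coefficients produced by \<open>step_sequence\<close> are square summable, so they define an analytic square
integrable matrix function \<open>Fm\<close>. The estimate \<open>hankel_kernel_estimate\<close> bounds all Poisson integrals
of \<open>(\<Psi> - Fm) \<xi> \<bullet> \<eta>\<close>, and Fatou's theorem passes to the boundary. Countably many \<open>\<xi>\<close> and \<open>\<eta>\<close> suffice to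
bound the operator norm, which also makes \<open>Fm\<close> bounded.\<close>

theorem nehari:
  fixes \<Psi> :: "complex \<Rightarrow> complex^'n^'m"
  assumes P: "\<Psi> \<in> ess_bounded" and H: "hankel_contractive \<Psi>"
  obtains F where "F \<in> Hinf" "AE \<zeta> in circle. \<forall>x. norm ((\<Psi> \<zeta> - F \<zeta>) *v x) \<le> norm x"
proof -
  obtain Psi C where seq: "Psi 0 = \<Psi> \<and> (\<forall>N. Psi (Suc N) = step (Psi N) (C N)) \<and> (\<forall>N. Psi N \<in> ess_bounded \<and> hankel_contractive (Psi N))"
    using step_sequence[OF P H] by (elim exE)
  have S0: "Psi 0 = \<Psi>" by (rule seq[THEN conjunct1])
  have S: "Psi (Suc N) = step (Psi N) (C N)" for N by (rule seq[THEN conjunct2, THEN conjunct1, THEN spec])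
  have PL: "Psi N \<in> ess_bounded" and HN: "hankel_contractive (Psi N)" for N using seq[THEN conjunct2, THEN conjunct2, THEN spec, of N] by simp_all
  define lim where "lim = (\<lambda>a i F. sqi F \<and> (\<forall>k<0. fc F k = 0) \<and>
    (\<lambda>n. LINT \<zeta>|circle. (norm ((\<Sum>k<n. C k $ a $ i * \<zeta> ^ k) - F \<zeta>))\<^sup>2) \<longlonglongrightarrow> 0)"
  have "\<exists>F. lim a i F" for a i
  proof (rule riesz_fischer[of "\<lambda>k. C k $ a $ i", OF step_coefficients_bound[of Psi C, OF S PL HN]])
    fix F assume "sqi F" "\<And>k. k < 0 \<Longrightarrow> fc F k = 0"
      "(\<lambda>n. LINT \<zeta>|circle. (norm ((\<Sum>k<n. C k $ a $ i * \<zeta> ^ k) - F \<zeta>))\<^sup>2) \<longlonglongrightarrow> 0"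
    then have "lim a i F" unfolding lim_def by (intro conjI allI impI)
    then show ?thesis by (rule exI[of "lim a i"])
  qed
  then have limF: "lim a i (SOME F. lim a i F)" for a i by (rule someI_ex)
  define F where "F = (\<lambda>a i. SOME F. lim a i F)"
  have "lim a i (F a i)" for a i unfolding F_def by (rule limF)
  then have F: "\<And>a i. sqi (F a i)" "\<And>a i k. k < 0 \<Longrightarrow> fc (F a i) k = 0"
    "\<And>a i. (\<lambda>n. LINT \<zeta>|circle. (norm ((\<Sum>k<n. C k $ a $ i * \<zeta> ^ k) - F a i \<zeta>))\<^sup>2) \<longlonglongrightarrow> 0" by (simp_all add: lim_def)
  define Fm :: "complex \<Rightarrow> complex^'n^'m" where "Fm = (\<lambda>\<zeta>. \<chi> a i. F a i \<zeta>)"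
  have sp: "sqi (\<lambda>\<zeta>. \<Sum>k<n. C k $ a $ i * \<zeta> ^ k)" for n a i
  proof -
    have "(\<Sum>k<n. C k $ a $ i * \<zeta> ^ k) = (\<Sum>k\<in>int ` {..<n}. C (nat k) $ a $ i * \<zeta> powi k)" for \<zeta>
      by (subst sum.reindex) simp_all
    then show ?thesis using sqi_trig_poly[where S = "int ` {..<n}" and c = "\<lambda>k. C (nat k) $ a $ i"] by simp
  qed
  define D where "D = (\<lambda>\<xi> \<zeta>. (\<Psi> \<zeta> - Fm \<zeta>) *v \<xi>)"
  have Fmul: "(Fm \<zeta> *v \<xi>) $ a = (\<Sum>i\<in>UNIV. F a i \<zeta> * \<xi> $ i)" for \<zeta> \<xi> a
    by (simp add: Fm_def matrix_vector_mult_def)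
  have FmL: "sqi (\<lambda>\<zeta>. Fm \<zeta> *v \<xi>)" for \<xi>
  proof -
    have fin: "sqi (\<lambda>\<zeta>. \<Sum>i\<in>I. F a i \<zeta> * \<xi> $ i)" if "finite I" for I a using that
    proof (induction I rule: finite_induct)
      case (insert i I)
      have "sqi (\<lambda>\<zeta>. F a i \<zeta> * \<xi> $ i)"
        using sqi_cmult[OF F(1), of "\<xi> $ i" a i] by (simp only: mult.commute)
      then show ?case using insert by (simp add: sqi_add)
    qed (simp add: sqi_const)
    have s: "sqi (\<lambda>\<zeta>. (Fm \<zeta> *v \<xi>) $ a)" for a unfolding Fmul by (rule fin) simp
    have "(\<lambda>\<zeta>. \<chi> a. (Fm \<zeta> *v \<xi>) $ a) \<in> borel_measurable circle"
      by (rule vec_lambda_measurable) (use s in \<open>simp add: sqi_def\<close>)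
    then show ?thesis unfolding sqi_def norm_vec_square using s by (simp add: sqi_def)
  qed
  have DL: "sqi (D \<xi>)" for \<xi>
    unfolding D_def matrix_vector_mult_diff_rdistrib
    using mv_L2[OF P const_L2, of \<xi>] by (intro sqi_diff FmL) (simp add: mv_def L2_iff_sqi)
  have Dnull: "l2null (\<lambda>N \<zeta>. (Psi 0 \<zeta> *v \<xi> - (\<Sum>j<N. \<zeta> ^ j *s (C j *v \<xi>))) - D \<xi> \<zeta>)" for \<xi>
  proof (rule l2null_vec)
    fix a
    have "l2null (\<lambda>N \<zeta>. \<Sum>i\<in>UNIV. - \<xi> $ i * ((\<Sum>k<N. C k $ a $ i * \<zeta> ^ k) - F a i \<zeta>))"
    proof (rule l2null_sum[OF finite[of UNIV]])
      fix i
      have n: "l2null (\<lambda>N \<zeta>. (\<Sum>k<N. C k $ a $ i * \<zeta> ^ k) - F a i \<zeta>)"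
        unfolding l2null_def using sqi_diff[OF sp F(1)] F(3) by blast
      show "l2null (\<lambda>N \<zeta>. - \<xi> $ i * ((\<Sum>k<N. C k $ a $ i * \<zeta> ^ k) - F a i \<zeta>))"
      proof (rule l2null_le[OF _ n, of _ "norm (\<xi> $ i)"])
        show "sqi (\<lambda>\<zeta>. - \<xi> $ i * ((\<Sum>k<N. C k $ a $ i * \<zeta> ^ k) - F a i \<zeta>))" for N
          by (rule sqi_cmult[OF sqi_diff[OF sp F(1)]])
      qed (simp add: norm_mult)
    qed
    moreover have "((Psi 0 \<zeta> *v \<xi> - (\<Sum>j<N. \<zeta> ^ j *s (C j *v \<xi>))) - D \<xi> \<zeta>) $ a
       = (\<Sum>i\<in>UNIV. - \<xi> $ i * ((\<Sum>k<N. C k $ a $ i * \<zeta> ^ k) - F a i \<zeta>))" for N \<zeta>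
    proof -
      have "(\<Sum>j<N. \<zeta> ^ j * (C j *v \<xi>) $ a) = (\<Sum>i\<in>UNIV. \<xi> $ i * (\<Sum>k<N. C k $ a $ i * \<zeta> ^ k))"
        unfolding matrix_vector_mult_def vec_lambda_beta sum_distrib_left
        by (subst sum.swap) (simp add: mult_ac)
      then show ?thesis unfolding S0 D_def matrix_vector_mult_diff_rdistrib
        by (simp add: Fmul right_diff_distrib sum_subtractf sum_negf mult.commute)
    qed
    ultimately show "l2null (\<lambda>N \<zeta>. ((Psi 0 \<zeta> *v \<xi> - (\<Sum>j<N. \<zeta> ^ j *s (C j *v \<xi>))) - D \<xi> \<zeta>) $ a)" by simp
  qed
  have pointwise: "AE \<zeta> in circle. \<bar>D \<xi> \<zeta> \<bullet> \<eta>\<bar> \<le> norm \<xi> * norm \<eta>" for \<xi> \<eta>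
  proof -
    define \<phi> where "\<phi> = (\<lambda>\<zeta>. D \<xi> \<zeta> \<bullet> \<eta>)"
    have i: "integrable circle \<phi>" unfolding \<phi>_def by (rule integrable_inner[OF DL sqi_const])
    define f where "f = (\<lambda>\<zeta>. complex_of_real (\<phi> \<zeta>))"
    have fi: "integrable circle f" using i by (simp add: f_def)
    have P: "(LINT \<xi>|circle. of_real (poisson_kernel w \<xi>) * f \<xi>) = complex_of_real (LINT \<xi>|circle. poisson_kernel w \<xi> * \<phi> \<xi>)" for w
      unfolding f_def of_real_mult[symmetric] by (rule integral_complex_of_real)
    show ?thesis
    proof (rule AE_mp[OF fatou_radial_limit[OF fi]], intro AE_I2 impI)
      fix \<zeta> assume x: "\<zeta> \<in> space circle"
        and l: "((\<lambda>r. LINT \<xi>|circle. of_real (poisson_kernel (of_real r * \<zeta>) \<xi>) * f \<xi>) \<longlongrightarrow> f \<zeta>) (at_left 1)"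
      have "\<forall>\<^sub>F r in at_left 1. norm (LINT \<xi>|circle. of_real (poisson_kernel (of_real r * \<zeta>) \<xi>) * f \<xi>) \<le> norm \<xi> * norm \<eta>"
        using at_left_1_interval
      proof eventually_elim
        case (elim r)
        then have "norm (of_real r * \<zeta>) < 1" using x by (simp add: norm_mult)
        then have "\<bar>LINT \<zeta>'|circle. poisson_kernel (of_real r * \<zeta>) \<zeta>' * (D \<xi> \<zeta>' \<bullet> \<eta>)\<bar> \<le> norm \<xi> * norm \<eta>"
          by (rule hankel_kernel_estimate[of Psi C, OF S PL HN Dnull DL])
        then show ?case unfolding P by (simp add: \<phi>_def)
      qed
      then have "norm (f \<zeta>) \<le> norm \<xi> * norm \<eta>" by (rule tendsto_upperbound[OF tendsto_norm[OF l]]) simp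
      then show "\<bar>D \<xi> \<zeta> \<bullet> \<eta>\<bar> \<le> norm \<xi> * norm \<eta>" by (simp add: f_def \<phi>_def)
    qed
  qed
  obtain X :: "(complex^'n) set" where X: "countable X" "\<And>U. open U \<Longrightarrow> U \<noteq> {} \<Longrightarrow> \<exists>x\<in>X. x \<in> U" using countable_dense_setE by blast
  obtain Y :: "(complex^'m) set" where Y: "countable Y" "\<And>U. open U \<Longrightarrow> U \<noteq> {} \<Longrightarrow> \<exists>x\<in>Y. x \<in> U" using countable_dense_setE by blast
  have "AE \<zeta> in circle. \<forall>\<xi>\<in>X. \<forall>\<eta>\<in>Y. \<bar>D \<xi> \<zeta> \<bullet> \<eta>\<bar> \<le> norm \<xi> * norm \<eta>"
    using pointwise by (simp add: AE_ball_countable X(1) Y(1))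
  then have contr: "AE \<zeta> in circle. \<forall>x. norm ((\<Psi> \<zeta> - Fm \<zeta>) *v x) \<le> norm x"
  proof eventually_elim
    case (elim \<zeta>)
    define A where "A = \<Psi> \<zeta> - Fm \<zeta>"
    have cont: "continuous_on UNIV (\<lambda>x. A *v x)" by (rule linear_continuous_on[OF mat_bounded_linear])
    have 1: "\<bar>(A *v x) \<bullet> y\<bar> \<le> norm x * norm y" if "x \<in> X" for x y
    proof (rule ccontr)
      assume "\<not> ?thesis"
      then have "{y. norm x * norm y < \<bar>(A *v x) \<bullet> y\<bar>} \<noteq> {}" by (auto simp: not_le)
      moreover have "open {y. norm x * norm y < \<bar>(A *v x) \<bullet> y\<bar>}"
        by (intro open_Collect_less continuous_intros)
      ultimately obtain y' where "y' \<in> Y" "norm x * norm y' < \<bar>(A *v x) \<bullet> y'\<bar>"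
        using Y(2)[of "{y. norm x * norm y < \<bar>(A *v x) \<bullet> y\<bar>}"] by auto
      then show False using elim that by (auto simp: D_def A_def not_le[symmetric])
    qed
    have 2: "\<bar>(A *v x) \<bullet> y\<bar> \<le> norm x * norm y" for x y
    proof (rule ccontr)
      assume "\<not> ?thesis"
      then have "{x. norm x * norm y < \<bar>(A *v x) \<bullet> y\<bar>} \<noteq> {}" by (auto simp: not_le)
      moreover have "open {x. norm x * norm y < \<bar>(A *v x) \<bullet> y\<bar>}"
        by (intro open_Collect_less continuous_intros cont)
      ultimately obtain x' where "x' \<in> X" "norm x' * norm y < \<bar>(A *v x') \<bullet> y\<bar>"
        using X(2)[of "{x. norm x * norm y < \<bar>(A *v x) \<bullet> y\<bar>}"] by auto
      then show False using 1[of x' y] by simp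
    qed
    have "norm (A *v x) \<le> norm x" for x
    proof (cases "A *v x = 0")
      case False
      have "norm (A *v x) * norm (A *v x) \<le> norm x * norm (A *v x)" using 2[of x "A *v x"] by (simp add: dot_square_norm power2_eq_square)
      then show ?thesis using False by simp
    qed simp
    then show ?case by (simp add: A_def)
  qed
  have "bdh (\<lambda>\<zeta>. Fm \<zeta> $ a $ i) (cau (\<lambda>\<zeta>. Fm \<zeta> $ a $ i))" for a i
  proof -
    obtain c where c: "AE \<zeta> in circle. norm (\<Psi> \<zeta> $ a $ i) \<le> c" using ess_bounded_entry_bounded[OF P] by blast
    have "AE \<zeta> in circle. norm (Fm \<zeta> $ a $ i) \<le> c + 1"
      using c contr
    proof eventually_elim
      case (elim \<zeta>)
      have "norm ((\<Psi> \<zeta> - Fm \<zeta>) $ a $ i) \<le> 1" by (rule norm_mat_entry_le) (use elim(2) in simp)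
      then show ?case using elim(1) norm_triangle_ineq4[of "\<Psi> \<zeta> $ a $ i" "(\<Psi> \<zeta> - Fm \<zeta>) $ a $ i"] by simp
    qed
    moreover have "(\<lambda>\<zeta>. Fm \<zeta> $ a $ i) = F a i" by (simp add: Fm_def)
    ultimately show ?thesis using F(1)[of a i] F(2) by (intro bounded_analytic_bdh) (auto simp: sqi_def)
  qed
  then have "Fm \<in> Hinf" by (rule Hinf_I)
  then show ?thesis using that contr by blast
qed

section \<open>Contractive symbols\<close>

definition contractive :: "(complex \<Rightarrow> complex^'n^'m) \<Rightarrow> bool" where
  "contractive \<Phi> \<longleftrightarrow> \<Phi> \<in> ess_bounded \<and> (AE \<zeta> in circle. \<forall>x. norm (\<Phi> \<zeta> *v x) \<le> norm x)"

lemma contractive_ess_bounded: "contractive \<Phi> \<Longrightarrow> \<Phi> \<in> ess_bounded"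
  by (simp add: contractive_def)

lemma contractive_ip:
  assumes C: "contractive \<Phi>" and f: "f \<in> L2" shows "ip (mv \<Phi> f) (mv \<Phi> f) \<le> ip f f"
  unfolding ip_square
proof (rule integral_mono_AE)
  show "integrable circle (\<lambda>\<zeta>. (norm (mv \<Phi> f \<zeta>))\<^sup>2)" using mv_L2[OF contractive_ess_bounded[OF C] f] by (simp add: L2_def)
  show "integrable circle (\<lambda>\<zeta>. (norm (f \<zeta>))\<^sup>2)" using f by (simp add: L2_def)
  have "AE \<zeta> in circle. \<forall>x. norm (\<Phi> \<zeta> *v x) \<le> norm x" using C by (simp add: contractive_def)
  then show "AE \<zeta> in circle. (norm (mv \<Phi> f \<zeta>))\<^sup>2 \<le> (norm (f \<zeta>))\<^sup>2"
    by eventually_elim (simp add: mv_def power_mono)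
qed

lemma contractive_hankel_contractive:
  assumes C: "contractive \<Phi>" shows "hankel_contractive \<Phi>"
  unfolding hankel_contractive_def
proof
  fix f :: "complex \<Rightarrow> complex^'a" assume f: "f \<in> H2"
  have a: "mv \<Phi> f \<in> L2" by (rule mv_L2[OF contractive_ess_bounded[OF C] H2_L2[OF f]])
  show "ip (hankel_part \<Phi> f) (hankel_part \<Phi> f) \<le> ip f f"
    using pythagoras_Pm[OF a] contractive_ip[OF C H2_L2[OF f]] L2.nonneg[OF H2_L2[OF L2_proj_H2(1)[OF a]]] by (simp add: hankel_part_def)
qed

lemma L0_proj:
  assumes P: "\<Phi> \<in> ess_bounded" and f: "f \<in> L2" shows "L0 \<Phi> f = c0 (L2_proj H2 (mv \<Phi> f))"
proof -
  have a: "mv \<Phi> f \<in> L2" by (rule mv_L2[OF P f])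
  have "c0 (mv \<Phi> f) = c0 (\<lambda>\<zeta>. Pm (mv \<Phi> f) \<zeta> + L2_proj H2 (mv \<Phi> f) \<zeta>)"
    by (rule arg_cong[where f = c0, OF split_Pm])
  also have "\<dots> = c0 (Pm (mv \<Phi> f)) + c0 (L2_proj H2 (mv \<Phi> f))"
    by (rule c0_add[OF Pm_L2[OF a] H2_L2[OF L2_proj_H2(1)[OF a]]])
  finally show ?thesis using c0_H2_minus[OF Pm_H2_minus[OF a]] by (simp add: L0_def)
qed

lemma contractive_proj_le:
  assumes C: "contractive \<Phi>" and f: "f \<in> H2"
  shows "ip (L2_proj H2 (mv \<Phi> f)) (L2_proj H2 (mv \<Phi> f)) \<le> hform \<Phi> f f"
  using pythagoras_Pm[OF mv_L2[OF contractive_ess_bounded[OF C] H2_L2[OF f]]] contractive_ip[OF C H2_L2[OF f]]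
  by (simp add: hform_def hankel_part_def)

lemma contractive_L0:
  assumes C: "contractive \<Phi>" and f: "f \<in> H2" shows "(norm (L0 \<Phi> f))\<^sup>2 \<le> hform \<Phi> f f"
proof -
  have P: "\<Phi> \<in> ess_bounded" by (rule contractive_ess_bounded[OF C])
  have p: "L2_proj H2 (mv \<Phi> f) \<in> H2" by (rule L2_proj_H2(1)[OF mv_L2[OF P H2_L2[OF f]]])
  show ?thesis
    unfolding L0_proj[OF P H2_L2[OF f]]
    by (rule order_trans[OF norm_c0_le[OF H2_L2[OF p]] contractive_proj_le[OF C f]])
qed

text \<open>The chain \<open>|L0 \<Phi> f|\<^sup>2 \<le> |P\<^sub>+ (\<Phi> f)|\<^sup>2 \<le> |f|\<^sup>2 - |H f|\<^sup>2\<close> collapses. Equality on the left makes the analytic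
part of \<open>\<Phi> f\<close> constant, equality on the right makes \<open>\<Phi>\<close> length preserving on \<open>f\<close> in the mean, hence
pointwise.\<close>

lemma extremal_function:
  assumes C: "contractive \<Phi>" and f: "f \<in> H2" and eq: "hform \<Phi> f f \<le> (norm (L0 \<Phi> f))\<^sup>2"
  shows "AE \<zeta> in circle. L2_proj H2 (mv \<Phi> f) \<zeta> = L0 \<Phi> f"
    and "AE \<zeta> in circle. norm (\<Phi> \<zeta> *v f \<zeta>) = norm (f \<zeta>)"
proof -
  have P: "\<Phi> \<in> ess_bounded" by (rule contractive_ess_bounded[OF C])
  have fL: "f \<in> L2" by (rule H2_L2[OF f])
  define a where "a = mv \<Phi> f"
  have aL: "a \<in> L2" unfolding a_def by (rule mv_L2[OF P fL])
  define p where "p = L2_proj H2 a"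
  have pL: "p \<in> L2" unfolding p_def by (rule H2_L2[OF L2_proj_H2(1)[OF aL]])
  define u where "u = L0 \<Phi> f"
  have u: "c0 p = u" unfolding u_def p_def a_def by (rule L0_proj[OF P fL, symmetric])
  have le: "ip p p \<le> (norm u)\<^sup>2"
    using contractive_proj_le[OF C f] eq by (simp add: p_def a_def u_def)
  have "ip (p - (\<lambda>_. u)) (p - (\<lambda>_. u)) = ip p p - (norm u)\<^sup>2"
    unfolding L2.square_diff[OF pL const_L2] c0_inner[OF pL] ip_const u by (simp add: dot_square_norm)
  then have z: "ip (p - (\<lambda>_. u)) (p - (\<lambda>_. u)) = 0"
    using le L2.nonneg[OF L2.closed(2)[OF pL const_L2], of u] by simp
  then have "AE \<zeta> in circle. (p - (\<lambda>_. u)) \<zeta> = 0" using ip_zero_AE[OF L2.closed(2)[OF pL const_L2]] by blast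
  then show "AE \<zeta> in circle. L2_proj H2 (mv \<Phi> f) \<zeta> = L0 \<Phi> f" by (simp add: p_def a_def u_def)
  have "ip p p = (norm u)\<^sup>2" using norm_c0_le[OF pL] le by (simp add: u)
  then have "ip f f \<le> ip a a"
    using eq pythagoras_Pm[OF aL] by (simp add: hform_def hankel_part_def a_def[symmetric] p_def[symmetric] u_def[symmetric])
  moreover have "ip a a \<le> ip f f" unfolding a_def by (rule contractive_ip[OF C fL])
  ultimately have "ip a a = ip f f" by simp
  have i: "integrable circle (\<lambda>\<zeta>. (norm (f \<zeta>))\<^sup>2)" "integrable circle (\<lambda>\<zeta>. (norm (a \<zeta>))\<^sup>2)"
    using fL aL by (simp_all add: L2_def)
  have c: "AE \<zeta> in circle. \<forall>x. norm (\<Phi> \<zeta> *v x) \<le> norm x" using C by (simp add: contractive_def)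
  have "AE \<zeta> in circle. 0 \<le> (norm (f \<zeta>))\<^sup>2 - (norm (a \<zeta>))\<^sup>2"
    using c by eventually_elim (simp add: a_def mv_def power_mono)
  moreover have "(LINT \<zeta>|circle. (norm (f \<zeta>))\<^sup>2 - (norm (a \<zeta>))\<^sup>2) = 0"
    using i \<open>ip a a = ip f f\<close> by (simp add: ip_square)
  ultimately have "AE \<zeta> in circle. (norm (f \<zeta>))\<^sup>2 - (norm (a \<zeta>))\<^sup>2 = 0"
    using integral_nonneg_eq_0_iff_AE[OF Bochner_Integration.integrable_diff[OF i]] by blast
  then show "AE \<zeta> in circle. norm (\<Phi> \<zeta> *v f \<zeta>) = norm (f \<zeta>)"
    by eventually_elim (simp add: a_def mv_def)
qed

section \<open>Completeness from a small essential norm\<close>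

lemma L2_norm_cong_AE:
  assumes "AE \<zeta> in circle. f \<zeta> = f' \<zeta>" "f \<in> L2" "f' \<in> L2" shows "L2_norm f = L2_norm f'"
  unfolding L2_norm_ip using ip_cong_AE[OF assms] by simp

lemma L2_norm_triangle: "f \<in> L2 \<Longrightarrow> g \<in> L2 \<Longrightarrow> L2_norm (\<lambda>\<zeta>. f \<zeta> + g \<zeta>) \<le> L2_norm f + L2_norm g"
  using L2.seminorm_triangle[of f g] by (simp add: L2_norm_ip plus_fun_def)

lemma L2_norm_scaleR: "f \<in> L2 \<Longrightarrow> L2_norm (\<lambda>\<zeta>. c *\<^sub>R f \<zeta>) = \<bar>c\<bar> * L2_norm f"
  using L2.square_scale[of f c] by (simp add: L2_norm_ip scaleR_fun_def real_sqrt_mult)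

text \<open>Some compact operator is at distance \<open>\<rho> < 1\<close> from the Hankel operator.\<close>

lemma essnorm_approx:
  fixes \<Phi> :: "complex \<Rightarrow> complex^'n^'m"
  assumes C: "contractive \<Phi>" and ess: "L2_essnorm H2 H2_minus (hankel \<Phi>) < 1"
  shows "\<exists>(K :: (complex \<Rightarrow> complex^'n) \<Rightarrow> complex \<Rightarrow> complex^'m) \<rho>. L2_compact_on H2 H2_minus K \<and> 0 \<le> \<rho> \<and> \<rho> < 1 \<and>
    (\<forall>f\<in>H2. L2_norm f \<le> 1 \<longrightarrow> L2_norm (hankel_part \<Phi> f) \<le> \<rho> + L2_norm (K f))"
proof -
  obtain K where K: "L2_compact_on H2 H2_minus K" "L2_opnorm H2 (\<lambda>f \<zeta>. hankel \<Phi> f \<zeta> - K f \<zeta>) < 1"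
    using ess unfolding L2_essnorm_def by (auto simp: INF_less_iff)
  define \<rho> where "\<rho> = enn2real (L2_opnorm H2 (\<lambda>f \<zeta>. hankel \<Phi> f \<zeta> - K f \<zeta>))"
  have ne: "L2_opnorm H2 (\<lambda>f \<zeta>. hankel \<Phi> f \<zeta> - K f \<zeta>) = ennreal \<rho>"
    unfolding \<rho>_def using K(2) by (simp add: ennreal_enn2real_if less_top[symmetric] order.strict_implies_not_eq)
       (metis ennreal_one_neq_top less_top order_less_imp_not_less order_less_trans top.not_eq_extremum)
  have r: "0 \<le> \<rho>" "\<rho> < 1" using K(2) unfolding ne by (simp_all add: \<rho>_def)
  have KH: "K f \<in> H2_minus" if "f \<in> H2" for f using K(1) that by (simp add: L2_compact_on_def L2_linear_on_def)
  show ?thesis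
  proof (intro exI[of _ K] exI[of _ \<rho>] conjI K(1) r ballI impI)
    fix f :: "complex \<Rightarrow> complex^'n" assume f: "f \<in> H2" "L2_norm f \<le> 1"
    have a: "(\<lambda>\<zeta>. \<Phi> \<zeta> *v f \<zeta>) \<in> L2" using mv_L2[OF contractive_ess_bounded[OF C] H2_L2[OF f(1)]] by (simp add: mv_def)
    have hL: "hankel \<Phi> f \<in> L2" by (rule H2_minus_L2[OF hankel_AE(2)[OF a]])
    have kL: "K f \<in> L2" by (rule H2_minus_L2[OF KH[OF f(1)]])
    have dL: "(\<lambda>\<zeta>. hankel \<Phi> f \<zeta> - K f \<zeta>) \<in> L2" by (rule L2_diff[OF hL kL])
    have "ennreal (L2_norm (\<lambda>\<zeta>. hankel \<Phi> f \<zeta> - K f \<zeta>)) \<le> ennreal \<rho>"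
      unfolding ne[symmetric] L2_opnorm_def using f by (intro SUP_upper) simp
    then have "L2_norm (\<lambda>\<zeta>. hankel \<Phi> f \<zeta> - K f \<zeta>) \<le> \<rho>" using r(1) by (simp add: ennreal_le_iff)
    moreover have "L2_norm (\<lambda>\<zeta>. (hankel \<Phi> f \<zeta> - K f \<zeta>) + K f \<zeta>) \<le> L2_norm (\<lambda>\<zeta>. hankel \<Phi> f \<zeta> - K f \<zeta>) + L2_norm (K f)"
      by (rule L2_norm_triangle[OF dL kL])
    moreover have "L2_norm (hankel_part \<Phi> f) = L2_norm (hankel \<Phi> f)"
      unfolding hankel_part_def mv_def using L2_norm_cong_AE[OF hankel_AE(1)[OF a] hL Pm_L2[OF a]] by simp
    ultimately show "L2_norm (hankel_part \<Phi> f) \<le> \<rho> + L2_norm (K f)" by simp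
  qed
qed

text \<open>Along a subsequence the images under the compact part \<open>K\<close> converge. For a difference \<open>d\<close> of two late
members with norm \<open>n\<close> the compact part contributes at most \<open>\<eta>\<close>, so \<open>|H d| \<le> \<rho> n + \<eta>\<close>, while
\<open>n\<^sup>2 - |H d|\<^sup>2\<close> is small because the form tends to zero on the sequence. Since \<open>\<rho> < 1\<close>, this makes \<open>n\<close> small.\<close>

lemma hform_compactness:
  fixes \<Phi> :: "complex \<Rightarrow> complex^'n^'m"
  assumes C: "contractive \<Phi>" and ess: "L2_essnorm H2 H2_minus (hankel \<Phi>) < 1"
    and f: "\<And>k::nat. f k \<in> H2" and b: "\<And>k. ip (f k) (f k) \<le> 1" and h: "(\<lambda>k. hform \<Phi> (f k) (f k)) \<longlonglongrightarrow> 0"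
  shows "\<exists>r. strict_mono r \<and> L2.form_cauchy (\<lambda>k. f (r k))"
proof -
  obtain K :: "(complex \<Rightarrow> complex^'n) \<Rightarrow> complex \<Rightarrow> complex^'m" and \<rho> where K0: "L2_compact_on H2 H2_minus K \<and> 0 \<le> \<rho> \<and> \<rho> < 1 \<and>
    (\<forall>f\<in>H2. L2_norm f \<le> 1 \<longrightarrow> L2_norm (hankel_part \<Phi> f) \<le> \<rho> + L2_norm (K f))"
    using essnorm_approx[OF C ess] by blast
  note K = K0[THEN conjunct1] K0[THEN conjunct2, THEN conjunct1] K0[THEN conjunct2, THEN conjunct2, THEN conjunct1]
    K0[THEN conjunct2, THEN conjunct2, THEN conjunct2, rule_format]
  interpret Q: psd_form H2 "hform \<Phi>" by (rule psd_hform[OF contractive_ess_bounded[OF C] contractive_hankel_contractive[OF C]])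
  have KH: "K f \<in> H2_minus" if "f \<in> H2" for f using K(1) that by (simp add: L2_compact_on_def L2_linear_on_def)
  have KL: "K f \<in> L2" if "f \<in> H2" for f by (rule H2_minus_L2[OF KH[OF that]])
  have Klin: "AE \<zeta> in circle. K (\<lambda>\<xi>. a *s f \<xi> + b *s g \<xi>) \<zeta> = a *s K f \<zeta> + b *s K g \<zeta>" if "f \<in> H2" "g \<in> H2" for f g a b
    using K(1) that by (simp add: L2_compact_on_def L2_linear_on_def)
  have "\<forall>k. f k \<in> H2 \<and> L2_norm (f k) \<le> 1" using f b by (simp add: L2_norm_ip)
  then obtain r g where r: "strict_mono r" "g \<in> H2_minus" "(\<lambda>k. L2_norm (\<lambda>\<zeta>. K (f (r k)) \<zeta> - g \<zeta>)) \<longlonglongrightarrow> 0"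
    using K(1) unfolding L2_compact_on_def by blast
  have gL: "g \<in> L2" by (rule H2_minus_L2[OF r(2)])
  have hr: "(\<lambda>k. hform \<Phi> (f (r k)) (f (r k))) \<longlonglongrightarrow> 0" using LIMSEQ_subseq_LIMSEQ[OF h r(1)] by (simp add: o_def)
  have "L2.form_cauchy (\<lambda>k. f (r k))" unfolding L2.form_cauchy_def
  proof (intro allI impI)
    fix e :: real assume e: "0 < e"
    define q where "q = 1 - \<rho>\<^sup>2"
    have q: "0 < q" using K(2,3) by (simp add: q_def abs_square_less_1)
    \<comment> \<open>The constant 7 leaves room for the error terms \<open>4 * \<eta> + 2 * \<eta>\<^sup>2\<close> below.\<close>
    define \<eta> where "\<eta> = min 1 (e * q / 7)"
    have eta: "0 < \<eta>" "\<eta> \<le> 1" "7 * \<eta> \<le> e * q" using e q by (auto simp: \<eta>_def min_def)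
    have "0 < \<eta> / 2" "0 < (\<eta> / 2)\<^sup>2" using eta by auto
    obtain N1 where N1: "\<And>k. k \<ge> N1 \<Longrightarrow> norm (hform \<Phi> (f (r k)) (f (r k)) - 0) < (\<eta> / 2)\<^sup>2"
      using LIMSEQ_D[OF hr \<open>0 < (\<eta> / 2)\<^sup>2\<close>] by auto
    obtain N2 where N2: "\<And>k. k \<ge> N2 \<Longrightarrow> norm (L2_norm (\<lambda>\<zeta>. K (f (r k)) \<zeta> - g \<zeta>) - 0) < \<eta> / 2"
      using LIMSEQ_D[OF r(3) \<open>0 < \<eta> / 2\<close>] by auto
    have main: "ip (f (r j) - f (r k)) (f (r j) - f (r k)) < e" if jk: "j \<ge> max N1 N2" "k \<ge> max N1 N2" for j k
    proof -
      define x where "x = f (r j)"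
      define y where "y = f (r k)"
      define d where "d = x - y"
      have H: "x \<in> H2" "y \<in> H2" by (simp_all add: x_def y_def f)
      have dH: "d \<in> H2" unfolding d_def by (rule Q.closed(2)[OF H])
      have dL: "d \<in> L2" by (rule H2_L2[OF dH])
      define n where "n = sqrt (ip d d)"
      have n0: "0 \<le> n" and n2: "n\<^sup>2 = ip d d" using L2.nonneg[OF dL] by (simp_all add: n_def)
      have sx: "sqrt (hform \<Phi> x x) < \<eta> / 2" and sy: "sqrt (hform \<Phi> y y) < \<eta> / 2"
      proof -
        have "sqrt v < \<eta> / 2" if "norm (v - 0) < (\<eta> / 2)\<^sup>2" for v
        proof -
          have "v < (\<eta> / 2)\<^sup>2" using that unfolding real_norm_def by linarith
          then have "sqrt v < sqrt ((\<eta> / 2)\<^sup>2)" by (rule real_sqrt_less_mono)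
          then show ?thesis unfolding real_sqrt_abs using eta(1) by simp
        qed
        then show "sqrt (hform \<Phi> x x) < \<eta> / 2" "sqrt (hform \<Phi> y y) < \<eta> / 2"
          using N1[of j] N1[of k] jk by (auto simp only: x_def y_def max.bounded_iff)
      qed
      have "sqrt (hform \<Phi> d d) \<le> sqrt (hform \<Phi> x x) + sqrt (hform \<Phi> (- y) (- y))"
        using Q.seminorm_triangle[OF H(1), of "- y"] Q.closed(3)[OF H(2), of "-1"] by (simp add: d_def)
      also have "hform \<Phi> (- y) (- y) = hform \<Phi> y y" using Q.square_scale[OF H(2), of "-1"] by simp
      finally have "sqrt (hform \<Phi> d d) \<le> \<eta>" using sx sy by simp
      then have hd: "hform \<Phi> d d \<le> \<eta>\<^sup>2" using Q.nonneg[OF dH] by (metis real_sqrt_le_iff real_sqrt_pow2 power_mono real_sqrt_ge_zero)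
      have n_le: "n \<le> 2"
      proof -
        have "n \<le> sqrt (ip x x) + sqrt (ip (- y) (- y))"
          using L2.seminorm_triangle[OF H2_L2[OF H(1)], of "- y"] L2.closed(3)[OF H2_L2[OF H(2)], of "-1"] by (simp add: d_def n_def)
        also have "ip (- y) (- y) = ip y y" using L2.square_scale[OF H2_L2[OF H(2)], of "-1"] by simp
        finally have "n \<le> sqrt (ip x x) + sqrt (ip y y)" .
        moreover have "sqrt (ip x x) \<le> 1" "sqrt (ip y y) \<le> 1" using b by (simp_all add: x_def y_def)
        ultimately show ?thesis by linarith
      qed
      define \<kappa> where "\<kappa> = L2_norm (\<lambda>\<zeta>. K x \<zeta> - K y \<zeta>)"
      have kap: "\<kappa> \<le> \<eta>"
      proof -
        have a: "(\<lambda>\<zeta>. K x \<zeta> - g \<zeta>) \<in> L2" "(\<lambda>\<zeta>. g \<zeta> - K y \<zeta>) \<in> L2" using L2_diff KL H gL by auto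
        have "\<kappa> = L2_norm (\<lambda>\<zeta>. (K x \<zeta> - g \<zeta>) + (g \<zeta> - K y \<zeta>))" by (simp add: \<kappa>_def)
        also have "\<dots> \<le> L2_norm (\<lambda>\<zeta>. K x \<zeta> - g \<zeta>) + L2_norm (\<lambda>\<zeta>. g \<zeta> - K y \<zeta>)" by (rule L2_norm_triangle[OF a])
        also have "L2_norm (\<lambda>\<zeta>. g \<zeta> - K y \<zeta>) = L2_norm (\<lambda>\<zeta>. K y \<zeta> - g \<zeta>)" by (simp add: L2_norm_def norm_minus_commute)
        finally show ?thesis using N2[of j] N2[of k] jk by (simp add: x_def y_def)
      qed
      have kap0: "0 \<le> \<kappa>" by (simp add: \<kappa>_def L2_norm_def)
      have hm: "ip (hankel_part \<Phi> d) (hankel_part \<Phi> d) = n\<^sup>2 - hform \<Phi> d d" by (simp add: hform_def n2)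
      have key: "ip (hankel_part \<Phi> d) (hankel_part \<Phi> d) \<le> (\<rho> * n + \<kappa>)\<^sup>2"
      proof (cases "n = 0")
        case True
        then show ?thesis unfolding hm using Q.nonneg[OF dH] by (simp add: order_trans[OF _ zero_le_power2])
      next
        case False
        then have npos: "0 < n" using n0 by simp
        define c where "c = 1 / n"
        have cn: "c * n = 1" "0 < c" using npos by (simp_all add: c_def)
        define u where "u = (\<lambda>\<xi>. complex_of_real c *s x \<xi> + complex_of_real (- c) *s y \<xi>)"
        have ud: "u = c *\<^sub>R d"
          by (simp add: u_def d_def fun_eq_iff scaleR_vscale vec_eq_iff algebra_simps)
        have uH: "u \<in> H2" unfolding ud by (rule Q.closed(3)[OF dH])
        have "ip u u = 1" unfolding ud L2.square_scale[OF dL] n2[symmetric] using cn by (simp flip: power_mult_distrib)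
        then have "L2_norm u \<le> 1" by (simp add: L2_norm_ip)
        then have "L2_norm (hankel_part \<Phi> u) \<le> \<rho> + L2_norm (K u)" by (rule K(4)[OF uH])
        also have "L2_norm (K u) = L2_norm (\<lambda>\<zeta>. c *\<^sub>R (K x \<zeta> - K y \<zeta>))"
        proof (rule L2_norm_cong_AE[OF _ KL[OF uH]])
          show "AE \<zeta> in circle. K u \<zeta> = c *\<^sub>R (K x \<zeta> - K y \<zeta>)"
            using Klin[OF H, of "complex_of_real c" "complex_of_real (- c)"]
            unfolding u_def[symmetric]
            by eventually_elim (simp add: scaleR_vscale vec_eq_iff algebra_simps)
          show "(\<lambda>\<zeta>. c *\<^sub>R (K x \<zeta> - K y \<zeta>)) \<in> L2"
            using L2.closed(3)[OF L2_diff[OF KL[OF H(1)] KL[OF H(2)]], of c] by (simp add: scaleR_fun_def)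
        qed
        also have "\<dots> = c * \<kappa>"
          using L2_norm_scaleR[OF L2_diff[OF KL[OF H(1)] KL[OF H(2)]], of c] cn by (simp add: \<kappa>_def)
        finally have "sqrt (ip (hankel_part \<Phi> u) (hankel_part \<Phi> u)) \<le> \<rho> + c * \<kappa>" by (simp add: L2_norm_ip)
        then have "ip (hankel_part \<Phi> u) (hankel_part \<Phi> u) \<le> (\<rho> + c * \<kappa>)\<^sup>2" using sqrt_le_D by blast
        moreover have "ip (hankel_part \<Phi> u) (hankel_part \<Phi> u) = c\<^sup>2 * ip (hankel_part \<Phi> d) (hankel_part \<Phi> d)"
        proof -
          have "hform \<Phi> u u = c\<^sup>2 * hform \<Phi> d d" unfolding ud by (rule Q.square_scale[OF dH])
          moreover have "ip u u = c\<^sup>2 * ip d d" unfolding ud by (rule L2.square_scale[OF dL])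
          ultimately show ?thesis by (simp add: hform_def algebra_simps)
        qed
        ultimately have "n\<^sup>2 * (c\<^sup>2 * ip (hankel_part \<Phi> d) (hankel_part \<Phi> d)) \<le> n\<^sup>2 * (\<rho> + c * \<kappa>)\<^sup>2" by (simp add: mult_left_mono)
        moreover have "n\<^sup>2 * (c\<^sup>2 * ip (hankel_part \<Phi> d) (hankel_part \<Phi> d)) = (c * n)\<^sup>2 * ip (hankel_part \<Phi> d) (hankel_part \<Phi> d)"
          by (simp add: power_mult_distrib)
        moreover have "n\<^sup>2 * (\<rho> + c * \<kappa>)\<^sup>2 = (\<rho> * n + (c * n) * \<kappa>)\<^sup>2"
          unfolding power_mult_distrib[symmetric] by (simp add: algebra_simps)
        ultimately show ?thesis by (simp add: cn)
      qed
      have "(\<rho> * n + \<kappa>)\<^sup>2 \<le> (\<rho> * n + \<eta>)\<^sup>2" using kap kap0 K(2) n0 by (intro power_mono) simp_all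
      also have "\<dots> = \<rho>\<^sup>2 * n\<^sup>2 + 2 * (\<rho> * n) * \<eta> + \<eta>\<^sup>2" by (simp add: power2_sum power_mult_distrib)
      also have "2 * (\<rho> * n) * \<eta> \<le> 4 * \<eta>"
      proof -
        have "\<rho> * n \<le> 1 * 2" using K(2,3) n0 n_le by (intro mult_mono) simp_all
        then have "(\<rho> * n) * (2 * \<eta>) \<le> 2 * (2 * \<eta>)" using eta(1) by (intro mult_right_mono) simp_all
        then show ?thesis by (simp add: mult.commute mult.left_commute)
      qed
      finally have "n\<^sup>2 - hform \<Phi> d d \<le> \<rho>\<^sup>2 * n\<^sup>2 + 4 * \<eta> + \<eta>\<^sup>2" using key unfolding hm by simp
      then have "q * n\<^sup>2 \<le> 4 * \<eta> + 2 * \<eta>\<^sup>2" using hd by (simp add: q_def algebra_simps)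
      also have "\<eta>\<^sup>2 \<le> \<eta>" using eta by (simp add: power2_eq_square mult_le_one)
      finally have "q * n\<^sup>2 < q * e" using eta by (simp add: mult.commute)
      then have "n\<^sup>2 < e" using q by simp
      then show ?thesis by (simp add: n2 d_def x_def y_def)
    qed
    then show "\<exists>N. \<forall>j\<ge>N. \<forall>k\<ge>N. ip (f (r j) - f (r k)) (f (r j) - f (r k)) < e" by blast
  qed
  then show ?thesis using r(1) by blast
qed

lemma form_complete_zH2: "L2.form_complete zH2"
proof (rule form_complete_closed)
  show "zH2 \<subseteq> L2" using zH2_subset H2_subset_L2 by blast
  fix y :: "nat \<Rightarrow> complex \<Rightarrow> complex^'a" and g
  assume y: "\<And>k. y k \<in> zH2" and g: "g \<in> L2" and lim: "(\<lambda>n. LINT \<zeta>|circle. (norm (y n \<zeta> - g \<zeta>))\<^sup>2) \<longlonglongrightarrow> 0"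
  have yH: "y k \<in> H2" for k by (rule zH2_H2[OF y])
  have gH: "g \<in> H2" by (rule H2_closed[OF yH g lim])
  have "c0 g $ i = 0" for i
  proof -
    have "(\<lambda>n. fc (\<lambda>\<zeta>. y n \<zeta> $ i) 0) \<longlonglongrightarrow> fc (\<lambda>\<zeta>. g \<zeta> $ i) 0"
      by (rule fc_limit_vec[OF H2_sqi[OF yH] H2_sqi[OF gH] lim])
    moreover have "fc (\<lambda>\<zeta>. y n \<zeta> $ i) 0 = 0" for n
      using c0_nth[OF H2_L2[OF yH], of n i] y[of n] by (simp add: zH2_def)
    ultimately show ?thesis using c0_nth[OF g, of i] by (simp add: LIMSEQ_const_iff)
  qed
  then show "g \<in> zH2" using gH by (simp add: zH2_def vec_eq_iff)
qed

lemma psd_ip_H2: "psd_form H2 ip"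
proof
  show "subspace H2" by (rule subspace_H2)
  fix x y z :: "complex \<Rightarrow> complex^'a" and c :: real
  assume x: "x \<in> H2" and y: "y \<in> H2"
  show "ip x y = ip y x" by (rule ip_sym)
  show "ip (c *\<^sub>R x) y = c * ip x y" by (rule L2.scale[OF H2_L2[OF x] H2_L2[OF y]])
  show "0 \<le> ip x x" by (rule L2.nonneg[OF H2_L2[OF x]])
  show "ip (x + y) z = ip x z + ip y z" if "z \<in> H2" by (rule L2.add[OF H2_L2[OF x] H2_L2[OF y] H2_L2[OF that]])
qed

lemma hform_complete_zH2:
  fixes \<Phi> :: "complex \<Rightarrow> complex^'n^'m"
  assumes C: "contractive \<Phi>" and ess: "L2_essnorm H2 H2_minus (hankel \<Phi>) < 1"
  shows "psd_form.form_complete (hform \<Phi>) zH2"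
proof (rule complete_of_compact_perturbation[OF psd_ip_H2 psd_hform subspace_zH2 zH2_subset form_complete_zH2])
  show "\<Phi> \<in> ess_bounded" by (rule contractive_ess_bounded[OF C])
  show "hankel_contractive \<Phi>" by (rule contractive_hankel_contractive[OF C])
  show "hform \<Phi> x x \<le> ip x x" if "x \<in> H2" for x
    using L2.nonneg[OF H2_minus_L2[OF hankel_part_H2_minus[OF contractive_ess_bounded[OF C] H2_L2[OF that]]]] by (simp add: hform_def)
  show "\<exists>r. strict_mono r \<and> L2.form_cauchy (\<lambda>k. f (r k))"
    if "\<And>k::nat. f k \<in> zH2" "\<And>k. ip (f k) (f k) \<le> 1" "(\<lambda>k. hform \<Phi> (f k) (f k)) \<longlonglongrightarrow> 0" for f
    by (rule hform_compactness[OF C ess zH2_H2[OF that(1)] that(2,3)])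
qed

section \<open>The alternative forced by uniqueness\<close>

text \<open>The complex sesquilinear form whose real part is \<open>hform\<close>.\<close>

definition cform :: "(complex \<Rightarrow> complex^'n^'m) \<Rightarrow> (complex \<Rightarrow> complex^'n) \<Rightarrow> (complex \<Rightarrow> complex^'n) \<Rightarrow> complex" where
  "cform \<Phi> f g = Complex (hform \<Phi> f g) (hform \<Phi> f (\<lambda>\<zeta>. \<i> *s g \<zeta>))"

lemma cform_add:
  assumes P: "\<Phi> \<in> ess_bounded" "hankel_contractive \<Phi>" and H: "f \<in> H2" "f' \<in> H2" "g \<in> H2"
  shows "cform \<Phi> (\<lambda>\<zeta>. f \<zeta> + f' \<zeta>) g = cform \<Phi> f g + cform \<Phi> f' g"
proof -
  interpret Q: psd_form H2 "hform \<Phi>" by (rule psd_hform[OF P])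
  show ?thesis unfolding cform_def
    using Q.add[OF H] Q.add[OF H(1,2) H2_vscale[OF H(3), of \<i>]] by (simp add: plus_fun_def complex_eq_iff)
qed

lemma cform_vscale:
  assumes P: "\<Phi> \<in> ess_bounded" "hankel_contractive \<Phi>" and H: "f \<in> H2" "g \<in> H2"
  shows "cform \<Phi> (\<lambda>\<zeta>. c *s f \<zeta>) g = c * cform \<Phi> f g"
proof -
  interpret Q: psd_form H2 "hform \<Phi>" by (rule psd_hform[OF P])
  define ig where "ig = (\<lambda>\<zeta>. \<i> *s g \<zeta>)"
  have ig: "ig \<in> H2" unfolding ig_def by (rule H2_vscale[OF H(2)])
  have s: "Re c *\<^sub>R g \<in> H2" "Im c *\<^sub>R ig \<in> H2" "Re c *\<^sub>R ig \<in> H2" "Im c *\<^sub>R g \<in> H2" using Q.closed(3) H(2) ig by auto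
  have 1: "(\<lambda>\<zeta>. cnj c *s g \<zeta>) = Re c *\<^sub>R g - Im c *\<^sub>R ig"
    by (simp add: ig_def fun_eq_iff vec_eq_iff complex_eq_iff)
  have 2: "(\<lambda>\<zeta>. cnj c *s ig \<zeta>) = Re c *\<^sub>R ig + Im c *\<^sub>R g"
    by (simp add: ig_def fun_eq_iff vec_eq_iff complex_eq_iff)
  have "hform \<Phi> (\<lambda>\<zeta>. c *s f \<zeta>) g = Re c * hform \<Phi> f g - Im c * hform \<Phi> f ig"
    unfolding hform_vscale_left[OF P(1) H2_L2[OF H(1)] H2_L2[OF H(2)]] 1
    by (simp add: Q.diff_right Q.scale_right s H ig)
  moreover have "hform \<Phi> (\<lambda>\<zeta>. c *s f \<zeta>) ig = Re c * hform \<Phi> f ig + Im c * hform \<Phi> f g"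
    unfolding hform_vscale_left[OF P(1) H2_L2[OF H(1)] H2_L2[OF ig]] 2
    by (simp add: Q.add_right Q.scale_right s H ig)
  ultimately show ?thesis by (simp add: cform_def ig_def[symmetric] complex_eq_iff)
qed

lemma hform_vscale_square:
  assumes P: "\<Phi> \<in> ess_bounded" "hankel_contractive \<Phi>" and f: "f \<in> H2"
  shows "hform \<Phi> (\<lambda>\<zeta>. c *s f \<zeta>) (\<lambda>\<zeta>. c *s f \<zeta>) = (norm c)\<^sup>2 * hform \<Phi> f f"
proof -
  interpret Q: psd_form H2 "hform \<Phi>" by (rule psd_hform[OF P])
  have "hform \<Phi> (\<lambda>\<zeta>. c *s f \<zeta>) (\<lambda>\<zeta>. c *s f \<zeta>) = hform \<Phi> f (\<lambda>\<zeta>. cnj c *s (c *s f \<zeta>))"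
    by (rule hform_vscale_left[OF P(1) H2_L2[OF f] L2_vscale[OF H2_L2[OF f]]])
  also have "(\<lambda>\<zeta>. cnj c *s (c *s f \<zeta>)) = (norm c)\<^sup>2 *\<^sub>R f"
    by (simp add: fun_eq_iff scaleR_vscale vector_smult_assoc complex_norm_square mult.commute flip: of_real_power)
  finally show ?thesis unfolding Q.scale_right[OF f f] .
qed

lemma cform_cauchy_schwarz:
  assumes P: "\<Phi> \<in> ess_bounded" "hankel_contractive \<Phi>" and H: "f \<in> H2" "g \<in> H2"
  shows "(norm (cform \<Phi> f g))\<^sup>2 \<le> hform \<Phi> f f * hform \<Phi> g g"
proof (cases "cform \<Phi> f g = 0")
  case True
  interpret Q: psd_form H2 "hform \<Phi>" by (rule psd_hform[OF P])
  show ?thesis using True Q.nonneg H by simp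
next
  case False
  interpret Q: psd_form H2 "hform \<Phi>" by (rule psd_hform[OF P])
  define w where "w = cform \<Phi> f g"
  define af where "af = (\<lambda>\<zeta>. cnj w *s f \<zeta>)"
  have afH: "af \<in> H2" unfolding af_def by (rule H2_vscale[OF H(1)])
  have "cform \<Phi> af g = cnj w * w" unfolding af_def w_def by (rule cform_vscale[OF P H])
  also have "\<dots> = of_real ((norm w)\<^sup>2)" unfolding complex_norm_square by (simp add: mult.commute)
  finally have "hform \<Phi> af g = (norm w)\<^sup>2" by (simp add: cform_def complex_eq_iff)
  then have "((norm w)\<^sup>2)\<^sup>2 \<le> hform \<Phi> af af * hform \<Phi> g g" using Q.cauchy_schwarz[OF afH H(2)] by simp
  also have "hform \<Phi> af af = (norm w)\<^sup>2 * hform \<Phi> f f"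
    unfolding af_def using hform_vscale_square[OF P H(1), of "cnj w"] by simp
  finally have "(norm w)\<^sup>2 * (norm w)\<^sup>2 \<le> (norm w)\<^sup>2 * (hform \<Phi> f f * hform \<Phi> g g)" by (simp add: power2_eq_square mult.assoc)
  moreover have "0 < (norm w)\<^sup>2" using False by (simp add: w_def)
  ultimately have "(norm w)\<^sup>2 \<le> hform \<Phi> f f * hform \<Phi> g g" by (rule mult_left_le_imp_le)
  then show ?thesis by (simp only: w_def)
qed

lemma H2_linear_combination:
  fixes x :: "'n \<Rightarrow> complex \<Rightarrow> complex^'n" and \<Phi> :: "complex \<Rightarrow> complex^'n^'m"
  assumes P: "\<Phi> \<in> ess_bounded" "hankel_contractive \<Phi>" and x: "\<And>i. x i \<in> H2" and g: "g \<in> H2" and I: "finite I"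
  shows "(\<lambda>\<zeta>. \<Sum>i\<in>I. c i *s x i \<zeta>) \<in> H2
     \<and> c0 (\<lambda>\<zeta>. \<Sum>i\<in>I. c i *s x i \<zeta>) = (\<Sum>i\<in>I. c i *s c0 (x i))
     \<and> L0 \<Phi> (\<lambda>\<zeta>. \<Sum>i\<in>I. c i *s x i \<zeta>) = (\<Sum>i\<in>I. c i *s L0 \<Phi> (x i))
     \<and> cform \<Phi> (\<lambda>\<zeta>. \<Sum>i\<in>I. c i *s x i \<zeta>) g = (\<Sum>i\<in>I. c i * cform \<Phi> (x i) g)"
  using I
proof (induction I rule: finite_induct)
  case empty
  have "cform \<Phi> (\<lambda>_. 0) g = 0" using cform_vscale[OF P H2_const[of 0] g, of 0] by simp
  moreover have "L0 \<Phi> (\<lambda>_. 0) = 0" by (simp add: L0_def mv_def c0_const)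
  ultimately show ?case by (simp add: H2_const c0_const)
next
  case (insert i I)
  have s: "(\<lambda>\<zeta>. c i *s x i \<zeta>) \<in> H2" by (rule H2_vscale[OF x])
  define S where "S = (\<lambda>\<zeta>. \<Sum>i\<in>I. c i *s x i \<zeta>)"
  have SH: "S \<in> H2" using insert by (simp add: S_def)
  have e: "(\<lambda>\<zeta>. \<Sum>i\<in>insert i I. c i *s x i \<zeta>) = (\<lambda>\<zeta>. c i *s x i \<zeta> + S \<zeta>)" using insert by (simp add: S_def)
  have "c0 (\<lambda>\<zeta>. c i *s x i \<zeta> + S \<zeta>) = c i *s c0 (x i) + c0 S"
    using c0_add[OF H2_L2[OF s] H2_L2[OF SH]] c0_vscale[OF H2_L2[OF x]] by simp
  moreover have "L0 \<Phi> (\<lambda>\<zeta>. c i *s x i \<zeta> + S \<zeta>) = c i *s L0 \<Phi> (x i) + L0 \<Phi> S"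
    using L0_add[OF P(1) H2_L2[OF s] H2_L2[OF SH]] L0_vscale[OF P(1) H2_L2[OF x]] by simp
  moreover have "cform \<Phi> (\<lambda>\<zeta>. c i *s x i \<zeta> + S \<zeta>) g = c i * cform \<Phi> (x i) g + cform \<Phi> S g"
    using cform_add[OF P s SH g] cform_vscale[OF P x g] by simp
  ultimately show ?case unfolding e using insert H2_add[OF s SH] by (simp add: S_def)
qed

text \<open>Correct each constant unit vector by its \<open>Q\<close>-projection to \<open>zH2\<close>, obtaining \<open>x i\<close> orthogonal to \<open>zH2\<close>. The
matrix \<open>A1\<close> with columns \<open>L0 \<Phi> (x i)\<close> is admissible by orthogonality, so uniqueness makes all these columns
vanish. If every \<open>x i\<close> has \<open>Q\<close>-length zero, the first alternative holds. Otherwise fix \<open>x i0\<close> of positive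
length and, for given \<open>p\<close>, let \<open>yp\<close> in \<open>zH2\<close> represent the functional \<open>L0 \<Phi> z \<bullet> p\<close>. The defect
\<open>u = p - L0 \<Phi> yp\<close> satisfies \<open>|L0 \<Phi> y + u|\<^sup>2 \<le> Q y + \<kappa>\<close> on \<open>zH2\<close> with a constant \<open>\<kappa>\<close>. Hence a small multiple of the
rank-one matrix built from \<open>u\<close> and the functional of \<open>x i0\<close> is admissible, so \<open>u = 0\<close>.\<close>

theorem uniqueness_alternative:
  fixes \<Phi> :: "complex \<Rightarrow> complex^'n^'m"
  assumes C: "contractive \<Phi>" and ess: "L2_essnorm H2 H2_minus (hankel \<Phi>) < 1"
    and uniq: "\<And>A. hankel_contractive (step \<Phi> A) \<Longrightarrow> A = 0"
  shows "(\<forall>i. \<exists>x\<in>H2. c0 x = axis i 1 \<and> hform \<Phi> x x = 0) \<or>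
         (\<forall>p. \<exists>y\<in>zH2. L0 \<Phi> y = p \<and> hform \<Phi> y y = (norm p)\<^sup>2)"
proof -
  have P: "\<Phi> \<in> ess_bounded" "hankel_contractive \<Phi>" by (rule contractive_ess_bounded[OF C]) (rule contractive_hankel_contractive[OF C])
  interpret Q: psd_form H2 "hform \<Phi>" by (rule psd_hform[OF P])
  have comp: "Q.form_complete zH2" by (rule hform_complete_zH2[OF C ess])
  have "\<exists>x. x \<in> H2 \<and> c0 x = axis i 1 \<and> (\<forall>z\<in>zH2. hform \<Phi> x z = 0)" for i :: 'n
  proof -
    obtain y where y: "y \<in> zH2" "\<And>z. z \<in> zH2 \<Longrightarrow> hform \<Phi> ((\<lambda>_. axis i 1) - y) z = 0"
      using Q.projection[OF subspace_zH2 zH2_subset comp H2_const[of "axis i 1"]] by metis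
    have yH: "y \<in> H2" by (rule zH2_H2[OF y(1)])
    have "c0 ((\<lambda>_. axis i (1::complex)) - y) = axis i 1"
      unfolding fun_diff_def c0_diff[OF const_L2 H2_L2[OF yH]] c0_const using y(1) by (simp add: zH2_def)
    then show ?thesis using Q.closed(2)[OF H2_const yH] y(2) by blast
  qed
  then obtain x where x: "\<And>i. x i \<in> H2" "\<And>i. c0 (x i) = axis i 1" "\<And>i z. z \<in> zH2 \<Longrightarrow> hform \<Phi> (x i) z = 0" by metis
  define X where "X = (\<lambda>c \<zeta>. \<Sum>i\<in>UNIV. (c $ i) *s x i \<zeta>)"
  note lin = H2_linear_combination[where x = x, OF P x(1) _ finite[of UNIV]]
  have XH: "X c \<in> H2" for c using lin[OF x(1)[of undefined], of "\<lambda>i. c $ i"] unfolding X_def by blast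
  have Xc0: "c0 (X c) = c" for c
  proof -
    have "c0 (X c) = (\<Sum>i\<in>UNIV. c $ i *s axis i 1)"
      using lin[OF x(1)[of undefined], of "\<lambda>i. c $ i"] unfolding X_def x(2) by blast
    then show ?thesis by (simp add: vec_eq_iff axis_def if_distrib cong: if_cong)
  qed
  have XL0: "L0 \<Phi> (X c) = (\<Sum>i\<in>UNIV. c $ i *s L0 \<Phi> (x i))" for c
    using lin[OF x(1)[of undefined], of "\<lambda>i. c $ i"] unfolding X_def by blast
  have Xcf: "cform \<Phi> (X c) g = (\<Sum>i\<in>UNIV. c $ i * cform \<Phi> (x i) g)" if "g \<in> H2" for c g
    using lin[OF that, of "\<lambda>i. c $ i"] unfolding X_def by blast
  have cf0: "cform \<Phi> (x i) z = 0" if "z \<in> zH2" for i z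
    using x(3)[OF that] x(3)[OF zH2_vscale[OF that]] by (simp add: cform_def complex_eq_iff)
  have Xorth: "hform \<Phi> (X c) z = 0" if z: "z \<in> zH2" for c z
  proof -
    have "cform \<Phi> (X c) z = 0" using Xcf[OF zH2_H2[OF z]] cf0[OF z] by simp
    then show ?thesis by (simp add: cform_def complex_eq_iff)
  qed
  have dec: "f - X (c0 f) \<in> zH2" if f: "f \<in> H2" for f
  proof -
    have "c0 (f - X (c0 f)) = 0" unfolding fun_diff_def c0_diff[OF H2_L2[OF f] H2_L2[OF XH]] Xc0 by simp
    then show ?thesis using Q.closed(2)[OF f XH] by (simp add: zH2_def)
  qed
  have pyth: "hform \<Phi> f f = hform \<Phi> (f - X (c0 f)) (f - X (c0 f)) + hform \<Phi> (X (c0 f)) (X (c0 f))" if f: "f \<in> H2" for f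
  proof -
    define y where "y = f - X (c0 f)"
    have yz: "y \<in> zH2" unfolding y_def by (rule dec[OF f])
    have "f = y + X (c0 f)" by (simp add: y_def)
    then have "hform \<Phi> f f = hform \<Phi> (y + X (c0 f)) (y + X (c0 f))" by simp
    also have "\<dots> = hform \<Phi> y y + 2 * hform \<Phi> y (X (c0 f)) + hform \<Phi> (X (c0 f)) (X (c0 f))"
      by (rule Q.square_add[OF zH2_H2[OF yz] XH])
    also have "hform \<Phi> y (X (c0 f)) = 0" using Xorth[OF yz] Q.sym[OF zH2_H2[OF yz] XH] by simp
    finally show ?thesis by (simp only: y_def mult_zero_right add_0_right)
  qed
  have L0dec: "L0 \<Phi> f = L0 \<Phi> (f - X (c0 f)) + L0 \<Phi> (X (c0 f))" if f: "f \<in> H2" for f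
    unfolding fun_diff_def L0_diff[OF P(1) H2_L2[OF f] H2_L2[OF XH]] by simp
  define A1 :: "complex^'n^'m" where "A1 = (\<chi> a i. L0 \<Phi> (x i) $ a)"
  have A1: "A1 *v c = L0 \<Phi> (X c)" for c
    unfolding XL0 by (simp add: A1_def vec_eq_iff matrix_vector_mult_def mult.commute)
  have "hankel_contractive (step \<Phi> A1)" unfolding hankel_contractive_step_iff[OF P(1)]
  proof
    fix f :: "complex \<Rightarrow> complex^'n" assume f: "f \<in> H2"
    have "(norm (L0 \<Phi> f - A1 *v c0 f))\<^sup>2 = (norm (L0 \<Phi> (f - X (c0 f))))\<^sup>2" unfolding A1 L0dec[OF f] by simp
    also have "\<dots> \<le> hform \<Phi> (f - X (c0 f)) (f - X (c0 f))" by (rule contractive_L0[OF C zH2_H2[OF dec[OF f]]])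
    also have "\<dots> \<le> hform \<Phi> f f" using pyth[OF f] Q.nonneg[OF XH] by simp
    finally show "(norm (L0 \<Phi> f - A1 *v c0 f))\<^sup>2 \<le> hform \<Phi> f f" .
  qed
  then have "A1 = 0" by (rule uniq)
  then have LX: "L0 \<Phi> (X c) = 0" for c using A1[of c] by simp
  show ?thesis
  proof (cases "\<forall>i. hform \<Phi> (x i) (x i) = 0")
    case True
    then show ?thesis using x by blast
  next
    case False
    then obtain i0 where i0: "hform \<Phi> (x i0) (x i0) \<noteq> 0" by blast
    define q where "q = hform \<Phi> (x i0) (x i0)"
    have q: "0 < q" using i0 Q.nonneg[OF x(1)[of i0]] by (simp add: q_def)
    have "\<exists>y\<in>zH2. L0 \<Phi> y = p \<and> hform \<Phi> y y = (norm p)\<^sup>2" for p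
    proof -
      define l where "l = (\<lambda>z. L0 \<Phi> z \<bullet> p)"
      have zL: "z \<in> zH2 \<Longrightarrow> z \<in> L2" for z by (rule H2_L2[OF zH2_H2])
      have l1: "l (x + y) = l x + l y" if "x \<in> zH2" "y \<in> zH2" for x y
        unfolding l_def plus_fun_def L0_add[OF P(1) zL[OF that(1)] zL[OF that(2)]] by (rule inner_add_left)
      have l2: "l (c *\<^sub>R x) = c * l x" if "x \<in> zH2" for c x
        unfolding l_def scaleR_fun_def scaleR_vscale L0_vscale[OF P(1) zL[OF that]] by (simp flip: scaleR_vscale)
      have l3: "(l x)\<^sup>2 \<le> (norm p)\<^sup>2 * hform \<Phi> x x" if "x \<in> zH2" for x
      proof -
        have "(l x)\<^sup>2 \<le> (norm (L0 \<Phi> x))\<^sup>2 * (norm p)\<^sup>2"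
          unfolding l_def using Cauchy_Schwarz_ineq[of "L0 \<Phi> x" p] by (simp add: dot_square_norm)
        also have "\<dots> \<le> hform \<Phi> x x * (norm p)\<^sup>2"
          by (intro mult_right_mono contractive_L0[OF C zH2_H2[OF that]]) simp
        finally show ?thesis by (simp add: mult.commute)
      qed
      obtain yp where yp: "yp \<in> zH2" "\<And>z. z \<in> zH2 \<Longrightarrow> hform \<Phi> yp z = l z"
        using Q.riesz[OF subspace_zH2 zH2_subset comp l1 l2 l3 zero_le_power2] by blast
      define u where "u = p - L0 \<Phi> yp"
      define R where "R = hform \<Phi> yp yp - (norm (L0 \<Phi> yp))\<^sup>2"
      have R: "0 \<le> R" using contractive_L0[OF C zH2_H2[OF yp(1)]] by (simp add: R_def)
      define \<kappa> where "\<kappa> = R + (norm u)\<^sup>2 + 1"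
      have kap: "0 < \<kappa>" using R by (simp add: \<kappa>_def add_nonneg_pos)
      \<comment> \<open>The scaling makes the Cauchy-Schwarz bound for the rank-one term consume exactly the length of \<open>X (c0 f)\<close>.\<close>
      define t where "t = 1 / sqrt (\<kappa> * q)"
      have t: "t\<^sup>2 * q * \<kappa> = 1" "t \<noteq> 0" using kap q by (simp_all add: t_def power_divide)
      define A2 :: "complex^'n^'m" where "A2 = (\<chi> a i. - (of_real t * cform \<Phi> (x i) (x i0) * u $ a))"
      have A2: "A2 *v c = - ((of_real t * cform \<Phi> (X c) (x i0)) *s u)" for c
        unfolding Xcf[OF x(1)]
        by (simp add: A2_def vec_eq_iff matrix_vector_mult_def sum_negf sum_distrib_left sum_distrib_right mult_ac)
      \<comment> \<open>Expand the bound \<open>|L0 \<Phi> z|\<^sup>2 \<le> Q z\<close> at \<open>z = y - yp\<close>; by the choice of \<open>yp\<close> and \<open>u\<close> its mixed terms are those of \<open>|L0 \<Phi> y + u|\<^sup>2\<close>.\<close>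
      have base: "(norm (L0 \<Phi> y + u))\<^sup>2 \<le> hform \<Phi> y y + \<kappa>" if y: "y \<in> zH2" for y
      proof -
        have yH: "y \<in> H2" "yp \<in> H2" using zH2_H2 y yp(1) by auto
        have "(norm (L0 \<Phi> (y - yp)))\<^sup>2 \<le> hform \<Phi> (y - yp) (y - yp)"
          by (rule contractive_L0[OF C Q.closed(2)[OF yH]])
        also have "\<dots> = hform \<Phi> y y - 2 * l y + hform \<Phi> yp yp"
          unfolding Q.square_diff[OF yH] using Q.sym[OF yH] yp(2)[OF y] by simp
        finally have 1: "(norm (L0 \<Phi> y - L0 \<Phi> yp))\<^sup>2 \<le> hform \<Phi> y y - 2 * l y + hform \<Phi> yp yp"
          unfolding fun_diff_def L0_diff[OF P(1) H2_L2[OF yH(1)] H2_L2[OF yH(2)]] .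
        have 2: "(norm (L0 \<Phi> y - L0 \<Phi> yp))\<^sup>2 = (norm (L0 \<Phi> y))\<^sup>2 - 2 * (L0 \<Phi> y \<bullet> L0 \<Phi> yp) + (norm (L0 \<Phi> yp))\<^sup>2"
          unfolding dot_square_norm[symmetric] by (simp add: inner_diff_left inner_diff_right inner_commute)
        have 3: "(norm (L0 \<Phi> y + u))\<^sup>2 = (norm (L0 \<Phi> y))\<^sup>2 + 2 * (l y - L0 \<Phi> y \<bullet> L0 \<Phi> yp) + (norm u)\<^sup>2"
          unfolding dot_square_norm[symmetric] u_def l_def by (simp add: inner_add_left inner_add_right inner_diff_left inner_diff_right inner_commute)
        show ?thesis using 1 2 3 by (simp add: \<kappa>_def R_def)
      qed
      have scaled: "(norm (L0 \<Phi> y + a *s u))\<^sup>2 \<le> hform \<Phi> y y + (norm a)\<^sup>2 * \<kappa>" if y: "y \<in> zH2" for y a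
      proof (cases "a = 0")
        case True
        then show ?thesis using contractive_L0[OF C zH2_H2[OF y]] by simp
      next
        case False
        define y' where "y' = (\<lambda>\<zeta>. inverse a *s y \<zeta>)"
        have y'z: "y' \<in> zH2" unfolding y'_def by (rule zH2_vscale[OF y])
        have yy: "y = (\<lambda>\<zeta>. a *s y' \<zeta>)" using False by (simp add: y'_def vector_smult_assoc)
        have "L0 \<Phi> y + a *s u = a *s (L0 \<Phi> y' + u)"
          unfolding yy L0_vscale[OF P(1) zL[OF y'z]] by (simp add: vector_add_ldistrib)
        then have "(norm (L0 \<Phi> y + a *s u))\<^sup>2 = (norm a)\<^sup>2 * (norm (L0 \<Phi> y' + u))\<^sup>2"
          by (simp only: norm_vscale power_mult_distrib)
        also have "\<dots> \<le> (norm a)\<^sup>2 * (hform \<Phi> y' y' + \<kappa>)" by (intro mult_left_mono base[OF y'z]) simp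
        also have "\<dots> = hform \<Phi> y y + (norm a)\<^sup>2 * \<kappa>"
          unfolding yy hform_vscale_square[OF P zH2_H2[OF y'z]] by (simp add: distrib_left)
        finally show ?thesis .
      qed
      have "hankel_contractive (step \<Phi> A2)" unfolding hankel_contractive_step_iff[OF P(1)]
      proof
        fix f :: "complex \<Rightarrow> complex^'n" assume f: "f \<in> H2"
        define a where "a = of_real t * cform \<Phi> (X (c0 f)) (x i0)"
        have "(norm a)\<^sup>2 * \<kappa> = t\<^sup>2 * \<kappa> * (norm (cform \<Phi> (X (c0 f)) (x i0)))\<^sup>2"
          by (simp add: a_def norm_mult power_mult_distrib)
        also have "\<dots> \<le> t\<^sup>2 * \<kappa> * (hform \<Phi> (X (c0 f)) (X (c0 f)) * q)"
          unfolding q_def using kap by (intro mult_left_mono cform_cauchy_schwarz[OF P XH x(1)]) simp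
        also have "\<dots> = (t\<^sup>2 * q * \<kappa>) * hform \<Phi> (X (c0 f)) (X (c0 f))" by simp
        finally have a2: "(norm a)\<^sup>2 * \<kappa> \<le> hform \<Phi> (X (c0 f)) (X (c0 f))" unfolding t(1) by simp
        have "L0 \<Phi> f - A2 *v c0 f = L0 \<Phi> (f - X (c0 f)) + a *s u"
          unfolding A2 a_def[symmetric] using L0dec[OF f] LX by simp
        then have "(norm (L0 \<Phi> f - A2 *v c0 f))\<^sup>2 \<le> hform \<Phi> (f - X (c0 f)) (f - X (c0 f)) + (norm a)\<^sup>2 * \<kappa>"
          using scaled[OF dec[OF f]] by simp
        then show "(norm (L0 \<Phi> f - A2 *v c0 f))\<^sup>2 \<le> hform \<Phi> f f" using a2 pyth[OF f] by simp
      qed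
      then have "A2 = 0" by (rule uniq)
      then have "A2 $ a $ i0 = 0" for a by simp
      then have "- (of_real t * cform \<Phi> (x i0) (x i0) * u $ a) = 0" for a
        by (simp only: A2_def vec_lambda_beta)
      moreover have "cform \<Phi> (x i0) (x i0) \<noteq> 0" using q by (simp add: cform_def q_def complex_eq_iff)
      ultimately have "u = 0" using t(2) by (simp add: vec_eq_iff)
      then have Lp: "L0 \<Phi> yp = p" by (simp add: u_def)
      have "hform \<Phi> yp yp = (norm p)\<^sup>2" using yp(2)[OF yp(1)] by (simp add: l_def Lp dot_square_norm)
      then show ?thesis using Lp yp(1) by blast
    qed
    then show ?thesis by blast
  qed
qed

section \<open>Linear algebra of contractions\<close>

lemma inner_mult_cnj: "inner (c * a) b = inner a (cnj c * (b::complex))"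
  by (simp add: inner_complex_def algebra_simps)

text \<open>The conjugate transpose is also the adjoint for the real inner product, so real Hilbert space arguments apply to complex matrices.\<close>

lemma adjoint_inner: "((A :: complex^'n^'m) *v x) \<bullet> y = x \<bullet> (conj_transpose A *v y)"
proof -
  have "(A *v x) \<bullet> y = (\<Sum>a\<in>UNIV. \<Sum>i\<in>UNIV. inner (A $ a $ i * x $ i) (y $ a))"
    by (simp add: inner_vec_def matrix_vector_mult_def inner_sum_left)
  also have "\<dots> = (\<Sum>i\<in>UNIV. \<Sum>a\<in>UNIV. inner (x $ i) (cnj (A $ a $ i) * y $ a))"
    unfolding inner_mult_cnj by (rule sum.swap)
  also have "\<dots> = x \<bullet> (conj_transpose A *v y)"
    by (simp add: inner_vec_def matrix_vector_mult_def inner_sum_right conj_transpose_def)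
  finally show ?thesis .
qed

lemma contraction_adjoint:
  assumes c: "\<And>x. norm ((A :: complex^'n^'m) *v x) \<le> norm x" shows "norm (conj_transpose A *v y) \<le> norm y"
proof (cases "conj_transpose A *v y = 0")
  case False
  define z where "z = conj_transpose A *v y"
  have "norm z * norm z = z \<bullet> z" by (simp add: dot_square_norm power2_eq_square)
  also have "\<dots> = (A *v z) \<bullet> y" unfolding adjoint_inner by (simp add: z_def)
  also have "\<dots> \<le> norm (A *v z) * norm y" by (rule norm_cauchy_schwarz)
  also have "\<dots> \<le> norm z * norm y" by (intro mult_right_mono c) simp
  finally show ?thesis using False by (simp add: z_def)
qed simp

text \<open>If a contraction preserves the length of \<open>x\<close>, then \<open>x\<close> is fixed by its adjoint applied after it: expand the square of the difference.\<close>

lemma contraction_norm_eq: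
  assumes c: "\<And>x. norm ((A :: complex^'n^'m) *v x) \<le> norm x" and e: "norm (A *v x) = norm x"
  shows "conj_transpose A *v (A *v x) = x"
proof -
  define z where "z = conj_transpose A *v (A *v x)"
  have z: "(norm z)\<^sup>2 \<le> (norm x)\<^sup>2"
    using contraction_adjoint[of A "A *v x", OF c] e by (simp add: z_def)
  have "x \<bullet> z = (A *v x) \<bullet> (A *v x)" unfolding z_def adjoint_inner ..
  then have xz: "x \<bullet> z = (norm x)\<^sup>2" by (simp add: dot_square_norm e)
  have "(norm (z - x))\<^sup>2 = (norm z)\<^sup>2 - 2 * (x \<bullet> z) + (norm x)\<^sup>2"
    unfolding dot_square_norm[symmetric] by (simp add: inner_diff_left inner_diff_right inner_commute)
  also have "\<dots> \<le> 0" using z xz by simp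
  finally show ?thesis by (simp add: z_def)
qed

lemma isometric_mat_iff: "isometric_mat A \<longleftrightarrow> (\<forall>x. conj_transpose A *v (A *v x) = x)"
  by (simp add: isometric_mat_def matrix_eq matrix_vector_mul_assoc)

lemma isometric_transpose_iff:
  fixes A :: "complex^'n^'m"
  shows "isometric_mat (transpose A) \<longleftrightarrow> (\<forall>y. A *v (conj_transpose A *v y) = y)"
proof -
  have e: "(conj_transpose (transpose A) ** transpose A) $ i $ j = cnj ((A ** conj_transpose A) $ i $ j)" for i j
    by (simp add: matrix_matrix_mult_def conj_transpose_def transpose_def)
  have m: "(mat 1 :: complex^'m^'m) $ i $ j = cnj (mat 1 $ i $ j)" for i j by (simp add: mat_def)
  have "isometric_mat (transpose A) \<longleftrightarrow>
    (\<forall>i j. cnj ((A ** conj_transpose A) $ i $ j) = cnj ((mat 1 :: complex^'m^'m) $ i $ j))"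
    unfolding isometric_mat_def vec_eq_iff e m[symmetric] ..
  also have "\<dots> \<longleftrightarrow> A ** conj_transpose A = mat 1" unfolding complex_cnj_cancel_iff vec_eq_iff ..
  finally show ?thesis by (simp add: matrix_eq matrix_vector_mul_assoc)
qed

lemma mat_linear: "linear ((*v) (A :: complex^'n^'m))"
  by (rule bounded_linear.linear[OF mat_bounded_linear])

lemma left_inverse_card_le:
  assumes "\<And>x. (B :: complex^'m^'n) *v (A *v x) = x" shows "CARD('n) \<le> CARD('m)"
proof -
  have "inj ((*v) A)" by (rule inj_on_inverseI[of _ "(*v) B"]) (rule assms)
  then have "dim (range ((*v) A)) = dim (UNIV :: (complex^'n) set)"
    by (intro dim_image_eq[OF mat_linear]) simp
  moreover have "dim (range ((*v) A)) \<le> DIM(complex^'m)" by (rule dim_subset_UNIV)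
  ultimately show ?thesis by simp
qed

lemma isometric_card_le: "isometric_mat (A :: complex^'n^'m) \<Longrightarrow> CARD('n) \<le> CARD('m)"
  unfolding isometric_mat_iff by (rule left_inverse_card_le[of "conj_transpose A" A]) simp

text \<open>The adjoint is injective between spaces of equal dimension, hence onto, and a right inverse is then also a left inverse.\<close>

lemma coisometric_square:
  fixes A :: "complex^'n^'m"
  assumes c: "isometric_mat (transpose A)" and le: "CARD('n) \<le> CARD('m)" shows "isometric_mat A"
proof -
  have AA: "A *v (conj_transpose A *v y) = y" for y using c by (simp add: isometric_transpose_iff)
  have "inj ((*v) (conj_transpose A))" by (rule inj_on_inverseI[of _ "(*v) A"]) (rule AA)
  then have "dim (range ((*v) (conj_transpose A))) = dim (UNIV :: (complex^'m) set)"
    by (intro dim_image_eq[OF mat_linear]) simp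
  moreover have "CARD('m) \<le> CARD('n)" by (rule left_inverse_card_le[of A "conj_transpose A"]) (rule AA)
  ultimately have "dim (range ((*v) (conj_transpose A))) = DIM(complex^'n)" using le by simp
  then have "span (range ((*v) (conj_transpose A))) = UNIV" by (simp only: dim_eq_full)
  moreover have "span (range ((*v) (conj_transpose A))) = range ((*v) (conj_transpose A))"
    by (rule span_eq_iff[THEN iffD2, OF linear_subspace_image[OF mat_linear subspace_UNIV]])
  ultimately have s: "range ((*v) (conj_transpose A)) = UNIV" by simp
  show ?thesis unfolding isometric_mat_iff
  proof
    fix x
    obtain y where "x = conj_transpose A *v y" using s by (metis rangeE UNIV_I)
    then show "conj_transpose A *v (A *v x) = x" by (simp add: AA)
  qed
qed

text \<open>The kernel is a complex subspace, so real orthogonality to it is the same as complex orthogonality.\<close>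

lemma ortho_ker_iff: "x \<in> vec_ortho (mat_ker A) \<longleftrightarrow> (\<forall>y. A *v y = 0 \<longrightarrow> x \<bullet> y = 0)"
proof
  assume "x \<in> vec_ortho (mat_ker A)"
  then show "\<forall>y. A *v y = 0 \<longrightarrow> x \<bullet> y = 0"
    by (auto simp: vec_ortho_def mat_ker_def vec_cinner_eq complex_eq_iff)
next
  assume r: "\<forall>y. A *v y = 0 \<longrightarrow> x \<bullet> y = 0"
  have "vec_cinner x y = 0" if y: "A *v y = 0" for y
  proof -
    have "A *v (\<i> *s y) = 0" using y by (simp add: vector_scalar_commute)
    then show ?thesis using r y by (simp add: vec_cinner_eq)
  qed
  then show "x \<in> vec_ortho (mat_ker A)" by (simp add: vec_ortho_def mat_ker_def)
qed

lemma ortho_ker_isometric: "isometric_mat A \<Longrightarrow> vec_ortho (mat_ker A) = UNIV"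
proof -
  assume "isometric_mat A"
  then have "y = 0" if "A *v y = 0" for y using that unfolding isometric_mat_iff by (metis matrix_vector_mult_0_right)
  then have "x \<in> vec_ortho (mat_ker A)" for x unfolding ortho_ker_iff by (metis inner_zero_right)
  then show ?thesis by blast
qed

lemma ortho_ker_coisometric:
  assumes c: "isometric_mat (transpose A)" shows "vec_ortho (mat_ker A) = range ((*v) (conj_transpose A))"
proof (intro set_eqI iffI)
  have AA: "A *v (conj_transpose A *v y) = y" for y using c by (simp add: isometric_transpose_iff)
  {
    fix x assume x: "x \<in> vec_ortho (mat_ker A)"
    define k where "k = x - conj_transpose A *v (A *v x)"
    have k: "A *v k = 0" by (simp add: k_def matrix_vector_mult_diff_distrib AA)
    have "k \<bullet> k = x \<bullet> k - k \<bullet> (conj_transpose A *v (A *v x))"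
      by (subst (2) k_def) (simp add: inner_diff_right inner_commute)
    also have "\<dots> = 0" using x k unfolding ortho_ker_iff adjoint_inner[symmetric] by simp
    finally have "x = conj_transpose A *v (A *v x)" by (simp add: k_def)
    then show "x \<in> range ((*v) (conj_transpose A))" by (rule range_eqI)
  next
    fix x assume "x \<in> range ((*v) (conj_transpose A))"
    then obtain z where z: "x = conj_transpose A *v z" by blast
    show "x \<in> vec_ortho (mat_ker A)"
      unfolding ortho_ker_iff z by (simp add: inner_commute adjoint_inner[symmetric])
  }
qed

lemma norm_on_ortho_ker:
  fixes A :: "complex^'n^'m"
  assumes A: "isometric_mat A \<or> isometric_mat (transpose A)" and x: "x \<in> vec_ortho (mat_ker A)"
  shows "norm (A *v x) = norm x"
proof -
  have "conj_transpose A *v (A *v x) = x"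
    using A
  proof
    assume c: "isometric_mat (transpose A)"
    then obtain y where "x = conj_transpose A *v y" using x ortho_ker_coisometric by blast
    then show ?thesis using c by (simp add: isometric_transpose_iff)
  qed (simp add: isometric_mat_iff)
  then have "(A *v x) \<bullet> (A *v x) = x \<bullet> x" by (simp add: adjoint_inner)
  then show ?thesis by (simp add: norm_eq_sqrt_inner)
qed

text \<open>In the coisometric case \<open>F\<close> annihilates the range of the adjoint of \<open>A\<close>. The adjoints of \<open>A\<close> and \<open>F\<close> therefore have orthogonal ranges, and \<open>|y|\<^sup>2 + |F\<^sup>* y|\<^sup>2 = |(A - F)\<^sup>* y|\<^sup>2 \<le> |y|\<^sup>2\<close>.\<close>

lemma contraction_rigidity:
  fixes A F :: "complex^'n^'m"
  assumes A: "isometric_mat A \<or> isometric_mat (transpose A)"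
    and c: "\<And>x. norm ((A - F) *v x) \<le> norm x" and F: "\<And>x. x \<in> vec_ortho (mat_ker A) \<Longrightarrow> F *v x = 0"
  shows "F = 0"
proof -
  have "F *v x = 0" for x
    using A
  proof
    assume "isometric_mat A"
    then show ?thesis using F ortho_ker_isometric by blast
  next
    assume co: "isometric_mat (transpose A)"
    then have FA: "F *v (conj_transpose A *v y) = 0" for y using F ortho_ker_coisometric by blast
    have AA: "A *v (conj_transpose A *v y) = y" for y using co by (simp add: isometric_transpose_iff)
    have "conj_transpose F *v y = 0" for y
    proof -
      define a where "a = conj_transpose A *v y"
      define f where "f = conj_transpose F *v y"
      have "conj_transpose (A - F) *v y = a - f"
        by (simp add: a_def f_def vec_eq_iff matrix_vector_mult_def conj_transpose_def sum_subtractf left_diff_distrib)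
      then have le: "(norm (a - f))\<^sup>2 \<le> (norm y)\<^sup>2" using contraction_adjoint[of "A - F" y, OF c] by simp
      have "a \<bullet> f = 0" unfolding f_def adjoint_inner[symmetric] by (simp add: a_def FA)
      moreover have "a \<bullet> a = (norm y)\<^sup>2" unfolding a_def adjoint_inner[symmetric]
        using adjoint_inner[of A "conj_transpose A *v y" y] by (simp add: AA dot_square_norm)
      moreover have "(norm (a - f))\<^sup>2 = a \<bullet> a - 2 * (a \<bullet> f) + f \<bullet> f"
        unfolding dot_square_norm[symmetric] by (simp add: inner_diff_left inner_diff_right inner_commute)
      ultimately have "f \<bullet> f \<le> 0" using le by simp
      then have "f = 0" by (metis inner_eq_zero_iff inner_ge_zero antisym)
      then show ?thesis by (simp add: f_def)
    qed
    then have "(F *v x) \<bullet> (F *v x) = 0" unfolding adjoint_inner by simp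
    then show ?thesis by simp
  qed
  then show ?thesis by (simp add: matrix_eq)
qed

section \<open>Pointwise independence\<close>

text \<open>Multiplying by an outer function \<open>h\<close> of modulus \<open>1 / (1 + \<Sum>|f j|\<^sup>2)\<close> makes all entries bounded, hence the
determinant of the matrix with columns \<open>h f j\<close> is bounded and analytic. At the origin it is a power of
the nonzero value of the outer function, so it vanishes almost nowhere on the circle.\<close>

theorem independent_AE:
  fixes f :: "'n::finite \<Rightarrow> complex \<Rightarrow> complex^'n"
  assumes f: "\<And>j. f j \<in> H2" and f0: "\<And>j. c0 (f j) = axis j 1"
  shows "AE \<zeta> in circle. \<forall>x. \<exists>y. x = (\<Sum>j\<in>UNIV. y $ j *s f j \<zeta>)"
proof -
  define S where "S = (\<lambda>\<zeta>. \<Sum>j\<in>UNIV. (norm (f j \<zeta>))\<^sup>2)"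
  have S0: "0 \<le> S \<zeta>" for \<zeta> unfolding S_def by (intro sum_nonneg) simp
  have i2: "integrable circle (\<lambda>\<zeta>. (norm (f j \<zeta>))\<^sup>2)" for j using H2_L2[OF f] by (simp add: L2_def)
  have Si: "integrable circle S" unfolding S_def by (rule Bochner_Integration.integrable_sum[OF i2])
  define w where "w = (\<lambda>\<zeta>. - ln (1 + S \<zeta>))"
  have wi: "integrable circle w"
  proof (rule Bochner_Integration.integrable_bound[OF Si])
    have "S \<in> borel_measurable circle" by (rule borel_measurable_integrable[OF Si])
    then show "w \<in> borel_measurable circle" unfolding w_def by measurable
    have "norm (w \<zeta>) \<le> norm (S \<zeta>)" for \<zeta>
      using ln_add_one_self_le_self[OF S0] S0 by (simp add: w_def)
    then show "AE \<zeta> in circle. norm (w \<zeta>) \<le> norm (S \<zeta>)" by simp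
  qed
  have w0: "AE \<zeta> in circle. w \<zeta> \<le> 0" using S0 by (simp add: w_def)
  obtain h H where h: "bdh h H" "AE \<zeta> in circle. norm (h \<zeta>) = exp (w \<zeta>)" "norm (H 0) = exp (LINT \<zeta>|circle. w \<zeta>)"
    by (rule outer_function[OF wi w0])
  have H0: "H 0 \<noteq> 0" using h(3) by auto
  define g where "g = (\<lambda>i j \<zeta>. h \<zeta> * f j \<zeta> $ i)"
  have fi: "integrable circle (\<lambda>\<zeta>. f j \<zeta> $ i)" for i j by (rule sqi_nth_integrable[OF H2_sqi[OF f]])
  have gc: "k < 0 \<Longrightarrow> fc (g i j) k = 0" "fc (g i j) 0 = H 0 * fc (\<lambda>\<zeta>. f j \<zeta> $ i) 0" for i j k
    unfolding g_def using bdh_mult_coeffs[OF h(1) fi H2_fc[OF f]] by blast+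
  have gm: "g i j \<in> borel_measurable circle" for i j
    unfolding g_def by (intro borel_measurable_times bdh_measurable[OF h(1)] borel_measurable_integrable fi)
  \<comment> \<open>Here \<open>2 * t \<le> 1 + t\<^sup>2\<close> bounds the modulus of \<open>f j\<close> by \<open>1 + S\<close>.\<close>
  have gb: "AE \<zeta> in circle. norm (g i j \<zeta>) \<le> 1" for i j
    using h(2)
  proof eventually_elim
    case (elim \<zeta>)
    define t where "t = norm (f j \<zeta>)"
    have "t\<^sup>2 \<le> S \<zeta>" unfolding S_def t_def by (rule member_le_sum) simp_all
    moreover have "2 * t \<le> t\<^sup>2 + 1" using sum_squares_bound[of t 1] by simp
    moreover have "0 \<le> t" by (simp add: t_def)
    ultimately have t: "t \<le> 1 + S \<zeta>" using S0[of \<zeta>] by linarith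
    have pos: "0 < 1 + S \<zeta>" using S0[of \<zeta>] by simp
    have "norm (h \<zeta>) = inverse (1 + S \<zeta>)" unfolding elim w_def using pos by (simp add: exp_minus)
    then have "norm (g i j \<zeta>) = norm (f j \<zeta> $ i) * inverse (1 + S \<zeta>)" by (simp add: g_def norm_mult)
    also have "\<dots> \<le> t * inverse (1 + S \<zeta>)"
      unfolding t_def using pos by (intro mult_right_mono Finite_Cartesian_Product.norm_nth_le) simp
    also have "\<dots> \<le> (1 + S \<zeta>) * inverse (1 + S \<zeta>)" using t pos by (intro mult_right_mono) simp_all
    finally show ?case using pos by simp
  qed
  have gbdh: "bdh (g i j) (cau (g i j))" for i j by (rule bounded_analytic_bdh[OF gm gb gc(1)])
  have g0: "cau (g i j) 0 = (if i = j then H 0 else 0)" for i j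
  proof -
    have "cau (g i j) 0 = fc (g i j) 0" by (simp add: cau_0 fc_def)
    also have "\<dots> = H 0 * (axis j 1 $ i)" unfolding gc(2) c0_nth[OF H2_L2[OF f], symmetric] f0 ..
    finally show ?thesis by (simp add: axis_def)
  qed
  have "det (\<chi> i j. cau (g i j) 0) = (\<Prod>i\<in>(UNIV::'n set). H 0)"
    unfolding g0 by (subst det_diagonal) simp_all
  then have "det (\<chi> i j. cau (g i j) 0) \<noteq> 0" using H0 by simp
  then have "AE \<zeta> in circle. det (\<chi> i j. g i j \<zeta>) \<noteq> 0" by (rule bdh_nonzero_AE[OF bdh_det[OF gbdh]])
  then show ?thesis
  proof eventually_elim
    case (elim \<zeta>)
    define M where "M = (\<chi> i j. g i j \<zeta>)"
    have "invertible M" using elim by (simp add: M_def invertible_det_nz)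
    then obtain B where B: "M ** B = mat 1" by (auto simp: invertible_def)
    show ?case
    proof
      fix x :: "complex^'n"
      define z where "z = B *v x"
      have "x = M *v z" unfolding z_def matrix_vector_mul_assoc B by simp
      also have "\<dots> = (\<Sum>j\<in>UNIV. (\<chi> j. h \<zeta> * z $ j) $ j *s f j \<zeta>)"
        by (simp add: vec_eq_iff matrix_vector_mult_def M_def g_def mult_ac)
      finally show "\<exists>y. x = (\<Sum>j\<in>UNIV. y $ j *s f j \<zeta>)" by blast
    qed
  qed
qed

section \<open>Uniqueness and one-step extensions\<close>

text \<open>Uniqueness of the best approximation, freed from infima; compare \<open>best_approximation_zero_iff\<close>.\<close>

definition only_zero :: "(complex \<Rightarrow> complex^'n^'m) \<Rightarrow> bool" where
  "only_zero \<Phi> \<longleftrightarrow> (\<forall>F\<in>Hinf. (AE \<zeta> in circle. \<forall>x. norm ((\<Phi> \<zeta> - F \<zeta>) *v x) \<le> norm x) \<longrightarrow> (AE \<zeta> in circle. F \<zeta> = 0))"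

lemma bdh_id: "bdh (\<lambda>\<zeta>. \<zeta>) (\<lambda>z. z)"
  unfolding bdh_def
proof (intro conjI)
  show "(\<lambda>\<zeta>. \<zeta>) \<in> borel_measurable circle" by (rule measurable_circle_continuous) (rule continuous_on_id)
  show "\<exists>C. \<forall>z\<in>ball 0 1. norm (z::complex) \<le> C" by (intro exI[of _ 1]) simp
  have "((\<lambda>r. complex_of_real r * \<zeta>) \<longlongrightarrow> of_real 1 * \<zeta>) (at_left 1)" for \<zeta> by (intro tendsto_intros)
  then show "AE \<zeta> in circle. ((\<lambda>r. complex_of_real r * \<zeta>) \<longlongrightarrow> \<zeta>) (at_left 1)" by simp
qed (rule holomorphic_on_ident)

text \<open>Nehari supplies \<open>F\<^sub>1\<close> with \<open>step \<Phi> C - F\<^sub>1\<close> contractive; then \<open>F = C + \<zeta> F\<^sub>1\<close> is admissible and has the value \<open>C\<close> at the origin.\<close>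

lemma only_zero_step:
  fixes \<Phi> :: "complex \<Rightarrow> complex^'n^'m"
  assumes P: "\<Phi> \<in> ess_bounded" and u: "only_zero \<Phi>" and H: "hankel_contractive (step \<Phi> C)"
  shows "C = 0"
proof -
  obtain F1 where F1: "F1 \<in> Hinf" "AE \<zeta> in circle. \<forall>x. norm ((step \<Phi> C \<zeta> - F1 \<zeta>) *v x) \<le> norm x"
    by (rule nehari[OF step_ess_bounded[OF P] H])
  obtain G where G: "\<And>a i. bdh (\<lambda>\<zeta>. F1 \<zeta> $ a $ i) (G a i)" using Hinf_D[OF F1(1)] by blast
  define F :: "complex \<Rightarrow> complex^'n^'m" where "F = (\<lambda>\<zeta>. \<chi> a i. C $ a $ i + \<zeta> * F1 \<zeta> $ a $ i)"
  have Fb: "bdh (\<lambda>\<zeta>. F \<zeta> $ a $ i) (\<lambda>z. C $ a $ i + z * G a i z)" for a i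
    unfolding F_def vec_lambda_beta by (intro bdh_add bdh_const bdh_mult bdh_id G)
  have FH: "F \<in> Hinf" by (rule Hinf_I[OF Fb])
  have mult: "(\<Phi> \<zeta> - F \<zeta>) *v x = \<zeta> *s ((step \<Phi> C \<zeta> - F1 \<zeta>) *v x)" if z: "norm \<zeta> = 1" for \<zeta> x
  proof -
    have zz: "\<zeta> * cnj \<zeta> = 1" using z by (simp flip: complex_norm_square)
    have alg: "(p - (c + \<zeta> * f)) * y = \<zeta> * ((cnj \<zeta> * (p - c) - f) * y)" for p c f y
    proof -
      have "\<zeta> * ((cnj \<zeta> * (p - c) - f) * y) = ((\<zeta> * cnj \<zeta>) * (p - c) - \<zeta> * f) * y" by (simp add: algebra_simps)
      then show ?thesis unfolding zz by (simp add: algebra_simps)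
    qed
    then show ?thesis
      unfolding vec_eq_iff vector_smult_component matrix_vector_mult_def vec_lambda_beta sum_distrib_left
      by (intro allI sum.cong refl) (simp only: F_def step_def vec_lambda_beta vector_minus_component alg)
  qed
  have "AE \<zeta> in circle. \<forall>x. norm ((\<Phi> \<zeta> - F \<zeta>) *v x) \<le> norm x"
    using F1(2) AE_space
  proof eventually_elim
    case (elim \<zeta>)
    then have z: "norm \<zeta> = 1" by simp
    show ?case unfolding mult[OF z] norm_vscale z using elim(1) by simp
  qed
  then have F0: "AE \<zeta> in circle. F \<zeta> = 0" using u FH by (simp add: only_zero_def)
  have "C $ a $ i = 0" for a i
  proof -
    have "C $ a $ i = (LINT \<zeta>|circle. F \<zeta> $ a $ i)" using bdh_mean_value[OF Fb, of a i] by simp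
    also have "\<dots> = 0"
    proof (rule integral_eq_zero_AE)
      show "AE \<zeta> in circle. F \<zeta> $ a $ i = 0" using F0 by eventually_elim simp
    qed
    finally show ?thesis .
  qed
  then show ?thesis by (simp add: vec_eq_iff)
qed

section \<open>Necessity\<close>

lemma finite_family:
  fixes x :: "'k::finite \<Rightarrow> complex \<Rightarrow> complex^'n"
  assumes x: "\<And>i. x i \<in> S"
  shows "\<exists>(l::nat) f. (\<forall>j\<in>{1..l}. f j \<in> S) \<and> (\<forall>\<zeta>. (\<lambda>j. f j \<zeta>) ` {1..l} = range (\<lambda>i. x i \<zeta>))"
proof -
  obtain e where e: "bij_betw e {1..CARD('k)} (UNIV :: 'k set)"
    using ex_bij_betw_nat_finite_1[of "UNIV :: 'k set"] by auto
  show ?thesis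
  proof (intro exI[of _ "CARD('k)"] exI[of _ "\<lambda>j. x (e j)"] conjI allI ballI)
    fix \<zeta>
    have "(\<lambda>j. x (e j) \<zeta>) ` {1..CARD('k)} = (\<lambda>i. x i \<zeta>) ` (e ` {1..CARD('k)})" by (simp add: image_image)
    then show "(\<lambda>j. x (e j) \<zeta>) ` {1..CARD('k)} = range (\<lambda>i. x i \<zeta>)" using e by (simp add: bij_betw_def)
  qed (rule x)
qed

definition conditions :: "(complex \<Rightarrow> complex^'n^'m) \<Rightarrow> bool" where
  "conditions \<Phi> \<longleftrightarrow>
     (AE \<zeta> in circle. if CARD('n) \<le> CARD('m) then isometric_mat (\<Phi> \<zeta>) else isometric_mat (transpose (\<Phi> \<zeta>))) \<and>
     (\<exists>(l::nat) f. (\<forall>j\<in>{1..l}. f j \<in> toeplitz_ker \<Phi>) \<and>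
        (AE \<zeta> in circle. vec_ortho (mat_ker (\<Phi> \<zeta>)) = vec.span ((\<lambda>j. f j \<zeta>) ` {1..l})))"

text \<open>Both alternatives produce either an isometry or a coisometry; comparing dimensions shows which of the two cases of condition (i) it is.\<close>

lemma conditionsI:
  fixes \<Phi> :: "complex \<Rightarrow> complex^'n^'m" and x :: "'k::finite \<Rightarrow> complex \<Rightarrow> complex^'n"
  assumes i: "AE \<zeta> in circle. isometric_mat (\<Phi> \<zeta>) \<or> isometric_mat (transpose (\<Phi> \<zeta>))"
    and x: "\<And>i. x i \<in> toeplitz_ker \<Phi>"
    and s: "AE \<zeta> in circle. vec_ortho (mat_ker (\<Phi> \<zeta>)) = vec.span (range (\<lambda>i. x i \<zeta>))"
  shows "conditions \<Phi>"
  unfolding conditions_def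
proof
  show "AE \<zeta> in circle. if CARD('n) \<le> CARD('m) then isometric_mat (\<Phi> \<zeta>) else isometric_mat (transpose (\<Phi> \<zeta>))"
    using i
  proof eventually_elim
    case (elim \<zeta>)
    then show ?case using isometric_card_le[of "\<Phi> \<zeta>"] coisometric_square[of "\<Phi> \<zeta>"] by auto
  qed
  obtain l :: nat and f :: "nat \<Rightarrow> complex \<Rightarrow> complex^'n"
    where f: "(\<forall>j\<in>{1..l}. f j \<in> toeplitz_ker \<Phi>) \<and> (\<forall>\<zeta>. (\<lambda>j. f j \<zeta>) ` {1..l} = range (\<lambda>i. x i \<zeta>))"
    using finite_family[of x, OF x] by (elim exE)
  then show "\<exists>(l::nat) f. (\<forall>j\<in>{1..l}. f j \<in> toeplitz_ker \<Phi>) \<and>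
        (AE \<zeta> in circle. vec_ortho (mat_ker (\<Phi> \<zeta>)) = vec.span ((\<lambda>j. f j \<zeta>) ` {1..l}))"
    using s by (intro exI[of _ l] exI[of _ f] conjI) simp_all
qed

lemma combination_in_span: "(\<Sum>j\<in>UNIV. y $ j *s x j) \<in> vec.span (range x)"
  by (intro vec.span_sum vec.span_scale vec.span_base) simp

lemma span_closed:
  fixes S :: "(complex^'n) set"
  assumes B: "\<And>x. x \<in> B \<Longrightarrow> x \<in> S" and S: "vec.subspace S" shows "vec.span B \<subseteq> S"
  by (rule vec.span_minimal) (use assms in auto)

lemma toeplitz_kerI:
  assumes "f \<in> H2" "AE \<zeta> in circle. L2_proj H2 (mv \<Phi> f) \<zeta> = 0" shows "f \<in> toeplitz_ker \<Phi>"
  using assms by (simp add: toeplitz_ker_def toeplitz_def mv_def)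

text \<open>The functions \<open>x\<close> satisfy \<open>L0 \<Phi> x = 0\<close>, so \<open>extremal_function\<close> puts them into the kernel of the Toeplitz operator and makes \<open>\<Phi>\<close> length preserving on them. Since they span the whole space almost everywhere, \<open>\<Phi>\<^sup>* \<Phi>\<close> is the identity.\<close>

lemma conditions_isometric:
  fixes \<Phi> :: "complex \<Rightarrow> complex^'n^'m"
  assumes C: "contractive \<Phi>" and ex: "\<And>i. \<exists>x\<in>H2. c0 x = axis i 1 \<and> hform \<Phi> x x = 0"
  shows "conditions \<Phi>"
proof -
  have ex': "\<exists>x. x \<in> H2 \<and> c0 x = axis i 1 \<and> hform \<Phi> x x = 0" for i using ex[of i] by blast
  define x where "x = (\<lambda>i. SOME x. x \<in> H2 \<and> c0 x = axis i 1 \<and> hform \<Phi> x x = 0)"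
  have "x i \<in> H2 \<and> c0 (x i) = axis i 1 \<and> hform \<Phi> (x i) (x i) = 0" for i
    unfolding x_def by (rule someI_ex[OF ex'])
  then have x: "\<And>i. x i \<in> H2" "\<And>i. c0 (x i) = axis i 1" "\<And>i. hform \<Phi> (x i) (x i) = 0" by blast+
  have L: "L0 \<Phi> (x i) = 0" for i using contractive_L0[OF C x(1)[of i]] x(3)[of i] by simp
  have eq: "hform \<Phi> (x i) (x i) \<le> (norm (L0 \<Phi> (x i)))\<^sup>2" for i by (simp add: x(3) L)
  have ker: "x i \<in> toeplitz_ker \<Phi>" for i
    using extremal_function(1)[OF C x(1) eq, of i] by (intro toeplitz_kerI x(1)) (simp add: L)
  have "AE \<zeta> in circle. \<forall>i\<in>UNIV. norm (\<Phi> \<zeta> *v x i \<zeta>) = norm (x i \<zeta>)"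
    by (intro AE_finite_allI finite extremal_function(2)[OF C x(1) eq])
  moreover have "AE \<zeta> in circle. \<forall>x. norm (\<Phi> \<zeta> *v x) \<le> norm x" using C by (simp add: contractive_def)
  moreover note independent_AE[OF x(1,2)]
  ultimately have iso: "AE \<zeta> in circle. isometric_mat (\<Phi> \<zeta>) \<and> vec.span (range (\<lambda>i. x i \<zeta>)) = UNIV"
  proof eventually_elim
    case (elim \<zeta>)
    define T where "T = conj_transpose (\<Phi> \<zeta>) ** \<Phi> \<zeta>"
    have fixed: "T *v x i \<zeta> = x i \<zeta>" for i
      unfolding T_def matrix_vector_mul_assoc[symmetric]
      by (rule contraction_norm_eq) (use elim(1,2) in simp_all)
    have "T *v v = v" for v
    proof -
      obtain y where "v = (\<Sum>j\<in>UNIV. y $ j *s x j \<zeta>)" using elim(3) by blast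
      then show ?thesis by (simp add: vec.linear_sum[OF matrix_vector_mul_linear_gen] vec.linear_scale[OF matrix_vector_mul_linear_gen] fixed)
    qed
    then have "isometric_mat (\<Phi> \<zeta>)" by (simp add: isometric_mat_iff T_def matrix_vector_mul_assoc)
    moreover have "v \<in> vec.span (range (\<lambda>i. x i \<zeta>))" for v
      using elim(3) combination_in_span[where x = "\<lambda>i. x i \<zeta>"] by metis
    ultimately show ?case by blast
  qed
  show ?thesis
  proof (rule conditionsI[OF _ ker])
    show "AE \<zeta> in circle. isometric_mat (\<Phi> \<zeta>) \<or> isometric_mat (transpose (\<Phi> \<zeta>))"
      using iso by eventually_elim simp
    show "AE \<zeta> in circle. vec_ortho (mat_ker (\<Phi> \<zeta>)) = vec.span (range (\<lambda>i. x i \<zeta>))"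
      using iso by eventually_elim (simp add: ortho_ker_isometric)
  qed
qed

lemma fc_cong_AE:
  assumes "AE \<zeta> in circle. f \<zeta> = g \<zeta>" "f \<in> borel_measurable circle" "g \<in> borel_measurable circle"
  shows "fc f k = fc g k"
  unfolding fc_def
proof (rule integral_cong_AE)
  show "AE \<zeta> in circle. \<zeta> powi - k * f \<zeta> = \<zeta> powi - k * g \<zeta>" using assms(1) by eventually_elim simp
qed (use assms(2,3) in measurable)

text \<open>Shift the frequency \<open>n\<close> down to zero, where \<open>c0_H2_minus\<close> applies.\<close>

lemma H2_minus_fc:
  fixes m :: "complex \<Rightarrow> complex^'n"
  assumes "m \<in> H2_minus" shows "fc (\<lambda>\<zeta>. m \<zeta> $ a) (int n) = 0"
  using assms
proof (induction n arbitrary: m)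
  case 0
  then show ?case using c0_H2_minus[OF 0] c0_nth[OF H2_minus_L2[OF 0], of a] by simp
next
  case (Suc n)
  have "fc (\<lambda>\<zeta>. (cnj \<zeta> *s (m \<zeta> + 0)) $ a) (int n) = 0" by (rule Suc.IH[OF H2_minus_backshift[OF Suc.prems]])
  then show ?case using fc_mult_cnj[of "\<lambda>\<zeta>. m \<zeta> $ a" "int n"] by (simp add: add.commute)
qed

text \<open>By \<open>extremal_function\<close> the analytic part of \<open>\<Phi> y\<close> is the constant \<open>p\<close>. Multiplication by \<open>cnj \<zeta>\<close> makes it antianalytic, and conjugation turns \<open>\<Phi> y\<close> into a function in \<open>H2\<close> with value \<open>cnj p\<close> at the origin.\<close>

lemma extremal_kernel_function:
  fixes \<Phi> :: "complex \<Rightarrow> complex^'n^'m"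
  assumes C: "contractive \<Phi>" and y: "y \<in> zH2" and L: "L0 \<Phi> y = p" and h: "hform \<Phi> y y = (norm p)\<^sup>2"
  shows "(\<lambda>\<zeta>. cnj \<zeta> *s y \<zeta>) \<in> toeplitz_ker \<Phi>"
    and "(\<lambda>\<zeta>. \<chi> a. cnj (mv \<Phi> y \<zeta> $ a)) \<in> H2"
    and "c0 (\<lambda>\<zeta>. \<chi> a. cnj (mv \<Phi> y \<zeta> $ a)) = (\<chi> a. cnj (p $ a))"
proof -
  have P: "\<Phi> \<in> ess_bounded" by (rule contractive_ess_bounded[OF C])
  have yH: "y \<in> H2" by (rule zH2_H2[OF y])
  define a where "a = mv \<Phi> y"
  have aL: "a \<in> L2" unfolding a_def by (rule mv_L2[OF P H2_L2[OF yH]])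
  \<comment> \<open>\<open>q\<close> vanishes almost everywhere, but the splitting of \<open>a\<close> must hold everywhere for \<open>projection_unique\<close>.\<close>
  define q where "q = (\<lambda>\<zeta>. L2_proj H2 a \<zeta> - p)"
  have projH: "L2_proj H2 a \<in> H2" by (rule L2_proj_H2(1)[OF aL])
  have qH: "q \<in> H2" unfolding q_def by (rule H2_diff[OF projH H2_const])
  have "hform \<Phi> y y \<le> (norm (L0 \<Phi> y))\<^sup>2" by (simp add: L h)
  from extremal_function(1)[OF C yH this] have q0: "AE \<zeta> in circle. q \<zeta> = 0"
    unfolding q_def a_def L by eventually_elim simp
  have qfc: "fc (\<lambda>\<zeta>. q \<zeta> $ i) k = 0" for i k
  proof -
    have "fc (\<lambda>\<zeta>. q \<zeta> $ i) k = fc (\<lambda>_. 0) k"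
    proof (rule fc_cong_AE)
      show "AE \<zeta> in circle. q \<zeta> $ i = 0" using q0 by eventually_elim simp
      show "(\<lambda>\<zeta>. q \<zeta> $ i) \<in> borel_measurable circle" by (rule borel_measurable_integrable[OF sqi_nth_integrable[OF H2_sqi[OF qH]]])
    qed simp
    then show ?thesis by (simp add: fc_const)
  qed
  have asplit: "a \<zeta> = Pm a \<zeta> + p + q \<zeta>" for \<zeta> by (simp add: Pm_def q_def)
  have mH: "Pm a \<in> H2_minus" by (rule Pm_H2_minus[OF aL])
  have c0y: "c0 y = 0" using y by (simp add: zH2_def)
  have g: "(\<lambda>\<zeta>. cnj \<zeta> *s y \<zeta>) \<in> H2"
    by (rule H2_backshift[OF yH]) (simp add: c0_nth[OF H2_L2[OF yH], symmetric] c0y)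
  have "mv \<Phi> (\<lambda>\<zeta>. cnj \<zeta> *s y \<zeta>) = (\<lambda>\<zeta>. cnj \<zeta> *s (Pm a \<zeta> + p) + cnj \<zeta> *s q \<zeta>)"
  proof
    fix \<zeta>
    have "mv \<Phi> (\<lambda>\<zeta>. cnj \<zeta> *s y \<zeta>) \<zeta> = cnj \<zeta> *s a \<zeta>" unfolding mv_vscale a_def ..
    also have "\<dots> = cnj \<zeta> *s (Pm a \<zeta> + p) + cnj \<zeta> *s q \<zeta>" by (subst asplit) (rule vector_add_ldistrib)
    finally show "mv \<Phi> (\<lambda>\<zeta>. cnj \<zeta> *s y \<zeta>) \<zeta> = cnj \<zeta> *s (Pm a \<zeta> + p) + cnj \<zeta> *s q \<zeta>" .
  qed
  from projection_unique(1)[OF H2_backshift[OF qH qfc] H2_minus_backshift[OF mH] this]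
  have "AE \<zeta> in circle. L2_proj H2 (mv \<Phi> (\<lambda>\<zeta>. cnj \<zeta> *s y \<zeta>)) \<zeta> = cnj \<zeta> *s q \<zeta>" .
  then have "AE \<zeta> in circle. L2_proj H2 (mv \<Phi> (\<lambda>\<zeta>. cnj \<zeta> *s y \<zeta>)) \<zeta> = 0"
    using q0 by eventually_elim simp
  then show "(\<lambda>\<zeta>. cnj \<zeta> *s y \<zeta>) \<in> toeplitz_ker \<Phi>" by (rule toeplitz_kerI[OF g])
  define k where "k = (\<lambda>\<zeta>. (\<chi> i. cnj (a \<zeta> $ i)))"
  have as: "sqi a" using aL by (simp add: L2_iff_sqi)
  have nk: "norm (k \<zeta>) = norm (a \<zeta>)" for \<zeta> by (simp add: k_def norm_vec_def L2_set_def)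
  have km: "k \<in> borel_measurable circle" unfolding k_def
  proof (rule vec_lambda_measurable)
    fix i
    have "(\<lambda>\<zeta>. a \<zeta> $ i) \<in> borel_measurable circle" by (rule borel_measurable_integrable[OF sqi_nth_integrable[OF as]])
    then show "(\<lambda>\<zeta>. cnj (a \<zeta> $ i)) \<in> borel_measurable circle"
      by (rule measurable_compose) (intro borel_measurable_continuous_onI continuous_intros)
  qed
  have ks: "sqi k" using km as by (simp add: sqi_def nk)
  have i1: "integrable circle (\<lambda>\<zeta>. Pm a \<zeta> $ i)" for i
    using Pm_L2[OF aL] by (intro sqi_nth_integrable) (simp add: L2_iff_sqi)
  have i2: "integrable circle (\<lambda>\<zeta>. q \<zeta> $ i)" for i by (rule sqi_nth_integrable[OF H2_sqi[OF qH]])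
  have afc: "fc (\<lambda>\<zeta>. a \<zeta> $ i) (int n) = (if n = 0 then p $ i else 0)" for i n
  proof -
    have "fc (\<lambda>\<zeta>. a \<zeta> $ i) (int n) = fc (\<lambda>\<zeta>. (Pm a \<zeta> $ i + p $ i) + q \<zeta> $ i) (int n)"
      by (rule fc_cong) (subst asplit, simp)
    also have "\<dots> = (fc (\<lambda>\<zeta>. Pm a \<zeta> $ i) (int n) + fc (\<lambda>_. p $ i) (int n)) + fc (\<lambda>\<zeta>. q \<zeta> $ i) (int n)"
      using i1 i2 by (subst fc_add, simp, simp)+ simp
    finally show ?thesis by (simp add: H2_minus_fc[OF mH] qfc fc_const)
  qed
  have kfc: "fc (\<lambda>\<zeta>. k \<zeta> $ i) (- int n) = (if n = 0 then cnj (p $ i) else 0)" for i n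
    by (simp add: k_def fc_cnj afc)
  have kH: "k \<in> H2"
  proof (rule H2I[OF ks])
    fix i and j :: int assume "j < 0"
    then have "j = - int (nat (- j))" "nat (- j) \<noteq> 0" by simp_all
    then show "fc (\<lambda>\<zeta>. k \<zeta> $ i) j = 0" using kfc[of i "nat (- j)"] by metis
  qed
  then show "(\<lambda>\<zeta>. \<chi> i. cnj (mv \<Phi> y \<zeta> $ i)) \<in> H2" by (simp add: k_def a_def)
  have "c0 k = (\<chi> i. cnj (p $ i))" using kfc[of _ 0] by (simp add: vec_eq_iff c0_nth[OF H2_L2[OF kH]])
  then show "c0 (\<lambda>\<zeta>. \<chi> i. cnj (mv \<Phi> y \<zeta> $ i)) = (\<chi> i. cnj (p $ i))" by (simp add: k_def a_def)
qed

text \<open>The conjugates of the functions \<open>\<Phi> (y i)\<close> are in \<open>H2\<close> with the unit vectors as values at the origin, so the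
\<open>\<Phi> (y i)\<close> span the target space almost everywhere. As \<open>\<Phi>\<^sup>* \<Phi>\<close> fixes the \<open>y i\<close>, the product \<open>\<Phi> \<Phi>\<^sup>*\<close> is the identity and
the \<open>y i\<close> span the range of \<open>\<Phi>\<^sup>*\<close>, the orthogonal complement of the kernel.\<close>

lemma conditions_coisometric:
  fixes \<Phi> :: "complex \<Rightarrow> complex^'n^'m"
  assumes C: "contractive \<Phi>" and ex: "\<And>p. \<exists>y\<in>zH2. L0 \<Phi> y = p \<and> hform \<Phi> y y = (norm p)\<^sup>2"
  shows "conditions \<Phi>"
proof -
  have ex': "\<exists>y. y \<in> zH2 \<and> L0 \<Phi> y = p \<and> hform \<Phi> y y = (norm p)\<^sup>2" for p using ex[of p] by blast
  define y where "y = (\<lambda>i. SOME y. y \<in> zH2 \<and> L0 \<Phi> y = axis i 1 \<and> hform \<Phi> y y = (norm (axis i 1 :: complex^'m))\<^sup>2)"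
  have "y i \<in> zH2 \<and> L0 \<Phi> (y i) = axis i 1 \<and> hform \<Phi> (y i) (y i) = (norm (axis i 1 :: complex^'m))\<^sup>2" for i
    unfolding y_def by (rule someI_ex[OF ex'])
  then have y: "\<And>i. y i \<in> zH2" "\<And>i. L0 \<Phi> (y i) = axis i 1"
      "\<And>i. hform \<Phi> (y i) (y i) = (norm (axis i 1 :: complex^'m))\<^sup>2" by blast+
  have eq: "hform \<Phi> (y i) (y i) \<le> (norm (L0 \<Phi> (y i)))\<^sup>2" for i by (simp add: y)
  define g where "g = (\<lambda>i \<zeta>. cnj \<zeta> *s y i \<zeta>)"
  have ker: "g i \<in> toeplitz_ker \<Phi>" for i unfolding g_def by (rule extremal_kernel_function(1)[OF C y])
  define k where "k = (\<lambda>i \<zeta>. (\<chi> a. cnj (mv \<Phi> (y i) \<zeta> $ a)))"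
  have kH: "k i \<in> H2" for i unfolding k_def by (rule extremal_kernel_function(2)[OF C y])
  have k0: "c0 (k i) = axis i 1" for i
    unfolding k_def extremal_kernel_function(3)[OF C y] by (simp add: vec_eq_iff axis_def)
  have "AE \<zeta> in circle. \<forall>i\<in>UNIV. norm (\<Phi> \<zeta> *v y i \<zeta>) = norm (y i \<zeta>)"
    by (intro AE_finite_allI finite extremal_function(2)[OF C zH2_H2[OF y(1)] eq])
  moreover have "AE \<zeta> in circle. \<forall>x. norm (\<Phi> \<zeta> *v x) \<le> norm x" using C by (simp add: contractive_def)
  moreover note independent_AE[OF kH k0] AE_space
  ultimately have co: "AE \<zeta> in circle. isometric_mat (transpose (\<Phi> \<zeta>)) \<and>
     vec_ortho (mat_ker (\<Phi> \<zeta>)) = vec.span (range (\<lambda>i. g i \<zeta>))"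
  proof eventually_elim
    case (elim \<zeta>)
    define A where "A = \<Phi> \<zeta>"
    have z: "norm \<zeta> = 1" using elim(4) by simp
    have zz: "\<zeta> * cnj \<zeta> = 1" using z by (simp flip: complex_norm_square)
    have fixed: "conj_transpose A *v (A *v y i \<zeta>) = y i \<zeta>" for i
      unfolding A_def by (rule contraction_norm_eq) (use elim(1,2) in simp_all)
    have span: "\<exists>c. v = (\<Sum>j\<in>UNIV. c $ j *s (A *v y j \<zeta>))" for v
    proof -
      obtain c where c: "(\<chi> a. cnj (v $ a)) = (\<Sum>j\<in>UNIV. c $ j *s k j \<zeta>)" using elim(3) by blast
      have "v = (\<Sum>j\<in>UNIV. (\<chi> j. cnj (c $ j)) $ j *s (A *v y j \<zeta>))"
      proof (rule vec_eq_iff[THEN iffD2], rule allI)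
        fix a
        have "cnj (v $ a) = (\<Sum>j\<in>UNIV. c $ j * cnj ((A *v y j \<zeta>) $ a))"
          using arg_cong[OF c, of "\<lambda>w. w $ a"] by (simp add: k_def mv_def A_def)
        from arg_cong[OF this, of cnj]
        have "v $ a = cnj (\<Sum>j\<in>UNIV. c $ j * cnj ((A *v y j \<zeta>) $ a))" by (simp only: complex_cnj_cnj)
        then show "v $ a = (\<Sum>j\<in>UNIV. (\<chi> j. cnj (c $ j)) $ j *s (A *v y j \<zeta>)) $ a" by simp
      qed
      then show ?thesis by blast
    qed
    have adj: "conj_transpose A *v (\<Sum>j\<in>UNIV. c $ j *s (A *v y j \<zeta>)) = (\<Sum>j\<in>UNIV. c $ j *s y j \<zeta>)" for c
      by (simp add: vec.linear_sum[OF matrix_vector_mul_linear_gen] vec.linear_scale[OF matrix_vector_mul_linear_gen] fixed)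
    have "A *v (conj_transpose A *v v) = v" for v
    proof -
      obtain c where c: "v = (\<Sum>j\<in>UNIV. c $ j *s (A *v y j \<zeta>))" using span by blast
      show ?thesis unfolding c adj
        by (simp add: vec.linear_sum[OF matrix_vector_mul_linear_gen] vec.linear_scale[OF matrix_vector_mul_linear_gen])
    qed
    then have iso: "isometric_mat (transpose A)" by (simp add: isometric_transpose_iff)
    have ysg: "y j \<zeta> = \<zeta> *s g j \<zeta>" for j by (simp add: g_def vector_smult_assoc zz)
    have "range ((*v) (conj_transpose A)) = vec.span (range (\<lambda>i. g i \<zeta>))"
    proof
      show "range ((*v) (conj_transpose A)) \<subseteq> vec.span (range (\<lambda>i. g i \<zeta>))"
      proof
        fix x assume "x \<in> range ((*v) (conj_transpose A))"
        then obtain v where v: "x = conj_transpose A *v v" by blast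
        obtain c where c: "v = (\<Sum>j\<in>UNIV. c $ j *s (A *v y j \<zeta>))" using span by blast
        show "x \<in> vec.span (range (\<lambda>i. g i \<zeta>))" unfolding v c adj unfolding ysg
          by (rule vec.span_sum, rule vec.span_scale, rule vec.span_scale, rule vec.span_base) simp
      qed
      show "vec.span (range (\<lambda>i. g i \<zeta>)) \<subseteq> range ((*v) (conj_transpose A))"
      proof (rule span_closed)
        show "vec.subspace (range ((*v) (conj_transpose A)))"
          by (rule vec.subspace_image[OF vec.subspace_UNIV])
        fix x assume "x \<in> range (\<lambda>i. g i \<zeta>)"
        then obtain i where "x = cnj \<zeta> *s y i \<zeta>" by (auto simp: g_def)
        also have "\<dots> = conj_transpose A *v (cnj \<zeta> *s (A *v y i \<zeta>))" by (simp add: vector_scalar_commute fixed)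
        finally show "x \<in> range ((*v) (conj_transpose A))" by (rule range_eqI)
      qed
    qed
    then show ?case using iso ortho_ker_coisometric[OF iso] by (simp add: A_def)
  qed
  show ?thesis
  proof (rule conditionsI[OF _ ker])
    show "AE \<zeta> in circle. isometric_mat (\<Phi> \<zeta>) \<or> isometric_mat (transpose (\<Phi> \<zeta>))"
      using co by eventually_elim simp
    show "AE \<zeta> in circle. vec_ortho (mat_ker (\<Phi> \<zeta>)) = vec.span (range (\<lambda>i. g i \<zeta>))"
      using co by eventually_elim simp
  qed
qed

theorem conditions_necessary:
  fixes \<Phi> :: "complex \<Rightarrow> complex^'n^'m"
  assumes C: "contractive \<Phi>" and ess: "L2_essnorm H2 H2_minus (hankel \<Phi>) < 1" and u: "only_zero \<Phi>"
  shows "conditions \<Phi>"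
  using uniqueness_alternative[OF C ess only_zero_step[OF contractive_ess_bounded[OF C] u]]
    conditions_isometric[OF C] conditions_coisometric[OF C] by blast

section \<open>Sufficiency\<close>

lemma Hinf_mv_H2:
  fixes F :: "complex \<Rightarrow> complex^'n^'m"
  assumes F: "F \<in> Hinf" and f: "f \<in> H2" shows "mv F f \<in> H2"
proof (rule H2I)
  obtain G where G: "\<And>a i. bdh (\<lambda>\<zeta>. F \<zeta> $ a $ i) (G a i)" using Hinf_D[OF F] by blast
  have "F \<in> ess_bounded" using F by (simp add: Hinf_def Linf_eq_ess_bounded)
  then show "sqi (mv F f)" using mv_L2[OF _ H2_L2[OF f]] by (simp add: L2_iff_sqi)
  fix a and k :: int assume k: "k < 0"
  have fi: "integrable circle (\<lambda>\<zeta>. f \<zeta> $ i)" for i by (rule sqi_nth_integrable[OF H2_sqi[OF f]])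
  have gi: "integrable circle (\<lambda>\<zeta>. F \<zeta> $ a $ i * f \<zeta> $ i)" for i by (rule bdh_integrable_mult[OF G fi])
  have gk: "fc (\<lambda>\<zeta>. F \<zeta> $ a $ i * f \<zeta> $ i) k = 0" for i
    by (rule bdh_mult_coeffs(1)[OF G fi H2_fc[OF f] k])
  have "fc (\<lambda>\<zeta>. \<Sum>i\<in>I. F \<zeta> $ a $ i * f \<zeta> $ i) k = 0" if "finite I" for I using that
  proof (induction I rule: finite_induct)
    case (insert i I)
    have "integrable circle (\<lambda>\<zeta>. \<Sum>i\<in>I. F \<zeta> $ a $ i * f \<zeta> $ i)" by (rule Bochner_Integration.integrable_sum[OF gi])
    then show ?case using insert fc_add[OF gi] gk by simp
  qed (simp add: fc_const)
  then show "fc (\<lambda>\<zeta>. mv F f \<zeta> $ a) k = 0" by (simp add: mv_def matrix_vector_mult_def)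
qed

text \<open>\<open>\<Phi> f\<close> is antianalytic and \<open>F f\<close> analytic, so their squared norms add up in that of \<open>(\<Phi> - F) f\<close>; the first one already exhausts the norm of \<open>f\<close>.\<close>

lemma analytic_perturbation_kills:
  fixes \<Phi> F :: "complex \<Rightarrow> complex^'n^'m"
  assumes P: "\<Phi> \<in> ess_bounded" and F: "F \<in> Hinf" and c: "contractive (\<lambda>\<zeta>. \<Phi> \<zeta> - F \<zeta>)"
    and f: "f \<in> toeplitz_ker \<Phi>" and iso: "AE \<zeta> in circle. norm (\<Phi> \<zeta> *v f \<zeta>) = norm (f \<zeta>)"
  shows "AE \<zeta> in circle. F \<zeta> *v f \<zeta> = 0"
proof -
  have fH: "f \<in> H2" and t: "AE \<zeta> in circle. L2_proj H2 (mv \<Phi> f) \<zeta> = 0"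
    using f by (simp_all add: toeplitz_ker_def toeplitz_def mv_def)
  define a where "a = mv \<Phi> f"
  have aL: "a \<in> L2" unfolding a_def by (rule mv_L2[OF P H2_L2[OF fH]])
  have projH: "L2_proj H2 a \<in> H2" by (rule L2_proj_H2(1)[OF aL])
  define p where "p = (\<lambda>\<zeta>. L2_proj H2 a \<zeta> - mv F f \<zeta>)"
  have pH: "p \<in> H2" unfolding p_def by (rule H2_diff[OF projH Hinf_mv_H2[OF F fH]])
  have proj0: "ip (L2_proj H2 a) (L2_proj H2 a) = 0"
    using ip_zero_AE[OF H2_L2[OF projH]] t by (simp add: a_def)
  have "mv (\<lambda>\<zeta>. \<Phi> \<zeta> - F \<zeta>) f = (\<lambda>\<zeta>. Pm a \<zeta> + p \<zeta>)"
    by (simp add: fun_eq_iff mv_def Pm_def p_def a_def matrix_vector_mult_diff_rdistrib)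
  then have "ip (Pm a) (Pm a) + ip p p \<le> ip f f"
    using contractive_ip[OF c H2_L2[OF fH]] pythagoras[OF pH Pm_H2_minus[OF aL]] by simp
  moreover have "ip a a = ip f f"
    unfolding ip_square
  proof (rule integral_cong_AE)
    show "AE \<zeta> in circle. (norm (a \<zeta>))\<^sup>2 = (norm (f \<zeta>))\<^sup>2" using iso by eventually_elim (simp add: a_def mv_def)
  qed (use aL H2_L2[OF fH] in \<open>simp_all add: L2_def borel_measurable_integrable\<close>)
  ultimately have "ip p p \<le> 0" using pythagoras_Pm[OF aL] proj0 by simp
  then have "ip p p = 0" using L2.nonneg[OF H2_L2[OF pH]] by simp
  then have "AE \<zeta> in circle. p \<zeta> = 0" using ip_zero_AE[OF H2_L2[OF pH]] by simp
  then show ?thesis using t by eventually_elim (simp add: p_def a_def mv_def)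
qed

theorem conditions_sufficient:
  fixes \<Phi> :: "complex \<Rightarrow> complex^'n^'m"
  assumes P: "\<Phi> \<in> ess_bounded" and cond: "conditions \<Phi>"
  shows "only_zero \<Phi>"
  unfolding only_zero_def
proof (intro ballI impI)
  fix F assume F: "F \<in> Hinf" and c: "AE \<zeta> in circle. \<forall>x. norm ((\<Phi> \<zeta> - F \<zeta>) *v x) \<le> norm x"
  have iso: "AE \<zeta> in circle. isometric_mat (\<Phi> \<zeta>) \<or> isometric_mat (transpose (\<Phi> \<zeta>))"
    using cond unfolding conditions_def by (elim conjE) (erule AE_mp, auto split: if_splits)
  obtain l :: nat and f where f: "\<And>j. j \<in> {1..l} \<Longrightarrow> f j \<in> toeplitz_ker \<Phi>"
    and s: "AE \<zeta> in circle. vec_ortho (mat_ker (\<Phi> \<zeta>)) = vec.span ((\<lambda>j. f j \<zeta>) ` {1..l})"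
    using cond unfolding conditions_def by blast
  have m: "\<Phi> \<in> borel_measurable circle" "F \<in> borel_measurable circle"
    using P F by (simp_all add: ess_bounded_def Hinf_def Linf_def)
  have "(\<lambda>\<zeta>. \<Phi> \<zeta> - F \<zeta>) \<in> borel_measurable circle" using m by (rule borel_measurable_diff)
  moreover have "AE \<zeta> in circle. \<forall>x. norm ((\<Phi> \<zeta> - F \<zeta>) *v x) \<le> 1 * norm x" using c by simp
  ultimately have contr: "contractive (\<lambda>\<zeta>. \<Phi> \<zeta> - F \<zeta>)" using c unfolding contractive_def ess_bounded_def by blast
  have "AE \<zeta> in circle. F \<zeta> *v f j \<zeta> = 0" if j: "j \<in> {1..l}" for j
  proof (rule analytic_perturbation_kills[OF P F contr f[OF j]])
    show "AE \<zeta> in circle. norm (\<Phi> \<zeta> *v f j \<zeta>) = norm (f j \<zeta>)"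
      using iso s
    proof eventually_elim
      case (elim \<zeta>)
      show ?case by (rule norm_on_ortho_ker[OF elim(1)]) (use elim(2) j in \<open>simp add: vec.span_base\<close>)
    qed
  qed
  then have "AE \<zeta> in circle. \<forall>j\<in>{1..l}. F \<zeta> *v f j \<zeta> = 0" by (intro AE_finite_allI) simp_all
  then show "AE \<zeta> in circle. F \<zeta> = 0"
    using iso s c
  proof eventually_elim
    case (elim \<zeta>)
    have "vec.span ((\<lambda>j. f j \<zeta>) ` {1..l}) \<subseteq> {x. F \<zeta> *v x = 0}"
    proof (rule span_closed)
      show "vec.subspace {x. F \<zeta> *v x = 0}"
        by (rule vec.subspaceI) (simp_all add: matrix_vector_right_distrib vector_scalar_commute)
    qed (use elim(1) in auto)
    then show ?case using elim(3,4) by (intro contraction_rigidity[OF elim(2)]) auto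
  qed
qed

section \<open>Best approximation by zero\<close>

lemma zero_Hinf: "(\<lambda>_. 0) \<in> Hinf"
  by (rule Hinf_I[where G = "\<lambda>_ _ _. 0"]) (simp add: bdh_const)

text \<open>If only zero satisfies the bound one, no \<open>G\<close> can do strictly better than one: such a \<open>G\<close> would satisfy the bound, hence vanish, and \<open>\<Phi>\<close> itself would have norm below one. So the distance is attained at zero.\<close>

lemma best_approximation_zero_iff:
  fixes \<Phi> :: "complex \<Rightarrow> complex^'n^'m"
  assumes m: "\<Phi> \<in> borel_measurable circle" and n: "Linf_norm \<Phi> = 1"
  shows "(best_approximation \<Phi> (\<lambda>_. 0) \<and> (\<forall>F. best_approximation \<Phi> F \<longrightarrow> (AE \<zeta> in circle. F \<zeta> = 0)))
     \<longleftrightarrow> only_zero \<Phi>"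
proof -
  define I where "I = (INF G\<in>Hinf. Linf_norm (\<lambda>\<zeta>. \<Phi> \<zeta> - G \<zeta>))"
  have best: "best_approximation \<Phi> F \<longleftrightarrow> F \<in> Hinf \<and> Linf_norm (\<lambda>\<zeta>. \<Phi> \<zeta> - F \<zeta>) = I" for F
    by (simp add: best_approximation_def I_def)
  have dm: "(\<lambda>\<zeta>. \<Phi> \<zeta> - F \<zeta>) \<in> borel_measurable circle" if "F \<in> Hinf" for F
    using m that by (intro borel_measurable_diff) (simp_all add: Hinf_def Linf_def)
  have contr: "(AE \<zeta> in circle. \<forall>x. norm ((\<Phi> \<zeta> - F \<zeta>) *v x) \<le> norm x) \<longleftrightarrow> Linf_norm (\<lambda>\<zeta>. \<Phi> \<zeta> - F \<zeta>) \<le> 1" if "F \<in> Hinf" for F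
    using Linf_norm_le_iff[OF dm[OF that], of 1] by simp
  have lower: "I \<le> Linf_norm (\<lambda>\<zeta>. \<Phi> \<zeta> - F \<zeta>)" if "F \<in> Hinf" for F
    unfolding I_def by (rule INF_lower[OF that])
  show ?thesis
  proof
    assume L: "best_approximation \<Phi> (\<lambda>_. 0) \<and> (\<forall>F. best_approximation \<Phi> F \<longrightarrow> (AE \<zeta> in circle. F \<zeta> = 0))"
    then have "I = 1" using n by (simp add: best)
    then show "only_zero \<Phi>"
      unfolding only_zero_def
    proof (intro ballI impI)
      fix F assume F: "F \<in> Hinf" and c: "AE \<zeta> in circle. \<forall>x. norm ((\<Phi> \<zeta> - F \<zeta>) *v x) \<le> norm x"
      have "Linf_norm (\<lambda>\<zeta>. \<Phi> \<zeta> - F \<zeta>) = I"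
        using c contr[OF F] lower[OF F] \<open>I = 1\<close> by (intro antisym) simp_all
      then have "best_approximation \<Phi> F" using F by (simp add: best)
      then show "AE \<zeta> in circle. F \<zeta> = 0" using L by blast
    qed
  next
    assume u: "only_zero \<Phi>"
    have ge: "1 \<le> Linf_norm (\<lambda>\<zeta>. \<Phi> \<zeta> - G \<zeta>)" if G: "G \<in> Hinf" for G
    proof (rule ccontr)
      assume "\<not> ?thesis"
      then have lt: "Linf_norm (\<lambda>\<zeta>. \<Phi> \<zeta> - G \<zeta>) < 1" by simp
      then obtain c where c: "0 \<le> c" "Linf_norm (\<lambda>\<zeta>. \<Phi> \<zeta> - G \<zeta>) = ennreal c"
        by (cases "Linf_norm (\<lambda>\<zeta>. \<Phi> \<zeta> - G \<zeta>)") auto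
      have "AE \<zeta> in circle. G \<zeta> = 0" using u G lt contr[OF G] by (simp add: only_zero_def)
      moreover have "AE \<zeta> in circle. \<forall>x. norm ((\<Phi> \<zeta> - G \<zeta>) *v x) \<le> c * norm x"
        using Linf_norm_le_iff[OF dm[OF G] c(1)] c(2) by simp
      ultimately have "AE \<zeta> in circle. \<forall>x. norm (\<Phi> \<zeta> *v x) \<le> c * norm x" by eventually_elim simp
      then have "Linf_norm \<Phi> \<le> ennreal c" using Linf_norm_le_iff[OF m c(1)] by simp
      then show False using lt c(2) n by simp
    qed
    have "I = 1"
    proof (rule antisym)
      show "I \<le> 1" using lower[OF zero_Hinf] n by simp
      show "1 \<le> I" unfolding I_def by (rule INF_greatest) (rule ge)
    qed
    then show "best_approximation \<Phi> (\<lambda>_. 0) \<and> (\<forall>F. best_approximation \<Phi> F \<longrightarrow> (AE \<zeta> in circle. F \<zeta> = 0))"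
      using u n contr zero_Hinf by (simp add: best only_zero_def)
  qed
qed

theorem theorem6p2:
  fixes \<Phi> :: "complex \<Rightarrow> complex^'n^'m"
  assumes "\<Phi> \<in> Linf"
    and "Linf_norm \<Phi> = 1"
    and "L2_essnorm H2 H2_minus (hankel \<Phi>) < Linf_norm \<Phi>"
  shows "(best_approximation \<Phi> (\<lambda>_. 0) \<and>
          (\<forall>F. best_approximation \<Phi> F \<longrightarrow> (AE \<zeta> in circle. F \<zeta> = 0)))
     \<longleftrightarrow>
         (AE \<zeta> in circle. if CARD('n) \<le> CARD('m) then isometric_mat (\<Phi> \<zeta>)
                          else isometric_mat (transpose (\<Phi> \<zeta>))) \<and>
         (\<exists>(l::nat) f. (\<forall>j\<in>{1..l}. f j \<in> toeplitz_ker \<Phi>) \<and>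
            (AE \<zeta> in circle.
               vec_ortho (mat_ker (\<Phi> \<zeta>)) = vec.span ((\<lambda>j. f j \<zeta>) ` {1..l})))"
proof -
  have m: "\<Phi> \<in> borel_measurable circle" using assms(1) by (simp add: Linf_def)
  have P: "\<Phi> \<in> ess_bounded" using assms(1) by (simp add: Linf_eq_ess_bounded)
  have "AE \<zeta> in circle. \<forall>x. norm (\<Phi> \<zeta> *v x) \<le> norm x"
    using Linf_norm_le_iff[OF m, of 1] assms(2) by simp
  then have C: "contractive \<Phi>" using P by (simp add: contractive_def)
  have "L2_essnorm H2 H2_minus (hankel \<Phi>) < 1" using assms(2,3) by simp
  then have "only_zero \<Phi> \<longleftrightarrow> conditions \<Phi>"
    using conditions_necessary[OF C] conditions_sufficient[OF P] by blast
  then show ?thesis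
    unfolding best_approximation_zero_iff[OF m assms(2)] conditions_def .
qed

end
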